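(* Let $k\ge 4$ be even and let $\widehat{\Psi}(\tau,z)$ be defined as in the context. Then, as a function of $z\in\mathbb{H}$ (for fixed $\tau$), $\widehat{\Psi}(\tau,z)$ is an element of $\mathbb{A}_{k+\frac12}$, while as a function of $\tau\in\mathbb{H}$ (for fixed $z$) it is an element of $\mathbb{A}_{2-2k}$.
   Context: Let $k\geq 4$ be an even integer. For $D\in\mathbb{Z}$ let $\mathcal{Q}_D$ be the set of integral binary quadratic forms $Q=[a,b,c]$, $Q(X,Y)=aX^2+bXY+cY^2$ with $a,b,c\in\mathbb{Z}$ and $b^2-4ac=D$. Write $\tau=x+iy$, $z=u+iv\in\mathbb{H}$. For $Q=[a,b,c]$ put $Q(\tau,1)=a\tau^2+b\tau+c$ and $Q_\tau:=\frac1y\left(a|\tau|^2+bx+c\right)$; $\operatorname{sgn}$ is the sign function with $\operatorname{sgn}(0)=0$. Let $\beta(v;s,w):=\int_0^v t^{s-1}(1-t)^{w-1}dt$, $\beta(s,w):=\beta(1;s,w)$, $\psi_k(v):=\frac12\beta(v;k-\frac12,\frac12)$, and $\Gamma(s;w):=\int_w^\infty t^{s-1}e^{-t}dt$. For $D>0$ define $\mathcal{F}_D(\tau):=\frac{2}{\beta(k-\frac12,\frac12)}\sum_{Q\in\mathcal{Q}_D}\operatorname{sgn}(Q_\tau)Q(\tau,1)^{k-1}\psi_k\!\left(\frac{Dy^2}{|Q(\tau,1)|^2}\right)$, and for $D\in\mathbb{Z}$ define $\mathcal{G}_D(v;\tau):=-\frac{1}{\sqrt\pi}\sum_{Q\in\mathcal{Q}_D}\operatorname{sgn}(Q_\tau)Q(\tau,1)^{k-1}\Gamma\!\left(\frac12;4\pi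 Q_\tau^2v\right)$. Let $\Psi(\tau,z):=\sum_{D>0}\mathcal{F}_D(\tau)e^{2\pi iDz}$, $\Psi^*(\tau,z):=\sum_{D\in\mathbb{Z}}\mathcal{G}_D(v;\tau)e^{2\pi iDz}$ and $\widehat\Psi:=\Psi+\Psi^*$. For $\kappa\in\frac12\mathbb{Z}$ let $\Gamma=\mathrm{SL}_2(\mathbb{Z})$ if $\kappa\in\mathbb{Z}$ and $\Gamma=\Gamma_0(4)$ otherwise. $\mathbb{A}_\kappa$ denotes the space of real analytic functions $f:\mathbb{H}\to\mathbb{C}$ with $f|_\kappa M=f$ for all $M\in\Gamma$ (usual weight $\kappa$ slash operator; for half-integral $\kappa$ the standard half-integral weight slash operator on $\Gamma_0(4)$), such that moreover, when $\kappa=\ell+\frac12$ with $\ell\in\mathbb{Z}$, $f$ lies in Kohnen's plus space, i.e. its Fourier expansion has the form $\sum_{(-1)^\ell n\equiv 0,1\pmod 4}a_n(v)e^{2\pi inz}$. *)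

theory Defs
  imports "HOL-Analysis.Analysis" "HOL-Number_Theory.Number_Theory"
begin

definition upper_half_plane :: "complex set" where
  "upper_half_plane = {z. Im z > 0}"


section \<open>Integral binary quadratic forms\<close>

type_synonym quad_form = "int \<times> int \<times> int"

definition forms_of_disc :: "int \<Rightarrow> quad_form set" where
  "forms_of_disc D = {(a, b, c). b\<^sup>2 - 4 * a * c = D}"

fun form_eval :: "quad_form \<Rightarrow> complex \<Rightarrow> complex \<Rightarrow> complex" where
  "form_eval (a, b, c) X Y = of_int a * X\<^sup>2 + of_int b * X * Y + of_int c * Y\<^sup>2"

text \<open>The real number $Q_\tau$.\<close>

fun form_at :: "quad_form \<Rightarrow> complex \<Rightarrow> real" where
  "form_at (a, b, c) \<tau> =
     (of_int a * (cmod \<tau>)\<^sup>2 + of_int b * Re \<tau> + of_int c) / Im \<tau>"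


section \<open>Incomplete beta and gamma functions\<close>

definition incomplete_beta :: "real \<Rightarrow> real \<Rightarrow> real \<Rightarrow> real" where
  "incomplete_beta v s w = integral {0..v} (\<lambda>t. t powr (s - 1) * (1 - t) powr (w - 1))"

definition upper_incomplete_gamma :: "real \<Rightarrow> real \<Rightarrow> real" where
  "upper_incomplete_gamma s w = integral {w..} (\<lambda>t. t powr (s - 1) * exp (- t))"

definition psi_fun :: "nat \<Rightarrow> real \<Rightarrow> real" where
  "psi_fun k v = 1 / 2 * incomplete_beta v (real k - 1 / 2) (1 / 2)"


section \<open>The functions \<open>\<F>\<^sub>D\<close>, \<open>\<G>\<^sub>D\<close> and the completed generating function\<close>

definition F_fun :: "nat \<Rightarrow> int \<Rightarrow> complex \<Rightarrow> complex" where
  "F_fun k D \<tau> =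
     of_real (2 / incomplete_beta 1 (real k - 1 / 2) (1 / 2)) *
     (\<Sum>\<^sub>\<infinity>Q\<in>forms_of_disc D.
        of_real (sgn (form_at Q \<tau>)) * form_eval Q \<tau> 1 ^ (k - 1) *
        of_real (psi_fun k (of_int D * (Im \<tau>)\<^sup>2 / (cmod (form_eval Q \<tau> 1))\<^sup>2)))"

definition G_fun :: "nat \<Rightarrow> int \<Rightarrow> real \<Rightarrow> complex \<Rightarrow> complex" where
  "G_fun k D v \<tau> =
     - of_real (1 / sqrt pi) *
     (\<Sum>\<^sub>\<infinity>Q\<in>forms_of_disc D.
        of_real (sgn (form_at Q \<tau>)) * form_eval Q \<tau> 1 ^ (k - 1) *
        of_real (upper_incomplete_gamma (1 / 2) (4 * pi * (form_at Q \<tau>)\<^sup>2 * v)))"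

definition Psi :: "nat \<Rightarrow> complex \<Rightarrow> complex \<Rightarrow> complex" where
  "Psi k \<tau> z =
     (\<Sum>\<^sub>\<infinity>D\<in>{D::int. D > 0}. F_fun k D \<tau> * exp (2 * of_real pi * \<i> * of_int D * z))"

definition Psi_star :: "nat \<Rightarrow> complex \<Rightarrow> complex \<Rightarrow> complex" where
  "Psi_star k \<tau> z =
     (\<Sum>\<^sub>\<infinity>D\<in>(UNIV :: int set).
        G_fun k D (Im z) \<tau> * exp (2 * of_real pi * \<i> * of_int D * z))"

definition Psi_hat :: "nat \<Rightarrow> complex \<Rightarrow> complex \<Rightarrow> complex" where
  "Psi_hat k \<tau> z = Psi k \<tau> z + Psi_star k \<tau> z"


section \<open>Real analytic functions of an open subset of the plane\<close>

definition real_analytic_on :: "(complex \<Rightarrow> complex) \<Rightarrow> complex set \<Rightarrow> bool" where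
  "real_analytic_on f S \<longleftrightarrow>
     (\<forall>z0\<in>S. \<exists>r>0. \<exists>a :: nat \<Rightarrow> nat \<Rightarrow> complex. \<forall>z\<in>ball z0 r.
        ((\<lambda>(m, n). a m n * of_real ((Re z - Re z0) ^ m * (Im z - Im z0) ^ n)) has_sum f z) UNIV)"


section \<open>Slash operators\<close>

definition SL2Z :: "(int^2^2) set" where
  "SL2Z = {M. det M = 1}"

definition Gamma0_4 :: "(int^2^2) set" where
  "Gamma0_4 = {M \<in> SL2Z. 4 dvd M $ 2 $ 1}"

definition cocycle :: "int^2^2 \<Rightarrow> complex \<Rightarrow> complex" where
  "cocycle M z = of_int (M $ 2 $ 1) * z + of_int (M $ 2 $ 2)"

definition moebius :: "int^2^2 \<Rightarrow> complex \<Rightarrow> complex" where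
  "moebius M z = (of_int (M $ 1 $ 1) * z + of_int (M $ 1 $ 2)) / cocycle M z"

text \<open>
  Shimura's extension of the Jacobi symbol $(c/d)$ to odd $d$ of either sign: it equals
  $(c/|d|)$, except that the sign is reversed if both $c$ and $d$ are negative.
  In particular $(0/\pm 1) = 1$.
\<close>

definition shimura_symbol :: "int \<Rightarrow> int \<Rightarrow> int" where
  "shimura_symbol c d =
     (if c < 0 \<and> d < 0 then - 1 else 1) *
     (\<Prod>p\<in>prime_factors \<bar>d\<bar>. Legendre c p ^ multiplicity p \<bar>d\<bar>)"

definition theta_eps :: "int \<Rightarrow> complex" where
  "theta_eps d = (if [d = 1] (mod 4) then 1 else \<i>)"

text \<open>
  The automorphy factor $(c/d)\,\varepsilon_d^{-1}\,(cz+d)^{1/2}$ of the theta function on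
  $\Gamma_0(4)$, with the principal branch of the square root.
\<close>

definition theta_factor :: "int^2^2 \<Rightarrow> complex \<Rightarrow> complex" where
  "theta_factor M z =
     of_int (shimura_symbol (M $ 2 $ 1) (M $ 2 $ 2)) * inverse (theta_eps (M $ 2 $ 2)) *
     csqrt (cocycle M z)"

text \<open>
  The weight \<open>\<kappa>\<close> is meant to lie in $\frac12\mathbb{Z}$, so that \<open>\<lfloor>2 * \<kappa>\<rfloor>\<close> is exactly $2\kappa$.
\<close>

definition slash :: "real \<Rightarrow> (complex \<Rightarrow> complex) \<Rightarrow> int^2^2 \<Rightarrow> complex \<Rightarrow> complex" where
  "slash \<kappa> f M z =
     (if \<kappa> \<in> \<int> then cocycle M z powi (- \<lfloor>\<kappa>\<rfloor>) else theta_factor M z powi (- \<lfloor>2 * \<kappa>\<rfloor>)) *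
     f (moebius M z)"

definition weight_group :: "real \<Rightarrow> (int^2^2) set" where
  "weight_group \<kappa> = (if \<kappa> \<in> \<int> then SL2Z else Gamma0_4)"


section \<open>The spaces \<open>\<A>\<^sub>\<kappa>\<close>\<close>

text \<open>
  Kohnen's plus condition in weight $\ell + \frac12$. The Fourier coefficients may depend
  on the imaginary part of the variable.
\<close>

definition plus_space_expansion :: "int \<Rightarrow> (complex \<Rightarrow> complex) \<Rightarrow> bool" where
  "plus_space_expansion l f \<longleftrightarrow>
     (\<exists>a :: int \<Rightarrow> real \<Rightarrow> complex. \<forall>z\<in>upper_half_plane.
        ((\<lambda>n. a n (Im z) * exp (2 * of_real pi * \<i> * of_int n * z)) has_sum f z)
          {n. [(- 1) ^ nat \<bar>l\<bar> * n = 0] (mod 4) \<or> [(- 1) ^ nat \<bar>l\<bar> * n = 1] (mod 4)})"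

text \<open>
  Elements are total functions on the complex plane; only their values on the upper half-plane
  are constrained.
\<close>

definition A_space :: "real \<Rightarrow> (complex \<Rightarrow> complex) set" where
  "A_space \<kappa> =
     {f. real_analytic_on f upper_half_plane \<and>
         (\<forall>M\<in>weight_group \<kappa>. \<forall>z\<in>upper_half_plane. slash \<kappa> f M z = f z) \<and>
         (\<forall>l::int. \<kappa> = of_int l + 1 / 2 \<longrightarrow> plus_space_expansion l f)}"

end

theory Submission
  imports Defs "HOL-Complex_Analysis.Complex_Analysis" "HOL-Probability.Probability"
begin

text \<open>
  Write \<open>P = Q(\<tau>,1)\<close>, \<open>t = Q\<^sub>\<tau>\<close> and \<open>D\<close> for the discriminant of \<open>Q\<close>, so that \<open>\<bar>P\<bar>\<^sup>2 = y\<^sup>2 (D + t\<^sup>2)\<close> and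
  \<open>D + 2 t\<^sup>2\<close> is positive definite on the lattice of forms. Up to one nonzero constant, the \<open>Q\<close>-th term of
  the completed generating function, holomorphic and nonholomorphic part together, is the integral over
  the upper half-plane, in \<open>w = u + i \<eta>\<close>, of
  \<open>t P\<^bsup>k-1\<^esup> e(D w) exp(-4 \<pi> \<eta> t\<^sup>2) \<eta>\<^bsup>k-1\<^esup> (w - z)\<^bsup>-1\<^esup> (i (cnj w - z))\<^bsup>1/2-k\<^esup>\<close>:
  the integral over \<open>u\<close> is elementary Fourier analysis, and the one over \<open>\<eta>\<close> produces the incomplete beta
  and gamma functions. Everything converges absolutely, so the generating function is the integral of the
  theta series \<open>\<Sum> t P\<^bsup>k-1\<^esup> e(D w) exp(-4 \<pi> \<eta> t\<^sup>2)\<close> against an explicit kernel in \<open>w\<close> and \<open>z\<close>.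
  Poisson summation in the variable \<open>c\<close> gives the behaviour of the theta series under
  \<open>w \<mapsto> w / (4 w + 1)\<close>, which the kernel turns into the transformation law of the lift; together with
  \<open>z \<mapsto> z + 1\<close> this determines the action of the whole of \<open>\<Gamma>\<^sub>0(4)\<close> by a cocycle computation with the Shimura
  symbol. Modularity in \<open>\<tau>\<close> is the substitution \<open>Q \<mapsto> Q \<circ> M\<close>. For real analyticity the real variables
  are complexified, and a bounded separately holomorphic function of two variables has a double power
  series.
\<close>

section \<open>Parameter integrals and termwise integration\<close>

text \<open>The obstacle is that the defining series display neither analyticity in \<tau> nor
  modularity in z: the factor sgn makes the terms of both series jump where
  \<open>form_at Q \<tau>\<close> = 0. In the integral the sign disappears, because sgn times an
  incomplete beta or gamma value comes from the smooth factor \<open>form_at Q \<tau>\<close>. The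
  kernel is of Cauchy type: in z it is holomorphic up to a simple pole at w = z and transforms with
  weight 1 + (k - 1/2), while its behaviour in w is inverse to that of the theta series and the
  measure together. The two variables need different models: analyticity in \<tau> is read off the
  integral, where no sign occurs; analyticity in z is read off the two series, because the kernel is
  singular at w = z. The lattice has rank 3, so absolute convergence asks for decay beyond the third
  power of the size of Q; the integrals decay like size^(1/2 - k), and k \<ge> 4 gives the exponent
  7/2. The theta series is reached through generating exponentials, whose transformation carries a
  Gaussian factor; only one power of \<open>form_at\<close> occurs, and a single derivative at 0
  does not see that factor.\<close>

lemma holomorphic_parameter_integral:
  fixes f :: "complex \<Rightarrow> 'a \<Rightarrow> complex"
  assumes S: "open S"
    and meas: "\<And>z. z \<in> S \<Longrightarrow> f z \<in> borel_measurable M"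
    and hol: "\<And>w. w \<in> space M \<Longrightarrow> (\<lambda>z. f z w) holomorphic_on S"
    and bd: "\<And>z w. z \<in> S \<Longrightarrow> w \<in> space M \<Longrightarrow> norm (f z w) \<le> g w"
    and int: "integrable M g"
    and z: "z \<in> S"
  shows "((\<lambda>z. \<integral>w. f z w \<partial>M) has_field_derivative (\<integral>w. deriv (\<lambda>z. f z w) z \<partial>M)) (at z)"
proof -
  obtain R where R: "R > 0" "cball z R \<subseteq> S"
    using S z open_contains_cball by blast
  \<comment> \<open>Halving the radius keeps the closed r-ball about every point of the r-ball
    inside \<open>S\<close>, as Cauchy's estimate at those points requires.\<close>
  define r where "r = R / 2"
  have r: "r > 0" using R by (simp add: r_def)
  have sub: "cball y r \<subseteq> S" if "y \<in> cball z r" for y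
  proof
    fix x assume "x \<in> cball y r"
    then have "dist z x \<le> r + r" using that dist_triangle[of z x y] by auto
    then show "x \<in> S" using R by (auto simp: r_def)
  qed
  have sub1: "ball z r \<subseteq> S" using sub[of z] r by auto
  have intf: "integrable M (f y)" if "y \<in> S" for y
    by (rule Bochner_Integration.integrable_bound[OF int meas[OF that]])
       (intro AE_I2, use bd[OF that] in force)
  \<comment> \<open>Cauchy's estimate transfers the majorant \<open>g\<close> to the derivative; the
    mean value inequality transfers it further to the difference quotients.\<close>
  have derbd: "norm (deriv (\<lambda>z. f z w) y) \<le> g w / r" if "y \<in> ball z r" "w \<in> space M" for y w
  proof -
    have sy: "cball y r \<subseteq> S" using sub that by auto
    have "norm ((deriv ^^ 1) (\<lambda>z. f z w) y) \<le> fact 1 * g w / r ^ 1"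
    proof (rule Cauchy_inequality)
      show "(\<lambda>z. f z w) holomorphic_on ball y r"
        using hol[OF that(2)] sy ball_subset_cball holomorphic_on_subset by blast
      show "continuous_on (cball y r) (\<lambda>z. f z w)"
        using hol[OF that(2)] sy holomorphic_on_imp_continuous_on holomorphic_on_subset by blast
      show "norm (f x w) \<le> g w" if "norm (y - x) = r" for x
        using sy that \<open>w \<in> space M\<close> bd by (auto simp: subset_iff dist_norm)
    qed (use r in auto)
    then show ?thesis by simp
  qed
  have qbd: "norm ((f (z + h) w - f z w) / h) \<le> g w / r" if "h \<in> ball 0 r" "h \<noteq> 0" "w \<in> space M" for h w
  proof -
    have "norm (f (z + h) w - f z w) \<le> g w / r * norm (z + h - z)"
    proof (rule field_differentiable_bound[where S = "ball z r" and f' = "\<lambda>y. deriv (\<lambda>z. f z w) y"])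
      fix y assume y: "y \<in> ball z r"
      have "(\<lambda>z. f z w) field_differentiable at y"
        using hol[OF that(3)] S sub1 y holomorphic_on_imp_differentiable_at by blast
      then show "((\<lambda>z. f z w) has_field_derivative deriv (\<lambda>z. f z w) y) (at y within ball z r)"
        by (simp add: DERIV_deriv_iff_field_differentiable has_field_derivative_at_within)
    qed (use that r derbd in \<open>auto simp: dist_norm\<close>)
    then show ?thesis using that by (simp add: norm_divide divide_le_eq)
  qed
  have lim: "(\<lambda>i. (f (z + X i) w - f z w) / X i) \<longlonglongrightarrow> deriv (\<lambda>z. f z w) z"
    if X: "\<And>i. X i \<in> ball 0 r - {0}" "X \<longlonglongrightarrow> 0" and w: "w \<in> space M" for X w
  proof -
    have "(\<lambda>z. f z w) field_differentiable at z"
      using hol[OF w] S z holomorphic_on_imp_differentiable_at by blast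
    then have "((\<lambda>z. f z w) has_field_derivative deriv (\<lambda>z. f z w) z) (at z)"
      by (simp add: DERIV_deriv_iff_field_differentiable)
    then have "((\<lambda>h. (f (z + h) w - f z w) / h) \<longlongrightarrow> deriv (\<lambda>z. f z w) z) (at 0)"
      by (simp add: DERIV_def)
    then show ?thesis
      using X unfolding tendsto_at_iff_sequentially by (auto simp: o_def)
  qed
  have dmeas: "(\<lambda>w. deriv (\<lambda>z. f z w) z) \<in> borel_measurable M"
  proof (rule borel_measurable_LIMSEQ_metric)
    \<comment> \<open>The derivative is a pointwise limit of measurable difference quotients; the
      shift by 2 keeps every increment nonzero and strictly smaller than r.\<close>
    let ?X = "\<lambda>i::nat. complex_of_real (r / real (i + 2))"
    have X: "?X i \<in> ball 0 r - {0}" for i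
    proof -
      have "norm (?X i) = r / real (i + 2)" using r by (simp only: norm_of_real) simp
      also have "\<dots> < r" using r by (simp add: field_simps add_pos_nonneg)
      finally show ?thesis using r by (auto simp: of_real_eq_0_iff add_pos_nonneg simp del: of_real_divide)
    qed
    have "(\<lambda>i. r / real (i + 2)) \<longlonglongrightarrow> 0" by real_asymp
    then have X0: "?X \<longlonglongrightarrow> 0" using tendsto_of_real[where 'a=complex] by fastforce
    show "(\<lambda>i. (f (z + ?X i) w - f z w) / ?X i) \<longlonglongrightarrow> deriv (\<lambda>z. f z w) z" if "w \<in> space M" for w
      using lim[OF X X0 that] .
    fix i
    have "z + ?X i \<in> S" using X[of i] sub1 by (auto simp: dist_norm subset_iff)
    then show "(\<lambda>w. (f (z + ?X i) w - f z w) / ?X i) \<in> borel_measurable M"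
      using meas z by (intro borel_measurable_divide borel_measurable_diff) auto
  qed
  have "((\<lambda>h. ((\<integral>w. f (z + h) w \<partial>M) - (\<integral>w. f z w \<partial>M)) / h) \<longlongrightarrow> (\<integral>w. deriv (\<lambda>z. f z w) z \<partial>M)) (at 0 within ball 0 r)"
    unfolding tendsto_at_iff_sequentially
  proof (intro allI impI)
    fix X :: "nat \<Rightarrow> complex" assume X: "\<forall>i. X i \<in> ball 0 r - {0}" "X \<longlonglongrightarrow> 0"
    have inS: "z + X i \<in> S" for i using X(1) sub1 by (auto simp: dist_norm subset_iff)
    have "(\<lambda>i. \<integral>w. (f (z + X i) w - f z w) / X i \<partial>M) \<longlonglongrightarrow> (\<integral>w. deriv (\<lambda>z. f z w) z \<partial>M)"
    proof (rule integral_dominated_convergence[where w = "\<lambda>w. g w / r"])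
      show "(\<lambda>w. (f (z + X i) w - f z w) / X i) \<in> borel_measurable M" for i
        using meas z inS by (intro borel_measurable_divide borel_measurable_diff) auto
      show "AE w in M. norm ((f (z + X i) w - f z w) / X i) \<le> g w / r" for i
        using X(1) by (intro AE_I2 qbd) auto
      show "AE w in M. (\<lambda>i. (f (z + X i) w - f z w) / X i) \<longlonglongrightarrow> deriv (\<lambda>z. f z w) z"
        using X by (intro AE_I2 lim) auto
    qed (use dmeas int in auto)
    also have "(\<lambda>i. \<integral>w. (f (z + X i) w - f z w) / X i \<partial>M)
      = (\<lambda>h. ((\<integral>w. f (z + h) w \<partial>M) - (\<integral>w. f z w \<partial>M)) / h) \<circ> X"
      using intf[OF z] intf[OF inS] by (auto simp: o_def fun_eq_iff)
    finally show "((\<lambda>h. ((\<integral>w. f (z + h) w \<partial>M) - (\<integral>w. f z w \<partial>M)) / h) \<circ> X) \<longlonglongrightarrow> (\<integral>w. deriv (\<lambda>z. f z w) z \<partial>M)" .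
  qed
  then show ?thesis
    using r by (simp add: DERIV_def at_within_open[of 0 "ball 0 r"])
qed

corollary holomorphic_on_parameter_integral:
  fixes f :: "complex \<Rightarrow> 'a \<Rightarrow> complex"
  assumes "open S"
    and "\<And>z. z \<in> S \<Longrightarrow> f z \<in> borel_measurable M"
    and "\<And>w. w \<in> space M \<Longrightarrow> (\<lambda>z. f z w) holomorphic_on S"
    and "\<And>z w. z \<in> S \<Longrightarrow> w \<in> space M \<Longrightarrow> norm (f z w) \<le> g w"
    and "integrable M g"
  shows "(\<lambda>z. \<integral>w. f z w \<partial>M) holomorphic_on S"
  using holomorphic_parameter_integral[OF assms]
  by (meson field_differentiable_at_within field_differentiable_def holomorphic_on_def)

lemma integral_count_space_eq_infsum:
  fixes f :: "'a \<Rightarrow> complex"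
  assumes "(\<lambda>x. norm (f x)) summable_on A"
  shows "(\<integral>x. f x \<partial>count_space A) = infsum f A"
  using infsetsum_infsum[of f A] abs_summable_equivalent[of f A] assms
  by (simp add: infsetsum_def)

lemma integrable_count_space_real_summable:
  fixes f :: "'a \<Rightarrow> real"
  assumes "f summable_on A" "\<And>x. x \<in> A \<Longrightarrow> f x \<ge> 0"
  shows "integrable (count_space A) f"
proof -
  have "(\<lambda>x. norm (f x)) summable_on A"
    using assms by (subst summable_on_cong[where g = f]) auto
  then show ?thesis
    using abs_summable_equivalent[of f A] by (simp add: Infinite_Set_Sum.abs_summable_on_def)
qed

text \<open>An absolutely convergent sum is an integral against counting measure, so differentiation
  under the integral sign becomes termwise differentiation. The second conclusion makes the
  differentiated series absolutely convergent as well.\<close>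

lemma holomorphic_infsum:
  fixes f :: "complex \<Rightarrow> 'a \<Rightarrow> complex"
  assumes S: "open S"
    and hol: "\<And>q. (\<lambda>z. f z q) holomorphic_on S"
    and bd: "\<And>z q. z \<in> S \<Longrightarrow> norm (f z q) \<le> g q"
    and sm: "g summable_on UNIV"
    and z: "z \<in> S"
  shows "((\<lambda>z. \<Sum>\<^sub>\<infinity>q. f z q) has_field_derivative (\<Sum>\<^sub>\<infinity>q. deriv (\<lambda>z. f z q) z)) (at z)"
    and "(\<lambda>q. norm (deriv (\<lambda>z. f z q) z)) summable_on UNIV"
proof -
  have g0: "g q \<ge> 0" for q using bd[OF z, of q] norm_ge_zero order_trans by blast
  have int: "integrable (count_space UNIV) g"
    by (rule integrable_count_space_real_summable[OF sm g0])
  have abs: "(\<lambda>q. norm (f y q)) summable_on UNIV" if "y \<in> S" for y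
    by (rule summable_on_comparison_test[OF sm]) (use bd[OF that] in auto)
  obtain r where r: "r > 0" "cball z r \<subseteq> S"
    using S z open_contains_cball by blast
  have dbd: "norm (deriv (\<lambda>z. f z q) z) \<le> g q / r" for q
  proof -
    have "norm ((deriv ^^ 1) (\<lambda>z. f z q) z) \<le> fact 1 * g q / r ^ 1"
    proof (rule Cauchy_inequality)
      show "(\<lambda>z. f z q) holomorphic_on ball z r"
        using hol r ball_subset_cball holomorphic_on_subset by blast
      show "continuous_on (cball z r) (\<lambda>z. f z q)"
        using hol r holomorphic_on_imp_continuous_on holomorphic_on_subset by blast
      show "norm (f x q) \<le> g q" if "norm (z - x) = r" for x
        using r that bd by (auto simp: subset_iff dist_norm)
    qed (use r in auto)
    then show ?thesis by simp
  qed
  show dsum: "(\<lambda>q. norm (deriv (\<lambda>z. f z q) z)) summable_on UNIV"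
  proof (rule summable_on_comparison_test)
    show "(\<lambda>q. g q / r) summable_on UNIV"
      using summable_on_cmult_right[OF sm, of "1 / r"] by simp
  qed (use dbd in auto)
  have "((\<lambda>z. \<integral>q. f z q \<partial>count_space UNIV) has_field_derivative (\<integral>q. deriv (\<lambda>z. f z q) z \<partial>count_space UNIV)) (at z)"
    by (rule holomorphic_parameter_integral[OF S _ _ _ int z]) (use hol bd in auto)
  then have "((\<lambda>z. \<integral>q. f z q \<partial>count_space UNIV) has_field_derivative (\<Sum>\<^sub>\<infinity>q. deriv (\<lambda>z. f z q) z)) (at z)"
    by (simp add: integral_count_space_eq_infsum[OF dsum])
  then show "((\<lambda>z. \<Sum>\<^sub>\<infinity>q. f z q) has_field_derivative (\<Sum>\<^sub>\<infinity>q. deriv (\<lambda>z. f z q) z)) (at z)"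
    by (rule has_field_derivative_transform_within_open[OF _ S z])
       (simp add: integral_count_space_eq_infsum[OF abs])
qed

text \<open>Fubini for counting measure times \<open>M\<close>; a countable index type makes the
  former sigma-finite. The bounds \<open>B\<close> stand in for the L1 norms, so only estimates of
  the single integrals have to be supplied.\<close>

lemma has_sum_integral:
  fixes f :: "'i::countable \<Rightarrow> 'a \<Rightarrow> complex"
  assumes M: "sigma_finite_measure M"
    and int: "\<And>i. integrable M (f i)"
    and bd: "\<And>i. (\<integral>x. norm (f i x) \<partial>M) \<le> B i"
    and sm: "B summable_on UNIV"
    and pt: "\<And>x. x \<in> space M \<Longrightarrow> (\<lambda>i. norm (f i x)) summable_on UNIV"
  shows "((\<lambda>i. \<integral>x. f i x \<partial>M) has_sum (\<integral>x. (\<Sum>\<^sub>\<infinity>i. f i x) \<partial>M)) UNIV"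
    and "integrable M (\<lambda>x. \<Sum>\<^sub>\<infinity>i. f i x)"
proof -
  interpret C: sigma_finite_measure "count_space (UNIV :: 'i set)"
    by (rule sigma_finite_measure_count_space_countable) auto
  interpret M: sigma_finite_measure M by fact
  interpret P: pair_sigma_finite "count_space (UNIV :: 'i set)" M ..
  have nsm: "(\<lambda>i. norm (\<integral>x. norm (f i x) \<partial>M)) summable_on UNIV"
    by (rule summable_on_comparison_test[OF sm]) (use bd in auto)
  have meas: "(\<lambda>(i, x). f i x) \<in> borel_measurable (count_space UNIV \<Otimes>\<^sub>M M)"
    by (rule measurable_pair_measure_countable1) (use int in \<open>auto intro: borel_measurable_integrable\<close>)
  have P: "integrable (count_space UNIV \<Otimes>\<^sub>M M) (\<lambda>(i, x). f i x)"
  proof (rule P.Fubini_integrable[OF meas])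
    show "integrable (count_space UNIV) (\<lambda>x. \<integral>y. norm (case (x, y) of (i, x) \<Rightarrow> f i x) \<partial>M)"
      using nsm integrable_count_space_real_summable[of "\<lambda>i. \<integral>x. norm (f i x) \<partial>M" UNIV] by simp
    show "AE x in count_space UNIV. integrable M (\<lambda>y. case (x, y) of (i, x) \<Rightarrow> f i x)"
      using int by auto
  qed
  have isum: "(\<lambda>i. norm (\<integral>x. f i x \<partial>M)) summable_on UNIV"
  proof (rule summable_on_comparison_test[OF sm])
    fix i
    show "norm (\<integral>x. f i x \<partial>M) \<le> B i"
      using order_trans[OF integral_norm_bound[of M "f i"] bd[of i]] by simp
  qed auto
  have eq: "(\<integral>x. (\<integral>i. f i x \<partial>count_space UNIV) \<partial>M) = (\<integral>x. (\<Sum>\<^sub>\<infinity>i. f i x) \<partial>M)"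
    by (rule Bochner_Integration.integral_cong) (auto simp: integral_count_space_eq_infsum pt)
  have "(\<integral>x. (\<integral>i. f i x \<partial>count_space UNIV) \<partial>M) = (\<integral>i. (\<integral>x. f i x \<partial>M) \<partial>count_space UNIV)"
    using P.Fubini_integral[OF P] by simp
  then have "(\<integral>x. (\<Sum>\<^sub>\<infinity>i. f i x) \<partial>M) = (\<Sum>\<^sub>\<infinity>i. \<integral>x. f i x \<partial>M)"
    by (simp add: eq integral_count_space_eq_infsum[OF isum])
  then show "((\<lambda>i. \<integral>x. f i x \<partial>M) has_sum (\<integral>x. (\<Sum>\<^sub>\<infinity>i. f i x) \<partial>M)) UNIV"
    using abs_summable_summable[OF isum] by simp
  have "integrable M (\<lambda>x. \<integral>i. f i x \<partial>count_space UNIV)"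
    using P.integrable_snd[OF P] by simp
  then show "integrable M (\<lambda>x. \<Sum>\<^sub>\<infinity>i. f i x)"
    by (subst (asm) Bochner_Integration.integrable_cong[OF refl, where g = "\<lambda>x. \<Sum>\<^sub>\<infinity>i. f i x"])
       (auto simp: integral_count_space_eq_infsum pt)
qed

section \<open>The Jacobi and Shimura symbols\<close>

text \<open>The product inside \<open>shimura_symbol\<close>, without its sign rule. Reading it as a
  product over the multiset of prime factors makes multiplicativity in \<open>n\<close>
  immediate.\<close>

definition jacobi :: "int \<Rightarrow> int \<Rightarrow> int" where
  "jacobi c n = (\<Prod>p\<in>prime_factors n. Legendre c p ^ multiplicity p n)"

lemma jacobi_prod_mset: "jacobi c n = prod_mset (image_mset (Legendre c) (prime_factorization n))"
proof -
  have "prod_mset (image_mset (Legendre c) (prime_factorization n))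
     = (\<Prod>p\<in>prime_factors n. Legendre c p ^ count (prime_factorization n) p)"
    by (rule image_prod_mset_multiplicity)
  also have "\<dots> = jacobi c n"
    unfolding jacobi_def
    by (intro prod.cong refl) (auto simp: count_prime_factorization_prime in_prime_factors_imp_prime)
  finally show ?thesis by simp
qed

lemma jacobi_1 [simp]: "jacobi c 1 = 1"
  by (simp add: jacobi_prod_mset)

lemma jacobi_mult_right: "m \<noteq> 0 \<Longrightarrow> n \<noteq> 0 \<Longrightarrow> jacobi c (m * n) = jacobi c m * jacobi c n"
  by (simp add: jacobi_prod_mset prime_factorization_mult)

lemma jacobi_prime: "prime p \<Longrightarrow> jacobi c p = Legendre c p"
  by (simp add: jacobi_prod_mset prime_factorization_prime)

lemma Legendre_cong: "[a = b] (mod p) \<Longrightarrow> Legendre a p = Legendre b p"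
  by (simp add: Legendre_def QuadRes_def cong_def)

text \<open>Values in {-1, 0, 1} differ by at most 2 < p. This upgrades the congruences of Euler's
  criterion to equalities.\<close>

lemma Legendre_eqI:
  assumes "x \<in> {-1, 0, 1}" "y \<in> {-1, 0, 1}" "[x = y] (mod p)" "(p::int) > 2"
  shows "x = y"
proof -
  have "p dvd x - y" using assms(3) by (simp add: cong_iff_dvd_diff)
  moreover have "\<bar>x - y\<bar> < p" using assms by auto
  ultimately show ?thesis using dvd_imp_le_int[of "x - y" p] by fastforce
qed

lemma Legendre_values: "Legendre a p \<in> {-1, 0, 1}"
  by (simp add: Legendre_def)

lemma euler_criterion_int:
  assumes "prime (p::int)" "odd p"
  shows "p > 2" "[Legendre a p = a ^ (nat ((p - 1) div 2))] (mod p)"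
proof -
  show p2: "p > 2" using assms prime_ge_2_int[of p] by (cases "p = 2") auto
  have pn: "prime (nat p)" "2 < nat p" using assms p2 by auto
  have e: "(nat p - 1) div 2 = nat ((p - 1) div 2)" using p2 by (simp add: nat_div_distrib nat_diff_distrib)
  show "[Legendre a p = a ^ (nat ((p - 1) div 2))] (mod p)"
    using euler_criterion[OF pn, of a] p2 e by simp
qed

lemma Legendre_mult:
  assumes "prime (p::int)" "odd p"
  shows "Legendre (a * b) p = Legendre a p * Legendre b p"
proof (rule Legendre_eqI[where p = p])
  note e = euler_criterion_int[OF assms]
  show "p > 2" by (rule e)
  show "Legendre a p * Legendre b p \<in> {-1, 0, 1}"
    using Legendre_values[of a p] Legendre_values[of b p] by auto
  have "[Legendre a p * Legendre b p = (a * b) ^ (nat ((p - 1) div 2))] (mod p)"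
    using cong_mult[OF e(2)[of a] e(2)[of b]] by (simp add: power_mult_distrib)
  then show "[Legendre (a * b) p = Legendre a p * Legendre b p] (mod p)"
    using e(2)[of "a * b"] cong_sym cong_trans by blast
qed (rule Legendre_values)

text \<open>At odd arguments, the only ones considered, this is the nontrivial character modulo
  4.\<close>

definition chi4 :: "int \<Rightarrow> int" where
  "chi4 n = (if n mod 4 = 1 then 1 else -1)"

lemma odd_mod_4: "odd (n::int) \<Longrightarrow> n mod 4 = 1 \<or> n mod 4 = 3"
  by presburger

lemma odd_mult_mod_4:
  assumes "odd (m::int)" "odd n"
  shows "(m * n) mod 4 = (if m mod 4 = n mod 4 then 1 else 3)"
proof -
  have "(m * n) mod 4 = ((m mod 4) * (n mod 4)) mod 4" by (simp add: mod_mult_eq)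
  then show ?thesis using odd_mod_4[OF assms(1)] odd_mod_4[OF assms(2)]
    by (elim disjE) (simp_all del: mod_mult_eq)
qed

lemma chi4_mult:
  assumes "odd m" "odd n"
  shows "chi4 (m * n) = chi4 m * chi4 n"
  using odd_mult_mod_4[OF assms] odd_mod_4[OF assms(1)] odd_mod_4[OF assms(2)] unfolding chi4_def
  by (cases "m mod 4 = 1"; cases "n mod 4 = 1") simp_all

lemma Legendre_minus_1:
  assumes "prime (p::int)" "odd p"
  shows "Legendre (-1) p = chi4 p"
proof (rule Legendre_eqI[where p = p])
  note e = euler_criterion_int[OF assms]
  have "(-1::int) ^ (nat ((p - 1) div 2)) = chi4 p"
  proof (cases "p mod 4 = 1")
    case True
    then obtain j where j: "p = 4 * j + 1" by (metis mult_div_mod_eq)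
    then have "nat ((p - 1) div 2) = 2 * nat j" using e(1) by (simp add: nat_mult_distrib)
    then show ?thesis using True by (simp add: chi4_def power_mult)
  next
    case False
    then have "p mod 4 = 3" using odd_mod_4[OF assms(2)] by simp
    then obtain j where j: "p = 4 * j + 3" by (metis mult_div_mod_eq)
    then have "nat ((p - 1) div 2) = Suc (2 * nat j)" using e(1) by (simp add: nat_mult_distrib nat_add_distrib)
    then show ?thesis using False by (simp add: chi4_def power_mult)
  qed
  then show "[Legendre (-1) p = chi4 p] (mod p)" using e(2)[of "-1"] by simp
  show "p > 2" by (rule e)
qed (rule Legendre_values, simp add: chi4_def)

lemma odd_pos_int_induct [consumes 2, case_names one mult]:
  fixes n :: int
  assumes "odd n" "n > 0" "P 1"
    and "\<And>p m. prime p \<Longrightarrow> odd p \<Longrightarrow> odd m \<Longrightarrow> m > 0 \<Longrightarrow> P m \<Longrightarrow> P (p * m)"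
  shows "P n"
proof -
  have "odd n \<longrightarrow> n > 0 \<longrightarrow> P n"
  proof (induction n rule: prime_divisors_induct)
    case (unit x)
    then show ?case using assms(3) by auto
  next
    case (factor p x)
    show ?case
    proof (intro impI)
      assume "odd (p * x)" "0 < p * x"
      then show "P (p * x)"
        using factor assms(4)[of p x] prime_gt_0_int[of p] by (auto simp: zero_less_mult_iff)
    qed
  qed auto
  then show ?thesis using assms by simp
qed

lemma jacobi_mult_left:
  assumes "odd n" "n > 0"
  shows "jacobi (a * b) n = jacobi a n * jacobi b n"
  using assms
proof (induction n rule: odd_pos_int_induct)
  case (mult p m)
  then have "p \<noteq> 0" "m \<noteq> 0" by auto
  then show ?case using mult by (simp add: jacobi_mult_right jacobi_prime Legendre_mult)
qed auto

lemma jacobi_cong: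
  assumes "odd n" "n > 0" "[a = b] (mod n)"
  shows "jacobi a n = jacobi b n"
  using assms
proof (induction n rule: odd_pos_int_induct)
  case (mult p m)
  then have "p \<noteq> 0" "m \<noteq> 0" by auto
  moreover have "[a = b] (mod p)" "[a = b] (mod m)"
    using mult.prems cong_modulus_mult[of a b p m] cong_modulus_mult[of a b m p] by (auto simp: mult.commute)
  ultimately show ?case using mult by (simp add: jacobi_mult_right jacobi_prime Legendre_cong[of a b p])
qed auto

lemma jacobi_one_left: "odd n \<Longrightarrow> n > 0 \<Longrightarrow> jacobi 1 n = 1"
proof (induction n rule: odd_pos_int_induct)
  case (mult p m)
  then have "p \<noteq> 0" "m \<noteq> 0" by auto
  moreover have "Legendre 1 p = 1"
  proof -
    have "QuadRes p 1" unfolding QuadRes_def by (rule exI[of _ 1]) simp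
    moreover have "\<not> [1 = 0] (mod p)" using mult(1) not_prime_unit cong_0_iff by blast
    ultimately show ?thesis by (simp add: Legendre_def)
  qed
  ultimately show ?case using mult by (simp add: jacobi_mult_right jacobi_prime)
qed auto

lemma jacobi_minus_1: "odd n \<Longrightarrow> n > 0 \<Longrightarrow> jacobi (-1) n = chi4 n"
proof (induction n rule: odd_pos_int_induct)
  case (mult p m)
  then have "p \<noteq> 0" "m \<noteq> 0" by auto
  then show ?case using mult by (simp add: jacobi_mult_right jacobi_prime Legendre_minus_1 chi4_mult)
qed (auto simp: chi4_def)

lemma jacobi_power_left: "odd n \<Longrightarrow> n > 0 \<Longrightarrow> jacobi (a ^ e) n = jacobi a n ^ e"
  by (induction e) (auto simp: jacobi_one_left jacobi_mult_left)

text \<open>For odd arguments this is -1 to the power (m-1)/2 times (n-1)/2, expressed by residues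
  so that it stays meaningful for negative lower entries of matrices.\<close>

definition recip_sign :: "int \<Rightarrow> int \<Rightarrow> int" where
  "recip_sign m n = (if m mod 4 = 3 \<and> n mod 4 = 3 then -1 else 1)"

lemma recip_sign_commute: "recip_sign m n = recip_sign n m"
  by (auto simp: recip_sign_def)

lemma recip_sign_mult:
  assumes "odd a" "odd b"
  shows "recip_sign m (a * b) = recip_sign m a * recip_sign m b"
  using odd_mult_mod_4[OF assms] odd_mod_4[OF assms(1)] odd_mod_4[OF assms(2)] unfolding recip_sign_def
  by (cases "a mod 4 = 1"; cases "b mod 4 = 1") simp_all

text \<open>The classical law gives the product of the two symbols; for distinct primes the second
  symbol squares to 1 and can be moved across.\<close>

lemma Legendre_reciprocity:
  assumes "prime (p::int)" "odd p" "prime q" "odd q" "p \<noteq> q"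
  shows "Legendre p q = Legendre q p * recip_sign p q"
proof -
  have p2: "p > 2" "q > 2" using euler_criterion_int(1) assms by auto
  have pr: "prime (nat p)" "prime (nat q)" using assms by auto
  have "Legendre p q * Legendre q p = (-1) ^ (nat ((p - 1) div 2 * ((q - 1) div 2)))"
    using Quadratic_Reciprocity_int pr p2 assms by blast
  also have "\<dots> = recip_sign p q"
  proof -
    have *: "even ((r - 1) div 2) \<longleftrightarrow> r mod 4 = 1" if "odd r" for r :: int using that by presburger
    have "(p - 1) div 2 * ((q - 1) div 2) \<ge> 0" using p2 by auto
    then have "even (nat ((p - 1) div 2 * ((q - 1) div 2))) \<longleftrightarrow> p mod 4 = 1 \<or> q mod 4 = 1"
      using * assms by (simp add: even_nat_iff)
    then show ?thesis
      using odd_mod_4[OF assms(2)] odd_mod_4[OF assms(4)]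
      by (cases "even (nat ((p - 1) div 2 * ((q - 1) div 2)))") (auto simp: recip_sign_def)
  qed
  finally have 1: "Legendre p q * Legendre q p = recip_sign p q" .
  have "coprime q p" using assms by (simp add: primes_coprime)
  then have "\<not> p dvd q" using assms(1) by (metis coprime_common_divisor dvd_refl not_prime_unit)
  then have "Legendre q p * Legendre q p = 1" by (simp add: Legendre_def cong_0_iff)
  then show ?thesis using 1 by (metis mult.assoc mult.commute mult_1)
qed

text \<open>Both symbols and the sign are multiplicative in each argument, so reciprocity passes
  from primes to odd numbers one argument at a time; here the first argument is still prime.\<close>

lemma jacobi_reciprocity_prime:
  assumes "odd n" "n > 0" "coprime p n" "prime (p::int)" "odd p"
  shows "jacobi p n = jacobi n p * recip_sign p n"
  using assms
proof (induction n rule: odd_pos_int_induct)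
  case one
  then show ?case by (simp add: jacobi_one_left recip_sign_def prime_gt_0_int)
next
  case (mult q m)
  then have nz: "q \<noteq> 0" "m \<noteq> 0" by auto
  have "p \<noteq> q" "coprime p m" using mult.prems mult(1) by auto
  have "jacobi p (q * m) = (Legendre q p * recip_sign p q) * (jacobi m p * recip_sign p m)"
    using mult nz Legendre_reciprocity[of p q] \<open>p \<noteq> q\<close> \<open>coprime p m\<close>
    by (simp add: jacobi_mult_right jacobi_prime)
  also have "\<dots> = jacobi (q * m) p * recip_sign p (q * m)"
    using mult prime_gt_0_int[of p] by (simp add: jacobi_mult_left jacobi_prime recip_sign_mult Legendre_mult)
  finally show ?case .
qed

lemma jacobi_reciprocity:
  assumes "odd m" "m > 0" "odd n" "n > 0" "coprime m n"
  shows "jacobi m n = jacobi n m * recip_sign m n"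
  using assms
proof (induction m rule: odd_pos_int_induct)
  case one
  then show ?case by (simp add: jacobi_one_left recip_sign_def)
next
  case (mult p m)
  then have nz: "p \<noteq> 0" "m \<noteq> 0" by auto
  have cp: "coprime p n" "coprime m n" using mult.prems by auto
  have "jacobi (p * m) n = (jacobi n p * recip_sign p n) * (jacobi n m * recip_sign m n)"
    using mult jacobi_reciprocity_prime[of n p] cp by (simp add: jacobi_mult_left)
  also have "\<dots> = jacobi n (p * m) * recip_sign (p * m) n"
    using nz mult recip_sign_mult[of p m n] by (simp add: jacobi_mult_right recip_sign_commute[of _ n])
  finally show ?case .
qed

text \<open>Since \<open>n - 2 \<equiv> -2\<close> modulo \<open>n\<close> and \<open>n \<equiv> 2\<close> modulo \<open>n - 2\<close>, reciprocity for \<open>n - 2\<close> and \<open>n\<close>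
  steps the symbol of 2 from \<open>n - 2\<close> to \<open>n\<close>.\<close>

lemma jacobi_2_nat: "jacobi 2 (2 * int n + 1) = (if n mod 4 = 0 \<or> n mod 4 = 3 then 1 else -1)"
proof (induction n)
  case (Suc n)
  define N where "N = 2 * int n + 1"
  have N: "odd N" "N > 0" "odd (N + 2)" "N + 2 > 0" by (auto simp: N_def)
  have cop: "coprime N (N + 2)"
  proof -
    have "coprime N 2" using N by simp
    then have "gcd N (N + 2) = 1" by (simp add: coprime_iff_gcd_eq_1)
    then show ?thesis by (simp add: coprime_iff_gcd_eq_1)
  qed
  have "jacobi N (N + 2) = jacobi (-1 * 2) (N + 2)"
    by (rule jacobi_cong) (use N in \<open>auto simp: cong_iff_dvd_diff\<close>)
  also have "\<dots> = chi4 (N + 2) * jacobi 2 (N + 2)"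
    using N by (subst jacobi_mult_left) (auto simp: jacobi_minus_1)
  finally have 1: "jacobi N (N + 2) = chi4 (N + 2) * jacobi 2 (N + 2)" .
  have "jacobi N (N + 2) = jacobi (N + 2) N * recip_sign N (N + 2)"
    by (rule jacobi_reciprocity) (use N cop in auto)
  also have "jacobi (N + 2) N = jacobi 2 N"
    by (rule jacobi_cong) (use N in \<open>auto simp: cong_iff_dvd_diff\<close>)
  also have "recip_sign N (N + 2) = 1" using N unfolding recip_sign_def by presburger
  finally have "chi4 (N + 2) * jacobi 2 (N + 2) = jacobi 2 N" using 1 by simp
  then have "jacobi 2 (N + 2) = chi4 (N + 2) * jacobi 2 N"
    by (auto simp: chi4_def split: if_splits)
  moreover have "N + 2 = 2 * int (Suc n) + 1" by (simp add: N_def)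
  moreover have "chi4 (N + 2) = (if even n then -1 else 1)"
    unfolding chi4_def N_def by (cases "even n") (auto, presburger+)
  ultimately have "jacobi 2 (2 * int (Suc n) + 1)
      = (if even n then -1 else 1) * (if n mod 4 = 0 \<or> n mod 4 = 3 then 1 else -1)"
    using Suc N_def by simp
  also have "\<dots> = (if Suc n mod 4 = 0 \<or> Suc n mod 4 = 3 then 1 else -1)"
    by (simp, presburger)
  finally show ?case .
qed auto

lemma jacobi_2:
  assumes "odd n" "n > 0"
  shows "jacobi 2 n = (if n mod 8 = 1 \<or> n mod 8 = 7 then 1 else -1)"
proof -
  obtain j where j: "n = 2 * j + 1" using assms(1) by (elim oddE)
  define i where "i = nat j"
  have n: "n = 2 * int i + 1" using j assms by (simp add: i_def)
  have "int (i mod 4) = int i mod 4" by (simp add: zmod_int)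
  then have "i mod 4 = 0 \<or> i mod 4 = 3 \<longleftrightarrow> int i mod 4 = 0 \<or> int i mod 4 = 3" by linarith
  also have "\<dots> \<longleftrightarrow> n mod 8 = 1 \<or> n mod 8 = 7" unfolding n by presburger
  finally show ?thesis using jacobi_2_nat[of i] n by simp
qed

lemma shimura_symbol_jacobi:
  "shimura_symbol c d = (if c < 0 \<and> d < 0 then -1 else 1) * jacobi c \<bar>d\<bar>"
  by (simp add: shimura_symbol_def jacobi_def)

text \<open>The sign rule in Shimura's symbol turns (-1/|d|) into a function of d modulo 4, and in
  the odd part (-1/m) absorbs the passage from |d| to d. So one formula serves both signs of
  \<open>d\<close>, and \<open>d\<close> enters it only through residues modulo 4, 8 and
  \<open>m\<close>.\<close>

lemma shimura_symbol_reciprocity: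
  assumes m: "odd m" "m > 0" and d: "odd d" "coprime m d" and \<sigma>: "\<sigma> = 1 \<or> \<sigma> = -1"
  shows "shimura_symbol (\<sigma> * 2 ^ e * m) d =
    (if \<sigma> = -1 \<and> d mod 4 = 3 then -1 else 1) * (if d mod 8 = 1 \<or> d mod 8 = 7 then 1 else -1) ^ e
      * jacobi d m * recip_sign m d"
proof -
  have ad: "odd \<bar>d\<bar>" "\<bar>d\<bar> > 0" "coprime m \<bar>d\<bar>" using d by auto
  have "jacobi (\<sigma> * 2 ^ e * m) \<bar>d\<bar> = jacobi \<sigma> \<bar>d\<bar> * jacobi 2 \<bar>d\<bar> ^ e * jacobi m \<bar>d\<bar>"
    using ad by (simp add: jacobi_mult_left jacobi_power_left)
  also have "jacobi m \<bar>d\<bar> = jacobi d m * recip_sign m d"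
  proof (cases "d > 0")
    case True
    then show ?thesis using jacobi_reciprocity[of m "\<bar>d\<bar>"] m ad by simp
  next
    case False
    have "jacobi m \<bar>d\<bar> = jacobi (-1 * d) m * recip_sign m (- d)"
      using jacobi_reciprocity[of m "\<bar>d\<bar>"] m ad False by simp
    also have "jacobi (-1 * d) m = chi4 m * jacobi d m"
      using m by (subst jacobi_mult_left) (auto simp: jacobi_minus_1)
    also have "chi4 m * jacobi d m * recip_sign m (- d) = jacobi d m * recip_sign m d"
    proof -
      have "(- d) mod 4 = 3 \<longleftrightarrow> d mod 4 = 1" "d mod 4 = 1 \<longleftrightarrow> d mod 4 \<noteq> 3" using d(1) by presburger+
      then show ?thesis using odd_mod_4[OF m(1)] by (auto simp: chi4_def recip_sign_def)
    qed
    finally show ?thesis .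
  qed
  also have "jacobi 2 \<bar>d\<bar> = (if d mod 8 = 1 \<or> d mod 8 = 7 then 1 else -1)"
  proof -
    have "(- d) mod 8 = 1 \<longleftrightarrow> d mod 8 = 7" "(- d) mod 8 = 7 \<longleftrightarrow> d mod 8 = 1" by presburger+
    then have "\<bar>d\<bar> mod 8 = 1 \<or> \<bar>d\<bar> mod 8 = 7 \<longleftrightarrow> d mod 8 = 1 \<or> d mod 8 = 7" by (auto simp: abs_if)
    then show ?thesis using ad by (simp add: jacobi_2)
  qed
  finally have J: "jacobi (\<sigma> * 2 ^ e * m) \<bar>d\<bar> = jacobi \<sigma> \<bar>d\<bar> * (if d mod 8 = 1 \<or> d mod 8 = 7 then 1 else -1) ^ e
    * (jacobi d m * recip_sign m d)" .
  have neg: "\<sigma> * 2 ^ e * m < 0 \<longleftrightarrow> \<sigma> = -1" using m \<sigma> by (auto simp: mult_less_0_iff zero_less_mult_iff)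
  have "(if \<sigma> = -1 \<and> d < 0 then -1 else 1) * jacobi \<sigma> \<bar>d\<bar> = (if \<sigma> = -1 \<and> d mod 4 = 3 then -1 else 1)"
  proof (cases "\<sigma> = 1")
    case True
    then show ?thesis using ad by (simp add: jacobi_one_left)
  next
    case False
    then have "\<sigma> = -1" using \<sigma> by simp
    moreover have "(- d) mod 4 = 1 \<longleftrightarrow> d mod 4 = 3" "d mod 4 = 1 \<longleftrightarrow> d mod 4 \<noteq> 3" using d(1) by presburger+
    ultimately show ?thesis using ad by (auto simp: jacobi_minus_1 chi4_def abs_if)
  qed
  then show ?thesis
    unfolding shimura_symbol_jacobi J neg by (simp add: mult.assoc[symmetric])
qed

section \<open>Half-integral weight transformations from two generators\<close>

text \<open>By reciprocity \<open>d\<close> matters only modulo 4, modulo the odd part of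
  \<open>c\<close>, and modulo 8 if the exponent of 2 in \<open>c\<close> is odd. Adding
  \<open>c\<close> preserves the first two residues; an odd exponent together with 4 | c is at least
  3, so the third is preserved too.\<close>

lemma shimura_symbol_add:
  assumes "4 dvd c" "coprime c d"
  shows "shimura_symbol c (d + c) = shimura_symbol c d"
proof (cases "c = 0")
  case False
  define e where "e = multiplicity 2 c"
  obtain m' where e: "c = 2 ^ e * m'" "odd m'"
    using False multiplicity_decompose'[of c 2] unfolding e_def by auto
  define \<sigma> m where "\<sigma> = sgn m'" and "m = \<bar>m'\<bar>"
  have m: "odd m" "m > 0" using e by (auto simp: m_def)
  have \<sigma>: "\<sigma> = 1 \<or> \<sigma> = -1" using e by (auto simp: \<sigma>_def sgn_if)
  have c: "c = \<sigma> * 2 ^ e * m" using e by (simp add: \<sigma>_def m_def mult.assoc) (metis mult.commute mult_sgn_abs)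
  have evc: "even c" using assms(1) dvd_trans[of 2 4 c] by simp
  have odd: "odd d" using coprime_common_divisor[OF assms(2), of 2] evc by auto
  have cop: "coprime m d" using assms(2) c by auto
  have cop': "coprime m (d + c)"
  proof (rule coprimeI)
    fix q assume q: "q dvd m" "q dvd d + c"
    then have "q dvd c" unfolding c by (simp add: dvd_mult)
    then have "q dvd d" using q(2) by (simp add: dvd_add_left_iff)
    then show "is_unit q" using coprime_common_divisor[OF cop q(1)] by simp
  qed
  have "jacobi (d + c) m = jacobi d m"
    by (rule jacobi_cong) (use m c in \<open>auto simp: cong_iff_dvd_diff\<close>)
  moreover have "(d + c) mod 4 = d mod 4" using assms(1) by presburger
  moreover have "(if (d + c) mod 8 = 1 \<or> (d + c) mod 8 = 7 then 1 else -1) ^ e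
      = (if d mod 8 = 1 \<or> d mod 8 = 7 then 1 else -1::int) ^ e"
  proof (cases "even e")
    case False
    then have "e \<noteq> 1 \<and> e \<noteq> 0 \<Longrightarrow> e \<ge> 3" by presburger
    moreover have "e \<noteq> 1"
    proof
      assume "e = 1"
      then show False using assms(1) e by (auto simp: dvd_def)
    qed
    ultimately have "(2::int) ^ 3 dvd 2 ^ e" using False by (intro le_imp_power_dvd) auto
    then have "8 dvd c" using e by (simp add: dvd_mult2)
    then have "(d + c) mod 8 = d mod 8" by presburger
    then show ?thesis by simp
  qed auto
  moreover have "odd (d + c)" using odd evc by simp
  ultimately show ?thesis
    using shimura_symbol_reciprocity[OF m odd cop \<sigma>, of e] shimura_symbol_reciprocity[OF m _ cop' \<sigma>, of e]
    unfolding c[symmetric] recip_sign_def by simp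
qed auto

text \<open>The Jacobi part sees \<open>c\<close> only modulo |d|, so a change can come only from
  the sign rule; for negative \<open>d\<close>, adding 4 d can turn a nonnegative upper entry
  negative but not conversely.\<close>

lemma shimura_symbol_add_4:
  assumes "odd d"
  shows "shimura_symbol (c + 4 * d) d = (if d < 0 \<and> c \<ge> 0 \<and> c + 4 * d < 0 then -1 else 1) * shimura_symbol c d"
proof -
  have "jacobi (c + 4 * d) \<bar>d\<bar> = jacobi c \<bar>d\<bar>"
    by (rule jacobi_cong) (use assms in \<open>auto simp: cong_iff_dvd_diff\<close>)
  then show ?thesis unfolding shimura_symbol_jacobi by auto
qed

text \<open>In the application j = 4z + 1, Y = (c + 4d) z + d and W = Y/j. The principal root is
  multiplicative unless arg W + arg j exceeds pi, and the lemma identifies this event with the sign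
  change found in \<open>shimura_symbol_add_4\<close>.\<close>

lemma csqrt_mult_branch:
  fixes d :: int and Y j :: complex
  assumes j: "Im j > 0" and W: "W = Y / j" and nz: "Y \<noteq> 0"
    and ImY: "sgn (Im Y) = sgn (of_int y)" and ImW: "sgn (Im W) = sgn (of_int c)"
    and y: "y = c + 4 * d" and d1: "c = 0 \<Longrightarrow> W = of_int d" and d2: "y = 0 \<Longrightarrow> Y = of_int d"
  shows "csqrt Y = (if d < 0 \<and> c \<ge> 0 \<and> y < 0 then -1 else 1) * (csqrt W * csqrt j)"
proof -
  have jnz: "j \<noteq> 0" using j by auto
  have WY: "Y = W * j" using W jnz by simp
  have Wnz: "W \<noteq> 0" using WY nz by auto
  have Lj: "0 < Im (Ln j)" "Im (Ln j) < pi" using j jnz Im_Ln_pos_lt_imp[of j] Im_Ln_pos_lt[of j] by auto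
  have rW: "- pi < Im (Ln W)" "Im (Ln W) \<le> pi" using Wnz mpi_less_Im_Ln Im_Ln_le_pi by auto
  have rY: "- pi < Im (Ln Y)" "Im (Ln Y) \<le> pi" using nz mpi_less_Im_Ln Im_Ln_le_pi by auto
  have eqn: "Ln Y = (if Im (Ln W + Ln j) \<le> pi then Ln W + Ln j else Ln W + Ln j - 2 * of_real pi * \<i>)"
    using Ln_times[OF Wnz jnz] Lj rW unfolding WY by (auto simp: algebra_simps)
  have s: "csqrt X = exp (Ln X / 2)" if "X \<noteq> 0" for X using csqrt_exp_Ln[OF that] .
  have m1: "exp (of_real pi * \<i>) = (-1::complex)" by (metis exp_pi_i mult.commute)
  \<comment> \<open>Since 0 < arg j < pi, the half-planes containing W and Y decide the case. On the
    boundary the value is the integer \<open>d\<close>, and a negative \<open>d\<close> has argument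
    exactly pi; so c = 0 wraps around while y = 0 does not.\<close>
  have iff: "(Im (Ln W + Ln j) \<le> pi) \<longleftrightarrow> \<not> (d < 0 \<and> c \<ge> 0 \<and> y < 0)"
  proof -
    consider "c < 0" | "c = 0" | "c > 0" by linarith
    then show ?thesis
    proof cases
      case 1
      then have "Im W < 0" using ImW by (simp add: sgn_if split: if_splits)
      then have "Im (Ln W) < 0" using Im_Ln_pos_le[OF Wnz] rW by force
      then show ?thesis using Lj 1 by auto
    next
      case 2
      then have Wd: "W = of_int d" using d1 by simp
      have dnz: "d \<noteq> 0" using Wd Wnz by auto
      show ?thesis
      proof (cases "d > 0")
        case True
        then have "Im (Ln W) = 0" using Wd by (simp add: Ln_of_real[of "of_int d", simplified])
        then show ?thesis using True Lj by auto
      next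
        case False
        then have dn: "d < 0" using dnz by simp
        have "Im (Ln W) = pi" using Im_Ln_eq_pi[OF Wnz] Wd dn by simp
        then show ?thesis using Lj dn 2 y by auto
      qed
    next
      case 3
      then have "Im W > 0" using ImW by (simp add: sgn_if split: if_splits)
      then have W0: "0 < Im (Ln W)" "Im (Ln W) < pi" using Im_Ln_pos_lt_imp[of W] Im_Ln_pos_lt[OF Wnz] by auto
      consider "y > 0" | "y = 0" | "y < 0" by linarith
      then show ?thesis
      proof cases
        case 1
        then have "Im Y > 0" using ImY by (simp add: sgn_if split: if_splits)
        then have "0 < Im (Ln Y)" using Im_Ln_pos_lt[OF nz] by auto
        then show ?thesis using eqn Lj W0 1 by (auto split: if_splits)
      next
        case 2
        then have "Y = of_int d" "d < 0" using d2 3 y by auto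
        then have "Im (Ln Y) = pi" using Im_Ln_eq_pi[OF nz] by simp
        then show ?thesis using eqn Lj W0 2 by (auto split: if_splits)
      next
        case 3
        then have "Im Y < 0" using ImY by (simp add: sgn_if split: if_splits)
        then have "Im (Ln Y) < 0" using Im_Ln_pos_le[OF nz] rY by force
        then show ?thesis using eqn Lj W0 3 \<open>c > 0\<close> y by (auto split: if_splits)
      qed
    qed
  qed
  show ?thesis
  proof (cases "Im (Ln W + Ln j) \<le> pi")
    case True
    then have "Ln Y / 2 = Ln W / 2 + Ln j / 2" using eqn by (simp add: add_divide_distrib)
    then have "exp (Ln Y / 2) = exp (Ln W / 2) * exp (Ln j / 2)" by (simp only: exp_add)
    then show ?thesis using True iff unfolding s[OF nz] s[OF Wnz] s[OF jnz] by simp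
  next
    case False
    then have "Ln Y / 2 = Ln W / 2 + Ln j / 2 - of_real pi * \<i>" using eqn by (simp add: field_simps)
    then have "exp (Ln Y / 2) = exp (Ln W / 2) * exp (Ln j / 2) / exp (of_real pi * \<i>)"
      by (simp only: exp_add exp_diff)
    then show ?thesis using False iff m1 unfolding s[OF nz] s[OF Wnz] s[OF jnz] by simp
  qed
qed


section \<open>Integer matrices and the cocycle of the theta factor\<close>

definition mat2 :: "int \<Rightarrow> int \<Rightarrow> int \<Rightarrow> int \<Rightarrow> int^2^2" where
  "mat2 a b c d = vector [vector [a, b], vector [c, d]]"

lemma mat2_nth [simp]:
  "mat2 a b c d $ 1 $ 1 = a" "mat2 a b c d $ 1 $ 2 = b"
  "mat2 a b c d $ 2 $ 1 = c" "mat2 a b c d $ 2 $ 2 = d"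
  by (simp_all add: mat2_def)

lemma mat2_eta: "M = mat2 (M $ 1 $ 1) (M $ 1 $ 2) (M $ 2 $ 1) (M $ 2 $ 2)"
  by (simp add: vec_eq_iff forall_2)

lemma mat2_in_SL2Z: "mat2 a b c d \<in> SL2Z \<longleftrightarrow> a * d - b * c = 1"
  by (simp add: SL2Z_def det_2)

lemma mat2_in_Gamma0_4: "mat2 a b c d \<in> Gamma0_4 \<longleftrightarrow> a * d - b * c = 1 \<and> 4 dvd c"
  by (simp add: Gamma0_4_def mat2_in_SL2Z)

lemma det_odd_entry:
  assumes "a * d - b * c = 1" "4 dvd (c::int)"
  shows "odd d" "coprime c d"
proof -
  show cop: "coprime c d"
  proof (rule coprimeI)
    fix q assume "q dvd c" "q dvd d"
    then have "q dvd a * d - b * c" by simp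
    then show "is_unit q" using assms by simp
  qed
  show "odd d"
  proof
    assume "even d"
    moreover have "even c" using assms(2) by auto
    ultimately show False using cop by (metis coprime_common_divisor odd_one)
  qed
qed

lemma theta_eps_add: "4 dvd c \<Longrightarrow> theta_eps (c + d) = theta_eps d"
  by (auto simp: theta_eps_def cong_def mod_add_eq dvd_def)

lemma theta_factor_translate:
  assumes "a * d - b * c = 1" "4 dvd c"
  shows "theta_factor (mat2 a (a + b) c (c + d)) z = theta_factor (mat2 a b c d) (z + 1)"
  using shimura_symbol_add[OF assms(2) det_odd_entry(2)[OF assms]]
  by (simp add: theta_factor_def cocycle_def theta_eps_add[OF assms(2)] algebra_simps)

text \<open>The symbol jumps, by \<open>shimura_symbol_add_4\<close>, under the same condition as
  the square root, by \<open>csqrt_mult_branch\<close>. The two signs cancel and the cocycle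
  relation holds exactly; \<open>theta_eps\<close> sees only the unchanged \<open>d\<close>.\<close>

lemma theta_factor_lower:
  assumes M: "a * d - b * c = 1" "4 dvd c" and z: "Im z > 0"
  shows "theta_factor (mat2 (a + 4 * b) b (c + 4 * d) d) z
    = theta_factor (mat2 a b c d) (z / (4 * z + 1)) * csqrt (4 * z + 1)"
proof -
  define j where "j = 4 * z + 1"
  define Y where "Y = of_int (c + 4 * d) * z + of_int d"
  define W where "W = of_int c * (z / j) + of_int d"
  have j: "Im j > 0" using z by (simp add: j_def)
  then have jnz: "j \<noteq> 0" by auto
  have odd: "odd d" using det_odd_entry[OF M] by simp
  then have dnz: "d \<noteq> 0" by auto
  have WY: "W = Y / j" unfolding W_def Y_def using jnz by (simp add: j_def field_simps)
  have Ynz: "Y \<noteq> 0"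
  proof
    assume "Y = 0"
    then have "Im Y = 0" "Re Y = 0" by auto
    then have "(of_int (c + 4 * d)::real) = 0" "of_int d = (0::real)"
      using z by (auto simp: Y_def)
    then show False using dnz by simp
  qed
  have ImY: "Im Y = of_int (c + 4 * d) * Im z" by (simp add: Y_def)
  have ImW: "Im W = of_int c * (Im z / (cmod j)\<^sup>2)"
  proof -
    have "Im (z / j) = Im z / (cmod j)\<^sup>2"
      unfolding Im_divide by (simp add: j_def cmod_power2 algebra_simps)
    then show ?thesis unfolding W_def by (simp del: times_divide_eq_right)
  qed
  have "csqrt Y = (if d < 0 \<and> c \<ge> 0 \<and> c + 4 * d < 0 then -1 else 1) * (csqrt W * csqrt j)"
  proof (rule csqrt_mult_branch[OF j WY Ynz _ _ refl])
    show "sgn (Im Y) = sgn (of_int (c + 4 * d))" using z by (simp add: ImY sgn_mult)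
    have "Im z / (cmod j)\<^sup>2 > 0" using z jnz by simp
    then have "sgn (Im z / (cmod j)\<^sup>2) = 1" by (simp only: sgn_pos)
    then show "sgn (Im W) = sgn (of_int c)" by (simp only: ImW sgn_mult mult_1_right)
  qed (auto simp: W_def Y_def)
  moreover have "of_int (shimura_symbol (c + 4 * d) d)
     = (if d < 0 \<and> c \<ge> 0 \<and> c + 4 * d < 0 then -1 else 1) * (of_int (shimura_symbol c d) :: complex)"
    by (simp add: shimura_symbol_add_4[OF odd])
  ultimately have *: "of_int (shimura_symbol (c + 4 * d) d) * csqrt Y
      = of_int (shimura_symbol c d) * (csqrt W * csqrt j)"
    by auto
  have "theta_factor (mat2 (a + 4 * b) b (c + 4 * d) d) z
      = inverse (theta_eps d) * (of_int (shimura_symbol (c + 4 * d) d) * csqrt Y)"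
    unfolding theta_factor_def cocycle_def mat2_nth Y_def by (simp only: ac_simps)
  also have "\<dots> = inverse (theta_eps d) * (of_int (shimura_symbol c d) * (csqrt W * csqrt j))"
    by (simp only: *)
  also have "\<dots> = theta_factor (mat2 a b c d) (z / (4 * z + 1)) * csqrt (4 * z + 1)"
    unfolding theta_factor_def cocycle_def mat2_nth W_def j_def by (simp only: ac_simps)
  finally show ?thesis .
qed

text \<open>The claim for M is equivalent to the claim for M times either generator, both directions
  being available because the generators act bijectively on the upper half-plane. A Euclidean
  descent on |c| + |d| ends at c = 0.\<close>

lemma Gamma0_4_transformation:
  fixes f :: "complex \<Rightarrow> complex" and N :: nat
  assumes fT: "\<And>z. Im z > 0 \<Longrightarrow> f (z + 1) = f z"
    and fV: "\<And>z. Im z > 0 \<Longrightarrow> f (z / (4 * z + 1)) = csqrt (4 * z + 1) ^ N * f z"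
    and M: "M \<in> Gamma0_4" and z: "Im z > 0"
  shows "f (moebius M z) = theta_factor M z ^ N * f z"
proof -
  define P where "P = (\<lambda>M. \<forall>z. Im z > 0 \<longrightarrow> f (moebius M z) = theta_factor M z ^ N * f z)"
  have T: "P (mat2 a (a + b) c (c + d)) \<longleftrightarrow> P (mat2 a b c d)"
    if "a * d - b * c = 1" "4 dvd c" for a b c d
  proof -
    have 1: "moebius (mat2 a (a + b) c (c + d)) z = moebius (mat2 a b c d) (z + 1)" for z
      by (simp add: moebius_def cocycle_def algebra_simps)
    have 2: "(f (moebius (mat2 a (a + b) c (c + d)) z) = theta_factor (mat2 a (a + b) c (c + d)) z ^ N * f z)
      \<longleftrightarrow> (f (moebius (mat2 a b c d) (z + 1)) = theta_factor (mat2 a b c d) (z + 1) ^ N * f (z + 1))"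
      if "Im z > 0" for z
      using fT[OF that] by (simp add: 1 theta_factor_translate[OF \<open>a * d - b * c = 1\<close> \<open>4 dvd c\<close>])
    show ?thesis
    proof
      assume "P (mat2 a (a + b) c (c + d))"
      then show "P (mat2 a b c d)"
        using 2[of "z - 1" for z] unfolding P_def by (metis Im_complex_of_real diff_add_cancel minus_complex.simps(2) of_real_1 diff_zero)
    next
      assume "P (mat2 a b c d)"
      then show "P (mat2 a (a + b) c (c + d))" using 2 unfolding P_def by simp
    qed
  qed
  have V: "P (mat2 (a + 4 * b) b (c + 4 * d) d) \<longleftrightarrow> P (mat2 a b c d)"
    if "a * d - b * c = 1" "4 dvd c" for a b c d
  proof -
    have nz: "4 * z + 1 \<noteq> 0" if "Im z > 0" for z using that by (auto simp: complex_eq_iff)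
    have 1: "moebius (mat2 (a + 4 * b) b (c + 4 * d) d) z = moebius (mat2 a b c d) (z / (4 * z + 1))"
      if "Im z > 0" for z
    proof -
      have "moebius (mat2 a b c d) (z / (4 * z + 1))
          = ((of_int a * (z / (4 * z + 1)) + of_int b) * (4 * z + 1)) / ((of_int c * (z / (4 * z + 1)) + of_int d) * (4 * z + 1))"
        using nz[OF that] by (simp add: moebius_def cocycle_def)
      also have "(of_int a * (z / (4 * z + 1)) + of_int b) * (4 * z + 1) = of_int (a + 4 * b) * z + of_int b"
        using nz[OF that] by (simp add: field_simps)
      also have "(of_int c * (z / (4 * z + 1)) + of_int d) * (4 * z + 1) = of_int (c + 4 * d) * z + of_int d"
        using nz[OF that] by (simp add: field_simps)
      finally show ?thesis by (simp add: moebius_def cocycle_def)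
    qed
    have 2: "(f (moebius (mat2 (a + 4 * b) b (c + 4 * d) d) z) = theta_factor (mat2 (a + 4 * b) b (c + 4 * d) d) z ^ N * f z)
      \<longleftrightarrow> (f (moebius (mat2 a b c d) (z / (4 * z + 1))) = theta_factor (mat2 a b c d) (z / (4 * z + 1)) ^ N * f (z / (4 * z + 1)))"
      if "Im z > 0" for z
      using that by (simp add: 1 fV theta_factor_lower[OF \<open>a * d - b * c = 1\<close> \<open>4 dvd c\<close>] power_mult_distrib mult.assoc)
    have im: "Im (z / (4 * z + 1)) > 0" if "Im z > 0" for z
    proof -
      have "Im (z / (4 * z + 1)) = Im z / (cmod (4 * z + 1))\<^sup>2"
        unfolding Im_divide by (simp add: cmod_power2 algebra_simps)
      then show ?thesis using that nz[OF that] by simp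
    qed
    have inv: "\<exists>z'. Im z' > 0 \<and> z' / (4 * z' + 1) = z" if "Im z > 0" for z
    proof (intro exI conjI)
      have n: "1 - 4 * z \<noteq> 0" using that by (auto simp: complex_eq_iff)
      have "Im (z / (1 - 4 * z)) = Im z / (cmod (1 - 4 * z))\<^sup>2"
        unfolding Im_divide by (simp add: cmod_power2 algebra_simps)
      then show "Im (z / (1 - 4 * z)) > 0" using that n by simp
      have "4 * (z / (1 - 4 * z)) + 1 = 1 / (1 - 4 * z)" using n by (simp add: field_simps)
      then show "z / (1 - 4 * z) / (4 * (z / (1 - 4 * z)) + 1) = z" using n by simp
    qed
    show ?thesis
    proof
      assume L: "P (mat2 (a + 4 * b) b (c + 4 * d) d)"
      show "P (mat2 a b c d)" unfolding P_def
      proof (intro allI impI)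
        fix z :: complex assume "Im z > 0"
        then obtain z' where "Im z' > 0" "z' / (4 * z' + 1) = z" using inv by blast
        then show "f (moebius (mat2 a b c d) z) = theta_factor (mat2 a b c d) z ^ N * f z"
          using L 2[of z'] unfolding P_def by simp
      qed
    next
      assume "P (mat2 a b c d)"
      then show "P (mat2 (a + 4 * b) b (c + 4 * d) d)" using 2 im unfolding P_def by simp
    qed
  qed
  have base1: "P (mat2 1 b 0 1)" for b
  proof (induction b rule: int_induct[of _ 0])
    case base
    show ?case unfolding P_def
      by (auto simp: moebius_def theta_factor_def cocycle_def shimura_symbol_jacobi theta_eps_def)
  next
    case (step1 i)
    then show ?case using T[of 1 1 i 0] by (simp add: add.commute)
  next
    case (step2 i)
    then show ?case using T[of 1 1 "i - 1" 0] by simp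
  qed
  have base2: "P (mat2 (-1) b 0 (-1))" for b
  proof (induction b rule: int_induct[of _ 0])
    case base
    \<comment> \<open>For minus the identity the inverse of \<open>theta_eps\<close> cancels the
      principal root of -1, so the theta factor is 1.\<close>
    have "theta_eps (- 1) = \<i>" by (simp add: theta_eps_def cong_def)
    then show ?case unfolding P_def
      by (auto simp: moebius_def theta_factor_def cocycle_def shimura_symbol_jacobi)
  next
    case (step1 i)
    then show ?case using T[of "-1" "-1" "i + 1" 0] by simp
  next
    case (step2 i)
    then show ?case using T[of "-1" "-1" i 0] by simp
  qed
  have main: "\<forall>a b c d. n = nat (\<bar>c\<bar> + \<bar>d\<bar>) \<longrightarrow> a * d - b * c = 1 \<longrightarrow> 4 dvd c \<longrightarrow> P (mat2 a b c d)" for n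
  proof (induction n rule: less_induct)
    case (less n)
    show ?case
    proof (intro allI impI)
      fix a b c d :: int assume n: "n = nat (\<bar>c\<bar> + \<bar>d\<bar>)" and det: "a * d - b * c = 1" and c4: "4 dvd c"
      have odd: "odd d" using det_odd_entry[OF det c4] by simp
      have IH: "P (mat2 a' b' c' d')" if "\<bar>c'\<bar> + \<bar>d'\<bar> < \<bar>c\<bar> + \<bar>d\<bar>" "a' * d' - b' * c' = 1" "4 dvd c'" for a' b' c' d'
        using less.IH[of "nat (\<bar>c'\<bar> + \<bar>d'\<bar>)"] that n by auto
      show "P (mat2 a b c d)"
      proof (cases "c = 0")
        case True
        then have "a * d = 1" using det by simp
        then have "a = 1 \<and> d = 1 \<or> a = -1 \<and> d = -1" by (simp add: zmult_eq_1_iff)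
        then show ?thesis using True base1 base2 by auto
      next
        case False
        \<comment> \<open>Equality would block the descent; it is impossible because 4 divides
          \<open>c\<close> while \<open>d\<close> is odd. For |c| below 2|d| a translation shortens
          \<open>d\<close>, above it the lower triangular generator shortens
          \<open>c\<close>.\<close>
        have ne: "\<bar>c\<bar> \<noteq> 2 * \<bar>d\<bar>"
        proof
          assume "\<bar>c\<bar> = 2 * \<bar>d\<bar>"
          moreover have "4 dvd \<bar>c\<bar>" using c4 by simp
          ultimately have "2 * 2 dvd 2 * \<bar>d\<bar>" by simp
          then have "even \<bar>d\<bar>" using dvd_mult_cancel_left[of 2 2 "\<bar>d\<bar>"] by simp
          then show False using odd by simp
        qed
        have d0: "d \<noteq> 0" using odd by auto
        have c4': "4 dvd c - 4 * d" "4 dvd c + 4 * d" using c4 by auto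
        consider "\<bar>c\<bar> < 2 * \<bar>d\<bar>" "\<bar>d - c\<bar> < \<bar>d\<bar>" | "\<bar>c\<bar> < 2 * \<bar>d\<bar>" "\<bar>c + d\<bar> < \<bar>d\<bar>"
          | "\<bar>c - 4 * d\<bar> < \<bar>c\<bar>" | "\<bar>c + 4 * d\<bar> < \<bar>c\<bar>"
          using ne False d0 by linarith
        then show ?thesis
        proof cases
          case 1
          have det': "a * (d - c) - (b - a) * c = 1" using det by (simp add: algebra_simps)
          have "P (mat2 a (b - a) c (d - c))" by (rule IH) (use 1 det' c4 in auto)
          then show ?thesis using T[OF det' c4] by simp
        next
          case 2
          have det': "a * (c + d) - (a + b) * c = 1" using det by (simp add: algebra_simps)
          have "P (mat2 a (a + b) c (c + d))" by (rule IH) (use 2 det' c4 in auto)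
          then show ?thesis using T[OF det c4] by simp
        next
          case 3
          have det': "(a - 4 * b) * d - b * (c - 4 * d) = 1" using det by (simp add: algebra_simps)
          have "P (mat2 (a - 4 * b) b (c - 4 * d) d)" by (rule IH) (use 3 det' c4' in auto)
          then show ?thesis using V[OF det' c4'(1)] by simp
        next
          case 4
          have det': "(a + 4 * b) * d - b * (c + 4 * d) = 1" using det by (simp add: algebra_simps)
          have "P (mat2 (a + 4 * b) b (c + 4 * d) d)" by (rule IH) (use 4 det' c4' in auto)
          then show ?thesis using V[OF det c4] by simp
        qed
      qed
    qed
  qed
  have "M = mat2 (M $ 1 $ 1) (M $ 1 $ 2) (M $ 2 $ 1) (M $ 2 $ 2)" by (rule mat2_eta)
  then have "P M"
    using main M mat2_in_Gamma0_4 by metis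
  then show ?thesis using z by (simp add: P_def)
qed

section \<open>Sums over forms and Gaussian integrals\<close>

lemma summable_on_int_abs:
  fixes h :: "nat \<Rightarrow> real"
  assumes "summable h" "\<And>n. h n \<ge> 0"
  shows "(\<lambda>n::int. h (nat \<bar>n\<bar>)) summable_on UNIV"
proof -
  have h: "h summable_on UNIV" using assms by (intro norm_summable_imp_summable_on) simp
  have 1: "(\<lambda>n::int. h (nat \<bar>n\<bar>)) summable_on range int"
    using h by (subst summable_on_reindex) (auto simp: o_def)
  have 2: "(\<lambda>n::int. h (nat \<bar>n\<bar>)) summable_on range (\<lambda>k. - int k)"
    using h by (subst summable_on_reindex) (auto simp: o_def inj_on_def)
  have "(UNIV :: int set) = range int \<union> range (\<lambda>k. - int k)"
  proof -
    have "x \<in> range int \<union> range (\<lambda>k. - int k)" for x :: int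
      by (cases "x \<ge> 0") (auto intro: range_eqI[of _ _ "nat x"] range_eqI[of _ _ "nat (- x)"])
    then show ?thesis by auto
  qed
  then show ?thesis using summable_on_union[OF 1 2] by simp
qed

lemma summable_on_prod_int3:
  fixes h :: "int \<Rightarrow> real"
  assumes "h summable_on UNIV" "\<And>n. h n \<ge> 0"
  shows "(\<lambda>(a, b, c). h a * (h b * h c)) summable_on (UNIV :: (int \<times> int \<times> int) set)"
proof -
  have s: "(h has_sum infsum h UNIV) UNIV" using assms(1) by simp
  have h0: "infsum h UNIV \<ge> 0" by (intro infsum_nonneg) (use assms in auto)
  have 1: "(\<lambda>(b, c). h b * h c) summable_on (UNIV \<times> UNIV)"
    by (rule summable_on_SigmaI[where g = "\<lambda>b. h b * infsum h UNIV"])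
       (use assms in \<open>auto intro!: has_sum_cmult_right s summable_on_cmult_left\<close>)
  have 2: "((\<lambda>(b, c). h b * h c) has_sum infsum (\<lambda>(b, c). h b * h c) UNIV) UNIV"
    using 1 by simp
  have "(\<lambda>(a, p). h a * (case p of (b, c) \<Rightarrow> h b * h c)) summable_on (UNIV \<times> UNIV)"
    by (rule summable_on_SigmaI[where g = "\<lambda>a. h a * infsum (\<lambda>(b, c). h b * h c) UNIV"])
       (use assms 2 in \<open>auto intro!: has_sum_cmult_right[OF 2] summable_on_cmult_left\<close>)
  then show ?thesis by (simp add: case_prod_unfold)
qed

text \<open>The l1 norm on the coefficient lattice, against which all convergence over forms is
  measured.\<close>

definition form_size :: "int \<times> int \<times> int \<Rightarrow> real" where
  "form_size = (\<lambda>(a, b, c). \<bar>of_int a\<bar> + \<bar>of_int b\<bar> + \<bar>of_int c\<bar>)"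

lemma form_size_nonneg [simp]: "form_size Q \<ge> 0"
  by (cases Q) (simp add: form_size_def)

lemma form_size_ge_1: "Q \<noteq> (0, 0, 0) \<Longrightarrow> form_size Q \<ge> 1"
proof (cases Q)
  case (fields a b c)
  assume "Q \<noteq> (0, 0, 0)"
  then have "\<bar>a\<bar> + \<bar>b\<bar> + \<bar>c\<bar> \<ge> 1" using fields by auto
  then have "real_of_int (\<bar>a\<bar> + \<bar>b\<bar> + \<bar>c\<bar>) \<ge> 1" by linarith
  then show ?thesis by (simp add: fields form_size_def)
qed

text \<open>For a nonzero form each of 1 + |a|, 1 + |b|, 1 + |c| is at most twice the size, so
  splitting the exponent in three compares with a product of one-dimensional series of exponent
  \<alpha>/3 > 1. At the zero form \<open>0 powr\<close> gives 0.\<close>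

lemma form_size_pow_summable:
  assumes "\<alpha> > 3"
  shows "(\<lambda>Q. form_size Q powr (- \<alpha>)) summable_on UNIV"
proof -
  define h where "h = (\<lambda>n::nat. (1 + real n) powr (- \<alpha> / 3))"
  have sm: "summable h"
  proof -
    have "summable (\<lambda>n. real n powr (- \<alpha> / 3))" using assms by (simp add: summable_real_powr_iff)
    then have "summable (\<lambda>n. real (Suc n) powr (- \<alpha> / 3))" by (subst summable_Suc_iff)
    then show ?thesis by (simp add: h_def add.commute)
  qed
  have h0: "h n \<ge> 0" for n by (simp add: h_def)
  have "(\<lambda>(a, b, c). h (nat \<bar>a\<bar>) * (h (nat \<bar>b\<bar>) * h (nat \<bar>c\<bar>))) summable_on (UNIV :: (int \<times> int \<times> int) set)"
    by (rule summable_on_prod_int3[OF summable_on_int_abs[OF sm h0]]) (use h0 in auto)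
  then have "(\<lambda>Q. 2 powr \<alpha> * (case Q of (a, b, c) \<Rightarrow> h (nat \<bar>a\<bar>) * (h (nat \<bar>b\<bar>) * h (nat \<bar>c\<bar>)))) summable_on (UNIV :: (int \<times> int \<times> int) set)"
    by (rule summable_on_cmult_right)
  then show ?thesis
  proof (rule summable_on_comparison_test)
    fix Q :: "int \<times> int \<times> int"
    obtain a b c where Q: "Q = (a, b, c)" by (cases Q)
    show "form_size Q powr (- \<alpha>) \<le> 2 powr \<alpha> * (case Q of (a, b, c) \<Rightarrow> h (nat \<bar>a\<bar>) * (h (nat \<bar>b\<bar>) * h (nat \<bar>c\<bar>)))"
    proof (cases "Q = (0, 0, 0)")
      case False
      define n where "n = form_size Q"
      have n1: "n \<ge> 1" using form_size_ge_1[OF False] by (simp add: n_def)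
      have le: "1 + \<bar>real_of_int a\<bar> \<le> 2 * n" "1 + \<bar>real_of_int b\<bar> \<le> 2 * n" "1 + \<bar>real_of_int c\<bar> \<le> 2 * n"
        using n1 unfolding n_def Q form_size_def by auto
      have hb: "(2 * n) powr (- \<alpha> / 3) \<le> h (nat \<bar>i\<bar>)" if "1 + \<bar>real_of_int i\<bar> \<le> 2 * n" for i
        unfolding h_def using assms that by (intro powr_mono2') auto
      have "n powr (- \<alpha>) = 2 powr \<alpha> * ((2 * n) powr (- \<alpha> / 3) * ((2 * n) powr (- \<alpha> / 3) * (2 * n) powr (- \<alpha> / 3)))"
        using n1 by (simp add: powr_add[symmetric] powr_mult field_simps powr_minus)
      also have "\<dots> \<le> 2 powr \<alpha> * (h (nat \<bar>a\<bar>) * (h (nat \<bar>b\<bar>) * h (nat \<bar>c\<bar>)))"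
        by (intro mult_left_mono mult_mono hb le mult_nonneg_nonneg h0) auto
      finally show ?thesis by (simp add: n_def Q)
    qed (auto simp: form_size_def h_def)
  qed auto
qed

text \<open>Raise x/N \<le> exp(x/N) to the power N.\<close>

lemma exp_mult_powr_bounded:
  fixes N :: real
  assumes "N > 0" "x > 0"
  shows "exp (- x) \<le> N powr N * x powr (- N)"
proof -
  have "x / N \<le> exp (x / N)" using exp_ge_add_one_self[of "x / N"] by linarith
  then have "(x / N) powr N \<le> exp (x / N) powr N" using assms by (intro powr_mono2) auto
  also have "exp (x / N) powr N = exp x" using assms by (simp add: powr_def)
  finally have "x powr N \<le> exp x * N powr N" using assms by (simp add: powr_divide field_simps)
  then show ?thesis using assms by (simp add: exp_minus powr_minus field_simps)
qed

lemma gauss_form_size_summable: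
  fixes \<epsilon> B :: real
  assumes "\<epsilon> > 0"
  shows "(\<lambda>Q. exp (- \<epsilon> * form_size Q ^ 2 + B * form_size Q)) summable_on UNIV"
proof -
  \<comment> \<open>The first factor is the maximum of exp((B + 1) n - \<epsilon> n^2). It leaves
    exp(-n), which the second factor bounds by the power -4 of n; the exponent 4 exceeds the rank
    3.\<close>
  define C where "C = exp ((B + 1)\<^sup>2 / (4 * \<epsilon>)) * (4 powr 4)"
  have "(\<lambda>Q. C * form_size Q powr (- 4)) summable_on UNIV"
    by (intro summable_on_cmult_right form_size_pow_summable) simp
  then have "(\<lambda>Q. exp (- \<epsilon> * form_size Q ^ 2 + B * form_size Q)) summable_on UNIV - {(0,0,0)}"
  proof (rule summable_on_comparison_test[OF summable_on_subset_banach])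
    fix Q :: "int \<times> int \<times> int" assume "Q \<in> UNIV - {(0,0,0)}"
    then have n1: "form_size Q \<ge> 1" using form_size_ge_1 by auto
    define n where "n = form_size Q"
    have "0 \<le> (2 * \<epsilon> * n - (B + 1))\<^sup>2 / (4 * \<epsilon>)" using assms by simp
    also have "(2 * \<epsilon> * n - (B + 1))\<^sup>2 / (4 * \<epsilon>) = \<epsilon> * n ^ 2 - (B + 1) * n + (B + 1)\<^sup>2 / (4 * \<epsilon>)"
      using assms by (simp add: field_simps power2_eq_square)
    finally have "- \<epsilon> * n ^ 2 + B * n \<le> (B + 1)\<^sup>2 / (4 * \<epsilon>) - n" by (simp add: algebra_simps)
    then have "exp (- \<epsilon> * n ^ 2 + B * n) \<le> exp ((B + 1)\<^sup>2 / (4 * \<epsilon>)) * exp (- n)"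
      by (simp add: exp_add[symmetric])
    also have "\<dots> \<le> exp ((B + 1)\<^sup>2 / (4 * \<epsilon>)) * (4 powr 4 * n powr (- 4))"
      using exp_mult_powr_bounded[of 4 n] n1 by (intro mult_left_mono) (auto simp: n_def)
    finally show "exp (- \<epsilon> * form_size Q ^ 2 + B * form_size Q) \<le> C * form_size Q powr (- 4)"
      by (simp add: C_def n_def mult.assoc)
  qed auto
  then show ?thesis
    using summable_on_union[of "\<lambda>Q. exp (- \<epsilon> * form_size Q ^ 2 + B * form_size Q)" "UNIV - {(0,0,0)}" "{(0,0,0)}"]
    by simp
qed

lemma gauss_int_summable:
  fixes \<epsilon> B :: real
  assumes "\<epsilon> > 0"
  shows "(\<lambda>n::int. exp (- \<epsilon> * \<bar>of_int n\<bar> ^ 2 + B * \<bar>of_int n\<bar>)) summable_on UNIV"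
proof -
  have "(\<lambda>Q. exp (- \<epsilon> * form_size Q ^ 2 + B * form_size Q)) summable_on range (\<lambda>n. (n, 0, 0))"
    using summable_on_subset_banach[OF gauss_form_size_summable[OF assms]] by blast
  then show ?thesis
    by (subst (asm) summable_on_reindex) (auto simp: inj_on_def o_def form_size_def)
qed

section \<open>Gaussian integrals with complex parameters\<close>

lemma gauss_integrable_real:
  fixes p q :: real
  assumes "p > 0"
  shows "has_bochner_integral lborel (\<lambda>x. exp (- pi * p * x\<^sup>2 + 2 * pi * q * x)) (exp (pi * q\<^sup>2 / p) / sqrt p)"
proof -
  define \<sigma> where "\<sigma> = 1 / sqrt (2 * pi * p)"
  have \<sigma>: "\<sigma> > 0" "\<sigma>\<^sup>2 = 1 / (2 * pi * p)" using assms by (auto simp: \<sigma>_def power_divide)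
  have eq: "exp (- pi * p * x\<^sup>2 + 2 * pi * q * x) = (exp (pi * q\<^sup>2 / p) / sqrt p) * normal_density (q / p) \<sigma> x" for x
  proof -
    have 1: "2 * pi * \<sigma>\<^sup>2 = 1 / p" using assms by (simp add: \<sigma>)
    have 2: "- (x - q / p)\<^sup>2 / (2 * \<sigma>\<^sup>2) = - pi * p * x\<^sup>2 + 2 * pi * q * x - pi * q\<^sup>2 / p"
      using assms unfolding \<sigma>(2) by (simp add: field_simps power2_eq_square)
    have "normal_density (q / p) \<sigma> x = sqrt p * exp (- pi * p * x\<^sup>2 + 2 * pi * q * x - pi * q\<^sup>2 / p)"
      using assms unfolding normal_density_def 1 2 by (simp add: real_sqrt_divide)
    then show ?thesis using assms by (simp add: exp_diff)
  qed
  have "has_bochner_integral lborel (\<lambda>x. (exp (pi * q\<^sup>2 / p) / sqrt p) * normal_density (q / p) \<sigma> x)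
      ((exp (pi * q\<^sup>2 / p) / sqrt p) * 1)"
    using \<sigma> by (intro has_bochner_integral_mult_right) (simp add: has_bochner_integral_iff)
  then show ?thesis unfolding eq by (simp only: mult_1_right)
qed

text \<open>Real parameters accumulate inside the domain, so identities proved for them extend by
  the identity theorem.\<close>

lemma islimpt_reals_complex:
  assumes "open U" "of_real x \<in> U" "V = U \<inter> \<real>"
  shows "(of_real x :: complex) islimpt V"
  unfolding islimpt_approachable
proof (intro allI impI)
  fix e :: real assume "e > 0"
  obtain d where d: "d > 0" "ball (of_real x) d \<subseteq> U" using assms open_contains_ball by blast
  define y where "y = x + min d e / 2"
  have "complex_of_real y - of_real x = of_real (min d e / 2)" by (simp add: y_def)
  then have dd: "dist (complex_of_real y) (of_real x) = min d e / 2"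
    unfolding dist_norm using d \<open>e > 0\<close> by (simp only: norm_of_real)
  then have "complex_of_real y \<in> V" using d \<open>e > 0\<close> assms(3) by (auto simp: subset_iff dist_commute)
  moreover have "complex_of_real y \<noteq> of_real x" using d \<open>e > 0\<close> by (simp add: y_def)
  ultimately show "\<exists>x'\<in>V. x' \<noteq> complex_of_real x \<and> dist x' (complex_of_real x) < e"
    using dd d \<open>e > 0\<close> by (intro bexI[of _ "complex_of_real y"]) auto
qed

lemma gauss_integrable_abs:
  fixes p q :: complex
  assumes "Re p > 0"
  shows "integrable lborel (\<lambda>x::real. exp (- of_real pi * p * of_real x ^ 2 + 2 * of_real pi * q * of_real x))"
proof (rule Bochner_Integration.integrable_bound)
  show "integrable lborel (\<lambda>x. exp (- pi * Re p * x\<^sup>2 + 2 * pi * Re q * x))"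
    using gauss_integrable_real[OF assms] by (simp add: has_bochner_integral_iff)
qed (auto simp: power2_eq_square)

text \<open>The normal density gives real parameters; the identity is continued in \<open>q\<close>
  over the plane and in \<open>p\<close> over the right half-plane, where the principal root is
  holomorphic. This settles the branch.\<close>

lemma gauss_integral:
  fixes p q :: complex
  assumes p: "Re p > 0"
  shows "(\<integral>x. exp (- of_real pi * p * of_real x ^ 2 + 2 * of_real pi * q * of_real x) \<partial>lborel)
    = exp (of_real pi * q\<^sup>2 / p) / csqrt p"
proof -
  define F :: "complex \<Rightarrow> complex \<Rightarrow> complex" where "F = (\<lambda>p q. \<integral>x. exp (- of_real pi * p * of_real x ^ 2 + 2 * of_real pi * q * of_real x) \<partial>lborel)"
  have real: "F (of_real p) (of_real q) = exp (of_real pi * (of_real q)\<^sup>2 / of_real p) / csqrt (of_real p)" if "p > 0" for p q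
  proof -
    have "F (of_real p) (of_real q) = (\<integral>x. of_real (exp (- pi * p * x\<^sup>2 + 2 * pi * q * x)) \<partial>lborel)"
      unfolding F_def by (intro Bochner_Integration.integral_cong refl) (simp add: exp_of_real[symmetric])
    also have "\<dots> = of_real (exp (pi * q\<^sup>2 / p) / sqrt p)"
      using has_bochner_integral_of_real[OF gauss_integrable_real[OF that, of q], where 'a=complex]
      by (simp add: has_bochner_integral_iff)
    finally show ?thesis using that by (simp add: exp_of_real[symmetric] csqrt_of_real_nonneg)
  qed
  have holq: "F (of_real p) holomorphic_on UNIV" if p: "p > 0" for p
  proof -
    have "F (of_real p) holomorphic_on ball 0 R" for R
      unfolding F_def
    proof (rule holomorphic_on_parameter_integral)
      \<comment> \<open>The exponential of 2 pi R |x| is at most the sum of the exponentials for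
        both signs of x, so the majorant remains a sum of Gaussians.\<close>
      show "integrable lborel (\<lambda>x. exp (- pi * p * x\<^sup>2 + 2 * pi * R * x) + exp (- pi * p * x\<^sup>2 + 2 * pi * (- R) * x))"
        using gauss_integrable_real[OF p, of R] gauss_integrable_real[OF p, of "- R"]
        by (intro Bochner_Integration.integrable_add) (simp_all only: has_bochner_integral_iff)
      fix q :: complex and x :: real assume q: "q \<in> ball 0 R"
      have "norm (exp (- of_real pi * of_real p * of_real x ^ 2 + 2 * of_real pi * q * of_real x))
         = exp (- pi * p * x\<^sup>2 + 2 * pi * (Re q * x))" by (simp add: power2_eq_square)
      also have "\<dots> \<le> exp (- pi * p * x\<^sup>2 + 2 * pi * (R * \<bar>x\<bar>))"
      proof -
        have "Re q * x \<le> \<bar>Re q\<bar> * \<bar>x\<bar>" by (metis abs_ge_self abs_mult)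
        also have "\<dots> \<le> R * \<bar>x\<bar>" using q abs_Re_le_cmod[of q] by (intro mult_right_mono) auto
        finally show ?thesis by simp
      qed
      also have "\<dots> \<le> exp (- pi * p * x\<^sup>2 + 2 * pi * R * x) + exp (- pi * p * x\<^sup>2 + 2 * pi * (- R) * x)"
        by (cases "x \<ge> 0") (simp_all add: mult.assoc)
      finally show "norm (exp (- of_real pi * of_real p * of_real x ^ 2 + 2 * of_real pi * q * of_real x))
        \<le> exp (- pi * p * x\<^sup>2 + 2 * pi * R * x) + exp (- pi * p * x\<^sup>2 + 2 * pi * (- R) * x)" .
    qed (auto intro!: holomorphic_intros)
    then have "F (of_real p) field_differentiable at q" for q
      using holomorphic_on_imp_differentiable_at[of "F (of_real p)" "ball 0 (norm q + 1)" q] by auto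
    then show ?thesis by (simp add: holomorphic_on_def field_differentiable_at_within)
  qed
  have step1: "F (of_real p) q = exp (of_real pi * q\<^sup>2 / of_real p) / csqrt (of_real p)" if p: "p > 0" for p q
  proof -
    have "F (of_real p) q - exp (of_real pi * q\<^sup>2 / of_real p) / csqrt (of_real p) = 0"
    proof (rule analytic_continuation[where f = "\<lambda>q. F (of_real p) q - exp (of_real pi * q\<^sup>2 / of_real p) / csqrt (of_real p)" and w = q and U = "\<real>" and \<xi> = "of_real 0" and S = UNIV])
      show "(complex_of_real 0) islimpt \<real>" by (rule islimpt_reals_complex[of UNIV]) auto
      show "(\<lambda>q. F (of_real p) q - exp (of_real pi * q\<^sup>2 / of_real p) / csqrt (of_real p)) holomorphic_on UNIV"
        using p by (intro holomorphic_intros holq) auto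
      show "F (of_real p) z - exp (of_real pi * z\<^sup>2 / of_real p) / csqrt (of_real p) = 0" if "z \<in> \<real>" for z
        using that real[OF p] by (auto elim!: Reals_cases)
    qed auto
    then show ?thesis by simp
  qed
  have holp: "(\<lambda>p. F p q) holomorphic_on {p. Re p > 0}"
  proof -
    have "(\<lambda>p. F p q) holomorphic_on {p. Re p > \<epsilon>}" if \<epsilon>: "\<epsilon> > 0" for \<epsilon>
      unfolding F_def
    proof (rule holomorphic_on_parameter_integral)
      show "integrable lborel (\<lambda>x. exp (- pi * \<epsilon> * x\<^sup>2 + 2 * pi * Re q * x))"
        using gauss_integrable_real[OF \<epsilon>] by (simp add: has_bochner_integral_iff)
      fix p :: complex and x :: real assume "p \<in> {p. Re p > \<epsilon>}"
      then have "\<epsilon> * x\<^sup>2 \<le> Re p * x\<^sup>2" by (intro mult_right_mono) auto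
      then show "norm (exp (- of_real pi * p * of_real x ^ 2 + 2 * of_real pi * q * of_real x))
        \<le> exp (- pi * \<epsilon> * x\<^sup>2 + 2 * pi * Re q * x)"
        by (simp add: power2_eq_square)
    qed (auto intro!: holomorphic_intros simp: open_halfspace_Re_gt)
    note hol = this
    have "(\<lambda>p. F p q) field_differentiable at p" if p: "Re p > 0" for p
    proof -
      obtain \<epsilon> where \<epsilon>: "0 < \<epsilon>" "\<epsilon> < Re p" using p dense by blast
      show ?thesis
        by (rule holomorphic_on_imp_differentiable_at[OF hol[OF \<epsilon>(1)]]) (use \<epsilon> open_halfspace_Re_gt in auto)
    qed
    then show ?thesis by (simp add: holomorphic_on_def field_differentiable_at_within)
  qed
  have "F p q - exp (of_real pi * q\<^sup>2 / p) / csqrt p = 0"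
  proof (rule analytic_continuation[where f = "\<lambda>p. F p q - exp (of_real pi * q\<^sup>2 / p) / csqrt p" and w = p and U = "{p. Re p > 0} \<inter> \<real>" and \<xi> = "of_real 1" and S = "{p. Re p > 0}"])
    show "(complex_of_real 1) islimpt {p. Re p > 0} \<inter> \<real>"
      by (rule islimpt_reals_complex[of "{p. Re p > 0}"]) (auto simp: open_halfspace_Re_gt)
    show "(\<lambda>p. F p q - exp (of_real pi * q\<^sup>2 / p) / csqrt p) holomorphic_on {p. Re p > 0}"
      by (intro holomorphic_intros holp) (auto simp: complex_nonpos_Reals_iff)
    show "F z q - exp (of_real pi * q\<^sup>2 / z) / csqrt z = 0" if "z \<in> {p. Re p > 0} \<inter> \<real>" for z
      using that step1 by (auto elim!: Reals_cases)
  qed (use p in \<open>auto simp: open_halfspace_Re_gt convex_connected convex_halfspace_Re_gt\<close>)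
  then show ?thesis by (simp add: F_def)
qed

section \<open>Fourier series at a point and Poisson summation\<close>

text \<open>Half-open, so that the integer translates of the interval tile the line without
  overlap.\<close>

definition unit_measure :: "real measure" where
  "unit_measure = restrict_space lborel {0..<1}"

definition ecis :: "int \<Rightarrow> real \<Rightarrow> complex" where
  "ecis n x = exp (2 * of_real pi * \<i> * of_int n * of_real x)"

lemma space_unit_measure [simp]: "space unit_measure = {0..<1}"
  by (simp add: unit_measure_def space_restrict_space)

lemma finite_measure_unit: "finite_measure unit_measure"
  by (rule finite_measureI) (simp add: unit_measure_def space_restrict_space emeasure_restrict_space)

lemma measure_unit_space: "measure unit_measure {0..<1} = 1"
  by (simp add: unit_measure_def measure_restrict_space)

lemma borel_measurable_unit [simp]: "f \<in> borel_measurable borel \<Longrightarrow> f \<in> borel_measurable unit_measure"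
  unfolding unit_measure_def by (rule measurable_restrict_space1) simp

lemma integral_unit: "(\<integral>x. f x \<partial>unit_measure) = (\<integral>x. indicator {0..<1} x *\<^sub>R f x \<partial>lborel)"
  for f :: "real \<Rightarrow> complex"
  unfolding unit_measure_def by (rule integral_restrict_space) simp

lemma integrable_unit_bounded:
  fixes f :: "real \<Rightarrow> complex"
  assumes "f \<in> borel_measurable borel" "\<And>x. 0 \<le> x \<Longrightarrow> x < 1 \<Longrightarrow> norm (f x) \<le> B"
  shows "integrable unit_measure f"
proof -
  interpret finite_measure unit_measure by (rule finite_measure_unit)
  show ?thesis by (rule integrable_const_bound[where B = B]) (use assms in auto)
qed

lemma norm_ecis [simp]: "norm (ecis n x) = 1"
  by (simp add: ecis_def)

lemma ecis_add: "ecis (m + n) x = ecis m x * ecis n x"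
  by (simp add: ecis_def exp_add[symmetric] algebra_simps)

lemma cnj_ecis: "cnj (ecis n x) = ecis (- n) x"
  by (simp add: ecis_def exp_cnj)

lemma ecis_0 [simp]: "ecis 0 x = 1"
  by (simp add: ecis_def)

lemma measurable_ecis [measurable]: "ecis n \<in> borel_measurable borel"
  unfolding ecis_def by (intro borel_measurable_continuous_onI continuous_intros)

lemma ecis_int: "ecis n (of_int m) = 1"
proof -
  have "ecis n (of_int m) = exp ((2 * of_int (n * m) * of_real pi) * \<i>)"
    by (simp add: ecis_def algebra_simps)
  then show ?thesis using exp_integer_2pi[of "of_int (n * m)"] by simp
qed

lemma integral_ecis: "(\<integral>x. ecis n x \<partial>unit_measure) = (if n = 0 then 1 else 0)"
proof (cases "n = 0")
  case True
  have "ecis 0 = (\<lambda>x. 1)" by auto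
  then show ?thesis using True measure_unit_space by simp
next
  case False
  have "(\<integral>x. indicator {0..<1} x *\<^sub>R ecis n x \<partial>lborel) = (\<integral>x. indicator {0..1} x *\<^sub>R ecis n x \<partial>lborel)"
  proof (rule integral_cong_AE)
    show "AE x in lborel. indicator {0..<1} x *\<^sub>R ecis n x = indicator {0..1} x *\<^sub>R ecis n x"
      using AE_lborel_singleton[of "1::real"] by eventually_elim (auto simp: indicator_def)
  qed auto
  also have "\<dots> = ecis n 1 / (2 * of_real pi * \<i> * of_int n) - ecis n 0 / (2 * of_real pi * \<i> * of_int n)"
  proof (rule integral_FTC_Icc)
    fix x :: real
    have "((\<lambda>z. exp (2 * of_real pi * \<i> * of_int n * z) / (2 * of_real pi * \<i> * of_int n)) has_field_derivative ecis n x) (at (of_real x))"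
      using False by (auto intro!: derivative_eq_intros simp: ecis_def)
    then have "((\<lambda>y. ecis n y / (2 * of_real pi * \<i> * of_int n)) has_vector_derivative ecis n x) (at x)"
      unfolding ecis_def by (rule has_vector_derivative_real_field)
    then show "((\<lambda>y. ecis n y / (2 * of_real pi * \<i> * of_int n)) has_vector_derivative ecis n x) (at x within {0..1})"
      by (rule has_vector_derivative_at_within)
  next
    show "continuous_on {0..1} (ecis n)" unfolding ecis_def by (intro continuous_intros)
  qed simp
  also have "\<dots> = 0" using ecis_int[of n 1] ecis_int[of n 0] by simp
  finally show ?thesis using False by (simp add: integral_unit)
qed

definition fcoeff :: "(real \<Rightarrow> complex) \<Rightarrow> int \<Rightarrow> complex" where
  "fcoeff f n = (\<integral>x. f x * ecis (- n) x \<partial>unit_measure)"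

text \<open>For the partial sum \<open>s\<close>, expanding the nonnegative integral of |g - s|^2
  gives the integral of |g|^2 minus the sum of squared coefficients.\<close>

lemma bessel:
  fixes g :: "real \<Rightarrow> complex"
  assumes g: "g \<in> borel_measurable borel" "\<And>x. 0 \<le> x \<Longrightarrow> x < 1 \<Longrightarrow> norm (g x) \<le> B"
    and F: "finite F"
  shows "(\<Sum>n\<in>F. norm (fcoeff g n) ^ 2) \<le> B ^ 2"
proof -
  interpret finite_measure unit_measure by (rule finite_measure_unit)
  have B0: "B \<ge> 0" using g(2)[of 0] norm_ge_zero[of "g 0"] by linarith
  define s where "s = (\<lambda>x. \<Sum>n\<in>F. fcoeff g n * ecis n x)"
  have ms [measurable]: "s \<in> borel_measurable borel" unfolding s_def by measurable
  note g(1) [measurable]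
  define S where "S = (\<Sum>n\<in>F. norm (fcoeff g n))"
  have bs: "norm (s x) \<le> S" for x
    unfolding s_def S_def by (rule order_trans[OF norm_sum]) (simp add: norm_mult)
  define T where "T = (\<Sum>n\<in>F. norm (fcoeff g n) ^ 2)"
  have S0: "S \<ge> 0" unfolding S_def by (intro sum_nonneg) auto
  have [measurable]: "cnj \<in> borel_measurable borel"
    by (intro borel_measurable_continuous_onI continuous_intros)
  have m: "(\<lambda>x. g x * cnj (g x)) \<in> borel_measurable borel" "(\<lambda>x. g x * cnj (s x)) \<in> borel_measurable borel"
    "(\<lambda>x. s x * cnj (g x)) \<in> borel_measurable borel" "(\<lambda>x. s x * cnj (s x)) \<in> borel_measurable borel"
    by measurable
  have i1: "integrable unit_measure (\<lambda>x. g x * cnj (g x))"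
    by (rule integrable_unit_bounded[where B = "B * B"])
       (use m g(2) B0 in \<open>auto simp: norm_mult intro!: mult_mono\<close>)
  have i2: "integrable unit_measure (\<lambda>x. g x * cnj (s x))"
    by (rule integrable_unit_bounded[where B = "B * S"])
       (use m g(2) bs B0 S0 in \<open>auto simp: norm_mult intro!: mult_mono\<close>)
  have i3: "integrable unit_measure (\<lambda>x. s x * cnj (g x))"
    by (rule integrable_unit_bounded[where B = "S * B"])
       (use m g(2) bs B0 S0 in \<open>auto simp: norm_mult intro!: mult_mono\<close>)
  have i4: "integrable unit_measure (\<lambda>x. s x * cnj (s x))"
    by (rule integrable_unit_bounded[where B = "S * S"])
       (use m bs S0 in \<open>auto simp: norm_mult intro!: mult_mono\<close>)
  have ig: "integrable unit_measure (\<lambda>x. g x * ecis n x)" for n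
    by (rule integrable_unit_bounded[where B = B]) (use g(2) in \<open>auto simp: norm_mult\<close>)
  have sq: "fcoeff g n * cnj (fcoeff g n) = of_real (norm (fcoeff g n) ^ 2)" for n
    by (rule complex_norm_square[symmetric])
  have e2: "(\<integral>x. g x * cnj (s x) \<partial>unit_measure) = of_real T"
  proof -
    have "(\<integral>x. g x * cnj (s x) \<partial>unit_measure) = (\<integral>x. (\<Sum>n\<in>F. cnj (fcoeff g n) * (g x * ecis (- n) x)) \<partial>unit_measure)"
      by (intro Bochner_Integration.integral_cong refl) (simp add: s_def cnj_ecis sum_distrib_left mult_ac)
    also have "\<dots> = (\<Sum>n\<in>F. cnj (fcoeff g n) * fcoeff g n)"
      by (subst Bochner_Integration.integral_sum) (auto simp: fcoeff_def intro!: Bochner_Integration.integrable_mult_right ig)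
    finally show ?thesis by (simp add: T_def sq mult.commute)
  qed
  have e3: "(\<integral>x. s x * cnj (g x) \<partial>unit_measure) = of_real T"
  proof -
    have "(\<integral>x. s x * cnj (g x) \<partial>unit_measure) = (\<integral>x. cnj (g x * cnj (s x)) \<partial>unit_measure)"
      by (simp add: mult.commute)
    also have "\<dots> = cnj (\<integral>x. g x * cnj (s x) \<partial>unit_measure)"
      by (rule integral_bounded_linear[OF bounded_linear_cnj i2])
    finally show ?thesis by (simp add: e2)
  qed
  have e4: "(\<integral>x. s x * cnj (s x) \<partial>unit_measure) = of_real T"
  proof -
    have "(\<integral>x. s x * cnj (s x) \<partial>unit_measure)
       = (\<integral>x. (\<Sum>n\<in>F. \<Sum>m\<in>F. fcoeff g n * cnj (fcoeff g m) * ecis (n - m) x) \<partial>unit_measure)"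
    proof (intro Bochner_Integration.integral_cong refl)
      fix x
      have "ecis (n - m) x = ecis n x * ecis (- m) x" for n m using ecis_add[of n "- m" x] by simp
      then show "s x * cnj (s x) = (\<Sum>n\<in>F. \<Sum>m\<in>F. fcoeff g n * cnj (fcoeff g m) * ecis (n - m) x)"
        by (simp add: s_def cnj_ecis sum_product mult_ac)
    qed
    also have "\<dots> = (\<Sum>n\<in>F. \<Sum>m\<in>F. fcoeff g n * cnj (fcoeff g m) * (if n - m = 0 then 1 else 0))"
    proof -
      have ii: "integrable unit_measure (\<lambda>x. fcoeff g n * cnj (fcoeff g m) * ecis (n - m) x)" for n m
        by (intro Bochner_Integration.integrable_mult_right integrable_unit_bounded[where B = 1]) auto
      show ?thesis using ii by (simp add: Bochner_Integration.integral_sum integral_ecis)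
    qed
    also have "\<dots> = of_real T" using F by (simp add: T_def sq if_distrib sum.delta' cong: if_cong)
    finally show ?thesis .
  qed
  have "(\<integral>x. (g x - s x) * cnj (g x - s x) \<partial>unit_measure)
      = (\<integral>x. g x * cnj (g x) - g x * cnj (s x) - s x * cnj (g x) + s x * cnj (s x) \<partial>unit_measure)"
    by (intro Bochner_Integration.integral_cong refl) (simp add: algebra_simps)
  also have "\<dots> = (\<integral>x. g x * cnj (g x) \<partial>unit_measure) - of_real T"
    using i1 i2 i3 i4 e2 e3 e4 by simp
  finally have key: "(\<integral>x. (g x - s x) * cnj (g x - s x) \<partial>unit_measure) = (\<integral>x. g x * cnj (g x) \<partial>unit_measure) - of_real T" .
  have a: "(\<integral>x. (g x - s x) * cnj (g x - s x) \<partial>unit_measure) = of_real (\<integral>x. norm (g x - s x) ^ 2 \<partial>unit_measure)"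
    by (simp only: complex_norm_square[symmetric] integral_complex_of_real)
  have b: "(\<integral>x. g x * cnj (g x) \<partial>unit_measure) = of_real (\<integral>x. norm (g x) ^ 2 \<partial>unit_measure)"
    by (simp only: complex_norm_square[symmetric] integral_complex_of_real)
  have "complex_of_real (\<integral>x. norm (g x - s x) ^ 2 \<partial>unit_measure)
      = of_real ((\<integral>x. norm (g x) ^ 2 \<partial>unit_measure) - T)"
    by (rule trans[OF a[symmetric] trans[OF key]]) (simp only: b of_real_diff)
  then have "(\<integral>x. norm (g x - s x) ^ 2 \<partial>unit_measure) = (\<integral>x. norm (g x) ^ 2 \<partial>unit_measure) - T"
    by (simp only: of_real_eq_iff)
  moreover have "(\<integral>x. norm (g x - s x) ^ 2 \<partial>unit_measure) \<ge> 0" by (rule integral_nonneg_AE) auto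
  moreover have "(\<integral>x. norm (g x) ^ 2 \<partial>unit_measure) \<le> B ^ 2"
  proof -
    have "integrable unit_measure (\<lambda>x. norm (g x) ^ 2)"
      using integrable_norm[OF i1] by (simp add: norm_mult power2_eq_square)
    then have "(\<integral>x. norm (g x) ^ 2 \<partial>unit_measure) \<le> (\<integral>x. B ^ 2 \<partial>unit_measure)"
      using g(2) by (intro integral_mono) (auto intro!: power_mono)
    then show ?thesis using measure_unit_space by simp
  qed
  ultimately show ?thesis by (simp add: T_def)
qed

text \<open>Riemann-Lebesgue for bounded functions: by Bessel's inequality the squared coefficients
  are summable along any injective sequence of frequencies.\<close>

lemma fcoeff_tendsto_0:
  fixes g :: "real \<Rightarrow> complex" and k :: "nat \<Rightarrow> int"
  assumes g: "g \<in> borel_measurable borel" "\<And>x. 0 \<le> x \<Longrightarrow> x < 1 \<Longrightarrow> norm (g x) \<le> B" and k: "inj k"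
  shows "(\<lambda>N. fcoeff g (k N)) \<longlonglongrightarrow> 0"
proof -
  have "summable (\<lambda>N. norm (fcoeff g (k N)) ^ 2)"
  proof (rule summableI_nonneg_bounded)
    fix n
    have "(\<Sum>i<n. norm (fcoeff g (k i)) ^ 2) = (\<Sum>i\<in>k ` {..<n}. norm (fcoeff g i) ^ 2)"
      using k by (subst sum.reindex) (auto intro: inj_on_subset)
    also have "\<dots> \<le> B ^ 2" by (rule bessel[OF g]) auto
    finally show "(\<Sum>i<n. norm (fcoeff g (k i)) ^ 2) \<le> B ^ 2" .
  qed auto
  then have "(\<lambda>N. norm (fcoeff g (k N)) ^ 2) \<longlonglongrightarrow> 0" by (rule summable_LIMSEQ_zero)
  then have "(\<lambda>N. sqrt (norm (fcoeff g (k N)) ^ 2)) \<longlonglongrightarrow> sqrt 0" by (rule tendsto_real_sqrt)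
  then show ?thesis by (simp add: tendsto_norm_zero_iff)
qed

lemma sin_ge_quarter:
  assumes "0 \<le> y" "y \<le> pi / 2"
  shows "y / 4 \<le> sin y"
proof (cases "y \<le> pi / 3")
  case True
  have "sin 0 - 0 / 4 \<le> sin y - y / 4"
  proof (rule DERIV_nonneg_imp_nondecreasing[OF assms(1)])
    fix x assume x: "0 \<le> x" "x \<le> y"
    have "cos (pi / 3) \<le> cos x" using x True by (intro cos_monotone_0_pi_le) auto
    then have "0 \<le> cos x - 1 / 4" by (simp add: cos_60)
    moreover have "((\<lambda>x. sin x - x / 4) has_real_derivative cos x - 1 / 4) (at x)"
      by (auto intro!: derivative_eq_intros)
    ultimately show "\<exists>d. ((\<lambda>x. sin x - x / 4) has_real_derivative d) (at x) \<and> 0 \<le> d" by blast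
  qed
  then show ?thesis by simp
next
  case False
  have "sin (pi / 6) \<le> sin y" using False assms by (intro sin_monotone_2pi_le) auto
  then have "1 / 2 \<le> sin y" by (simp add: sin_30)
  then show ?thesis using assms pi_less_4 by linarith
qed

text \<open>On the unit interval |e(x) - 1| is at least the distance from x to the nearest integer,
  so dividing a Lipschitz difference by it leaves a bounded function.\<close>

lemma norm_ecis_minus_1:
  assumes "0 \<le> x" "x \<le> 1"
  shows "min x (1 - x) \<le> norm (ecis 1 x - 1)"
proof -
  have eq: "norm (ecis 1 x - 1) = 2 * sin (pi * x)"
  proof -
    have "norm (exp (\<i> * of_real (2 * pi * x)) - 1) = 2 * \<bar>sin (2 * pi * x / 2)\<bar>" by (rule dist_exp_i_1)
    moreover have "sin (pi * x) \<ge> 0" using assms by (intro sin_ge_zero) (auto simp: mult_le_cancel_left1)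
    ultimately show ?thesis by (simp add: ecis_def mult_ac)
  qed
  have *: "x \<le> 2 * sin (pi * x)" if "0 \<le> x" "x \<le> 1 / 2" for x
  proof -
    have "pi * x / 4 \<le> sin (pi * x)" by (rule sin_ge_quarter) (use that in auto)
    moreover have "2 * x \<le> pi * x" using that pi_ge_two by (intro mult_right_mono) auto
    ultimately show ?thesis by simp
  qed
  show ?thesis
  proof (cases "x \<le> 1 / 2")
    case True
    then show ?thesis using *[of x] assms eq by auto
  next
    case False
    have "sin (pi * (1 - x)) = sin (pi * x)" by (simp add: right_diff_distrib sin_diff)
    then show ?thesis using *[of "1 - x"] assms eq False by auto
  qed
qed

text \<open>Chernoff's argument: dividing \<open>f - f 0\<close> by \<open>e(x) - 1\<close> turns the partial sums of the Fourier
  series at 0 into telescoping sums.\<close>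

lemma fourier_series_at_0:
  fixes f :: "real \<Rightarrow> complex"
  assumes f: "f \<in> borel_measurable borel"
    and L0: "\<And>x. 0 \<le> x \<Longrightarrow> x \<le> 1 \<Longrightarrow> norm (f x - f 0) \<le> L * x"
    and L1: "\<And>x. 0 \<le> x \<Longrightarrow> x \<le> 1 \<Longrightarrow> norm (f x - f 0) \<le> L * (1 - x)"
    and sm: "fcoeff f summable_on UNIV"
  shows "(fcoeff f has_sum f 0) UNIV"
proof -
  define g where "g = (\<lambda>x. (f x - f 0) / (ecis 1 x - 1))"
  note f [measurable]
  have gm: "g \<in> borel_measurable borel" unfolding g_def by measurable
  have L: "L \<ge> 0" using L0[of 1] norm_ge_zero[of "f 1 - f 0"] by linarith
  have ne: "min x (1 - x) > 0 \<Longrightarrow> ecis 1 x - 1 \<noteq> 0" if "0 \<le> x" "x \<le> 1" for x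
    using norm_ecis_minus_1[OF that] by auto
  have le: "norm (f x - f 0) \<le> L * norm (ecis 1 x - 1)" if x: "0 \<le> x" "x \<le> 1" for x
  proof -
    have "norm (f x - f 0) \<le> L * min x (1 - x)" using L0[OF x] L1[OF x] by (auto simp: min_def)
    also have "\<dots> \<le> L * norm (ecis 1 x - 1)" using norm_ecis_minus_1[OF x] L by (rule mult_left_mono)
    finally show ?thesis .
  qed
  have gb: "norm (g x) \<le> L" if "0 \<le> x" "x < 1" for x
  proof (cases "ecis 1 x - 1 = 0")
    case False
    then show ?thesis using le[of x] that by (simp add: g_def norm_divide divide_le_eq)
  qed (use L in \<open>simp add: g_def\<close>)
  have fg: "f x = f 0 + (g x * ecis 1 x - g x)" if "0 \<le> x" "x < 1" for x
  proof (cases "ecis 1 x - 1 = 0")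
    case True
    then show ?thesis using le[of x] that by (simp add: g_def)
  next
    case False
    have "g x * ecis 1 x - g x = g x * (ecis 1 x - 1)" by (simp add: algebra_simps)
    then show ?thesis using False by (simp add: g_def)
  qed
  have ig: "integrable unit_measure (\<lambda>x. g x * ecis n x)" for n
    by (rule integrable_unit_bounded[where B = L]) (use gm gb in \<open>auto simp: norm_mult\<close>)
  have coeff: "fcoeff f n = (if n = 0 then f 0 else 0) + (fcoeff g (n - 1) - fcoeff g n)" for n
  proof -
    have "fcoeff f n = (\<integral>x. f 0 * ecis (- n) x + (g x * ecis (- (n - 1)) x - g x * ecis (- n) x) \<partial>unit_measure)"
      unfolding fcoeff_def
    proof (intro Bochner_Integration.integral_cong refl)
      fix x assume "x \<in> space unit_measure"
      then have x: "0 \<le> x" "x < 1" by auto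
      have e: "ecis (- (n - 1)) x = ecis 1 x * ecis (- n) x" using ecis_add[of 1 "- n" x] by simp
      show "f x * ecis (- n) x = f 0 * ecis (- n) x + (g x * ecis (- (n - 1)) x - g x * ecis (- n) x)"
        unfolding e by (subst fg[OF x]) (simp add: algebra_simps)
    qed
    also have "\<dots> = f 0 * (if - n = 0 then 1 else 0) + (fcoeff g (n - 1) - fcoeff g n)"
    proof -
      have "integrable unit_measure (\<lambda>x. f 0 * ecis (- n) x)"
        by (intro Bochner_Integration.integrable_mult_right integrable_unit_bounded[where B = 1]) auto
      then show ?thesis using ig[of "- (n - 1)"] ig[of "- n"] integral_ecis[of "- n"] by (simp add: fcoeff_def)
    qed
    finally show ?thesis by simp
  qed
  \<comment> \<open>Telescoping: since \<open>coeff\<close> pairs the indices n - 1 and n, the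
    surviving coefficients of \<open>g\<close> sit at -N - 1 and at N.\<close>
  have part: "(\<Sum>n\<in>{- int N..int N}. fcoeff f n) = f 0 + (fcoeff g (- int N - 1) - fcoeff g (int N))" for N
  proof (induction N)
    case 0
    then show ?case by (simp add: coeff)
  next
    case (Suc N)
    have "{- int (Suc N)..int (Suc N)} = insert (- int (Suc N)) (insert (int (Suc N)) {- int N..int N})" by auto
    then have "(\<Sum>n\<in>{- int (Suc N)..int (Suc N)}. fcoeff f n)
       = fcoeff f (- int (Suc N)) + (fcoeff f (int (Suc N)) + (\<Sum>n\<in>{- int N..int N}. fcoeff f n))"
      by (simp only: sum.insert_if) simp
    also have "\<dots> = f 0 + (fcoeff g (- int (Suc N) - 1) - fcoeff g (int (Suc N)))"
      unfolding Suc coeff[of "- int (Suc N)"] coeff[of "int (Suc N)"]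
      by (simp add: algebra_simps) (rule arg_cong[where f = "fcoeff g"], simp)
    finally show ?case .
  qed
  have lim1: "(\<lambda>N. \<Sum>n\<in>{- int N..int N}. fcoeff f n) \<longlonglongrightarrow> f 0 + (0 - 0)"
    unfolding part by (intro tendsto_intros fcoeff_tendsto_0[OF gm gb]) (auto simp: inj_on_def)
  \<comment> \<open>The intervals from -N to N are cofinal among finite sets of integers, so the
    unordered sum must agree with the limit of the symmetric partial sums.\<close>
  obtain S where S: "(fcoeff f has_sum S) UNIV" using sm by (auto simp: summable_on_def)
  have "filterlim (\<lambda>N. {- int N..int N}) (finite_subsets_at_top UNIV) sequentially"
    unfolding filterlim_finite_subsets_at_top
  proof (intro allI impI)
    fix X :: "int set" assume X: "finite X \<and> X \<subseteq> UNIV"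
    show "\<forall>\<^sub>F N in sequentially. finite {- int N..int N} \<and> X \<subseteq> {- int N..int N} \<and> {- int N..int N} \<subseteq> UNIV"
    proof (rule eventually_sequentiallyI)
      fix N assume N: "nat (Max (insert 0 (abs ` X))) \<le> N"
      have "\<bar>x\<bar> \<le> int N" if "x \<in> X" for x
      proof -
        have "\<bar>x\<bar> \<le> Max (insert 0 (abs ` X))" using X that by (intro Max_ge) auto
        then show ?thesis using N by linarith
      qed
      then show "finite {- int N..int N} \<and> X \<subseteq> {- int N..int N} \<and> {- int N..int N} \<subseteq> UNIV" by force
    qed
  qed
  then have "(\<lambda>N. \<Sum>n\<in>{- int N..int N}. fcoeff f n) \<longlonglongrightarrow> S"
    using S unfolding has_sum_def by (rule filterlim_compose[rotated])
  then have "S = f 0" using LIMSEQ_unique lim1 by fastforce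
  then show ?thesis using S by simp
qed

text \<open>The half-open unit intervals partition the line: at x only the summand indexed by the
  floor of x survives.\<close>

lemma integral_unfold_periods:
  fixes h :: "real \<Rightarrow> complex"
  assumes h: "integrable lborel h"
  shows "((\<lambda>n::int. \<integral>x. h (x + of_int n) \<partial>unit_measure) has_sum (\<integral>x. h x \<partial>lborel)) UNIV"
proof -
  define f where "f = (\<lambda>(n::int) x. indicator {of_int n..<of_int n + 1} x *\<^sub>R h x)"
  have ind: "indicator {of_int n..<of_int n + 1} x = (if n = \<lfloor>x\<rfloor> then 1 else (0::real))" for n x
    using floor_eq_iff[of x n] by (auto simp: indicator_def)
  have fi: "integrable lborel (f n)" for n
    unfolding f_def using h by (intro integrable_mult_indicator) auto
  have hs: "((\<lambda>n. f n x) has_sum h x) UNIV" for x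
    by (rule has_sum_finite_neutralI[where B = "{\<lfloor>x\<rfloor>}"]) (auto simp: f_def ind)
  have hn: "finite {n \<in> UNIV. norm (f n x) \<noteq> 0}" for x
    by (rule finite_subset[of _ "{\<lfloor>x\<rfloor>}"]) (auto simp: f_def ind split: if_splits)
  have sm: "(\<lambda>n. \<integral>x. norm (f n x) \<partial>lborel) summable_on UNIV"
  proof (rule nonneg_bdd_above_summable_on)
    show "bdd_above (sum (\<lambda>n. \<integral>x. norm (f n x) \<partial>lborel) ` {F. F \<subseteq> UNIV \<and> finite F})"
    proof (rule bdd_aboveI2)
      fix F :: "int set" assume "F \<in> {F. F \<subseteq> UNIV \<and> finite F}"
      then have F: "finite F" by simp
      have "(\<Sum>n\<in>F. \<integral>x. norm (f n x) \<partial>lborel) = (\<integral>x. (\<Sum>n\<in>F. norm (f n x)) \<partial>lborel)"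
        using fi by (subst Bochner_Integration.integral_sum) auto
      also have "\<dots> \<le> (\<integral>x. norm (h x) \<partial>lborel)"
      proof (rule integral_mono)
        fix x
        have "(\<Sum>n\<in>F. norm (f n x)) = (\<Sum>n\<in>F. if n = \<lfloor>x\<rfloor> then norm (h x) else 0)"
          by (intro sum.cong refl) (auto simp: f_def ind)
        also have "\<dots> \<le> norm (h x)" using F by (simp add: sum.delta)
        finally show "(\<Sum>n\<in>F. norm (f n x)) \<le> norm (h x)" .
      qed (use fi h in auto)
      finally show "(\<Sum>n\<in>F. \<integral>x. norm (f n x) \<partial>lborel) \<le> (\<integral>x. norm (h x) \<partial>lborel)" .
    qed
  qed auto
  have "((\<lambda>n. \<integral>x. f n x \<partial>lborel) has_sum (\<integral>x. (\<Sum>\<^sub>\<infinity>n. f n x) \<partial>lborel)) UNIV"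
  proof (rule has_sum_integral(1)[OF _ fi order_refl sm])
    show "(\<lambda>n. norm (f n x)) summable_on UNIV" for x
      by (rule finite_nonzero_values_imp_summable_on) (rule hn)
  qed (rule lborel.sigma_finite_measure_axioms)
  moreover have "(\<Sum>\<^sub>\<infinity>n. f n x) = h x" for x using infsumI[OF hs] .
  moreover have "(\<integral>x. f n x \<partial>lborel) = (\<integral>x. h (x + of_int n) \<partial>unit_measure)" for n
  proof -
    have "(\<integral>x. f n x \<partial>lborel) = \<bar>1\<bar> *\<^sub>R (\<integral>x. f n (of_int n + 1 * x) \<partial>lborel)"
      by (rule lborel_integral_real_affine) simp
    also have "\<dots> = (\<integral>x. indicator {0..<1} x *\<^sub>R h (x + of_int n) \<partial>lborel)"
      by (auto simp: f_def indicator_def add.commute intro!: Bochner_Integration.integral_cong)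
    finally show ?thesis by (simp add: integral_unit)
  qed
  ultimately show ?thesis by simp
qed

section \<open>Poisson summation for Gaussians\<close>

lemma Re_inverse_pos: "Re p > 0 \<Longrightarrow> Re (1 / p) > 0"
  by (auto simp: Re_divide complex_eq_iff intro!: divide_pos_pos)
     (metis Re_complex_div_gt_0 add_pos_nonneg cmod_power2 less_irrefl zero_le_power2 zero_less_power)

text \<open>The periodisation F of the Gaussian is holomorphic, hence Lipschitz, and its Fourier
  coefficients unfold to Gaussian integrals with \<open>q\<close> shifted by -\<i> b. The identity
  is the Fourier series of F evaluated at 0.\<close>

lemma poisson_gauss:
  fixes p q :: complex
  assumes p: "Re p > 0"
  shows "((\<lambda>b::int. exp (of_real pi * (q - \<i> * of_int b)\<^sup>2 / p) / csqrt p) has_sum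
    (\<Sum>\<^sub>\<infinity>n::int. exp (- of_real pi * p * of_int n ^ 2 + 2 * of_real pi * q * of_int n))) UNIV"
proof -
  define G :: "complex \<Rightarrow> complex" where "G = (\<lambda>x. exp (- of_real pi * p * x ^ 2 + 2 * of_real pi * q * x))"
  define F where "F = (\<lambda>x::complex. \<Sum>\<^sub>\<infinity>n::int. G (x + of_int n))"
  define f where "f = (\<lambda>x::real. F (of_real x))"
  \<comment> \<open>Up to the factor pi, for |x| \<le> 3 the terms p x^2, 2 p x n, 2 q x and 2 q n
    of the expanded exponent are bounded by 9 |p|, 6 |p| |n|, 6 |q| and 2 |q| |n|.\<close>
  define B where "B = 6 * pi * norm p + 2 * pi * norm q"
  define C where "C = 9 * pi * norm p + 6 * pi * norm q"
  define M where "M = (\<lambda>n::int. exp C * exp (- (pi * Re p) * \<bar>of_int n\<bar> ^ 2 + B * \<bar>of_int n\<bar>))"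
  have Msum: "M summable_on UNIV"
    unfolding M_def using p by (intro summable_on_cmult_right gauss_int_summable) simp
  have Gb: "norm (G (x + of_int n)) \<le> M n" if "x \<in> ball 0 3" for x n
  proof -
    have x: "norm x \<le> 3" using that by simp
    define E where "E = - of_real pi * p * (x + of_int n) ^ 2 + 2 * of_real pi * q * (x + of_int n)"
    have E: "E = of_real (- (pi * of_int n ^ 2)) * p + (- of_real pi * p * x\<^sup>2 - 2 * of_real pi * p * x * of_int n
        + 2 * of_real pi * q * x + 2 * of_real pi * q * of_int n)"
      by (simp add: E_def algebra_simps power2_eq_square)
    have "Re E \<le> - (pi * of_int n ^ 2) * Re p + norm (- of_real pi * p * x\<^sup>2 - 2 * of_real pi * p * x * of_int n
        + 2 * of_real pi * q * x + 2 * of_real pi * q * of_int n)"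
      (is "_ \<le> _ + norm ?X")
    proof -
      have "Re E = - (pi * of_int n ^ 2) * Re p + Re ?X"
        unfolding E by (simp only: plus_complex.simps(1) times_complex.simps(1) Re_complex_of_real Im_complex_of_real)
      then show ?thesis using complex_Re_le_cmod[of ?X] by linarith
    qed
    also have "norm (- of_real pi * p * x\<^sup>2 - 2 * of_real pi * p * x * of_int n
        + 2 * of_real pi * q * x + 2 * of_real pi * q * of_int n)
        \<le> norm (- of_real pi * p * x\<^sup>2) + norm (2 * of_real pi * p * x * of_int n)
          + norm (2 * of_real pi * q * x) + norm (2 * of_real pi * q * of_int n)"
      by (intro order_trans[OF norm_triangle_ineq] add_mono order_refl order_trans[OF norm_triangle_ineq4])
    also have "\<dots> \<le> (pi * norm p) * 9 + (2 * pi * norm p * \<bar>of_int n\<bar>) * 3 + (2 * pi * norm q) * 3 + 2 * pi * norm q * \<bar>of_int n\<bar>"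
    proof (intro add_mono)
      have "norm x ^ 2 \<le> 3 ^ 2" using x by (intro power_mono) auto
      then show "norm (- of_real pi * p * x\<^sup>2) \<le> (pi * norm p) * 9"
        by (simp add: norm_mult norm_power mult_left_mono)
      show "norm (2 * of_real pi * p * x * of_int n) \<le> (2 * pi * norm p * \<bar>of_int n\<bar>) * 3"
        using mult_left_mono[OF x, of "2 * pi * norm p * \<bar>of_int n\<bar>"] by (simp add: norm_mult mult_ac)
      show "norm (2 * of_real pi * q * x) \<le> (2 * pi * norm q) * 3"
        using mult_left_mono[OF x, of "2 * pi * norm q"] by (simp add: norm_mult mult_ac)
    qed (simp add: norm_mult)
    finally have "Re E \<le> C + (- (pi * Re p) * \<bar>of_int n\<bar> ^ 2 + B * \<bar>of_int n\<bar>)"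
      by (simp add: B_def C_def algebra_simps)
    moreover have "norm (G (x + of_int n)) = exp (Re E)" by (simp add: G_def E_def)
    ultimately show ?thesis by (simp add: M_def exp_add[symmetric])
  qed
  have Ghol: "(\<lambda>x. G (x + of_int n)) holomorphic_on ball 0 3" for n
    unfolding G_def by (intro holomorphic_intros)
  have Fder: "F field_differentiable at x" if "x \<in> ball 0 3" for x
    using holomorphic_infsum(1)[OF open_ball Ghol Gb Msum that] unfolding F_def field_differentiable_def by blast
  have Fhol: "F holomorphic_on ball 0 3"
    using Fder by (auto simp: holomorphic_on_def field_differentiable_at_within)
  have sumG: "(\<lambda>n. norm (G (x + of_int n))) summable_on UNIV" if "x \<in> ball 0 3" for x
    by (rule summable_on_comparison_test[OF Msum]) (use Gb[OF that] in auto)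
  obtain L where L: "\<And>x. x \<in> cball 0 2 \<Longrightarrow> norm (deriv F x) \<le> L"
  proof -
    have "continuous_on (cball 0 2) (deriv F)"
      by (intro holomorphic_on_imp_continuous_on holomorphic_on_subset[OF holomorphic_deriv[OF Fhol]]) auto
    then have "bounded (deriv F ` cball 0 2)" by (intro compact_imp_bounded compact_continuous_image) auto
    then show ?thesis using that unfolding bounded_iff by blast
  qed
  have Lip: "norm (F x - F y) \<le> L * norm (x - y)" if "x \<in> cball 0 2" "y \<in> cball 0 2" for x y
  proof (rule field_differentiable_bound[where S = "cball 0 2" and f' = "deriv F"])
    fix z :: complex assume "z \<in> cball 0 2"
    then have "F field_differentiable at z" by (intro Fder) auto
    then show "(F has_field_derivative deriv F z) (at z within cball 0 2)"
      by (simp add: DERIV_deriv_iff_field_differentiable has_field_derivative_at_within)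
  qed (use L that in auto)
  have per: "F 1 = F 0"
    unfolding F_def by (rule infsum_reindex_bij_witness[of _ "\<lambda>n. n - 1" "\<lambda>n. n + 1"]) (auto simp: add.commute)
  have fm': "continuous_on {0..1} f"
    unfolding f_def
    by (rule continuous_on_compose2[OF holomorphic_on_imp_continuous_on[OF Fhol]]) (auto intro!: continuous_intros)
  \<comment> \<open>Cutting off outside the unit interval yields a Borel function from continuity on
    that interval alone; the coefficients and the value at 0 are unaffected.\<close>
  define f1 where "f1 = (\<lambda>x. indicator {0..1} x *\<^sub>R f x)"
  have f1m: "f1 \<in> borel_measurable borel"
    unfolding f1_def using borel_measurable_continuous_on_indicator[OF _ fm'] by simp
  have coeff: "fcoeff f1 b = exp (of_real pi * (q - \<i> * of_int b)\<^sup>2 / p) / csqrt p" for b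
  proof -
    define h where "h = (\<lambda>x::real. exp (- of_real pi * p * of_real x ^ 2 + 2 * of_real pi * (q - \<i> * of_int b) * of_real x))"
    have hG: "h x = G (of_real x) * ecis (- b) x" for x
      by (simp add: h_def G_def ecis_def exp_add[symmetric] algebra_simps)
    have hper: "h (x + of_int n) = G (of_real x + of_int n) * ecis (- b) x" for x n
    proof -
      have "ecis (- b) (x + of_int n) = ecis (- b) x * ecis (- b) (of_int n)"
        by (simp add: ecis_def exp_add[symmetric] algebra_simps)
      then show ?thesis by (simp add: hG ecis_int)
    qed
    have hint: "integrable lborel h" unfolding h_def by (rule gauss_integrable_abs[OF p])
    have 1: "((\<lambda>n::int. \<integral>x. h (x + of_int n) \<partial>unit_measure) has_sum (\<integral>x. h x \<partial>lborel)) UNIV"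
      by (rule integral_unfold_periods[OF hint])
    interpret U: finite_measure unit_measure by (rule finite_measure_unit)
    have bd: "norm (h (x + of_int n)) \<le> M n" if "0 \<le> x" "x < 1" for x n
      using Gb[of "of_real x" n] that by (simp add: hper norm_mult)
    have ii: "integrable unit_measure (\<lambda>x. h (x + of_int n))" for n
    proof (rule integrable_unit_bounded[where B = "M n"])
      show "(\<lambda>x. h (x + of_int n)) \<in> borel_measurable borel"
        unfolding h_def by (intro borel_measurable_continuous_onI continuous_intros)
    qed (use bd in auto)
    have "((\<lambda>n::int. \<integral>x. h (x + of_int n) \<partial>unit_measure) has_sum (\<integral>x. (\<Sum>\<^sub>\<infinity>n. h (x + of_int n)) \<partial>unit_measure)) UNIV"
    proof (rule has_sum_integral(1)[OF _ ii _ Msum])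
      show "sigma_finite_measure unit_measure" by (rule U.sigma_finite_measure_axioms)
      show "(\<integral>x. norm (h (x + of_int n)) \<partial>unit_measure) \<le> M n" for n
      proof -
        have "(\<integral>x. norm (h (x + of_int n)) \<partial>unit_measure) \<le> (\<integral>x. M n \<partial>unit_measure)"
          using ii[of n] bd by (intro integral_mono) auto
        then show ?thesis using measure_unit_space by simp
      qed
      show "(\<lambda>n. norm (h (x + of_int n))) summable_on UNIV" if "x \<in> space unit_measure" for x
        by (rule summable_on_comparison_test[OF Msum]) (use bd that in auto)
    qed
    then have "(\<integral>x. (\<Sum>\<^sub>\<infinity>n. h (x + of_int n)) \<partial>unit_measure) = (\<integral>x. h x \<partial>lborel)"
      using 1 has_sum_unique by blast
    moreover have "(\<integral>x. (\<Sum>\<^sub>\<infinity>n. h (x + of_int n)) \<partial>unit_measure) = fcoeff f1 b"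
      unfolding fcoeff_def
    proof (intro Bochner_Integration.integral_cong refl)
      fix x assume "x \<in> space unit_measure"
      then show "(\<Sum>\<^sub>\<infinity>n. h (x + of_int n)) = f1 x * ecis (- b) x"
        by (auto simp: hper f1_def f_def F_def infsum_cmult_left')
    qed
    moreover have "(\<integral>x. h x \<partial>lborel) = exp (of_real pi * (q - \<i> * of_int b)\<^sup>2 / p) / csqrt p"
      unfolding h_def by (rule gauss_integral[OF p])
    ultimately show ?thesis by simp
  qed
  have sm: "fcoeff f1 summable_on UNIV"
  proof (rule abs_summable_summable, rule summable_on_comparison_test)
    define \<epsilon> where "\<epsilon> = pi * Re (1 / p)"
    define B' where "B' = 2 * pi * norm (q / p)"
    define C' where "C' = exp (pi * norm (q\<^sup>2 / p)) / norm (csqrt p)"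
    have "\<epsilon> > 0" using Re_inverse_pos[OF p] by (simp add: \<epsilon>_def)
    then show "(\<lambda>n::int. C' * exp (- \<epsilon> * \<bar>of_int n\<bar> ^ 2 + B' * \<bar>of_int n\<bar>)) summable_on UNIV"
      by (intro summable_on_cmult_right gauss_int_summable)
    fix b :: int
    have "of_real pi * (q - \<i> * of_int b)\<^sup>2 / p = of_real (- (pi * of_int b ^ 2)) * (1 / p)
        + (of_real pi * (q\<^sup>2 / p) - 2 * of_real pi * \<i> * of_int b * (q / p))"
      by (simp add: power2_eq_square diff_divide_distrib add_divide_distrib algebra_simps)
    then have "Re (of_real pi * (q - \<i> * of_int b)\<^sup>2 / p) = - (pi * of_int b ^ 2) * Re (1 / p)
        + Re (of_real pi * (q\<^sup>2 / p) - 2 * of_real pi * \<i> * of_int b * (q / p))"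
      by (simp only: plus_complex.simps Re_complex_of_real times_complex.simps Im_complex_of_real)
    also have "\<dots> \<le> - (pi * of_int b ^ 2) * Re (1 / p) + (norm (of_real pi * (q\<^sup>2 / p)) + norm (2 * of_real pi * \<i> * of_int b * (q / p)))"
      by (intro add_left_mono order_trans[OF complex_Re_le_cmod norm_triangle_ineq4])
    also have "\<dots> = pi * norm (q\<^sup>2 / p) + (- \<epsilon> * \<bar>of_int b\<bar> ^ 2 + B' * \<bar>of_int b\<bar>)"
      by (simp add: norm_mult norm_divide B'_def \<epsilon>_def algebra_simps)
    finally have "exp (Re (of_real pi * (q - \<i> * of_int b)\<^sup>2 / p)) \<le> exp (pi * norm (q\<^sup>2 / p)) * exp (- \<epsilon> * \<bar>of_int b\<bar> ^ 2 + B' * \<bar>of_int b\<bar>)"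
      by (simp add: exp_add[symmetric])
    then show "norm (fcoeff f1 b) \<le> C' * exp (- \<epsilon> * \<bar>of_int b\<bar> ^ 2 + B' * \<bar>of_int b\<bar>)"
      unfolding coeff C'_def norm_divide norm_exp_eq_Re by (simp add: divide_right_mono)
  qed auto
  have "(fcoeff f1 has_sum f1 0) UNIV"
  proof (rule fourier_series_at_0[OF f1m _ _ sm])
    fix x :: real assume x: "0 \<le> x" "x \<le> 1"
    show "norm (f1 x - f1 0) \<le> L * x"
      using Lip[of "of_real x" 0] x by (simp add: f1_def f_def)
    have "norm (of_real x - 1 :: complex) = 1 - x"
      using x by (metis abs_of_nonpos diff_ge_0_iff_ge minus_diff_eq neg_le_0_iff_le norm_of_real of_real_1 of_real_diff)
    then show "norm (f1 x - f1 0) \<le> L * (1 - x)"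
      using Lip[of "of_real x" 1] x per by (simp add: f1_def f_def)
  qed
  moreover have "fcoeff f1 = (\<lambda>b. exp (of_real pi * (q - \<i> * of_int b)\<^sup>2 / p) / csqrt p)"
    by (rule ext) (rule coeff)
  moreover have "f1 0 = (\<Sum>\<^sub>\<infinity>n::int. exp (- of_real pi * p * of_int n ^ 2 + 2 * of_real pi * q * of_int n))"
    by (simp add: f1_def f_def F_def G_def)
  ultimately show ?thesis by simp
qed


section \<open>The unary theta series in the middle coefficient of a form\<close>

definition unary_theta :: "complex \<Rightarrow> complex \<Rightarrow> complex" where
  "unary_theta w \<zeta> = (\<Sum>\<^sub>\<infinity>b::int. exp (2 * of_real pi * \<i> * (w * of_int b ^ 2 + \<zeta> * of_int b)))"

text \<open>Poisson summation with p = -2 \<i> w and q = \<i> \<zeta>; the dual index is negated to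
  bring the elliptic variable into the form -\<zeta>/(2w).\<close>

lemma unary_theta_inversion:
  assumes w: "Im w > 0"
  shows "unary_theta w \<zeta> = exp (- 2 * of_real pi * \<i> * (\<zeta>\<^sup>2 / (4 * w))) / csqrt (- 2 * \<i> * w)
    * unary_theta (- 1 / (4 * w)) (- \<zeta> / (2 * w))"
proof -
  define p where "p = - 2 * \<i> * w"
  have w0: "w \<noteq> 0" using w by auto
  have p: "Re p > 0" using w by (simp add: p_def)
  have "((\<lambda>b::int. exp (of_real pi * (\<i> * \<zeta> - \<i> * of_int b)\<^sup>2 / p) / csqrt p) has_sum
    (\<Sum>\<^sub>\<infinity>n::int. exp (- of_real pi * p * of_int n ^ 2 + 2 * of_real pi * (\<i> * \<zeta>) * of_int n))) UNIV"
    by (rule poisson_gauss[OF p])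
  also have "(\<lambda>n::int. exp (- of_real pi * p * of_int n ^ 2 + 2 * of_real pi * (\<i> * \<zeta>) * of_int n))
     = (\<lambda>b. exp (2 * of_real pi * \<i> * (w * of_int b ^ 2 + \<zeta> * of_int b)))"
    by (intro ext arg_cong[where f = exp]) (simp add: p_def algebra_simps)
  finally have 1: "((\<lambda>b::int. exp (of_real pi * (\<i> * \<zeta> - \<i> * of_int b)\<^sup>2 / p) / csqrt p) has_sum unary_theta w \<zeta>) UNIV"
    by (simp add: unary_theta_def)
  have e: "exp (of_real pi * (\<i> * \<zeta> - \<i> * of_int b)\<^sup>2 / p) / csqrt p
      = exp (- 2 * of_real pi * \<i> * (\<zeta>\<^sup>2 / (4 * w))) / csqrt p
        * exp (2 * of_real pi * \<i> * ((- 1 / (4 * w)) * of_int (- b) ^ 2 + (- \<zeta> / (2 * w)) * of_int (- b)))" for b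
  proof -
    have "of_real pi * (\<i> * \<zeta> - \<i> * of_int b)\<^sup>2 / p = - 2 * of_real pi * \<i> * (\<zeta>\<^sup>2 / (4 * w))
      + 2 * of_real pi * \<i> * ((- 1 / (4 * w)) * of_int (- b) ^ 2 + (- \<zeta> / (2 * w)) * of_int (- b))"
    proof -
      have "(\<i> * \<zeta> - \<i> * of_int b)\<^sup>2 = - (\<zeta>\<^sup>2 - 2 * \<zeta> * of_int b + of_int b ^ 2)"
        by (simp add: power2_eq_square algebra_simps)
      then show ?thesis using w0 by (simp add: p_def field_simps power2_eq_square)
    qed
    then show ?thesis by (simp only: exp_add times_divide_eq_left)
  qed
  have "unary_theta w \<zeta> = (\<Sum>\<^sub>\<infinity>b::int. exp (- 2 * of_real pi * \<i> * (\<zeta>\<^sup>2 / (4 * w))) / csqrt p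
        * exp (2 * of_real pi * \<i> * ((- 1 / (4 * w)) * of_int (- b) ^ 2 + (- \<zeta> / (2 * w)) * of_int (- b))))"
    using infsumI[OF 1] unfolding e by simp
  also have "\<dots> = exp (- 2 * of_real pi * \<i> * (\<zeta>\<^sup>2 / (4 * w))) / csqrt p
    * (\<Sum>\<^sub>\<infinity>b::int. exp (2 * of_real pi * \<i> * ((- 1 / (4 * w)) * of_int (- b) ^ 2 + (- \<zeta> / (2 * w)) * of_int (- b))))"
    by (rule infsum_cmult_right')
  also have "(\<Sum>\<^sub>\<infinity>b::int. exp (2 * of_real pi * \<i> * ((- 1 / (4 * w)) * of_int (- b) ^ 2 + (- \<zeta> / (2 * w)) * of_int (- b))))
    = unary_theta (- 1 / (4 * w)) (- \<zeta> / (2 * w))"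
    unfolding unary_theta_def
    by (rule infsum_reindex_bij_witness[of _ uminus uminus]) auto
  finally show ?thesis by (simp add: p_def)
qed

lemma unary_theta_translate: "unary_theta (w + 1) \<zeta> = unary_theta w \<zeta>"
  unfolding unary_theta_def
proof (intro infsum_cong)
  fix b :: int
  have "exp (2 * of_real pi * \<i> * ((w + 1) * of_int b ^ 2 + \<zeta> * of_int b))
    = exp (2 * of_real pi * \<i> * (w * of_int b ^ 2 + \<zeta> * of_int b)) * exp ((2 * of_int (b ^ 2) * of_real pi) * \<i>)"
    by (simp add: exp_add[symmetric] algebra_simps)
  also have "exp ((2 * of_int (b ^ 2) * of_real pi) * \<i>) = 1"
    using exp_integer_2pi[of "of_int (b ^ 2)"] by simp
  finally show "exp (2 * of_real pi * \<i> * ((w + 1) * of_int b ^ 2 + \<zeta> * of_int b))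
    = exp (2 * of_real pi * \<i> * (w * of_int b ^ 2 + \<zeta> * of_int b))" by simp
qed

text \<open>Both arguments are below pi/2 in modulus, so their difference stays inside the principal
  strip.\<close>

lemma Ln_divide_Re_pos:
  assumes "Re A > 0" "Re B > 0"
  shows "Ln (A / B) = Ln A - Ln B"
proof -
  have nz: "A \<noteq> 0" "B \<noteq> 0" using assms by auto
  have "exp (Ln A - Ln B) = A / B" using nz by (simp add: exp_diff)
  moreover have "\<bar>Im (Ln A)\<bar> < pi / 2" "\<bar>Im (Ln B)\<bar> < pi / 2" using Re_Ln_pos_lt_imp assms by auto
  ultimately show ?thesis by (intro Ln_unique) auto
qed

lemma csqrt_divide_Re_pos:
  assumes "Re A > 0" "Re B > 0"
  shows "csqrt (A / B) = csqrt A / csqrt B"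
proof -
  have nz: "A \<noteq> 0" "B \<noteq> 0" using assms by auto
  then show ?thesis
    by (simp add: csqrt_exp_Ln Ln_divide_Re_pos[OF assms] diff_divide_distrib exp_diff)
qed

lemma Im_lower_moebius: "Im (w / (4 * w + 1)) = Im w / (cmod (4 * w + 1))\<^sup>2"
  unfolding Im_divide by (simp add: cmod_power2 algebra_simps)

lemma lower_moebius_upper:
  assumes "Im w > 0"
  shows "4 * w + 1 \<noteq> 0" "Im (w / (4 * w + 1)) > 0"
proof -
  show "4 * w + 1 \<noteq> 0" using assms by (auto simp: complex_eq_iff)
  then show "Im (w / (4 * w + 1)) > 0" using assms by (simp add: Im_lower_moebius)
qed

text \<open>After inversion the map w \<mapsto> w/(4w + 1) = v becomes a unit translation: -1/(4v) +
  1 = -1/(4w). The two roots combine without a sign because -2 \<i> w and -2 \<i> v lie in the right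
  half-plane.\<close>

lemma unary_theta_lower:
  assumes w: "Im w > 0"
  shows "unary_theta (w / (4 * w + 1)) (\<zeta> / (4 * w + 1))
    = csqrt (4 * w + 1) * exp (2 * of_real pi * \<i> * (\<zeta>\<^sup>2 / (4 * w + 1))) * unary_theta w \<zeta>"
proof -
  define j where "j = 4 * w + 1"
  define v where "v = w / j"
  have j0: "j \<noteq> 0" and v: "Im v > 0" using lower_moebius_upper[OF w] by (auto simp: j_def v_def)
  have w0: "w \<noteq> 0" using w by auto
  have v0: "v \<noteq> 0" using v by auto
  have 1: "unary_theta v (\<zeta> / j) = exp (- 2 * of_real pi * \<i> * ((\<zeta> / j)\<^sup>2 / (4 * v))) / csqrt (- 2 * \<i> * v)
    * unary_theta (- 1 / (4 * v)) (- (\<zeta> / j) / (2 * v))" by (rule unary_theta_inversion[OF v])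
  have "- 1 / (4 * v) + 1 = - 1 / (4 * w)" using w0 j0 by (simp add: v_def j_def field_simps)
  then have 2: "unary_theta (- 1 / (4 * v)) (- (\<zeta> / j) / (2 * v)) = unary_theta (- 1 / (4 * w)) (- (\<zeta> / j) / (2 * v))"
    using unary_theta_translate[of "- 1 / (4 * v)" "- (\<zeta> / j) / (2 * v)"] by simp
  have 3: "- (\<zeta> / j) / (2 * v) = - \<zeta> / (2 * w)" using w0 j0 by (simp add: v_def field_simps)
  have 4: "unary_theta w \<zeta> = exp (- 2 * of_real pi * \<i> * (\<zeta>\<^sup>2 / (4 * w))) / csqrt (- 2 * \<i> * w)
    * unary_theta (- 1 / (4 * w)) (- \<zeta> / (2 * w))" by (rule unary_theta_inversion[OF w])
  have A: "Re (- 2 * \<i> * w) > 0" "Re (- 2 * \<i> * v) > 0" using w v by auto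
  have jd: "j = (- 2 * \<i> * w) / (- 2 * \<i> * v)" using w0 v0 j0 by (simp add: v_def field_simps)
  have 5: "csqrt j = csqrt (- 2 * \<i> * w) / csqrt (- 2 * \<i> * v)"
    by (subst jd) (rule csqrt_divide_Re_pos[OF A])
  have cz: "csqrt (- 2 * \<i> * w) \<noteq> 0" "csqrt (- 2 * \<i> * v) \<noteq> 0" using w0 v0 by auto
  have 6: "exp (- 2 * of_real pi * \<i> * ((\<zeta> / j)\<^sup>2 / (4 * v)))
    = exp (2 * of_real pi * \<i> * (\<zeta>\<^sup>2 / j)) * exp (- 2 * of_real pi * \<i> * (\<zeta>\<^sup>2 / (4 * w)))"
  proof -
    have "\<zeta>\<^sup>2 / j - \<zeta>\<^sup>2 / (4 * w) = - ((\<zeta> / j)\<^sup>2 / (4 * v))"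
      using w0 j0 by (simp add: v_def field_simps power2_eq_square) (simp add: j_def algebra_simps)
    then have z: "(\<zeta> / j)\<^sup>2 / (4 * v) = \<zeta>\<^sup>2 / (4 * w) - \<zeta>\<^sup>2 / j" by (simp add: algebra_simps)
    have "- 2 * of_real pi * \<i> * ((\<zeta> / j)\<^sup>2 / (4 * v))
      = 2 * of_real pi * \<i> * (\<zeta>\<^sup>2 / j) + - 2 * of_real pi * \<i> * (\<zeta>\<^sup>2 / (4 * w))"
      unfolding z right_diff_distrib by simp
    then show ?thesis by (simp only: exp_add)
  qed
  show ?thesis
    unfolding j_def[symmetric] v_def[symmetric] 1 unfolding 2 unfolding 3 unfolding 4 5 6 using cz by (simp add: field_simps)
qed

section \<open>Forms, their discriminants and the theta kernel\<close>

definition disc :: "quad_form \<Rightarrow> int" where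
  "disc = (\<lambda>(a, b, c). b\<^sup>2 - 4 * a * c)"

text \<open>The coefficient \<open>c\<close> enters Q(\<tau>,1)/y only through
  \<open>form_at\<close>, which is what turns the sum over \<open>c\<close> into a one-dimensional
  Gaussian sum.\<close>

lemma form_eval_decomp:
  assumes "Im \<tau> > 0"
  shows "form_eval (a, b, c) \<tau> 1
    = of_real (Im \<tau>) * (of_real (form_at (a, b, c) \<tau>) + \<i> * (of_int b + 2 * of_int a * \<tau>))"
proof -
  define t where "t = form_at (a, b, c) \<tau>"
  have "t * Im \<tau> = of_int a * ((Re \<tau>)\<^sup>2 + (Im \<tau>)\<^sup>2) + of_int b * Re \<tau> + of_int c"
    using assms by (simp add: t_def cmod_power2)
  then show ?thesis unfolding t_def[symmetric]
    by (auto simp: complex_eq_iff power2_eq_square algebra_simps)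
qed

text \<open>The squares on the right are those of the real and imaginary parts of Q(\<tau>,1)/y.
  Together with \<open>form_at\<close> these parts diagonalise the discriminant, with signature
  (2,1).\<close>

lemma disc_add_form_at:
  assumes "Im \<tau> > 0"
  shows "of_int (disc (a, b, c)) + (form_at (a, b, c) \<tau>)\<^sup>2
    = (form_at (a, b, c) \<tau> - 2 * of_int a * Im \<tau>)\<^sup>2 + (of_int b + 2 * of_int a * Re \<tau>)\<^sup>2"
proof -
  define t where "t = form_at (a, b, c) \<tau>"
  have "of_int c = t * Im \<tau> - of_int a * ((Re \<tau>)\<^sup>2 + (Im \<tau>)\<^sup>2) - of_int b * Re \<tau>"
    using assms by (simp add: t_def cmod_power2)
  then have "of_int (disc (a, b, c)) = (of_int b)\<^sup>2 - 4 * of_int a * (t * Im \<tau> - of_int a * ((Re \<tau>)\<^sup>2 + (Im \<tau>)\<^sup>2) - of_int b * Re \<tau>)"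
    by (simp add: disc_def)
  then show ?thesis unfolding t_def[symmetric] by (simp add: power2_eq_square algebra_simps)
qed

lemma norm_form_eval:
  assumes "Im \<tau> > 0"
  shows "(cmod (form_eval Q \<tau> 1))\<^sup>2 = (Im \<tau>)\<^sup>2 * (of_int (disc Q) + (form_at Q \<tau>)\<^sup>2)"
proof -
  obtain a b c where Q: "Q = (a, b, c)" by (cases Q)
  have "(cmod (of_real t + \<i> * (of_int b + 2 * of_int a * \<tau>)))\<^sup>2
      = (t - 2 * of_int a * Im \<tau>)\<^sup>2 + (of_int b + 2 * of_int a * Re \<tau>)\<^sup>2" for t
    by (simp add: cmod_power2)
  then have "(cmod (of_real (form_at Q \<tau>) + \<i> * (of_int b + 2 * of_int a * \<tau>)))\<^sup>2 = of_int (disc Q) + (form_at Q \<tau>)\<^sup>2"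
    unfolding Q disc_add_form_at[OF assms] .
  then show ?thesis unfolding Q form_eval_decomp[OF assms] norm_mult power_mult_distrib by simp
qed

lemma form_size_le:
  fixes N :: real
  assumes "\<bar>of_int a\<bar> \<le> A * N" "\<bar>of_int b\<bar> \<le> B * N" "\<bar>of_int c\<bar> \<le> C * N" "0 < A + B + C"
  shows "form_size (a, b, c) ^ 2 / (A + B + C) ^ 2 \<le> N ^ 2"
proof -
  have "form_size (a, b, c) \<le> (A + B + C) * N"
    using assms by (simp add: form_size_def algebra_simps)
  then have "form_size (a, b, c) ^ 2 \<le> ((A + B + C) * N) ^ 2" by (intro power_mono) auto
  then show ?thesis using assms(4) by (simp add: power_mult_distrib divide_le_eq mult.commute)
qed

lemma abs_le_sqrt_sum3:
  "\<bar>u\<bar> \<le> sqrt (u\<^sup>2 + v\<^sup>2 + w\<^sup>2)" "\<bar>v\<bar> \<le> sqrt (u\<^sup>2 + v\<^sup>2 + w\<^sup>2)" "\<bar>w\<bar> \<le> sqrt (u\<^sup>2 + v\<^sup>2 + w\<^sup>2)" for u v w :: real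
  by (auto intro!: real_le_rsqrt)

lemma form_norm_lower:
  assumes \<tau>: "Im \<tau> > 0"
  obtains \<kappa> where "\<kappa> > 0" "\<And>Q. \<kappa> * form_size Q ^ 2 \<le> of_int (disc Q) + 2 * (form_at Q \<tau>)\<^sup>2"
proof -
  define x y where "x = Re \<tau>" and "y = Im \<tau>"
  \<comment> \<open>With N the Euclidean length in the diagonal coordinates t, v, w, these constants
    bound |a|, |b|, |c| by multiples of N: a is recovered from t - v = 2ay, b from w, and c from
    t.\<close>
  define A B C where "A = 1 / y" and "B = 1 + 2 * \<bar>x\<bar> * A" and "C = y + (x\<^sup>2 + y\<^sup>2) * A + \<bar>x\<bar> * B"
  have y: "y > 0" using \<tau> by (simp add: y_def)
  have A: "A > 0" using y by (simp add: A_def)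
  have B: "B > 0" using A unfolding B_def by (intro add_pos_nonneg) auto
  have C: "C \<ge> 0" using A B y by (auto simp: C_def)
  have pos: "0 < A + B + C" using A B C by simp
  have "1 / (A + B + C) ^ 2 * form_size Q ^ 2 \<le> of_int (disc Q) + 2 * (form_at Q \<tau>)\<^sup>2" for Q
  proof -
    obtain a b c where Q: "Q = (a, b, c)" by (cases Q)
    define t where "t = form_at Q \<tau>"
    define v w where "v = t - 2 * of_int a * y" and "w = of_int b + 2 * of_int a * x"
    define N where "N = sqrt (t\<^sup>2 + v\<^sup>2 + w\<^sup>2)"
    have N: "\<bar>t\<bar> \<le> N" "\<bar>v\<bar> \<le> N" "\<bar>w\<bar> \<le> N" unfolding N_def by (rule abs_le_sqrt_sum3)+
    have a: "\<bar>of_int a\<bar> \<le> A * N"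
    proof -
      have "2 * y * \<bar>of_int a\<bar> = \<bar>t - v\<bar>" using y by (simp add: v_def abs_mult)
      also have "\<dots> \<le> 2 * N" using N by linarith
      finally show ?thesis using y by (simp add: A_def field_simps)
    qed
    have b: "\<bar>of_int b\<bar> \<le> B * N"
    proof -
      have "\<bar>of_int b\<bar> = \<bar>w - 2 * of_int a * x\<bar>" by (simp add: w_def)
      also have "\<dots> \<le> \<bar>w\<bar> + 2 * \<bar>x\<bar> * \<bar>of_int a\<bar>" by (rule order_trans[OF abs_triangle_ineq4]) (simp add: abs_mult)
      also have "\<dots> \<le> N + 2 * \<bar>x\<bar> * (A * N)" using N a by (intro add_mono mult_left_mono) auto
      finally show ?thesis by (simp add: B_def algebra_simps)
    qed
    have c: "\<bar>of_int c\<bar> \<le> C * N"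
    proof -
      have "of_int c = y * t - (x\<^sup>2 + y\<^sup>2) * of_int a - x * of_int b"
        using y by (simp add: t_def Q x_def y_def cmod_power2)
      then have "\<bar>of_int c\<bar> \<le> \<bar>y * t\<bar> + \<bar>(x\<^sup>2 + y\<^sup>2) * of_int a\<bar> + \<bar>x * of_int b\<bar>" by linarith
      also have "\<dots> \<le> y * N + (x\<^sup>2 + y\<^sup>2) * (A * N) + \<bar>x\<bar> * (B * N)"
        unfolding abs_mult using N a b y by (intro add_mono mult_mono) auto
      finally show ?thesis by (simp add: C_def algebra_simps)
    qed
    have "form_size Q ^ 2 / (A + B + C) ^ 2 \<le> N ^ 2" unfolding Q by (rule form_size_le[OF a b c pos])
    also have "N ^ 2 = t\<^sup>2 + v\<^sup>2 + w\<^sup>2" by (simp add: N_def)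
    also have "\<dots> = of_int (disc Q) + 2 * (form_at Q \<tau>)\<^sup>2"
      using disc_add_form_at[OF \<tau>, of a b c] by (simp add: t_def v_def w_def Q x_def y_def)
    finally show ?thesis by simp
  qed
  moreover have "1 / (A + B + C) ^ 2 > 0" using pos by simp
  ultimately show ?thesis using that by blast
qed

lemma form_upper:
  assumes \<tau>: "Im \<tau> > 0"
  obtains C where "C \<ge> 1" "\<And>Q. \<bar>form_at Q \<tau>\<bar> \<le> C * form_size Q" "\<And>Q. cmod (form_eval Q \<tau> 1) \<le> C * form_size Q"
proof -
  define T where "T = 1 + cmod \<tau> + (cmod \<tau>)\<^sup>2"
  have T1: "T \<ge> 1" by (simp add: T_def)
  have le: "\<bar>of_int a\<bar> * (cmod \<tau>)\<^sup>2 + \<bar>of_int b\<bar> * cmod \<tau> + \<bar>of_int c\<bar> \<le> T * form_size (a, b, c)" for a b c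
  proof -
    have "\<bar>of_int a\<bar> * (cmod \<tau>)\<^sup>2 + \<bar>of_int b\<bar> * cmod \<tau> + \<bar>of_int c\<bar> \<le> \<bar>of_int a\<bar> * T + \<bar>of_int b\<bar> * T + \<bar>of_int c\<bar> * T"
      using T1 by (intro add_mono mult_left_mono) (auto simp: T_def mult_le_cancel_left1)
    then show ?thesis by (simp add: form_size_def algebra_simps)
  qed
  have "cmod (form_eval Q \<tau> 1) \<le> T * form_size Q" for Q
  proof -
    obtain a b c where Q: "Q = (a, b, c)" by (cases Q)
    have "cmod (form_eval Q \<tau> 1) \<le> cmod (of_int a * \<tau>\<^sup>2) + cmod (of_int b * \<tau>) + cmod (of_int c)"
      unfolding Q form_eval.simps power_one mult_1_right
      by (intro order_trans[OF norm_triangle_ineq] add_mono norm_triangle_ineq order_refl)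
    also have "\<dots> \<le> T * form_size Q" using le[of a b c] norm_of_int[of c, where 'a = complex] by (simp add: Q norm_mult norm_power)
    finally show ?thesis .
  qed
  moreover have "\<bar>form_at Q \<tau>\<bar> \<le> T / Im \<tau> * form_size Q" for Q
  proof -
    obtain a b c where Q: "Q = (a, b, c)" by (cases Q)
    have "\<bar>of_int b\<bar> * \<bar>Re \<tau>\<bar> \<le> \<bar>of_int b\<bar> * cmod \<tau>" by (intro mult_left_mono abs_Re_le_cmod) auto
    then have "\<bar>of_int a * (cmod \<tau>)\<^sup>2 + of_int b * Re \<tau> + of_int c\<bar> \<le> T * form_size Q"
      using le[of a b c] abs_mult[of "of_int a" "(cmod \<tau>)\<^sup>2"] abs_mult[of "of_int b" "Re \<tau>"]
        abs_triangle_ineq[of "of_int a * (cmod \<tau>)\<^sup>2 + of_int b * Re \<tau>" "of_int c"]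
        abs_triangle_ineq[of "of_int a * (cmod \<tau>)\<^sup>2" "of_int b * Re \<tau>"]
      unfolding Q by simp
    then show ?thesis using \<tau> by (simp add: Q divide_right_mono)
  qed
  moreover have "T \<le> T + T / Im \<tau>" "T / Im \<tau> \<le> T + T / Im \<tau>" using T1 \<tau> by auto
  ultimately have "\<bar>form_at Q \<tau>\<bar> \<le> (T + T / Im \<tau>) * form_size Q" "cmod (form_eval Q \<tau> 1) \<le> (T + T / Im \<tau>) * form_size Q" for Q
    by (meson form_size_nonneg mult_right_mono order_trans)+
  moreover have "T + T / Im \<tau> \<ge> 1" using T1 \<tau> by (simp add: add_increasing2)
  ultimately show ?thesis using that by blast
qed

section \<open>The Siegel theta series\<close>

definition gauss_wt :: "complex \<Rightarrow> complex \<Rightarrow> quad_form \<Rightarrow> complex" where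
  "gauss_wt \<tau> w Q = exp (2 * of_real pi * \<i> * of_int (disc Q) * w) *
     of_real (exp (- (4 * pi * Im w * (form_at Q \<tau>)\<^sup>2)))"

text \<open>\<open>form_at\<close> is the coordinate on the negative line and Q(\<tau>,1) is y times
  the complex coordinate on the positive plane, so the polynomial is harmonic on both. The series
  accordingly has weight k in w and weight 3/2 in the conjugate of w.\<close>

definition siegel_theta :: "nat \<Rightarrow> complex \<Rightarrow> complex \<Rightarrow> complex" where
  "siegel_theta k \<tau> w = (\<Sum>\<^sub>\<infinity>Q. of_real (form_at Q \<tau>) * form_eval Q \<tau> 1 ^ (k - 1) * gauss_wt \<tau> w Q)"

lemma norm_gauss_wt: "norm (gauss_wt \<tau> w Q) = exp (- (2 * pi * Im w * (of_int (disc Q) + 2 * (form_at Q \<tau>)\<^sup>2)))"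
  unfolding gauss_wt_def norm_mult norm_exp_eq_Re norm_of_real by (simp add: exp_add[symmetric] algebra_simps)

lemma gauss_wt_bound:
  assumes "Im \<tau> > 0" "Im w > 0"
  obtains \<epsilon> where "\<epsilon> > 0" "\<And>Q. norm (gauss_wt \<tau> w Q) \<le> exp (- \<epsilon> * form_size Q ^ 2)"
proof -
  obtain \<kappa> where \<kappa>: "\<kappa> > 0" "\<And>Q. \<kappa> * form_size Q ^ 2 \<le> of_int (disc Q) + 2 * (form_at Q \<tau>)\<^sup>2"
    using form_norm_lower[OF assms(1)] by blast
  have "norm (gauss_wt \<tau> w Q) \<le> exp (- (2 * pi * Im w * \<kappa>) * form_size Q ^ 2)" for Q
    using mult_left_mono[OF \<kappa>(2)[of Q], of "2 * pi * Im w"] assms(2) by (simp add: norm_gauss_wt mult_ac)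
  moreover have "2 * pi * Im w * \<kappa> > 0" using \<kappa> assms by simp
  ultimately show ?thesis using that by blast
qed

lemma power_le_exp: "0 \<le> x \<Longrightarrow> x ^ m \<le> exp (real m * x)" for x :: real
proof -
  assume x: "0 \<le> x"
  have "x \<le> exp x" using exp_ge_add_one_self[of x] by linarith
  then have "x ^ m \<le> exp x ^ m" using x by (intro power_mono) auto
  then show ?thesis by (simp add: exp_of_nat_mult)
qed

text \<open>Differentiating an identity between exponential sums at 0 brings down powers of the
  exponents. With a constant factor this works to every order. A factor exp(K2 \<alpha>^2) has value
  1 and derivative 0 at 0, hence leaves no trace in the first derivative, but it does in higher
  ones.\<close>

lemma exponential_sum_moments:
  fixes c c' s s' :: "int \<times> int \<times> int \<Rightarrow> complex"
  assumes \<epsilon>: "\<epsilon> > 0"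
    and c: "\<And>Q. norm (c Q) \<le> exp (- \<epsilon> * form_size Q ^ 2 + B * form_size Q)"
    and c': "\<And>Q. norm (c' Q) \<le> exp (- \<epsilon> * form_size Q ^ 2 + B * form_size Q)"
    and C: "C \<ge> 0" "\<And>Q. norm (s Q) \<le> C * form_size Q" "\<And>Q. norm (s' Q) \<le> C * form_size Q"
    and eq: "\<And>\<alpha>. (\<Sum>\<^sub>\<infinity>Q. c Q * exp (\<alpha> * s Q)) = K \<alpha> * (\<Sum>\<^sub>\<infinity>Q. c' Q * exp (\<alpha> * s' Q))"
    and K: "K = (\<lambda>\<alpha>. K0 * exp (K2 * \<alpha>\<^sup>2))" and nK: "n = 1 \<or> K2 = 0"
  shows "(\<Sum>\<^sub>\<infinity>Q. c Q * s Q ^ n) = K0 * (\<Sum>\<^sub>\<infinity>Q. c' Q * s' Q ^ n)"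
proof -
  have D: "((\<lambda>\<alpha>. \<Sum>\<^sub>\<infinity>Q. c Q * s Q ^ m * exp (\<alpha> * s Q)) has_field_derivative (\<Sum>\<^sub>\<infinity>Q. c Q * s Q ^ Suc m * exp (\<alpha> * s Q))) (at \<alpha>)"
    if c: "\<And>Q. norm (c Q) \<le> exp (- \<epsilon> * form_size Q ^ 2 + B * form_size Q)" and s: "\<And>Q. norm (s Q) \<le> C * form_size Q"
    for c s :: "int \<times> int \<times> int \<Rightarrow> complex" and m \<alpha>
  proof -
    define R where "R = norm \<alpha> + 1"
    define g where "g = (\<lambda>Q. exp (- \<epsilon> * form_size Q ^ 2 + (B + real m * C + R * C) * form_size Q))"
    have g: "g summable_on UNIV" unfolding g_def by (rule gauss_form_size_summable[OF \<epsilon>])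
    have bd: "norm (c Q * s Q ^ m * exp (\<beta> * s Q)) \<le> g Q" if "\<beta> \<in> ball 0 R" for \<beta> Q
    proof -
      have 1: "norm (s Q) ^ m \<le> exp (real m * (C * form_size Q))"
        using power_mono[OF s, of Q m] power_le_exp[of "C * form_size Q" m] C(1) by simp
      have "norm (exp (\<beta> * s Q)) \<le> exp (norm (\<beta> * s Q))" by (rule norm_exp)
      also have "norm (\<beta> * s Q) \<le> R * (C * form_size Q)"
        unfolding norm_mult using that s[of Q] by (intro mult_mono) (auto simp: R_def)
      finally have 2: "norm (exp (\<beta> * s Q)) \<le> exp (R * (C * form_size Q))" by simp
      have "norm (c Q * s Q ^ m * exp (\<beta> * s Q)) \<le> exp (- \<epsilon> * form_size Q ^ 2 + B * form_size Q) * exp (real m * (C * form_size Q)) * exp (R * (C * form_size Q))"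
        unfolding norm_mult norm_power by (intro mult_mono c 1 2) auto
      then show ?thesis by (simp add: g_def exp_add[symmetric] algebra_simps)
    qed
    have "((\<lambda>\<alpha>. \<Sum>\<^sub>\<infinity>Q. c Q * s Q ^ m * exp (\<alpha> * s Q)) has_field_derivative (\<Sum>\<^sub>\<infinity>Q. deriv (\<lambda>\<alpha>. c Q * s Q ^ m * exp (\<alpha> * s Q)) \<alpha>)) (at \<alpha>)"
      by (rule holomorphic_infsum(1)[where S = "ball 0 R" and g = g])
         (use bd g in \<open>auto simp: R_def intro!: holomorphic_intros\<close>)
    moreover have "deriv (\<lambda>\<alpha>. c Q * s Q ^ m * exp (\<alpha> * s Q)) \<alpha> = c Q * s Q ^ Suc m * exp (\<alpha> * s Q)" for Q
      by (rule DERIV_imp_deriv) (auto intro!: derivative_eq_intros)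
    ultimately show ?thesis by simp
  qed
  note D1 = D[OF c C(2)] and D2 = D[OF c' C(3)]
  show ?thesis
  proof (cases "K2 = 0")
    case True
    have "(\<Sum>\<^sub>\<infinity>Q. c Q * s Q ^ n * exp (\<alpha> * s Q)) = K0 * (\<Sum>\<^sub>\<infinity>Q. c' Q * s' Q ^ n * exp (\<alpha> * s' Q))" for \<alpha>
    proof (induction n arbitrary: \<alpha>)
      case 0
      then show ?case using eq K True by simp
    next
      case (Suc n)
      have "((\<lambda>\<alpha>. \<Sum>\<^sub>\<infinity>Q. c Q * s Q ^ n * exp (\<alpha> * s Q)) has_field_derivative K0 * (\<Sum>\<^sub>\<infinity>Q. c' Q * s' Q ^ Suc n * exp (\<alpha> * s' Q))) (at \<alpha>)"
        unfolding Suc using DERIV_cmult[OF D2] .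
      then show ?case using D1 DERIV_unique by blast
    qed
    from this[of 0] show ?thesis by simp
  next
    case False
    then have n: "n = 1" using nK by simp
    have eq0: "(\<lambda>\<alpha>. \<Sum>\<^sub>\<infinity>Q. c Q * s Q ^ 0 * exp (\<alpha> * s Q)) = (\<lambda>\<alpha>. K0 * exp (K2 * \<alpha>\<^sup>2) * (\<Sum>\<^sub>\<infinity>Q. c' Q * s' Q ^ 0 * exp (\<alpha> * s' Q)))"
      using eq by (simp add: K)
    have "((\<lambda>\<alpha>. K0 * exp (K2 * \<alpha>\<^sup>2) * (\<Sum>\<^sub>\<infinity>Q. c' Q * s' Q ^ 0 * exp (\<alpha> * s' Q))) has_field_derivative
      K0 * (\<Sum>\<^sub>\<infinity>Q. c' Q * s' Q ^ Suc 0 * exp (0 * s' Q))) (at 0)"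
      by (rule derivative_eq_intros D2 refl | simp)+
    then have "((\<lambda>\<alpha>. \<Sum>\<^sub>\<infinity>Q. c Q * s Q ^ 0 * exp (\<alpha> * s Q)) has_field_derivative
      K0 * (\<Sum>\<^sub>\<infinity>Q. c' Q * s' Q ^ Suc 0 * exp (0 * s' Q))) (at 0)" unfolding eq0 .
    then have "(\<Sum>\<^sub>\<infinity>Q. c Q * s Q ^ Suc 0 * exp (0 * s Q)) = K0 * (\<Sum>\<^sub>\<infinity>Q. c' Q * s' Q ^ Suc 0 * exp (0 * s' Q))"
      using D1 DERIV_unique by blast
    then show ?thesis using n by simp
  qed
qed

section \<open>The generating theta series and its Poisson dual\<close>

lemma infsum_int3:
  fixes f :: "int \<times> int \<times> int \<Rightarrow> complex"
  assumes "f summable_on UNIV"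
  shows "infsum f UNIV = (\<Sum>\<^sub>\<infinity>(a, b). \<Sum>\<^sub>\<infinity>c. f (a, b, c))"
    and "infsum f UNIV = (\<Sum>\<^sub>\<infinity>a. \<Sum>\<^sub>\<infinity>b. \<Sum>\<^sub>\<infinity>c. f (a, b, c))"
    and "(\<Sum>\<^sub>\<infinity>b. \<Sum>\<^sub>\<infinity>c. f (a, b, c)) = (\<Sum>\<^sub>\<infinity>c. \<Sum>\<^sub>\<infinity>b. f (a, b, c))"
proof -
  define g where "g = (\<lambda>p::(int \<times> int) \<times> int. f (fst (fst p), snd (fst p), snd p))"
  have bij: "bij_betw (\<lambda>p::(int \<times> int) \<times> int. (fst (fst p), snd (fst p), snd p)) UNIV UNIV"
    by (rule bij_betwI[where g = "\<lambda>q. ((fst q, fst (snd q)), snd (snd q))"]) auto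
  have "g summable_on UNIV" unfolding g_def
    using assms by (simp add: summable_on_reindex_bij_betw[OF bij, of f])
  then have gs: "g summable_on (UNIV \<times> UNIV)" by simp
  have "infsum f UNIV = infsum g UNIV" unfolding g_def by (rule infsum_reindex_bij_betw[OF bij, symmetric])
  also have "\<dots> = (\<Sum>\<^sub>\<infinity>x. \<Sum>\<^sub>\<infinity>y. g (x, y))" using infsum_Sigma_banach[OF gs] by simp
  finally show "infsum f UNIV = (\<Sum>\<^sub>\<infinity>(a, b). \<Sum>\<^sub>\<infinity>c. f (a, b, c))" by (simp add: g_def case_prod_unfold)
  have fs: "f summable_on (UNIV \<times> UNIV)" using assms by simp
  have f1: "(\<lambda>y. f (a, y)) summable_on UNIV" for a
    using summable_on_SigmaD1[of "\<lambda>x y. f (x, y)" UNIV "\<lambda>_. UNIV" a] fs by simp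
  then have fp: "(\<lambda>y. f (a, y)) summable_on (UNIV \<times> UNIV)" for a by simp
  have "infsum f UNIV = (\<Sum>\<^sub>\<infinity>a. \<Sum>\<^sub>\<infinity>y. f (a, y))" using infsum_Sigma_banach[OF fs] by simp
  also have "\<dots> = (\<Sum>\<^sub>\<infinity>a. \<Sum>\<^sub>\<infinity>b. \<Sum>\<^sub>\<infinity>c. f (a, b, c))"
    by (intro infsum_cong) (use infsum_Sigma_banach[OF fp] in simp)
  finally show "infsum f UNIV = (\<Sum>\<^sub>\<infinity>a. \<Sum>\<^sub>\<infinity>b. \<Sum>\<^sub>\<infinity>c. f (a, b, c))" .
  show "(\<Sum>\<^sub>\<infinity>b. \<Sum>\<^sub>\<infinity>c. f (a, b, c)) = (\<Sum>\<^sub>\<infinity>c. \<Sum>\<^sub>\<infinity>b. f (a, b, c))" for a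
    by (rule infsum_swap_banach) (use f1[of a] in \<open>simp add: case_prod_unfold\<close>)
qed

text \<open>\<open>\<alpha>\<close> generates powers of Q(\<tau>,1)/y and \<open>\<beta>\<close>
  powers of \<open>form_at\<close>. Exponential insertions keep every term Gaussian, so Poisson
  summation applies without polynomial factors.\<close>

definition gen_theta :: "complex \<Rightarrow> complex \<Rightarrow> complex \<Rightarrow> complex \<Rightarrow> complex" where
  "gen_theta \<tau> w \<alpha> \<beta> = (\<Sum>\<^sub>\<infinity>Q. gauss_wt \<tau> w Q *
     exp (\<alpha> * (form_eval Q \<tau> 1 / of_real (Im \<tau>))) * exp (\<beta> * of_real (form_at Q \<tau>)))"

text \<open>The exponent after Poisson summation in \<open>c\<close>, with dual index
  \<open>m\<close>, is split into the part free of \<open>b\<close> and, in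
  \<open>dual_tail\<close>, the coefficient that makes the sum over \<open>b\<close> a
  \<open>unary_theta\<close>. The combination M = m - 4wa arises because the discriminant
  contributes -4acw.\<close>

definition dual_head :: "complex \<Rightarrow> complex \<Rightarrow> complex \<Rightarrow> complex \<Rightarrow> int \<Rightarrow> int \<Rightarrow> complex" where
  "dual_head \<tau> w \<alpha> \<beta> a m = (let M = of_int m - 4 * w * of_int a in
     of_real pi * (\<i> * M + (\<alpha> + \<beta>) / (2 * of_real pi * of_real (Im \<tau>)))\<^sup>2 / of_real (4 * Im w / (Im \<tau>)\<^sup>2)
     - 2 * of_real pi * \<i> * M * of_int a * of_real ((Re \<tau>)\<^sup>2 + (Im \<tau>)\<^sup>2) + 2 * \<i> * \<alpha> * of_int a * \<tau>)"

definition dual_tail :: "complex \<Rightarrow> complex \<Rightarrow> complex \<Rightarrow> int \<Rightarrow> int \<Rightarrow> complex" where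
  "dual_tail \<tau> w \<alpha> a m = \<alpha> / (2 * of_real pi) - (of_int m - 4 * w * of_int a) * of_real (Re \<tau>)"

definition dual_term :: "complex \<Rightarrow> complex \<Rightarrow> complex \<Rightarrow> complex \<Rightarrow> int \<times> int \<times> int \<Rightarrow> complex" where
  "dual_term \<tau> w \<alpha> \<beta> = (\<lambda>(a, m, b). exp (dual_head \<tau> w \<alpha> \<beta> a m) *
     exp (2 * of_real pi * \<i> * (w * of_int b ^ 2 + dual_tail \<tau> w \<alpha> a m * of_int b)))"

text \<open>Absolute convergence permits summing over \<open>b\<close> before \<open>m\<close>. The
  quadratic part of the exponent has negative definite real part, and the terms with
  \<open>\<alpha>\<close> and \<open>\<beta>\<close> grow at most linearly.\<close>

lemma dual_term_summable:
  assumes \<tau>: "Im \<tau> > 0" and w: "Im w > 0"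
  shows "dual_term \<tau> w \<alpha> \<beta> summable_on UNIV"
proof (rule abs_summable_summable)
  define x y u \<eta> where "x = Re \<tau>" and "y = Im \<tau>" and "u = Re w" and "\<eta> = Im w"
  have y: "y > 0" and \<eta>: "\<eta> > 0" using \<tau> w by (auto simp: y_def \<eta>_def)
  define g where "g = pi * y\<^sup>2 / (4 * \<eta>)"
  have g: "g > 0" using y \<eta> by (simp add: g_def)
  define \<delta> where "\<delta> = (\<alpha> + \<beta>) / (2 * of_real pi * of_real y)"
  define s1 s2 s3 where "s1 = sqrt g" and "s2 = sqrt (4 * pi * \<eta> * y\<^sup>2)" and "s3 = sqrt (2 * pi * \<eta>)"
  have s: "s1 > 0" "s2 > 0" "s3 > 0" using g y \<eta> by (auto simp: s1_def s2_def s3_def)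
  define A B C where "A = 1 / s2" and "B = 1 / s1 + 4 * \<bar>u\<bar> / s2" and "C = 1 / s3 + 2 * \<bar>x\<bar> / s2"
  have ABC: "A > 0" "B > 0" "C > 0" using s by (auto simp: A_def B_def C_def intro!: add_pos_nonneg)
  define K0 where "K0 = g * norm \<delta> ^ 2"
  define K1 where "K1 = g * (2 * norm \<delta> * (1 + 4 * norm w)) + 2 * norm \<alpha> * norm \<tau> + norm \<alpha>"
  define \<epsilon> where "\<epsilon> = 1 / (A + B + C) ^ 2"
  have \<epsilon>: "\<epsilon> > 0" using ABC by (simp add: \<epsilon>_def)
  show "(\<lambda>p. norm (dual_term \<tau> w \<alpha> \<beta> p)) summable_on UNIV"
  proof (rule summable_on_comparison_test)
    show "(\<lambda>p. exp K0 * exp (- \<epsilon> * form_size p ^ 2 + K1 * form_size p)) summable_on UNIV"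
      by (intro summable_on_cmult_right gauss_form_size_summable \<epsilon>)
    fix p :: "int \<times> int \<times> int"
    obtain a m b where p: "p = (a, m, b)" by (cases p)
    define M where "M = of_int m - 4 * w * of_int a"
    define L where "L = of_real g * (2 * \<i> * M * \<delta> + \<delta>\<^sup>2) + 2 * \<i> * \<alpha> * of_int a * \<tau> + \<i> * \<alpha> * of_int b"
    define S where "S = of_real (- g) * M\<^sup>2 - 2 * of_real pi * \<i> * M * of_int a * of_real (x\<^sup>2 + y\<^sup>2)
      + 2 * of_real pi * \<i> * (w * of_int b ^ 2 - M * of_real x * of_int b)"
    have E: "dual_head \<tau> w \<alpha> \<beta> a m + 2 * of_real pi * \<i> * (w * of_int b ^ 2 + dual_tail \<tau> w \<alpha> a m * of_int b) = S + L"
    proof -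
      have "of_real pi * Z / of_real (4 * Im w / (Im \<tau>)\<^sup>2) = of_real g * Z" for Z :: complex
        using y \<eta> by (simp add: g_def y_def \<eta>_def field_simps)
      then have h: "dual_head \<tau> w \<alpha> \<beta> a m = of_real g * (\<i> * M + \<delta>)\<^sup>2 - 2 * of_real pi * \<i> * M * of_int a * of_real (x\<^sup>2 + y\<^sup>2) + 2 * \<i> * \<alpha> * of_int a * \<tau>"
        by (simp add: dual_head_def Let_def M_def \<delta>_def x_def y_def)
      have tl: "2 * of_real pi * \<i> * (dual_tail \<tau> w \<alpha> a m * of_int b) = \<i> * \<alpha> * of_int b - 2 * of_real pi * \<i> * (M * of_real x * of_int b)"
        by (simp add: dual_tail_def M_def x_def field_simps)
      show ?thesis
        unfolding h distrib_left[of "2 * of_real pi * \<i>"] tl S_def L_def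
        by (simp add: power2_eq_square algebra_simps)
    qed
    \<comment> \<open>The real part of \<open>S\<close> is minus a sum of three squares. The numbers
      s1, s2, s3 are the roots of their weights, and A, B, C recover a, m, b from them.\<close>
    define N where "N = sqrt ((s1 * (m - 4 * u * a))\<^sup>2 + (s2 * a)\<^sup>2 + (s3 * (b + 2 * a * x))\<^sup>2)"
    have ReS: "Re S = - N\<^sup>2"
    proof -
      have M: "Re M = m - 4 * u * a" "Im M = - 4 * \<eta> * a" by (simp_all add: M_def u_def \<eta>_def)
      have R: "Re S = - g * (Re M)\<^sup>2 + g * (Im M)\<^sup>2 + 2 * pi * Im M * a * (x\<^sup>2 + y\<^sup>2) - 2 * pi * (\<eta> * b\<^sup>2 - Im M * x * b)"
        by (simp add: S_def \<eta>_def power2_eq_square algebra_simps)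
      have gM: "g * (Im M)\<^sup>2 = 4 * pi * \<eta> * y\<^sup>2 * a\<^sup>2"
        using \<eta> by (simp add: M g_def power2_eq_square)
      have N2: "N\<^sup>2 = g * (m - 4 * u * a)\<^sup>2 + 4 * pi * \<eta> * y\<^sup>2 * a\<^sup>2 + 2 * pi * \<eta> * (b + 2 * a * x)\<^sup>2"
        unfolding N_def s1_def s2_def s3_def using g y \<eta> by (simp add: power_mult_distrib)
      show ?thesis unfolding R gM N2 unfolding M by (simp add: power2_eq_square algebra_simps)
    qed
    have N: "s1 * \<bar>m - 4 * u * a\<bar> \<le> N" "s2 * \<bar>of_int a\<bar> \<le> N" "s3 * \<bar>b + 2 * a * x\<bar> \<le> N"
      using abs_le_sqrt_sum3(1)[of "s1 * (m - 4 * u * a)" "s2 * a" "s3 * (b + 2 * a * x)"]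
        abs_le_sqrt_sum3(2)[of "s2 * a" "s1 * (m - 4 * u * a)" "s3 * (b + 2 * a * x)"]
        abs_le_sqrt_sum3(3)[of "s3 * (b + 2 * a * x)" "s1 * (m - 4 * u * a)" "s2 * a"] s
      by (simp_all add: N_def abs_mult)
    have a: "\<bar>of_int a\<bar> \<le> A * N" using N(2) s by (simp add: A_def field_simps)
    have m: "\<bar>of_int m\<bar> \<le> B * N"
    proof -
      have "\<bar>of_int m\<bar> \<le> \<bar>m - 4 * u * a\<bar> + \<bar>4 * u * a\<bar>" by linarith
      also have "\<bar>m - 4 * u * a\<bar> \<le> N / s1" using N(1) s by (simp add: field_simps)
      also have "\<bar>4 * u * a\<bar> \<le> 4 * \<bar>u\<bar> * (A * N)" unfolding abs_mult using a by (intro mult_mono) auto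
      finally show ?thesis by (simp add: A_def B_def algebra_simps)
    qed
    have b: "\<bar>of_int b\<bar> \<le> C * N"
    proof -
      have "\<bar>of_int b\<bar> \<le> \<bar>b + 2 * a * x\<bar> + \<bar>2 * x * a\<bar>" by (simp add: mult_ac)
      also have "\<bar>b + 2 * a * x\<bar> \<le> N / s3" using N(3) s by (simp add: field_simps)
      also have "\<bar>2 * x * a\<bar> \<le> 2 * \<bar>x\<bar> * (A * N)" unfolding abs_mult using a by (intro mult_mono) auto
      finally show ?thesis by (simp add: A_def C_def algebra_simps)
    qed
    have "form_size p ^ 2 / (A + B + C) ^ 2 \<le> N\<^sup>2"
      unfolding p by (rule form_size_le[OF a m b]) (use ABC in auto)
    then have quad: "Re S \<le> - \<epsilon> * form_size p ^ 2" by (simp add: ReS \<epsilon>_def)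
    define n where "n = form_size p"
    have n0: "n \<ge> 0" "\<bar>real_of_int a\<bar> \<le> n" "\<bar>real_of_int m\<bar> \<le> n" "\<bar>real_of_int b\<bar> \<le> n"
      by (auto simp: n_def p form_size_def)
    have nM: "norm M \<le> (1 + 4 * norm w) * n"
    proof -
      have "norm M \<le> \<bar>real_of_int m\<bar> + 4 * norm w * \<bar>real_of_int a\<bar>"
        unfolding M_def by (rule order_trans[OF norm_triangle_ineq4]) (simp add: norm_mult)
      also have "\<dots> \<le> n + 4 * norm w * n" using n0 by (intro add_mono mult_left_mono) auto
      finally show ?thesis by (simp add: algebra_simps)
    qed
    have "norm L \<le> norm (of_real g * (2 * \<i> * M * \<delta> + \<delta>\<^sup>2)) + norm (2 * \<i> * \<alpha> * of_int a * \<tau>) + norm (\<i> * \<alpha> * of_int b)"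
      unfolding L_def by (intro order_trans[OF norm_triangle_ineq] add_mono norm_triangle_ineq order_refl)
    also have "\<dots> \<le> g * (2 * ((1 + 4 * norm w) * n) * norm \<delta> + norm \<delta> ^ 2) + 2 * norm \<alpha> * n * norm \<tau> + norm \<alpha> * n"
    proof (intro add_mono)
      have "norm (2 * \<i> * M * \<delta> + \<delta>\<^sup>2) \<le> 2 * norm M * norm \<delta> + norm \<delta> ^ 2"
        by (rule order_trans[OF norm_triangle_ineq]) (simp add: norm_mult norm_power)
      also have "\<dots> \<le> 2 * ((1 + 4 * norm w) * n) * norm \<delta> + norm \<delta> ^ 2"
        using nM by (intro add_mono mult_mono) (auto intro: mult_nonneg_nonneg n0)
      finally show "norm (of_real g * (2 * \<i> * M * \<delta> + \<delta>\<^sup>2)) \<le> g * (2 * ((1 + 4 * norm w) * n) * norm \<delta> + norm \<delta> ^ 2)"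
        using g by (simp add: norm_mult)
      show "norm (2 * \<i> * \<alpha> * of_int a * \<tau>) \<le> 2 * norm \<alpha> * n * norm \<tau>"
        using n0 by (simp add: norm_mult mult_left_mono mult_right_mono)
      show "norm (\<i> * \<alpha> * of_int b) \<le> norm \<alpha> * n" using n0 by (simp add: norm_mult mult_left_mono)
    qed
    also have "\<dots> = K0 + K1 * n" by (simp add: K0_def K1_def algebra_simps)
    finally have lin: "Re L \<le> K0 + K1 * n" using complex_Re_le_cmod[of L] by linarith
    have "norm (dual_term \<tau> w \<alpha> \<beta> p) = exp (Re S + Re L)"
      unfolding p dual_term_def prod.case exp_add[symmetric] E norm_exp_eq_Re by simp
    also have "\<dots> \<le> exp (K0 + (- \<epsilon> * n ^ 2 + K1 * n))" using quad lin by (simp add: n_def)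
    finally show "norm (dual_term \<tau> w \<alpha> \<beta> p) \<le> exp K0 * exp (- \<epsilon> * form_size p ^ 2 + K1 * form_size p)"
      by (simp only: exp_add n_def)
  qed auto
qed

text \<open>For fixed \<open>a\<close> and \<open>b\<close> the summand is a constant times a
  Gaussian in \<open>c\<close> with p = 4 \<eta>/y^2, where \<eta> = Im w and y = Im \<tau>; the
  root of p produces the factor y/(2 sqrt \<eta>).\<close>

lemma gen_theta_inner:
  assumes \<tau>: "Im \<tau> > 0" and w: "Im w > 0"
  shows "(\<Sum>\<^sub>\<infinity>c. gauss_wt \<tau> w (a, b, c) * exp (\<alpha> * (form_eval (a, b, c) \<tau> 1 / of_real (Im \<tau>))) * exp (\<beta> * of_real (form_at (a, b, c) \<tau>)))
    = of_real (Im \<tau> / (2 * sqrt (Im w))) * (\<Sum>\<^sub>\<infinity>m. dual_term \<tau> w \<alpha> \<beta> (a, m, b))"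
proof -
  define y \<eta> where "y = complex_of_real (Im \<tau>)" and "\<eta> = complex_of_real (Im w)"
  have y0: "y \<noteq> 0" and \<eta>0: "\<eta> \<noteq> 0" using \<tau> w by (auto simp: y_def \<eta>_def)
  define \<kappa> where "\<kappa> = of_int a * complex_of_real ((Re \<tau>)\<^sup>2 + (Im \<tau>)\<^sup>2) + of_int b * of_real (Re \<tau>)"
  define A where "A = 4 * \<eta> / y\<^sup>2"
  have A0: "A \<noteq> 0" using y0 \<eta>0 by (simp add: A_def)
  have Ar: "A = of_real (4 * Im w / (Im \<tau>)\<^sup>2)" by (simp add: A_def y_def \<eta>_def)
  have A: "Re A > 0" using \<tau> w unfolding Ar Re_complex_of_real by simp
  define q where "q = - A * \<kappa> - 4 * \<i> * w * of_int a + (\<alpha> + \<beta>) / (2 * of_real pi * y)"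
  define E0 where "E0 = 2 * of_real pi * \<i> * w * of_int b ^ 2 - of_real pi * A * \<kappa>\<^sup>2 + (\<alpha> + \<beta>) * \<kappa> / y + \<i> * \<alpha> * (of_int b + 2 * of_int a * \<tau>)"
  have trm: "gauss_wt \<tau> w (a, b, c) * exp (\<alpha> * (form_eval (a, b, c) \<tau> 1 / of_real (Im \<tau>))) * exp (\<beta> * of_real (form_at (a, b, c) \<tau>))
     = exp E0 * exp (- of_real pi * A * of_int c ^ 2 + 2 * of_real pi * q * of_int c)" for c
  proof -
    define t where "t = complex_of_real (form_at (a, b, c) \<tau>)"
    have t: "t = (of_int c + \<kappa>) / y" by (simp add: t_def \<kappa>_def y_def cmod_power2)
    have X: "form_eval (a, b, c) \<tau> 1 / of_real (Im \<tau>) = t + \<i> * (of_int b + 2 * of_int a * \<tau>)"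
      using y0 unfolding form_eval_decomp[OF \<tau>] by (simp add: t_def y_def)
    have W: "gauss_wt \<tau> w (a, b, c) = exp (2 * of_real pi * \<i> * (of_int b ^ 2 - 4 * of_int a * of_int c) * w - 4 * of_real pi * \<eta> * t\<^sup>2)"
      by (simp add: gauss_wt_def disc_def exp_of_real[symmetric] exp_add[symmetric] t_def \<eta>_def)
    have At: "4 * of_real pi * \<eta> * t\<^sup>2 = of_real pi * A * (of_int c ^ 2 + 2 * \<kappa> * of_int c + \<kappa>\<^sup>2)"
      using y0 by (simp add: t A_def field_simps power2_eq_square)
    have tt: "(\<alpha> + \<beta>) * t = (\<alpha> + \<beta>) * \<kappa> / y + (\<alpha> + \<beta>) / y * of_int c"
      using y0 by (simp add: t field_simps)
    have pq: "2 * of_real pi * q = - 2 * of_real pi * A * \<kappa> - 8 * of_real pi * \<i> * w * of_int a + (\<alpha> + \<beta>) / y"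
      using y0 by (simp add: q_def field_simps)
    have "2 * of_real pi * \<i> * (of_int b ^ 2 - 4 * of_int a * of_int c) * w - 4 * of_real pi * \<eta> * t\<^sup>2
        + \<alpha> * (t + \<i> * (of_int b + 2 * of_int a * \<tau>)) + \<beta> * t
      = (2 * of_real pi * \<i> * (of_int b ^ 2 - 4 * of_int a * of_int c) * w - 4 * of_real pi * \<eta> * t\<^sup>2
        + \<i> * \<alpha> * (of_int b + 2 * of_int a * \<tau>)) + (\<alpha> + \<beta>) * t"
      by (simp add: algebra_simps)
    also have "\<dots> = E0 + (- of_real pi * A * of_int c ^ 2 + 2 * of_real pi * q * of_int c)"
      unfolding At tt pq E0_def by (simp add: algebra_simps)
    finally show ?thesis unfolding W X t_def[symmetric] by (simp only: exp_add[symmetric])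
  qed
  have P: "((\<lambda>m::int. exp (of_real pi * (q - \<i> * of_int m)\<^sup>2 / A) / csqrt A) has_sum
    (\<Sum>\<^sub>\<infinity>n::int. exp (- of_real pi * A * of_int n ^ 2 + 2 * of_real pi * q * of_int n))) UNIV"
    by (rule poisson_gauss[OF A])
  have cA: "1 / csqrt A = of_real (Im \<tau> / (2 * sqrt (Im w)))"
  proof -
    have "csqrt A = of_real (sqrt (4 * Im w / (Im \<tau>)\<^sup>2))" unfolding Ar using w by (subst csqrt_of_real_nonneg) auto
    also have "sqrt (4 * Im w / (Im \<tau>)\<^sup>2) = 2 * sqrt (Im w) / Im \<tau>" using \<tau> by (simp add: real_sqrt_divide real_sqrt_mult)
    finally show ?thesis using \<tau> w by simp
  qed
  \<comment> \<open>The dual index is taken with reversed sign, so that q - \<i> (-m) contains \<i>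
    (m - 4wa).\<close>
  have dual: "exp E0 * (exp (of_real pi * (q - \<i> * of_int (- m))\<^sup>2 / A) / csqrt A)
      = of_real (Im \<tau> / (2 * sqrt (Im w))) * dual_term \<tau> w \<alpha> \<beta> (a, m, b)" for m
  proof -
    define M where "M = of_int m - 4 * w * of_int a"
    define B1 where "B1 = \<i> * M + (\<alpha> + \<beta>) / (2 * of_real pi * y)"
    have qB: "q - \<i> * of_int (- m) = B1 - A * \<kappa>" by (simp add: q_def B1_def M_def algebra_simps)
    have e1: "of_real pi * (B1 - A * \<kappa>)\<^sup>2 / A = of_real pi * B1\<^sup>2 / A - 2 * of_real pi * \<kappa> * B1 + of_real pi * A * \<kappa>\<^sup>2"
      using A0 by (simp add: field_simps power2_eq_square)
    have e2: "2 * of_real pi * \<kappa> * B1 = 2 * of_real pi * \<i> * M * \<kappa> + (\<alpha> + \<beta>) * \<kappa> / y"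
      using y0 by (simp add: B1_def field_simps)
    have h: "dual_head \<tau> w \<alpha> \<beta> a m = of_real pi * B1\<^sup>2 / A
        - 2 * of_real pi * \<i> * M * of_int a * complex_of_real ((Re \<tau>)\<^sup>2 + (Im \<tau>)\<^sup>2) + 2 * \<i> * \<alpha> * of_int a * \<tau>"
      unfolding dual_head_def Let_def Ar B1_def M_def y_def by simp
    have tl: "2 * of_real pi * \<i> * (w * of_int b ^ 2 + dual_tail \<tau> w \<alpha> a m * of_int b)
       = 2 * of_real pi * \<i> * w * of_int b ^ 2 + \<i> * \<alpha> * of_int b - 2 * of_real pi * \<i> * M * (of_int b * of_real (Re \<tau>))"
      unfolding dual_tail_def M_def by (simp add: field_simps)
    have "E0 + of_real pi * (q - \<i> * of_int (- m))\<^sup>2 / A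
      = dual_head \<tau> w \<alpha> \<beta> a m + 2 * of_real pi * \<i> * (w * of_int b ^ 2 + dual_tail \<tau> w \<alpha> a m * of_int b)"
      unfolding qB e1 e2 h tl E0_def unfolding \<kappa>_def by (simp add: algebra_simps)
    then have "exp E0 * exp (of_real pi * (q - \<i> * of_int (- m))\<^sup>2 / A) = dual_term \<tau> w \<alpha> \<beta> (a, m, b)"
      unfolding dual_term_def prod.case exp_add[symmetric] by simp
    then show ?thesis unfolding cA[symmetric] by (simp add: field_simps)
  qed
  have "(\<Sum>\<^sub>\<infinity>c. exp E0 * exp (- of_real pi * A * of_int c ^ 2 + 2 * of_real pi * q * of_int c))
      = exp E0 * (\<Sum>\<^sub>\<infinity>n::int. exp (- of_real pi * A * of_int n ^ 2 + 2 * of_real pi * q * of_int n))"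
    by (rule infsum_cmult_right')
  also have "\<dots> = exp E0 * (\<Sum>\<^sub>\<infinity>m::int. exp (of_real pi * (q - \<i> * of_int m)\<^sup>2 / A) / csqrt A)"
    using infsumI[OF P] by simp
  also have "\<dots> = (\<Sum>\<^sub>\<infinity>m::int. exp E0 * (exp (of_real pi * (q - \<i> * of_int m)\<^sup>2 / A) / csqrt A))"
    by (rule infsum_cmult_right'[symmetric])
  also have "\<dots> = (\<Sum>\<^sub>\<infinity>m::int. exp E0 * (exp (of_real pi * (q - \<i> * of_int (- m))\<^sup>2 / A) / csqrt A))"
    by (rule infsum_reindex_bij_witness[of _ uminus uminus]) auto
  also have "\<dots> = of_real (Im \<tau> / (2 * sqrt (Im w))) * (\<Sum>\<^sub>\<infinity>m. dual_term \<tau> w \<alpha> \<beta> (a, m, b))"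
    unfolding dual by (rule infsum_cmult_right')
  finally show ?thesis unfolding trm .
qed


lemma gen_theta_summable:
  assumes \<tau>: "Im \<tau> > 0" and w: "Im w > 0"
  shows "(\<lambda>Q. gauss_wt \<tau> w Q * exp (\<alpha> * (form_eval Q \<tau> 1 / of_real (Im \<tau>))) * exp (\<beta> * of_real (form_at Q \<tau>))) summable_on UNIV"
proof -
  obtain \<epsilon> where \<epsilon>: "\<epsilon> > 0" "\<And>Q. norm (gauss_wt \<tau> w Q) \<le> exp (- \<epsilon> * form_size Q ^ 2)"
    using gauss_wt_bound[OF assms] by blast
  obtain C where C: "C \<ge> 1" "\<And>Q. \<bar>form_at Q \<tau>\<bar> \<le> C * form_size Q" "\<And>Q. cmod (form_eval Q \<tau> 1) \<le> C * form_size Q"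
    using form_upper[OF \<tau>] by blast
  define B where "B = norm \<alpha> * C / Im \<tau> + norm \<beta> * C"
  show ?thesis
  proof (rule abs_summable_summable, rule summable_on_comparison_test)
  show "(\<lambda>Q. exp (- \<epsilon> * form_size Q ^ 2 + B * form_size Q)) summable_on UNIV"
    by (rule gauss_form_size_summable[OF \<epsilon>(1)])
  fix Q
  have "norm (exp (\<alpha> * (form_eval Q \<tau> 1 / of_real (Im \<tau>)))) \<le> exp (norm \<alpha> * (C * form_size Q / Im \<tau>))"
    using C(3)[of Q] \<tau> by (intro order_trans[OF norm_exp]) (simp add: norm_mult norm_divide divide_right_mono mult_left_mono)
  moreover have "norm (exp (\<beta> * of_real (form_at Q \<tau>))) \<le> exp (norm \<beta> * (C * form_size Q))"
    using C(2)[of Q] by (intro order_trans[OF norm_exp]) (simp add: norm_mult mult_left_mono)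
  ultimately have "norm (gauss_wt \<tau> w Q * exp (\<alpha> * (form_eval Q \<tau> 1 / of_real (Im \<tau>))) * exp (\<beta> * of_real (form_at Q \<tau>)))
    \<le> exp (- \<epsilon> * form_size Q ^ 2) * exp (norm \<alpha> * (C * form_size Q / Im \<tau>)) * exp (norm \<beta> * (C * form_size Q))"
    unfolding norm_mult using \<epsilon>(2)[of Q] by (intro mult_mono) auto
  then show "norm (gauss_wt \<tau> w Q * exp (\<alpha> * (form_eval Q \<tau> 1 / of_real (Im \<tau>))) * exp (\<beta> * of_real (form_at Q \<tau>)))
    \<le> exp (- \<epsilon> * form_size Q ^ 2 + B * form_size Q)"
    by (simp add: B_def exp_add[symmetric] algebra_simps)
  qed auto
qed

lemma gen_theta_dual:
  assumes \<tau>: "Im \<tau> > 0" and w: "Im w > 0"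
  shows "gen_theta \<tau> w \<alpha> \<beta> = of_real (Im \<tau> / (2 * sqrt (Im w)))
    * (\<Sum>\<^sub>\<infinity>(a, m). exp (dual_head \<tau> w \<alpha> \<beta> a m) * unary_theta w (dual_tail \<tau> w \<alpha> a m))"
proof -
  let ?c = "complex_of_real (Im \<tau> / (2 * sqrt (Im w)))"
  note ds = dual_term_summable[OF \<tau> w, of \<alpha> \<beta>]
  have inner: "(\<Sum>\<^sub>\<infinity>b. dual_term \<tau> w \<alpha> \<beta> (a, m, b)) = exp (dual_head \<tau> w \<alpha> \<beta> a m) * unary_theta w (dual_tail \<tau> w \<alpha> a m)" for a m
    unfolding dual_term_def unary_theta_def prod.case by (rule infsum_cmult_right')
  have "gen_theta \<tau> w \<alpha> \<beta> = (\<Sum>\<^sub>\<infinity>a. \<Sum>\<^sub>\<infinity>b. ?c * (\<Sum>\<^sub>\<infinity>m. dual_term \<tau> w \<alpha> \<beta> (a, m, b)))"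
    unfolding gen_theta_def infsum_int3(2)[OF gen_theta_summable[OF \<tau> w]] gen_theta_inner[OF \<tau> w] ..
  also have "\<dots> = ?c * (\<Sum>\<^sub>\<infinity>a. \<Sum>\<^sub>\<infinity>b. \<Sum>\<^sub>\<infinity>m. dual_term \<tau> w \<alpha> \<beta> (a, m, b))"
    by (simp only: infsum_cmult_right')
  also have "(\<Sum>\<^sub>\<infinity>a. \<Sum>\<^sub>\<infinity>b. \<Sum>\<^sub>\<infinity>m. dual_term \<tau> w \<alpha> \<beta> (a, m, b)) = (\<Sum>\<^sub>\<infinity>a. \<Sum>\<^sub>\<infinity>m. \<Sum>\<^sub>\<infinity>b. dual_term \<tau> w \<alpha> \<beta> (a, m, b))"
    by (intro infsum_cong infsum_int3(3)[OF ds, symmetric])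
  also have "\<dots> = (\<Sum>\<^sub>\<infinity>(a, m). \<Sum>\<^sub>\<infinity>b. dual_term \<tau> w \<alpha> \<beta> (a, m, b))"
    using infsum_int3(1)[OF ds] infsum_int3(2)[OF ds] by simp
  finally show ?thesis unfolding inner .
qed

text \<open>The substitution \<open>a \<mapsto> a - m\<close> turns \<open>m - 4 V(w) a\<close> into \<open>(m - 4 w a) / (4 w + 1)\<close>.\<close>

lemma dual_lower:
  assumes \<tau>: "Im \<tau> > 0" and w: "Im w > 0"
  defines "j \<equiv> 4 * w + 1"
  shows "exp (dual_head \<tau> (w / j) (\<alpha> / j) (\<beta> / cnj j) (a + m) m) * unary_theta (w / j) (dual_tail \<tau> (w / j) (\<alpha> / j) (a + m) m)
    = csqrt j * exp (\<i> / (2 * of_real pi * cnj j) * \<beta>\<^sup>2) *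
      (exp (dual_head \<tau> w \<alpha> \<beta> a m) * unary_theta w (dual_tail \<tau> w \<alpha> a m))"
proof -
  define M where "M = of_int m - 4 * w * of_int a"
  define x y \<eta> jb where "x = complex_of_real (Re \<tau>)" and "y = complex_of_real (Im \<tau>)"
    and "\<eta> = complex_of_real (Im w)" and "jb = cnj j"
  have y0: "y \<noteq> 0" and \<eta>0: "\<eta> \<noteq> 0" using \<tau> w by (auto simp: y_def \<eta>_def)
  have j0: "j \<noteq> 0" using lower_moebius_upper[OF w] by (simp add: j_def)
  then have jb0: "jb \<noteq> 0" by (simp add: jb_def)
  have jb: "jb = j - 8 * \<i> * \<eta>" by (simp add: jb_def j_def \<eta>_def complex_eq_iff)
  have \<tau>xy: "\<tau> = x + \<i> * y" by (simp add: x_def y_def complex_eq_iff)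
  have M1: "of_int m - 4 * (w / j) * of_int (a + m) = M / j"
    using j0 by (simp add: M_def field_simps) (simp add: j_def algebra_simps)
  have tail: "dual_tail \<tau> (w / j) (\<alpha> / j) (a + m) m = dual_tail \<tau> w \<alpha> a m / j"
    unfolding dual_tail_def M1 using j0 by (simp add: M_def field_simps)
  define \<zeta> where "\<zeta> = dual_tail \<tau> w \<alpha> a m"
  have \<zeta>: "\<zeta> = \<alpha> / (2 * of_real pi) - M * x" by (simp add: \<zeta>_def dual_tail_def M_def x_def)
  define U W where "U = \<i> * M + \<alpha> / (2 * of_real pi * y)" and "W = \<beta> / (2 * of_real pi * y)"
  have \<eta>': "complex_of_real (Im (w / j)) = \<eta> / (j * jb)"
  proof -
    have "complex_of_real (Im (w / j)) = \<eta> / complex_of_real ((cmod j)\<^sup>2)" by (simp add: j_def Im_lower_moebius \<eta>_def)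
    then show ?thesis by (simp only: complex_norm_square jb_def)
  qed
  have pi0: "complex_of_real pi \<noteq> 0" by simp
  have h: "dual_head \<tau> w \<alpha> \<beta> a m = of_real pi * y\<^sup>2 / (4 * \<eta>) * (U + W)\<^sup>2
      - 2 * of_real pi * \<i> * M * of_int a * (x\<^sup>2 + y\<^sup>2) + 2 * \<i> * \<alpha> * of_int a * \<tau>"
  proof -
    have "\<i> * M + (\<alpha> + \<beta>) / (2 * of_real pi * y) = U + W" by (simp add: U_def W_def add_divide_distrib)
    then show ?thesis unfolding dual_head_def Let_def M_def[symmetric] y_def[symmetric]
      using y0 \<eta>0 by (simp add: x_def y_def \<eta>_def)
  qed
  have h': "dual_head \<tau> (w / j) (\<alpha> / j) (\<beta> / jb) (a + m) m = of_real pi * y\<^sup>2 * (j * jb) / (4 * \<eta>) * (U / j + W / jb)\<^sup>2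
      - 2 * of_real pi * \<i> * (M / j) * of_int (a + m) * (x\<^sup>2 + y\<^sup>2) + 2 * \<i> * (\<alpha> / j) * of_int (a + m) * \<tau>"
  proof -
    have e: "\<i> * (M / j) + (\<alpha> / j + \<beta> / jb) / (2 * of_real pi * y) = U / j + W / jb"
      using j0 jb0 y0 by (simp add: U_def W_def field_simps)
    have d: "complex_of_real (4 * Im (w / j) / (Im \<tau>)\<^sup>2) = 4 * (\<eta> / (j * jb)) / y\<^sup>2"
      unfolding \<eta>'[symmetric] by (simp add: y_def)
    show ?thesis unfolding dual_head_def Let_def M1 y_def[symmetric] e d
      using y0 \<eta>0 j0 jb0 by (simp add: x_def y_def field_simps)
  qed
  \<comment> \<open>This is where the conjugate of j enters the quadratic part: with cnj j = j - 8
    \<i> \<eta>, both cnj j/j and j/cnj j are 1 plus a correction. The prefactor cancels \<eta>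
    there, leaving one term in 1/j and one in 1/cnj j.\<close>
  have sq: "of_real pi * y\<^sup>2 * (j * jb) / (4 * \<eta>) * (U / j + W / jb)\<^sup>2
     = of_real pi * y\<^sup>2 / (4 * \<eta>) * (U + W)\<^sup>2 - 2 * of_real pi * \<i> * y\<^sup>2 * U\<^sup>2 / j + 2 * of_real pi * \<i> * y\<^sup>2 * W\<^sup>2 / jb"
  proof -
    have "(j * jb) * (U / j + W / jb)\<^sup>2 = U\<^sup>2 * (jb / j) + 2 * U * W + W\<^sup>2 * (j / jb)"
      using j0 jb0 by (simp add: field_simps power2_eq_square)
    also have "jb / j = 1 - 8 * \<i> * \<eta> / j" using j0 by (simp add: jb field_simps)
    also have "j / jb = 1 + 8 * \<i> * \<eta> / jb" using jb0 by (simp add: field_simps) (simp add: jb)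
    finally have e: "(j * jb) * (U / j + W / jb)\<^sup>2 = (U + W)\<^sup>2 - 8 * \<i> * \<eta> * U\<^sup>2 / j + 8 * \<i> * \<eta> * W\<^sup>2 / jb"
      by (simp add: power2_eq_square algebra_simps)
    have "of_real pi * y\<^sup>2 * (j * jb) / (4 * \<eta>) * (U / j + W / jb)\<^sup>2
       = of_real pi * y\<^sup>2 / (4 * \<eta>) * ((j * jb) * (U / j + W / jb)\<^sup>2)" by simp
    also have "\<dots> = of_real pi * y\<^sup>2 / (4 * \<eta>) * (U + W)\<^sup>2 - of_real pi * y\<^sup>2 / (4 * \<eta>) * (8 * \<i> * \<eta> * U\<^sup>2 / j)
       + of_real pi * y\<^sup>2 / (4 * \<eta>) * (8 * \<i> * \<eta> * W\<^sup>2 / jb)"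
      unfolding e by (simp only: distrib_left right_diff_distrib)
    finally show ?thesis using \<eta>0 by (simp add: mult_ac)
  qed
  have W2: "2 * of_real pi * \<i> * y\<^sup>2 * W\<^sup>2 / jb = \<i> / (2 * of_real pi * jb) * \<beta>\<^sup>2"
    using y0 jb0 by (simp add: W_def field_simps power2_eq_square)
  have yU: "y * U = \<i> * (M * y) + \<alpha> / (2 * of_real pi)" using y0 by (simp add: U_def field_simps)
  have key: "- 2 * of_real pi * \<i> * y\<^sup>2 * U\<^sup>2 / j - 2 * of_real pi * \<i> * (M / j) * of_int (a + m) * (x\<^sup>2 + y\<^sup>2)
      + 2 * \<i> * (\<alpha> / j) * of_int (a + m) * \<tau> + 2 * of_real pi * \<i> * (\<zeta>\<^sup>2 / j)
     = - 2 * of_real pi * \<i> * M * of_int a * (x\<^sup>2 + y\<^sup>2) + 2 * \<i> * \<alpha> * of_int a * \<tau>"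
  proof -
    define \<gamma> where "\<gamma> = \<alpha> / (2 * of_real pi)"
    have \<alpha>: "\<alpha> = 2 * of_real pi * \<gamma>" by (simp add: \<gamma>_def)
    \<comment> \<open>The shifted index expressed through M makes the remaining identity, after
      multiplication by j, a polynomial one.\<close>
    have am: "of_int (a + m) = M + j * of_int a" by (simp add: M_def j_def algebra_simps)
    have y2U2: "y\<^sup>2 * U\<^sup>2 = (\<i> * (M * y) + \<gamma>)\<^sup>2" using yU by (simp add: \<gamma>_def power_mult_distrib[symmetric])
    have z0: "- (y\<^sup>2 * U\<^sup>2) - M * (M + j * of_int a) * (x\<^sup>2 + y\<^sup>2) + 2 * \<gamma> * (M + j * of_int a) * (x + \<i> * y) + (\<gamma> - M * x)\<^sup>2
       = j * (- M * of_int a * (x\<^sup>2 + y\<^sup>2) + 2 * \<gamma> * of_int a * (x + \<i> * y))"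
      unfolding y2U2 by (simp add: power2_eq_square algebra_simps)
    have "- 2 * of_real pi * \<i> * y\<^sup>2 * U\<^sup>2 / j - 2 * of_real pi * \<i> * (M / j) * of_int (a + m) * (x\<^sup>2 + y\<^sup>2)
      + 2 * \<i> * (\<alpha> / j) * of_int (a + m) * \<tau> + 2 * of_real pi * \<i> * (\<zeta>\<^sup>2 / j)
      = 2 * of_real pi * \<i> / j * (- (y\<^sup>2 * U\<^sup>2) - M * (M + j * of_int a) * (x\<^sup>2 + y\<^sup>2) + 2 * \<gamma> * (M + j * of_int a) * (x + \<i> * y) + (\<gamma> - M * x)\<^sup>2)"
      unfolding am \<zeta> \<gamma>_def[symmetric] unfolding \<tau>xy \<alpha> using j0 by (simp add: field_simps)
    also have "\<dots> = 2 * of_real pi * \<i> * (- M * of_int a * (x\<^sup>2 + y\<^sup>2) + 2 * \<gamma> * of_int a * (x + \<i> * y))"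
      unfolding z0 using j0 by simp
    finally show ?thesis unfolding \<tau>xy[symmetric] by (simp add: \<alpha> algebra_simps)
  qed
  have "dual_head \<tau> (w / j) (\<alpha> / j) (\<beta> / jb) (a + m) m + 2 * of_real pi * \<i> * (\<zeta>\<^sup>2 / j)
     = \<i> / (2 * of_real pi * jb) * \<beta>\<^sup>2 + dual_head \<tau> w \<alpha> \<beta> a m"
    unfolding h h' sq W2 using key by (simp add: algebra_simps)
  then have E: "exp (dual_head \<tau> (w / j) (\<alpha> / j) (\<beta> / jb) (a + m) m) * exp (2 * of_real pi * \<i> * (\<zeta>\<^sup>2 / j))
     = exp (\<i> / (2 * of_real pi * jb) * \<beta>\<^sup>2) * exp (dual_head \<tau> w \<alpha> \<beta> a m)"
    by (simp only: exp_add[symmetric])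
  have UT: "unary_theta (w / j) (\<zeta> / j) = csqrt j * exp (2 * of_real pi * \<i> * (\<zeta>\<^sup>2 / j)) * unary_theta w \<zeta>"
    unfolding j_def by (rule unary_theta_lower[OF w])
  have "exp (dual_head \<tau> (w / j) (\<alpha> / j) (\<beta> / jb) (a + m) m) * unary_theta (w / j) (\<zeta> / j)
     = csqrt j * (exp (dual_head \<tau> (w / j) (\<alpha> / j) (\<beta> / jb) (a + m) m) * exp (2 * of_real pi * \<i> * (\<zeta>\<^sup>2 / j))) * unary_theta w \<zeta>"
    unfolding UT by (simp only: mult_ac)
  then show ?thesis unfolding tail \<zeta>_def[symmetric] jb_def[symmetric] unfolding E by (simp only: mult_ac)
qed

text \<open>The scalings by 1/j and 1/cnj j belong to the positive plane and the negative line. The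
  factor |j| comes from 1/sqrt(Im w) at the two points, csqrt j from the unary theta series.\<close>

lemma gen_theta_lower:
  assumes \<tau>: "Im \<tau> > 0" and w: "Im w > 0"
  defines "j \<equiv> 4 * w + 1"
  shows "gen_theta \<tau> (w / j) (\<alpha> / j) (\<beta> / cnj j)
    = of_real (cmod j) * csqrt j * exp (\<i> / (2 * of_real pi * cnj j) * \<beta>\<^sup>2) * gen_theta \<tau> w \<alpha> \<beta>"
proof -
  have j0: "j \<noteq> 0" and w': "Im (w / j) > 0" using lower_moebius_upper[OF w] by (auto simp: j_def)
  let ?G = "\<lambda>w \<alpha> \<beta> (a, m). exp (dual_head \<tau> w \<alpha> \<beta> a m) * unary_theta w (dual_tail \<tau> w \<alpha> a m)"
  let ?K = "csqrt j * exp (\<i> / (2 * of_real pi * cnj j) * \<beta>\<^sup>2)"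
  have key: "?K * ?G w \<alpha> \<beta> (a - m, m) = ?G (w / j) (\<alpha> / j) (\<beta> / cnj j) (a, m)" for a m
    using dual_lower[OF \<tau> w, of \<alpha> \<beta> "a - m" m] by (simp add: j_def)
  have "infsum (?G (w / j) (\<alpha> / j) (\<beta> / cnj j)) UNIV = (\<Sum>\<^sub>\<infinity>p. ?K * ?G w \<alpha> \<beta> p)"
    by (rule infsum_reindex_bij_witness[of _ "\<lambda>(a, m). (a + m, m)" "\<lambda>(a, m). (a - m, m)"])
       (use key in auto)
  also have "\<dots> = ?K * infsum (?G w \<alpha> \<beta>) UNIV" by (rule infsum_cmult_right')
  finally have 1: "infsum (?G (w / j) (\<alpha> / j) (\<beta> / cnj j)) UNIV = ?K * infsum (?G w \<alpha> \<beta>) UNIV" .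
  have "sqrt (Im (w / j)) = sqrt (Im w) / cmod j"
    using j0 by (simp add: j_def Im_lower_moebius real_sqrt_divide)
  then have "Im \<tau> / (2 * sqrt (Im (w / j))) = cmod j * (Im \<tau> / (2 * sqrt (Im w)))" by simp
  then have 2: "complex_of_real (Im \<tau> / (2 * sqrt (Im (w / j)))) = of_real (cmod j) * of_real (Im \<tau> / (2 * sqrt (Im w)))"
    by (simp only: of_real_mult)
  show ?thesis
    unfolding gen_theta_dual[OF \<tau> w] gen_theta_dual[OF \<tau> w'] 1 2 by (simp only: mult_ac)
qed

text \<open>One derivative in \<beta> at 0 removes the Gaussian factor and contributes cnj j. The
  identity that remains has a factor free of \<alpha>, so k - 1 derivatives in \<alpha> are harmless
  and contribute j^(k-1).\<close>

lemma siegel_theta_lower: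
  assumes \<tau>: "Im \<tau> > 0" and w: "Im w > 0" and k: "k > 0"
  defines "j \<equiv> 4 * w + 1"
  shows "siegel_theta k \<tau> (w / j) = j ^ (k - 1) * cnj j * of_real (cmod j) * csqrt j * siegel_theta k \<tau> w"
proof -
  have j0: "j \<noteq> 0" and w': "Im (w / j) > 0" using lower_moebius_upper[OF w] by (auto simp: j_def)
  define y where "y = Im \<tau>"
  have y: "y > 0" using \<tau> by (simp add: y_def)
  define X where "X = (\<lambda>Q. form_eval Q \<tau> 1 / complex_of_real y)"
  define t where "t = (\<lambda>Q. complex_of_real (form_at Q \<tau>))"
  define K where "K = of_real (cmod j) * csqrt j"
  obtain \<epsilon>1 where \<epsilon>1: "\<epsilon>1 > 0" "\<And>Q. norm (gauss_wt \<tau> w Q) \<le> exp (- \<epsilon>1 * form_size Q ^ 2)"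
    using gauss_wt_bound[OF \<tau> w] by blast
  obtain \<epsilon>2 where \<epsilon>2: "\<epsilon>2 > 0" "\<And>Q. norm (gauss_wt \<tau> (w / j) Q) \<le> exp (- \<epsilon>2 * form_size Q ^ 2)"
    using gauss_wt_bound[OF \<tau> w'] by blast
  define \<epsilon> where "\<epsilon> = min \<epsilon>1 \<epsilon>2"
  have \<epsilon>: "\<epsilon> > 0" using \<epsilon>1 \<epsilon>2 by (simp add: \<epsilon>_def)
  have e: "exp (- \<epsilon>1 * form_size Q ^ 2) \<le> exp (- \<epsilon> * form_size Q ^ 2)" "exp (- \<epsilon>2 * form_size Q ^ 2) \<le> exp (- \<epsilon> * form_size Q ^ 2)" for Q
    by (auto simp: \<epsilon>_def intro!: mult_right_mono)
  have g1: "norm (gauss_wt \<tau> w Q) \<le> exp (- \<epsilon> * form_size Q ^ 2)" for Q using \<epsilon>1(2)[of Q] e(1)[of Q] by linarith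
  have g2: "norm (gauss_wt \<tau> (w / j) Q) \<le> exp (- \<epsilon> * form_size Q ^ 2)" for Q using \<epsilon>2(2)[of Q] e(2)[of Q] by linarith
  obtain C0 where C0: "C0 \<ge> 1" "\<And>Q. \<bar>form_at Q \<tau>\<bar> \<le> C0 * form_size Q" "\<And>Q. cmod (form_eval Q \<tau> 1) \<le> C0 * form_size Q"
    using form_upper[OF \<tau>] by blast
  \<comment> \<open>Large enough for all four exponents: \<open>form_at\<close> and Q(\<tau>,1)/y,
    each with and without its automorphy factor.\<close>
  define C where "C = C0 + C0 / cmod j + C0 / y + C0 / (y * cmod j)"
  have Cp: "C0 \<le> C" "C0 / cmod j \<le> C" "C0 / y \<le> C" "C0 / (y * cmod j) \<le> C" "C \<ge> 0"
    using C0(1) y by (auto simp: C_def)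
  have sc: "u \<le> C' * form_size Q \<Longrightarrow> C' \<le> C \<Longrightarrow> u \<le> C * form_size Q" for u C' Q
    by (meson form_size_nonneg mult_right_mono order_trans)
  have bt: "norm (t Q) \<le> C * form_size Q" for Q
    using C0(2)[of Q] by (intro sc[OF _ Cp(1)]) (simp add: t_def)
  have btj: "norm (t Q / cnj j) \<le> C * form_size Q" for Q
    using divide_right_mono[OF C0(2)[of Q], of "cmod j"] by (intro sc[OF _ Cp(2)]) (simp add: t_def norm_divide)
  have bX: "norm (X Q) \<le> C * form_size Q" for Q
    using divide_right_mono[OF C0(3)[of Q], of y] y by (intro sc[OF _ Cp(3)]) (simp add: X_def norm_divide)
  have bXj: "norm (X Q / j) \<le> C * form_size Q" for Q
    using divide_right_mono[OF C0(3)[of Q], of "y * cmod j"] y by (intro sc[OF _ Cp(4)]) (simp add: X_def norm_divide norm_mult)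
  have step1: "(\<Sum>\<^sub>\<infinity>Q. gauss_wt \<tau> (w / j) Q * exp (\<alpha> * (X Q / j)) * (t Q / cnj j) ^ 1)
     = K * (\<Sum>\<^sub>\<infinity>Q. gauss_wt \<tau> w Q * exp (\<alpha> * X Q) * t Q ^ 1)" for \<alpha>
  proof (rule exponential_sum_moments[where B = "norm \<alpha> * C" and K = "\<lambda>\<beta>. K * exp (\<i> / (2 * of_real pi * cnj j) * \<beta>\<^sup>2)"
      and ?K0.0 = K and ?K2.0 = "\<i> / (2 * of_real pi * cnj j)" and C = C and \<epsilon> = \<epsilon>])
    fix Q
    have ex: "norm (exp (\<alpha> * Z)) \<le> exp (norm \<alpha> * C * form_size Q)" if "norm Z \<le> C * form_size Q" for Z
      using that by (intro order_trans[OF norm_exp]) (simp add: norm_mult mult_left_mono mult.assoc)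
    show "norm (gauss_wt \<tau> (w / j) Q * exp (\<alpha> * (X Q / j))) \<le> exp (- \<epsilon> * form_size Q ^ 2 + norm \<alpha> * C * form_size Q)"
      unfolding norm_mult exp_add by (intro mult_mono g2 ex bXj) auto
    show "norm (gauss_wt \<tau> w Q * exp (\<alpha> * X Q)) \<le> exp (- \<epsilon> * form_size Q ^ 2 + norm \<alpha> * C * form_size Q)"
      unfolding norm_mult exp_add by (intro mult_mono g1 ex bX) auto
  next
    fix \<beta>
    have "gen_theta \<tau> (w / j) (\<alpha> / j) (\<beta> / cnj j) = K * exp (\<i> / (2 * of_real pi * cnj j) * \<beta>\<^sup>2) * gen_theta \<tau> w \<alpha> \<beta>"
      using gen_theta_lower[OF \<tau> w, of \<alpha> \<beta>] by (simp add: j_def K_def)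
    then show "(\<Sum>\<^sub>\<infinity>Q. gauss_wt \<tau> (w / j) Q * exp (\<alpha> * (X Q / j)) * exp (\<beta> * (t Q / cnj j)))
      = K * exp (\<i> / (2 * of_real pi * cnj j) * \<beta>\<^sup>2) * (\<Sum>\<^sub>\<infinity>Q. gauss_wt \<tau> w Q * exp (\<alpha> * X Q) * exp (\<beta> * t Q))"
      by (simp add: gen_theta_def X_def t_def y_def mult_ac)
  qed (use \<epsilon> Cp bt btj in auto)
  have step2: "(\<Sum>\<^sub>\<infinity>Q. gauss_wt \<tau> (w / j) Q * (t Q / cnj j) * (X Q / j) ^ (k - 1))
     = K * (\<Sum>\<^sub>\<infinity>Q. gauss_wt \<tau> w Q * t Q * X Q ^ (k - 1))"
  proof (rule exponential_sum_moments[where B = C and K = "\<lambda>\<alpha>. K * exp (0 * \<alpha>\<^sup>2)"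
      and ?K0.0 = K and ?K2.0 = 0 and C = C and \<epsilon> = \<epsilon>])
    fix Q
    have ex: "norm Z \<le> exp (C * form_size Q)" if "norm Z \<le> C * form_size Q" for Z :: complex
      using that exp_ge_add_one_self[of "C * form_size Q"] by linarith
    show "norm (gauss_wt \<tau> (w / j) Q * (t Q / cnj j)) \<le> exp (- \<epsilon> * form_size Q ^ 2 + C * form_size Q)"
      unfolding norm_mult exp_add by (intro mult_mono g2 ex btj) auto
    show "norm (gauss_wt \<tau> w Q * t Q) \<le> exp (- \<epsilon> * form_size Q ^ 2 + C * form_size Q)"
      unfolding norm_mult exp_add by (intro mult_mono g1 ex bt) auto
  next
    fix \<alpha>
    show "(\<Sum>\<^sub>\<infinity>Q. gauss_wt \<tau> (w / j) Q * (t Q / cnj j) * exp (\<alpha> * (X Q / j)))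
       = K * exp (0 * \<alpha>\<^sup>2) * (\<Sum>\<^sub>\<infinity>Q. gauss_wt \<tau> w Q * t Q * exp (\<alpha> * X Q))"
      using step1[of \<alpha>] by (simp add: mult_ac)
  qed (use \<epsilon> Cp bX bXj in auto)
  have th: "siegel_theta k \<tau> v = of_real y ^ (k - 1) * (\<Sum>\<^sub>\<infinity>Q. gauss_wt \<tau> v Q * t Q * X Q ^ (k - 1))" for v
    unfolding siegel_theta_def infsum_cmult_right'[symmetric]
    using y by (intro infsum_cong) (simp add: X_def t_def power_divide mult_ac)
  have "(\<Sum>\<^sub>\<infinity>Q. gauss_wt \<tau> (w / j) Q * t Q * X Q ^ (k - 1))
     = j ^ (k - 1) * cnj j * (\<Sum>\<^sub>\<infinity>Q. gauss_wt \<tau> (w / j) Q * (t Q / cnj j) * (X Q / j) ^ (k - 1))"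
    unfolding infsum_cmult_right'[symmetric]
    using j0 by (intro infsum_cong) (simp add: power_divide)
  then show ?thesis unfolding th step2 K_def by (simp add: mult_ac)
qed

section \<open>The Cauchy kernel and the lifting integral\<close>

lemma gamma_integrable_real:
  fixes s c :: real
  assumes "s > 0" "c > 0"
  shows "has_bochner_integral lborel (\<lambda>x. indicator {0<..} x * (x powr (s - 1) * exp (- (c * x)))) (Gamma s * c powr (- s))"
proof -
  define f where "f = (\<lambda>x::real. indicator {0<..} x * (x powr (s - 1) * exp (- x)))"
  have "has_bochner_integral lborel f (Gamma s)"
  proof (rule has_bochner_integral_nn_integral)
    have "ennreal (Gamma s) = (\<integral>\<^sup>+t. ennreal (indicator {0..} t * t powr (s - 1) / exp t) \<partial>lborel)"
      by (rule Gamma_conv_nn_integral_real) fact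
    also have "\<dots> = (\<integral>\<^sup>+t. ennreal (f t) \<partial>lborel)"
    proof (rule nn_integral_cong_AE)
      show "AE x in lborel. ennreal (indicator {0..} x * x powr (s - 1) / exp x) = ennreal (f x)"
        using AE_lborel_singleton[of "0::real"] by eventually_elim (auto simp: f_def indicator_def exp_minus field_simps)
    qed
    finally show "(\<integral>\<^sup>+t. ennreal (f t) \<partial>lborel) = ennreal (Gamma s)" by simp
  qed (use assms in \<open>auto simp: f_def Gamma_real_pos less_imp_le\<close>)
  then have i: "integrable lborel f" "integral\<^sup>L lborel f = Gamma s" by (auto simp: has_bochner_integral_iff)
  have fc: "indicator {0<..} x * (x powr (s - 1) * exp (- (c * x))) = c powr (1 - s) * f (0 + c * x)" for x
    using assms(2) by (auto simp: f_def indicator_def powr_mult zero_less_mult_iff powr_diff powr_minus field_simps powr_add[symmetric])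
  have 1: "integrable lborel (\<lambda>x. f (0 + c * x))" by (rule lborel_integrable_real_affine[OF i(1)]) (use assms in simp)
  have "integral\<^sup>L lborel f = \<bar>c\<bar> *\<^sub>R (\<integral>x. f (0 + c * x) \<partial>lborel)"
    by (rule lborel_integral_real_affine) (use assms in simp)
  then have 2: "(\<integral>x. f (0 + c * x) \<partial>lborel) = Gamma s / c" using i(2) assms(2) by (simp add: field_simps)
  have "c powr (1 - s) * (Gamma s / c) = Gamma s * c powr (- s)"
    using assms(2) by (simp add: powr_diff powr_minus field_simps)
  then show ?thesis unfolding fc using 1 2 by (simp add: has_bochner_integral_iff)
qed

text \<open>The principal power is the continuation from the positive axis to the right half-plane,
  so the real gamma integral determines the complex one.\<close>

lemma gamma_integral_complex:
  fixes s :: real and c :: complex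
  assumes s: "s > 0" and c: "Re c > 0"
  shows "integrable lborel (\<lambda>x. of_real (indicator {0<..} x * x powr (s - 1)) * exp (- (c * of_real x)))"
    and "(\<integral>x. of_real (indicator {0<..} x * x powr (s - 1)) * exp (- (c * of_real x)) \<partial>lborel)
      = of_real (Gamma s) * c powr (- of_real s)"
proof -
  define f where "f = (\<lambda>c (x::real). of_real (indicator {0<..} x * x powr (s - 1)) * exp (- (c * complex_of_real x)))"
  have fm: "f c \<in> borel_measurable lborel" for c unfolding f_def by measurable
  have bd: "norm (f c x) \<le> indicator {0<..} x * (x powr (s - 1) * exp (- (\<epsilon> * x)))" if "Re c > \<epsilon>" for c x \<epsilon>
    using that by (cases "x > 0") (auto simp: f_def norm_mult indicator_def intro!: mult_left_mono)
  have gi: "integrable lborel (\<lambda>x. indicator {0<..} x * (x powr (s - 1) * exp (- (\<epsilon> * x))))" if "\<epsilon> > 0" for \<epsilon>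
    using gamma_integrable_real[OF s that] by (simp add: has_bochner_integral_iff)
  obtain \<epsilon> where \<epsilon>: "0 < \<epsilon>" "\<epsilon> < Re c" using c dense by blast
  have "integrable lborel (f c)"
    by (rule Bochner_Integration.integrable_bound[OF gi[OF \<epsilon>(1)] fm]) (use bd[OF \<epsilon>(2)] in \<open>auto simp: abs_mult\<close>)
  then show "integrable lborel (\<lambda>x. of_real (indicator {0<..} x * x powr (s - 1)) * exp (- (c * of_real x)))"
    by (simp add: f_def)
  define F where "F = (\<lambda>c. \<integral>x. f c x \<partial>lborel)"
  have hol: "F holomorphic_on {c. Re c > \<epsilon>}" if "\<epsilon> > 0" for \<epsilon>
    unfolding F_def
    by (rule holomorphic_on_parameter_integral[OF _ fm _ _ gi[OF that]])
       (use bd in \<open>auto simp: open_halfspace_Re_gt f_def intro!: holomorphic_intros\<close>)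
  have "F field_differentiable at c" if c: "Re c > 0" for c
  proof -
    obtain \<epsilon> where \<epsilon>: "0 < \<epsilon>" "\<epsilon> < Re c" using c dense by blast
    show ?thesis
      by (rule holomorphic_on_imp_differentiable_at[OF hol[OF \<epsilon>(1)]]) (use \<epsilon> open_halfspace_Re_gt in auto)
  qed
  then have holF: "F holomorphic_on {c. Re c > 0}" by (simp add: holomorphic_on_def field_differentiable_at_within)
  have real: "F (of_real c) = of_real (Gamma s) * of_real c powr (- of_real s)" if "c > 0" for c
  proof -
    have "F (of_real c) = (\<integral>x. of_real (indicator {0<..} x * (x powr (s - 1) * exp (- (c * x)))) \<partial>lborel)"
      unfolding F_def f_def by (intro Bochner_Integration.integral_cong refl) (simp add: exp_of_real[symmetric])
    also have "\<dots> = of_real (Gamma s * c powr (- s))"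
      using gamma_integrable_real[OF s that] by (simp only: integral_complex_of_real has_bochner_integral_iff)
    also have "\<dots> = of_real (Gamma s) * of_real c powr (- of_real s)"
      using that by (simp add: powr_of_real[symmetric])
    finally show ?thesis .
  qed
  have "F c - of_real (Gamma s) * c powr (- of_real s) = 0"
  proof (rule analytic_continuation[where f = "\<lambda>c. F c - of_real (Gamma s) * c powr (- of_real s)" and w = c
        and U = "{p. Re p > 0} \<inter> \<real>" and \<xi> = "of_real 1" and S = "{p. Re p > 0}"])
    show "(complex_of_real 1) islimpt {p. Re p > 0} \<inter> \<real>"
      by (rule islimpt_reals_complex[of "{p. Re p > 0}"]) (auto simp: open_halfspace_Re_gt)
    show "(\<lambda>c. F c - of_real (Gamma s) * c powr (- of_real s)) holomorphic_on {p. Re p > 0}"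
      by (intro holomorphic_intros holF) (auto simp: complex_nonpos_Reals_iff)
    show "F z - of_real (Gamma s) * z powr (- of_real s) = 0" if "z \<in> {p. Re p > 0} \<inter> \<real>" for z
      using that real by (auto elim!: Reals_cases)
  qed (use c in \<open>auto simp: open_halfspace_Re_gt convex_connected convex_halfspace_Re_gt\<close>)
  then show "(\<integral>x. of_real (indicator {0<..} x * x powr (s - 1)) * exp (- (c * of_real x)) \<partial>lborel)
      = of_real (Gamma s) * c powr (- of_real s)"
    by (simp add: F_def f_def)
qed

section \<open>Fourier inversion and transforms of the two kernel factors\<close>

lemma integrable_pair_mult:
  fixes A B :: "real \<Rightarrow> real"
  assumes "integrable lborel A" "integrable lborel B"
  shows "integrable (lborel \<Otimes>\<^sub>M lborel) (\<lambda>(x, y). A x * B y)"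
proof -
  note [measurable] = borel_measurable_integrable[OF assms(1)] borel_measurable_integrable[OF assms(2)]
  show ?thesis
  proof (rule lborel_pair.Fubini_integrable)
    show "integrable lborel (\<lambda>x. \<integral>y. norm (case (x, y) of (x, y) \<Rightarrow> A x * B y) \<partial>lborel)"
      using assms by (simp add: abs_mult)
    show "AE x in lborel. integrable lborel (\<lambda>y. case (x, y) of (x, y) \<Rightarrow> A x * B y)"
      using assms by simp
  qed measurable
qed

text \<open>Gaussian summability: a slowly decaying Gaussian factor in u justifies Fubini and turns
  the double integral into the mean of \<phi> against a narrow Gaussian at x0. Both sides converge
  by dominated convergence.\<close>

lemma fourier_inversion:
  fixes \<phi> :: "real \<Rightarrow> complex"
  assumes \<phi>: "integrable lborel \<phi>" "\<And>x. norm (\<phi> x) \<le> B" "isCont \<phi> x0"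
    and \<psi>: "\<And>u. \<psi> u = (\<integral>y. \<phi> y * exp (- (2 * of_real pi * \<i> * of_real u * of_real y)) \<partial>lborel)"
    and \<psi>i: "integrable lborel \<psi>"
  shows "(\<integral>u. \<psi> u * exp (2 * of_real pi * \<i> * of_real u * of_real x0) \<partial>lborel) = \<phi> x0"
proof -
  note [measurable] = borel_measurable_integrable[OF \<phi>(1)] borel_measurable_integrable[OF \<psi>i]
  define \<epsilon> where "\<epsilon> = (\<lambda>n::nat. 1 / (real n + 1))"
  have \<epsilon>0: "\<epsilon> n > 0" for n by (simp add: \<epsilon>_def)
  have \<epsilon>lim: "\<epsilon> \<longlonglongrightarrow> 0" unfolding \<epsilon>_def by real_asymp
  define I where "I = (\<lambda>n. \<integral>u. \<psi> u * exp (2 * of_real pi * \<i> * of_real u * of_real x0) * of_real (exp (- pi * (\<epsilon> n * u)\<^sup>2)) \<partial>lborel)"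
  have lim1: "I \<longlonglongrightarrow> (\<integral>u. \<psi> u * exp (2 * of_real pi * \<i> * of_real u * of_real x0) \<partial>lborel)"
    unfolding I_def
  proof (rule integral_dominated_convergence[where w = "\<lambda>u. norm (\<psi> u)"])
    show "AE u in lborel. (\<lambda>n. \<psi> u * exp (2 * of_real pi * \<i> * of_real u * of_real x0) * of_real (exp (- pi * (\<epsilon> n * u)\<^sup>2)))
        \<longlonglongrightarrow> \<psi> u * exp (2 * of_real pi * \<i> * of_real u * of_real x0)"
    proof (rule AE_I2)
      fix u :: real
      have "(\<lambda>n. exp (- pi * (\<epsilon> n * u)\<^sup>2)) \<longlonglongrightarrow> exp (- pi * (0 * u)\<^sup>2)"
        by (intro tendsto_intros \<epsilon>lim)
      then have "(\<lambda>n. complex_of_real (exp (- pi * (\<epsilon> n * u)\<^sup>2))) \<longlonglongrightarrow> of_real 1"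
        by (intro tendsto_of_real) simp
      from tendsto_mult[OF tendsto_const this]
      show "(\<lambda>n. \<psi> u * exp (2 * of_real pi * \<i> * of_real u * of_real x0) * of_real (exp (- pi * (\<epsilon> n * u)\<^sup>2)))
        \<longlonglongrightarrow> \<psi> u * exp (2 * of_real pi * \<i> * of_real u * of_real x0)" by simp
    qed
    show "AE u in lborel. norm (\<psi> u * exp (2 * of_real pi * \<i> * of_real u * of_real x0) * of_real (exp (- pi * (\<epsilon> n * u)\<^sup>2))) \<le> norm (\<psi> u)" for n
      by (rule AE_I2) (auto simp: norm_mult mult_left_le)
  qed (use \<psi>i in auto)
  have gi: "integrable lborel (\<lambda>u. exp (- pi * (e * u)\<^sup>2))" if "e > 0" for e :: real
    using gauss_integrable_real[of "e\<^sup>2" 0] that by (simp add: has_bochner_integral_iff power_mult_distrib mult.assoc)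
  have gauss: "(\<integral>u. exp (2 * of_real pi * \<i> * of_real u * of_real r) * of_real (exp (- pi * (e * u)\<^sup>2)) \<partial>lborel) = of_real (exp (- pi * (r / e)\<^sup>2) / e)"
    if e: "e > 0" for e r :: real
  proof -
    have "(\<integral>u. exp (2 * of_real pi * \<i> * of_real u * of_real r) * of_real (exp (- pi * (e * u)\<^sup>2)) \<partial>lborel)
      = (\<integral>u. exp (- of_real pi * of_real (e\<^sup>2) * of_real u ^ 2 + 2 * of_real pi * (\<i> * of_real r) * of_real u) \<partial>lborel)"
      by (intro Bochner_Integration.integral_cong refl)
         (simp add: exp_of_real[symmetric] exp_add[symmetric] power_mult_distrib algebra_simps)
    also have "\<dots> = exp (of_real pi * (\<i> * of_real r)\<^sup>2 / of_real (e\<^sup>2)) / csqrt (of_real (e\<^sup>2))"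
      by (rule gauss_integral) (use e in simp)
    also have "csqrt (of_real (e\<^sup>2)) = of_real e" using e by (subst csqrt_of_real_nonneg) auto
    also have "of_real pi * (\<i> * of_real r)\<^sup>2 / of_real (e\<^sup>2) = complex_of_real (- pi * (r / e)\<^sup>2)"
      by (simp add: power_mult_distrib power_divide)
    finally show ?thesis by (simp only: exp_of_real of_real_divide)
  qed
  have Ieq: "I n = (\<integral>v. \<phi> (x0 + \<epsilon> n * v) * of_real (exp (- pi * v\<^sup>2)) \<partial>lborel)" for n
  proof -
    define e where "e = \<epsilon> n"
    have e: "e > 0" using \<epsilon>0 by (simp add: e_def)
    define f where "f = (\<lambda>u y. \<phi> y * exp (- (2 * of_real pi * \<i> * of_real u * of_real y)) *
       (exp (2 * of_real pi * \<i> * of_real u * of_real x0) * of_real (exp (- pi * (e * u)\<^sup>2))))"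
    have fm: "(\<lambda>(u, y). f u y) \<in> borel_measurable (lborel \<Otimes>\<^sub>M lborel)" unfolding f_def by measurable
    have fi: "integrable (lborel \<Otimes>\<^sub>M lborel) (\<lambda>(u, y). f u y)"
      by (rule Bochner_Integration.integrable_bound[OF integrable_pair_mult[OF gi[OF e] integrable_norm[OF \<phi>(1)]] fm])
         (auto simp: f_def norm_mult)
    have inner: "(\<integral>y. f u y \<partial>lborel) = \<psi> u * (exp (2 * of_real pi * \<i> * of_real u * of_real x0) * of_real (exp (- pi * (e * u)\<^sup>2)))" for u
      unfolding f_def \<psi> by (rule integral_mult_left_zero)
    have "I n = (\<integral>u. (\<integral>y. f u y \<partial>lborel) \<partial>lborel)"
      unfolding I_def inner e_def by (simp only: mult.assoc)
    also have "\<dots> = (\<integral>y. (\<integral>u. f u y \<partial>lborel) \<partial>lborel)"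
      by (rule lborel_pair.Fubini_integral[symmetric]) (use fi in simp)
    also have "\<dots> = (\<integral>y. \<phi> y * of_real (exp (- pi * ((x0 - y) / e)\<^sup>2) / e) \<partial>lborel)"
    proof (intro Bochner_Integration.integral_cong refl)
      fix y
      have "(\<integral>u. f u y \<partial>lborel) = (\<integral>u. \<phi> y * (exp (2 * of_real pi * \<i> * of_real u * of_real (x0 - y)) * of_real (exp (- pi * (e * u)\<^sup>2))) \<partial>lborel)"
      proof (intro Bochner_Integration.integral_cong refl)
        fix u
        have "exp (- (2 * of_real pi * \<i> * of_real u * of_real y)) * exp (2 * of_real pi * \<i> * of_real u * of_real x0)
          = exp (2 * of_real pi * \<i> * of_real u * complex_of_real (x0 - y))"
          by (simp add: exp_add[symmetric] algebra_simps)
        then show "f u y = \<phi> y * (exp (2 * of_real pi * \<i> * of_real u * of_real (x0 - y)) * of_real (exp (- pi * (e * u)\<^sup>2)))"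
          unfolding f_def by (metis (no_types, lifting) mult.assoc)
      qed
      also have "\<dots> = \<phi> y * (\<integral>u. exp (2 * of_real pi * \<i> * of_real u * of_real (x0 - y)) * of_real (exp (- pi * (e * u)\<^sup>2)) \<partial>lborel)"
        by (rule integral_mult_right_zero)
      finally show "(\<integral>u. f u y \<partial>lborel) = \<phi> y * of_real (exp (- pi * ((x0 - y) / e)\<^sup>2) / e)"
        unfolding gauss[OF e] .
    qed
    also have "\<dots> = \<bar>e\<bar> *\<^sub>R (\<integral>v. \<phi> (x0 + e * v) * of_real (exp (- pi * ((x0 - (x0 + e * v)) / e)\<^sup>2) / e) \<partial>lborel)"
      by (rule lborel_integral_real_affine) (use e in simp)
    also have "\<dots> = (\<integral>v. \<phi> (x0 + e * v) * of_real (exp (- pi * v\<^sup>2)) \<partial>lborel)"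
      unfolding integral_scaleR_right[symmetric] using e
      by (intro Bochner_Integration.integral_cong refl) (simp add: scaleR_conv_of_real)
    finally show ?thesis by (simp add: e_def)
  qed
  have lim2: "I \<longlonglongrightarrow> (\<integral>v. \<phi> x0 * of_real (exp (- pi * v\<^sup>2)) \<partial>lborel)"
    unfolding Ieq
  proof (rule integral_dominated_convergence[where w = "\<lambda>v. B * exp (- pi * (1 * v)\<^sup>2)"])
    show "integrable lborel (\<lambda>v. B * exp (- pi * (1 * v)\<^sup>2))"
      by (intro integrable_mult_right gi) simp
    show "AE v in lborel. (\<lambda>n. \<phi> (x0 + \<epsilon> n * v) * of_real (exp (- pi * v\<^sup>2))) \<longlonglongrightarrow> \<phi> x0 * of_real (exp (- pi * v\<^sup>2))"
    proof (rule AE_I2)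
      fix v
      have "(\<lambda>n. x0 + \<epsilon> n * v) \<longlonglongrightarrow> x0 + 0 * v" by (intro tendsto_intros \<epsilon>lim)
      then have "(\<lambda>n. \<phi> (x0 + \<epsilon> n * v)) \<longlonglongrightarrow> \<phi> x0" using isCont_tendsto_compose[OF \<phi>(3)] by simp
      then show "(\<lambda>n. \<phi> (x0 + \<epsilon> n * v) * of_real (exp (- pi * v\<^sup>2))) \<longlonglongrightarrow> \<phi> x0 * of_real (exp (- pi * v\<^sup>2))"
        by (intro tendsto_mult tendsto_const)
    qed
    show "AE v in lborel. norm (\<phi> (x0 + \<epsilon> n * v) * of_real (exp (- pi * v\<^sup>2))) \<le> B * exp (- pi * (1 * v)\<^sup>2)" for n
      by (rule AE_I2) (auto simp: norm_mult \<phi>(2))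
  qed auto
  have "(\<integral>v. \<phi> x0 * of_real (exp (- pi * v\<^sup>2)) \<partial>lborel) = \<phi> x0 * of_real (\<integral>v. exp (- pi * v\<^sup>2) \<partial>lborel)"
    by simp
  also have "(\<integral>v. exp (- pi * v\<^sup>2) \<partial>lborel) = 1"
    using gauss_integrable_real[of 1 0] by (simp add: has_bochner_integral_iff)
  finally show ?thesis using LIMSEQ_unique[OF lim1 lim2] by simp
qed

lemma powr_of_real_mult_left:
  fixes z a :: complex
  assumes "r > 0" "z \<noteq> 0"
  shows "(of_real r * z) powr a = of_real r powr a * z powr a"
proof -
  have "Ln (of_real r * z) = of_real (ln r) + Ln z"
    using assms by (simp add: Ln_times_of_real Ln_of_real)
  then show ?thesis using assms by (simp add: powr_def Ln_of_real exp_add[symmetric] distrib_left)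
qed

lemma norm_powr_neg_real: "norm (z powr (- of_real s)) = norm z powr (- s)" for z :: complex
  using norm_powr_real_powr'[of "- of_real s" z] by simp

lemma powr_neg_le:
  fixes r a s :: real
  assumes "0 < a" "a \<le> r" "2 \<le> s"
  shows "r powr (- s) \<le> a powr (2 - s) / r\<^sup>2"
proof -
  have "r powr (- s) = r powr (2 - s) / r\<^sup>2"
    using assms by (simp add: powr_diff powr_minus field_simps powr_numeral)
  also have "\<dots> \<le> a powr (2 - s) / r\<^sup>2"
    using assms by (intro divide_right_mono powr_mono2') auto
  finally show ?thesis .
qed

lemma integrable_cauchy_density:
  assumes "a > 0"
  shows "integrable lborel (\<lambda>u. 1 / (a\<^sup>2 + u\<^sup>2) :: real)"
proof -
  have "set_integrable lborel UNIV (\<lambda>x. inverse (1 + x^2) :: real)"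
    using integrable_inverse_1_plus_square by simp
  then have 1: "integrable lborel (\<lambda>x. inverse (1 + x^2) :: real)" by (simp add: set_integrable_def)
  then have "integrable lborel (\<lambda>x. inverse (1 + (0 + (1 / a) * x)^2) :: real)"
    by (rule lborel_integrable_real_affine) (use assms in simp)
  then have "integrable lborel (\<lambda>x. 1 / a\<^sup>2 * inverse (1 + (0 + (1 / a) * x)^2) :: real)"
    by (rule integrable_mult_right)
  moreover have "1 / a\<^sup>2 * inverse (1 + (0 + (1 / a) * x)^2) = 1 / (a\<^sup>2 + x\<^sup>2)" for x
  proof -
    have "a\<^sup>2 + x\<^sup>2 > 0" using assms by (simp add: add_pos_nonneg)
    moreover have "1 + (0 + (1 / a) * x)^2 = (a\<^sup>2 + x\<^sup>2) / a\<^sup>2" using assms by (simp add: field_simps power2_eq_square)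
    ultimately show ?thesis using assms by simp
  qed
  ultimately show ?thesis by simp
qed

lemma powr_shift_bound:
  assumes "\<sigma> > 0" "s \<ge> 2"
  shows "norm ((of_real \<sigma> + \<i> * of_real u) powr (- of_real s)) \<le> \<sigma> powr (2 - s) * (1 / (\<sigma>\<^sup>2 + u\<^sup>2))"
proof -
  have n: "(norm (of_real \<sigma> + \<i> * of_real u))\<^sup>2 = \<sigma>\<^sup>2 + u\<^sup>2" by (simp add: cmod_power2)
  have "\<sigma> \<le> norm (of_real \<sigma> + \<i> * of_real u)"
    using complex_Re_le_cmod[of "of_real \<sigma> + \<i> * of_real u"] by simp
  then have "norm (of_real \<sigma> + \<i> * of_real u) powr (- s)
      \<le> \<sigma> powr (2 - s) / (norm (of_real \<sigma> + \<i> * of_real u))\<^sup>2"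
    by (rule powr_neg_le[OF assms(1) _ assms(2)])
  then show ?thesis unfolding norm_powr_neg_real n by simp
qed

lemma integrable_powr_shift:
  assumes "\<sigma> > 0" "s \<ge> 2"
  shows "integrable lborel (\<lambda>u. (of_real \<sigma> + \<i> * of_real u) powr (- of_real s))"
    and "(\<lambda>u. (of_real \<sigma> + \<i> * of_real u) powr (- complex_of_real s)) \<in> borel_measurable borel"
proof -
  show m: "(\<lambda>u. (of_real \<sigma> + \<i> * of_real u) powr (- complex_of_real s)) \<in> borel_measurable borel"
    using assms by (intro borel_measurable_continuous_onI continuous_intros)
      (auto simp: complex_nonpos_Reals_iff complex_eq_iff)
  have "integrable lborel (\<lambda>u. \<sigma> powr (2 - s) * (1 / (\<sigma>\<^sup>2 + u\<^sup>2)))"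
    by (intro integrable_mult_right integrable_cauchy_density assms)
  then show "integrable lborel (\<lambda>u. (of_real \<sigma> + \<i> * of_real u) powr (- of_real s))"
  proof (rule Bochner_Integration.integrable_bound)
    show "AE u in lborel. norm ((of_real \<sigma> + \<i> * of_real u) powr (- complex_of_real s)) \<le> norm (\<sigma> powr (2 - s) * (1 / (\<sigma>\<^sup>2 + u\<^sup>2)))"
    proof (rule AE_I2)
      fix u
      show "norm ((of_real \<sigma> + \<i> * of_real u) powr (- complex_of_real s)) \<le> norm (\<sigma> powr (2 - s) * (1 / (\<sigma>\<^sup>2 + u\<^sup>2)))"
        unfolding real_norm_def by (rule order_trans[OF powr_shift_bound[OF assms] abs_ge_self])
    qed
  qed (simp add: m)
qed

text \<open>The constant of Hankel's inversion integral for a power, with the exponential normalised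
  as exp(2 pi \<i> u E).\<close>

definition hankel_const :: "real \<Rightarrow> real" where
  "hankel_const s = (2 * pi) powr s / Gamma s"

text \<open>By the gamma integral, (\<sigma> + \<i> u)^(-s) is a multiple of the Fourier transform
  of E^(s-1) exp(-2 pi \<sigma> E) on the positive half-line; s \<ge> 2 gives the integrability and
  continuity needed to invert.\<close>

lemma fourier_powr_shift:
  assumes \<sigma>: "\<sigma> > 0" and s: "s \<ge> 2"
  shows "(\<integral>u. (of_real \<sigma> + \<i> * of_real u) powr (- of_real s) * exp (2 * of_real pi * \<i> * of_real u * of_real E) \<partial>lborel)
    = of_real (hankel_const s * (indicator {0<..} E * E powr (s - 1) * exp (- (2 * pi * \<sigma> * E))))"
proof -
  define c where "c = 2 * pi * \<sigma>"
  have c: "c > 0" using \<sigma> by (simp add: c_def)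
  \<comment> \<open>Writing the cutoff with \<open>max\<close> exhibits continuity at 0, which
    inversion at an arbitrary \<open>E\<close> requires.\<close>
  define f where "f = (\<lambda>y. max y 0 powr (s - 1) * exp (- (c * y)))"
  have f_ind: "f y = indicator {0<..} y * (y powr (s - 1) * exp (- (c * y)))" for y
    by (auto simp: f_def indicator_def max_def)
  define \<phi> where "\<phi> = (\<lambda>y. complex_of_real (f y))"
  have "integrable lborel f"
    using gamma_integrable_real[of s c] s c by (simp add: f_ind[abs_def] has_bochner_integral_iff)
  then have \<phi>i: "integrable lborel \<phi>" by (simp add: \<phi>_def)
  have \<phi>b: "norm (\<phi> y) \<le> (s - 1) powr (s - 1) * c powr (- (s - 1))" for y
  proof (cases "y > 0")
    case True
    have "exp (- (c * y)) \<le> (s - 1) powr (s - 1) * (c * y) powr (- (s - 1))"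
      by (rule exp_mult_powr_bounded) (use s c True in auto)
    then have "y powr (s - 1) * exp (- (c * y)) \<le> y powr (s - 1) * ((s - 1) powr (s - 1) * (c * y) powr (- (s - 1)))"
      by (intro mult_left_mono) auto
    also have "\<dots> = (s - 1) powr (s - 1) * c powr (- (s - 1)) * (y powr (s - 1) * y powr (- (s - 1)))"
      using c True by (simp add: powr_mult mult_ac)
    also have "y powr (s - 1) * y powr (- (s - 1)) = 1" using True by (simp add: powr_add[symmetric])
    finally show ?thesis using True by (simp add: \<phi>_def f_def max_def norm_mult)
  qed (simp add: \<phi>_def f_ind)
  have "continuous_on UNIV f"
    unfolding f_def using s by (intro continuous_intros continuous_on_powr') auto
  then have \<phi>c: "isCont \<phi> E" by (auto simp: \<phi>_def continuous_on_eq_continuous_at intro!: isCont_of_real)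
  define \<psi> where "\<psi> = (\<lambda>u. of_real (Gamma s * (2 * pi) powr (- s)) * (of_real \<sigma> + \<i> * of_real u) powr (- complex_of_real s))"
  have \<psi>: "\<psi> u = (\<integral>y. \<phi> y * exp (- (2 * of_real pi * \<i> * of_real u * of_real y)) \<partial>lborel)" for u
  proof -
    have "(\<integral>y. \<phi> y * exp (- (2 * of_real pi * \<i> * of_real u * of_real y)) \<partial>lborel)
      = (\<integral>y. of_real (indicator {0<..} y * y powr (s - 1)) * exp (- (of_real (2 * pi) * (of_real \<sigma> + \<i> * of_real u) * of_real y)) \<partial>lborel)"
    proof (intro Bochner_Integration.integral_cong refl)
      fix y :: real
      have "exp (- (of_real (2 * pi) * (of_real \<sigma> + \<i> * of_real u) * of_real y))
        = of_real (exp (- (c * y))) * exp (- (2 * of_real pi * \<i> * of_real u * of_real y))"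
        by (simp add: c_def exp_of_real[symmetric] exp_add[symmetric] algebra_simps)
      then show "\<phi> y * exp (- (2 * of_real pi * \<i> * of_real u * of_real y))
        = of_real (indicator {0<..} y * y powr (s - 1)) * exp (- (of_real (2 * pi) * (of_real \<sigma> + \<i> * of_real u) * of_real y))"
        by (simp add: \<phi>_def f_ind)
    qed
    also have "\<dots> = of_real (Gamma s) * (of_real (2 * pi) * (of_real \<sigma> + \<i> * of_real u)) powr (- of_real s)"
      by (rule gamma_integral_complex(2)) (use s \<sigma> in auto)
    also have "(of_real (2 * pi) * (of_real \<sigma> + \<i> * of_real u)) powr (- complex_of_real s)
       = of_real (2 * pi) powr (- of_real s) * (of_real \<sigma> + \<i> * of_real u) powr (- complex_of_real s)"
      by (rule powr_of_real_mult_left) (use \<sigma> in \<open>auto simp: complex_eq_iff\<close>)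
    also have "of_real (2 * pi) powr (- complex_of_real s) = of_real ((2 * pi) powr (- s))"
      using powr_of_real[of "2 * pi" "- s"] by simp
    finally show ?thesis by (simp add: \<psi>_def mult.assoc)
  qed
  have \<psi>i: "integrable lborel \<psi>"
    unfolding \<psi>_def by (intro integrable_mult_right integrable_powr_shift \<sigma> s)
  have "(\<integral>u. \<psi> u * exp (2 * of_real pi * \<i> * of_real u * of_real E) \<partial>lborel) = \<phi> E"
    by (rule fourier_inversion[OF \<phi>i \<phi>b \<phi>c \<psi> \<psi>i])
  moreover have "(\<integral>u. \<psi> u * exp (2 * of_real pi * \<i> * of_real u * of_real E) \<partial>lborel)
     = of_real (Gamma s * (2 * pi) powr (- s)) * (\<integral>u. (of_real \<sigma> + \<i> * of_real u) powr (- of_real s) * exp (2 * of_real pi * \<i> * of_real u * of_real E) \<partial>lborel)"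
    unfolding \<psi>_def mult.assoc by (rule integral_mult_right_zero)
  ultimately have "of_real (Gamma s * (2 * pi) powr (- s)) * (\<integral>u. (of_real \<sigma> + \<i> * of_real u) powr (- of_real s) * exp (2 * of_real pi * \<i> * of_real u * of_real E) \<partial>lborel) = \<phi> E"
    by simp
  moreover have "hankel_const s * (Gamma s * (2 * pi) powr (- s)) = 1"
  proof -
    have "Gamma s > 0" using s by (intro Gamma_real_pos) simp
    then have "Gamma s \<noteq> 0" by simp
    then show ?thesis by (simp add: hankel_const_def powr_minus field_simps)
  qed
  ultimately have "(\<integral>u. (of_real \<sigma> + \<i> * of_real u) powr (- of_real s) * exp (2 * of_real pi * \<i> * of_real u * of_real E) \<partial>lborel) = of_real (hankel_const s) * \<phi> E"
    by (metis (no_types, lifting) mult.assoc mult_1 of_real_1 of_real_mult)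
  then show ?thesis by (simp add: \<phi>_def f_ind c_def mult.assoc)
qed

text \<open>The transform of a one-sided exponential, supported on the side where it decays. The
  function 1/(u + \<i> \<delta>) is itself not integrable, so it is represented as a transform
  instead of being inverted.\<close>

lemma cauchy_kernel_fourier:
  fixes \<delta> u :: real
  assumes "\<delta> \<noteq> 0"
  defines "wt \<equiv> (\<lambda>x. (if \<delta> < 0 then indicator {0<..} x else - indicator {..<0} x) * exp (2 * pi * \<delta> * x) :: real)"
  shows "integrable lborel wt"
    and "1 / (of_real u + \<i> * of_real \<delta>) = 2 * of_real pi * \<i> * (\<integral>x. of_real (wt x) * exp (- (2 * of_real pi * \<i> * of_real u * of_real x)) \<partial>lborel)"
proof -
  have nz: "of_real u + \<i> * of_real \<delta> \<noteq> 0" using assms(1) by (auto simp: complex_eq_iff)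
  have canc: "1 / q = 2 * of_real pi * \<i> * (1 / (2 * of_real pi * \<i> * q))" if "q \<noteq> 0" for q :: complex
    using that by simp
  have pos: "has_bochner_integral lborel (\<lambda>x. indicator {0<..} x * exp (- (c * x))) (Gamma 1 * c powr (- 1))" if "c > 0" for c :: real
  proof -
    have "indicator {0<..} x * (x powr (1 - 1) * exp (- (c * x))) = indicator {0<..} x * exp (- (c * x))" for x :: real
      by (auto simp: indicator_def)
    moreover have "has_bochner_integral lborel (\<lambda>x. indicator {0<..} x * (x powr (1 - 1) * exp (- (c * x)))) (Gamma 1 * c powr (- 1))"
      by (rule gamma_integrable_real) (use that in auto)
    ultimately show ?thesis by (simp only:)
  qed
  have posc: "(\<integral>x. of_real (indicator {0<..} x) * exp (- (c * of_real x)) \<partial>lborel) = 1 / c" if "Re c > 0" for c :: complex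
  proof -
    have a: "indicator {0<..} x * x powr (1 - 1) = (indicator {0<..} x :: real)" for x :: real by (auto simp: indicator_def)
    have b: "c powr (- of_real 1) = 1 / c" using that by (auto simp: powr_def exp_minus divide_inverse)
    have "(\<integral>x. of_real (indicator {0<..} x * x powr (1 - 1)) * exp (- (c * of_real x)) \<partial>lborel) = of_real (Gamma 1) * c powr (- of_real 1)"
      by (rule gamma_integral_complex(2)) (use that in auto)
    then have "(\<integral>x. of_real (indicator {0<..} x) * exp (- (c * of_real x)) \<partial>lborel) = of_real (Gamma 1) * (1 / c)"
      by (simp only: a b)
    then show ?thesis by simp
  qed
  show "integrable lborel wt"
  proof (cases "\<delta> < 0")
    case True
    then show ?thesis using pos[of "- (2 * pi * \<delta>)"] by (simp add: wt_def has_bochner_integral_iff mult_pos_neg)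
  next
    case False
    then have d: "2 * pi * \<delta> > 0" using assms by simp
    have "integrable lborel (\<lambda>x. indicator {0<..} (0 + (-1) * x) * exp (- (2 * pi * \<delta> * (0 + (-1) * x))))"
      by (rule lborel_integrable_real_affine) (use pos[OF d] in \<open>auto simp: has_bochner_integral_iff\<close>)
    then have "integrable lborel (\<lambda>x. - (indicator {0<..} (0 + (-1) * x) * exp (- (2 * pi * \<delta> * (0 + (-1) * x)))))"
      by (rule integrable_minus)
    moreover have "- (indicator {0<..} (0 + (-1) * x) * exp (- (2 * pi * \<delta> * (0 + (-1) * x)))) = wt x" for x
      using False by (auto simp: wt_def indicator_def)
    ultimately show ?thesis by (simp only:)
  qed
  show "1 / (of_real u + \<i> * of_real \<delta>) = 2 * of_real pi * \<i> * (\<integral>x. of_real (wt x) * exp (- (2 * of_real pi * \<i> * of_real u * of_real x)) \<partial>lborel)"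
  proof (cases "\<delta> < 0")
    case True
    define c where "c = 2 * of_real pi * \<i> * (of_real u + \<i> * of_real \<delta>)"
    have "(\<integral>x. of_real (wt x) * exp (- (2 * of_real pi * \<i> * of_real u * of_real x)) \<partial>lborel)
       = (\<integral>x. of_real (indicator {0<..} x) * exp (- (c * of_real x)) \<partial>lborel)"
      by (intro Bochner_Integration.integral_cong refl)
         (use True in \<open>auto simp: wt_def c_def indicator_def exp_of_real[symmetric] exp_add[symmetric] algebra_simps\<close>)
    also have "\<dots> = 1 / c" by (rule posc) (use True in \<open>simp add: c_def mult_pos_neg\<close>)
    finally show ?thesis unfolding c_def using canc[OF nz] by simp
  next
    case False
    then have d: "\<delta> > 0" using assms by simp
    define c where "c = - (2 * of_real pi * \<i> * (of_real u + \<i> * of_real \<delta>))"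
    have "(\<integral>x. of_real (wt x) * exp (- (2 * of_real pi * \<i> * of_real u * of_real x)) \<partial>lborel)
       = \<bar>-1\<bar> *\<^sub>R (\<integral>x. of_real (wt (0 + (-1) * x)) * exp (- (2 * of_real pi * \<i> * of_real u * of_real (0 + (-1) * x))) \<partial>lborel)"
      by (rule lborel_integral_real_affine) simp
    also have "\<dots> = (\<integral>x. - (of_real (indicator {0<..} x) * exp (- (c * of_real x))) \<partial>lborel)"
      using d by (auto simp: wt_def c_def indicator_def exp_of_real[symmetric] exp_add[symmetric] algebra_simps
          intro!: Bochner_Integration.integral_cong)
    also have "\<dots> = - (1 / c)" using posc[of c] d by (simp add: c_def)
    finally show ?thesis unfolding c_def using canc[OF nz] by simp
  qed
qed

text \<open>Inserting the representation of the Cauchy factor and exchanging integrals leaves the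
  inverse transform of the power at D - x, hence a convolution. After x \<mapsto> D - x it is a
  gamma integral cut at D, on the side decided by the sign of \<delta>.\<close>

lemma cauchy_powr_fourier:
  fixes \<delta> \<sigma> s D :: real
  assumes \<delta>: "\<delta> \<noteq> 0" and \<sigma>: "\<sigma> > 0" and s: "s \<ge> 2"
  shows "(\<integral>u. exp (2 * of_real pi * \<i> * of_real u * of_real D) * (1 / (of_real u + \<i> * of_real \<delta>) * (of_real \<sigma> + \<i> * of_real u) powr (- of_real s)) \<partial>lborel)
    = 2 * of_real pi * \<i> * of_real (hankel_const s * exp (2 * pi * \<delta> * D) *
       (\<integral>x. (if \<delta> < 0 then indicator {0<..<D} x else - indicator {0<..} x * indicator {D<..} x) * (x powr (s - 1) * exp (- (2 * pi * (\<sigma> + \<delta>) * x))) \<partial>lborel))"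
proof -
  define wt where "wt = (\<lambda>x. (if \<delta> < 0 then indicator {0<..} x else - indicator {..<0} x) * exp (2 * pi * \<delta> * x) :: real)"
  have W: "integrable lborel wt"
    using cauchy_kernel_fourier(1)[OF \<delta>] by (simp only: wt_def)
  have W2: "1 / (of_real u + \<i> * of_real \<delta>) = 2 * of_real pi * \<i> * (\<integral>x. of_real (wt x) * exp (- (2 * of_real pi * \<i> * of_real u * of_real x)) \<partial>lborel)" for u
    using cauchy_kernel_fourier(2)[OF \<delta>, of u] by (simp only: wt_def)
  define g where "g = (\<lambda>u. (of_real \<sigma> + \<i> * of_real u) powr (- complex_of_real s))"
  note G = integrable_powr_shift[OF \<sigma> s, folded g_def]
  note [measurable] = borel_measurable_integrable[OF W] G(2)
  define f where "f = (\<lambda>u x. of_real (wt x) * (g u * exp (2 * of_real pi * \<i> * of_real u * of_real (D - x))))"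
  have fm: "(\<lambda>(u, x). f u x) \<in> borel_measurable (lborel \<Otimes>\<^sub>M lborel)" unfolding f_def by measurable
  have fi: "integrable (lborel \<Otimes>\<^sub>M lborel) (\<lambda>(u, x). f u x)"
    by (rule Bochner_Integration.integrable_bound[OF integrable_pair_mult[OF integrable_norm[OF G(1)] integrable_norm[OF W]] fm])
       (auto simp: f_def norm_mult)
  have "(\<integral>u. exp (2 * of_real pi * \<i> * of_real u * of_real D) * (1 / (of_real u + \<i> * of_real \<delta>) * g u) \<partial>lborel)
    = (\<integral>u. 2 * of_real pi * \<i> * (\<integral>x. f u x \<partial>lborel) \<partial>lborel)"
  proof (intro Bochner_Integration.integral_cong refl)
    fix u :: real
    have "(\<integral>x. f u x \<partial>lborel) = (\<integral>x. (g u * exp (2 * of_real pi * \<i> * of_real u * of_real D)) * (of_real (wt x) * exp (- (2 * of_real pi * \<i> * of_real u * of_real x))) \<partial>lborel)"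
    proof (intro Bochner_Integration.integral_cong refl)
      fix x
      have "exp (2 * of_real pi * \<i> * of_real u * complex_of_real (D - x)) = exp (2 * of_real pi * \<i> * of_real u * of_real D) * exp (- (2 * of_real pi * \<i> * of_real u * of_real x))"
        by (simp add: exp_add[symmetric] algebra_simps)
      then show "f u x = (g u * exp (2 * of_real pi * \<i> * of_real u * of_real D)) * (of_real (wt x) * exp (- (2 * of_real pi * \<i> * of_real u * of_real x)))"
        unfolding f_def by (simp only: mult_ac)
    qed
    also have "\<dots> = (g u * exp (2 * of_real pi * \<i> * of_real u * of_real D)) * (\<integral>x. of_real (wt x) * exp (- (2 * of_real pi * \<i> * of_real u * of_real x)) \<partial>lborel)"
      by (rule integral_mult_right_zero)
    finally show "exp (2 * of_real pi * \<i> * of_real u * of_real D) * (1 / (of_real u + \<i> * of_real \<delta>) * g u) = 2 * of_real pi * \<i> * (\<integral>x. f u x \<partial>lborel)"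
      unfolding W2[of u] by (simp only: mult_ac)
  qed
  also have "\<dots> = 2 * of_real pi * \<i> * (\<integral>u. (\<integral>x. f u x \<partial>lborel) \<partial>lborel)"
    by (rule integral_mult_right_zero)
  also have "(\<integral>u. (\<integral>x. f u x \<partial>lborel) \<partial>lborel) = (\<integral>x. (\<integral>u. f u x \<partial>lborel) \<partial>lborel)"
    by (rule lborel_pair.Fubini_integral[symmetric]) (use fi in simp)
  also have "\<dots> = (\<integral>x. of_real (wt x * (hankel_const s * (indicator {0<..} (D - x) * (D - x) powr (s - 1) * exp (- (2 * pi * \<sigma> * (D - x)))))) \<partial>lborel)"
  proof (intro Bochner_Integration.integral_cong refl)
    fix x
    have "(\<integral>u. f u x \<partial>lborel) = of_real (wt x) * (\<integral>u. g u * exp (2 * of_real pi * \<i> * of_real u * of_real (D - x)) \<partial>lborel)"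
      unfolding f_def by (rule integral_mult_right_zero)
    then show "(\<integral>u. f u x \<partial>lborel) = of_real (wt x * (hankel_const s * (indicator {0<..} (D - x) * (D - x) powr (s - 1) * exp (- (2 * pi * \<sigma> * (D - x))))))"
      unfolding g_def fourier_powr_shift[OF \<sigma> s] by (simp only: of_real_mult)
  qed
  also have "\<dots> = of_real (\<integral>x. wt x * (hankel_const s * (indicator {0<..} (D - x) * (D - x) powr (s - 1) * exp (- (2 * pi * \<sigma> * (D - x))))) \<partial>lborel)"
    by (rule integral_complex_of_real)
  also have "(\<integral>x. wt x * (hankel_const s * (indicator {0<..} (D - x) * (D - x) powr (s - 1) * exp (- (2 * pi * \<sigma> * (D - x))))) \<partial>lborel)
     = \<bar>-1\<bar> *\<^sub>R (\<integral>x. wt (D + (-1) * x) * (hankel_const s * (indicator {0<..} (D - (D + (-1) * x)) * (D - (D + (-1) * x)) powr (s - 1) * exp (- (2 * pi * \<sigma> * (D - (D + (-1) * x)))))) \<partial>lborel)"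
    by (rule lborel_integral_real_affine) simp
  also have "\<dots> = (\<integral>x. (hankel_const s * exp (2 * pi * \<delta> * D)) *
       ((if \<delta> < 0 then indicator {0<..<D} x else - indicator {0<..} x * indicator {D<..} x) * (x powr (s - 1) * exp (- (2 * pi * (\<sigma> + \<delta>) * x)))) \<partial>lborel)"
  proof -
    have e: "exp (2 * pi * \<delta> * (D - x)) * exp (- (2 * pi * \<sigma> * x)) = exp (2 * pi * \<delta> * D) * exp (- (2 * pi * (\<sigma> + \<delta>) * x))" for x
      by (simp add: exp_add[symmetric] algebra_simps)
    have "wt (D + (-1) * x) * (hankel_const s * (indicator {0<..} (D - (D + (-1) * x)) * (D - (D + (-1) * x)) powr (s - 1) * exp (- (2 * pi * \<sigma> * (D - (D + (-1) * x))))))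
     = (hankel_const s * exp (2 * pi * \<delta> * D)) *
       ((if \<delta> < 0 then indicator {0<..<D} x else - indicator {0<..} x * indicator {D<..} x) * (x powr (s - 1) * exp (- (2 * pi * (\<sigma> + \<delta>) * x))))" for x
      using e[of x] by (auto simp: wt_def indicator_def mult_ac)
    then show ?thesis by (simp only: abs_minus abs_one scaleR_one)
  qed
  also have "\<dots> = hankel_const s * exp (2 * pi * \<delta> * D) *
       (\<integral>x. (if \<delta> < 0 then indicator {0<..<D} x else - indicator {0<..} x * indicator {D<..} x) * (x powr (s - 1) * exp (- (2 * pi * (\<sigma> + \<delta>) * x))) \<partial>lborel)"
    by (rule integral_mult_right_zero)
  finally show ?thesis unfolding g_def .
qed

text \<open>The factor 1/(w - z) supplies the pole; the second factor supplies decay and the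
  remaining weight. It is holomorphic in z too, its base lies in the right half-plane, so the
  principal power has no branch problem, and on the diagonal w = z it equals (2 Im z)^(-s).\<close>

definition hker :: "real \<Rightarrow> complex \<Rightarrow> complex \<Rightarrow> complex" where
  "hker s z w = 1 / (w - z) * (\<i> * (cnj w - z)) powr (- of_real s)"

section \<open>Integration of the kernel along horizontal lines\<close>

lemma gamma_integrable_mono:
  assumes "s > 0" "c > 0" "S \<in> sets borel" "S \<subseteq> {0<..}"
  shows "integrable lborel (\<lambda>x. indicator S x * (x powr (s - 1) * exp (- (c * x))) :: real)"
proof (rule Bochner_Integration.integrable_bound)
  show "integrable lborel (\<lambda>x. indicator {0<..} x * (x powr (s - 1) * exp (- (c * x))) :: real)"
    using gamma_integrable_real[OF assms(1,2)] by (simp add: has_bochner_integral_iff)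
  show "AE x in lborel. norm (indicator S x * (x powr (s - 1) * exp (- (c * x)))) \<le> norm (indicator {0<..} x * (x powr (s - 1) * exp (- (c * x))))"
    using assms(4) by (intro AE_I2) (auto simp: indicator_def)
qed (use assms(3) in measurable)

text \<open>Here \<sigma> + \<delta> = 2 \<eta>. Minus the gamma integral beyond D is the integral
  over (0, D) minus the complete one, so both sides of the line \<eta> = Im z share one formula up
  to a complete gamma term above it. The common part leads to the incomplete beta function, the jump
  to the incomplete gamma function.\<close>

lemma hker_inner_integral:
  fixes z :: complex and D \<eta> s :: real
  assumes z: "Im z > 0" and \<eta>: "\<eta> > 0" "\<eta> \<noteq> Im z" and s: "s \<ge> 2"
  shows "(\<integral>u. exp (2 * of_real pi * \<i> * of_real D * Complex u \<eta>) * hker s z (Complex u \<eta>) \<partial>lborel)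
    = 2 * of_real pi * \<i> * of_real (hankel_const s) * exp (2 * of_real pi * \<i> * of_real D * z) *
      of_real ((\<integral>x. indicator {0<..<D} x * (x powr (s - 1) * exp (- (4 * pi * \<eta> * x))) \<partial>lborel)
        - (if Im z < \<eta> then Gamma s * (4 * pi * \<eta>) powr (- s) else 0))"
proof -
  define \<delta> \<sigma> where "\<delta> = \<eta> - Im z" and "\<sigma> = \<eta> + Im z"
  have \<delta>: "\<delta> \<noteq> 0" and \<sigma>: "\<sigma> > 0" using assms by (auto simp: \<delta>_def \<sigma>_def)
  have sd: "2 * pi * (\<sigma> + \<delta>) * x = 4 * pi * \<eta> * x" for x by (simp add: \<sigma>_def \<delta>_def)
  define h where "h = (\<lambda>x. x powr (s - 1) * exp (- (4 * pi * \<eta> * x)))"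
  define E where "E = exp (2 * of_real pi * \<i> * of_real D * of_real (Re z)) * complex_of_real (exp (- (2 * pi * D * \<eta>)))"
  have "(\<integral>u. exp (2 * of_real pi * \<i> * of_real D * Complex u \<eta>) * hker s z (Complex u \<eta>) \<partial>lborel)
    = \<bar>1\<bar> *\<^sub>R (\<integral>u. exp (2 * of_real pi * \<i> * of_real D * Complex (Re z + 1 * u) \<eta>) * hker s z (Complex (Re z + 1 * u) \<eta>) \<partial>lborel)"
    by (rule lborel_integral_real_affine) simp
  also have "\<dots> = (\<integral>u. E * (exp (2 * of_real pi * \<i> * of_real u * of_real D) * (1 / (of_real u + \<i> * of_real \<delta>) * (of_real \<sigma> + \<i> * of_real u) powr (- of_real s))) \<partial>lborel)"
  proof -
    have a: "Complex (Re z + 1 * u) \<eta> - z = of_real u + \<i> * of_real \<delta>" for u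
      by (simp add: complex_eq_iff \<delta>_def)
    have b: "\<i> * (cnj (Complex (Re z + 1 * u) \<eta>) - z) = of_real \<sigma> + \<i> * of_real u" for u
      by (simp add: complex_eq_iff \<sigma>_def)
    have c: "exp (2 * of_real pi * \<i> * of_real D * Complex (Re z + 1 * u) \<eta>) = E * exp (2 * of_real pi * \<i> * of_real u * of_real D)" for u
    proof -
      have "Complex (Re z + 1 * u) \<eta> = of_real (Re z) + of_real u + \<i> * of_real \<eta>" by (simp add: complex_eq_iff)
      then show ?thesis by (simp add: E_def exp_of_real[symmetric] exp_add[symmetric] algebra_simps)
    qed
    show ?thesis unfolding hker_def a b c by (simp add: mult.assoc)
  qed
  also have "\<dots> = E * (\<integral>u. exp (2 * of_real pi * \<i> * of_real u * of_real D) * (1 / (of_real u + \<i> * of_real \<delta>) * (of_real \<sigma> + \<i> * of_real u) powr (- of_real s)) \<partial>lborel)"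
    by (rule integral_mult_right_zero)
  also have "\<dots> = E * (2 * of_real pi * \<i> * of_real (hankel_const s * exp (2 * pi * \<delta> * D) *
       (\<integral>x. (if \<delta> < 0 then indicator {0<..<D} x else - indicator {0<..} x * indicator {D<..} x) * h x \<partial>lborel)))"
    unfolding cauchy_powr_fourier[OF \<delta> \<sigma> s] sd h_def ..
  also have "(\<integral>x. (if \<delta> < 0 then indicator {0<..<D} x else - indicator {0<..} x * indicator {D<..} x) * h x \<partial>lborel)
     = (\<integral>x. indicator {0<..<D} x * h x \<partial>lborel) - (if Im z < \<eta> then Gamma s * (4 * pi * \<eta>) powr (- s) else 0)"
  proof (cases "\<delta> < 0")
    case True
    then show ?thesis by (simp add: \<delta>_def)
  next
    case False
    have c: "4 * pi * \<eta> > 0" using \<eta> by simp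
    have i1: "integrable lborel (\<lambda>x. indicator {0<..} x * h x)" and v1: "(\<integral>x. indicator {0<..} x * h x \<partial>lborel) = Gamma s * (4 * pi * \<eta>) powr (- s)"
      using gamma_integrable_real[OF _ c, of s] s by (simp_all add: h_def has_bochner_integral_iff)
    have i2: "integrable lborel (\<lambda>x. indicator {0<..<D} x * h x)"
      unfolding h_def by (rule gamma_integrable_mono[OF _ c]) (use s in auto)
    have "(\<integral>x. (- indicator {0<..} x * indicator {D<..} x) * h x \<partial>lborel)
       = (\<integral>x. indicator {0<..<D} x * h x - indicator {0<..} x * h x \<partial>lborel)"
    proof (rule integral_cong_AE)
      show "AE x in lborel. (- indicator {0<..} x * indicator {D<..} x) * h x = indicator {0<..<D} x * h x - indicator {0<..} x * h x"
        using AE_lborel_singleton[of D] by eventually_elim (auto simp: indicator_def)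
    qed (auto simp: h_def)
    also have "\<dots> = (\<integral>x. indicator {0<..<D} x * h x \<partial>lborel) - Gamma s * (4 * pi * \<eta>) powr (- s)"
      using i1 i2 v1 by simp
    finally show ?thesis using False \<eta>(2) by (simp add: \<delta>_def)
  qed
  also have "E * (2 * of_real pi * \<i> * of_real (hankel_const s * exp (2 * pi * \<delta> * D) * R))
     = 2 * of_real pi * \<i> * of_real (hankel_const s) * exp (2 * of_real pi * \<i> * of_real D * z) * of_real R" for R
  proof -
    have "E * of_real (exp (2 * pi * \<delta> * D)) = exp (2 * of_real pi * \<i> * of_real D * z)"
    proof -
      have "z = of_real (Re z) + \<i> * of_real (Im z)" by (rule complex_eq)
      then have "2 * of_real pi * \<i> * of_real D * z = 2 * of_real pi * \<i> * of_real D * of_real (Re z) + of_real (- (2 * pi * D * \<eta>)) + of_real (2 * pi * \<delta> * D)"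
        by (simp add: complex_eq_iff \<delta>_def algebra_simps)
      then show ?thesis by (simp only: E_def exp_add exp_of_real)
    qed
    then show ?thesis by (simp add: mult_ac)
  qed
  finally show ?thesis by (simp only: h_def)
qed

section \<open>Incomplete gamma and beta functions as radial integrals\<close>

lemma upper_incomplete_gamma_half:
  assumes "c > 0" "v > 0"
  shows "integrable lborel (\<lambda>x. indicator {v<..} x * (x powr (- 1 / 2) * exp (- (c * x))) :: real)"
    and "upper_incomplete_gamma (1 / 2) (c * v) = sqrt c * (\<integral>x. indicator {v<..} x * (x powr (- 1 / 2) * exp (- (c * x))) \<partial>lborel)"
proof -
  have i: "integrable lborel (\<lambda>x. indicator {a<..} x * (x powr (1 / 2 - 1) * exp (- (b * x))) :: real)" if "a > 0" "b > 0" for a b :: real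
    by (rule gamma_integrable_mono) (use that in auto)
  show "integrable lborel (\<lambda>x. indicator {v<..} x * (x powr (- 1 / 2) * exp (- (c * x))) :: real)"
    using i[OF assms(2,1)] by simp
  define w where "w = c * v"
  have w: "w > 0" using assms by (simp add: w_def)
  have ae: "AE x in lborel. indicator {w<..} x * (x powr (1 / 2 - 1) * exp (- (1 * x))) = indicator {w..} x *\<^sub>R (x powr (1 / 2 - 1) * exp (- x) :: real)"
    using AE_lborel_singleton[of w] by eventually_elim (auto simp: indicator_def)
  have "set_integrable lborel {w..} (\<lambda>x. x powr (1 / 2 - 1) * exp (- x) :: real)"
    unfolding set_integrable_def using i[OF w, of 1] by (subst integrable_cong_AE[OF _ _ ae, symmetric]) auto
  then have "(LINT x:{w..}|lborel. x powr (1 / 2 - 1) * exp (- x)) = upper_incomplete_gamma (1 / 2) w"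
    unfolding upper_incomplete_gamma_def by (rule set_borel_integral_eq_integral)
  then have "upper_incomplete_gamma (1 / 2) w = (\<integral>x. indicator {w..} x *\<^sub>R (x powr (1 / 2 - 1) * exp (- x)) \<partial>lborel)"
    by (simp add: set_lebesgue_integral_def)
  also have "\<dots> = (\<integral>x. indicator {w<..} x * (x powr (1 / 2 - 1) * exp (- (1 * x))) \<partial>lborel)"
    by (rule integral_cong_AE[symmetric]) (use ae in auto)
  also have "\<dots> = \<bar>c\<bar> *\<^sub>R (\<integral>x. indicator {w<..} (0 + c * x) * ((0 + c * x) powr (1 / 2 - 1) * exp (- (1 * (0 + c * x)))) \<partial>lborel)"
    by (rule lborel_integral_real_affine) (use assms in simp)
  also have "\<dots> = (\<integral>x. sqrt c * (indicator {v<..} x * (x powr (- 1 / 2) * exp (- (c * x)))) \<partial>lborel)"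
    unfolding integral_scaleR_right[symmetric]
  proof (intro Bochner_Integration.integral_cong refl)
    fix x :: real
    have "c * c powr (- 1 / 2) = sqrt c"
      using assms by (simp add: powr_half_sqrt[symmetric] powr_mult_base powr_add[symmetric])
    moreover have "(c * x) powr (- 1 / 2) = c powr (- 1 / 2) * x powr (- 1 / 2)" if "x > 0"
      using assms that by (simp add: powr_mult)
    moreover have "w < c * x \<longleftrightarrow> v < x" using assms by (simp add: w_def)
    ultimately show "\<bar>c\<bar> *\<^sub>R (indicator {w<..} (0 + c * x) * ((0 + c * x) powr (1 / 2 - 1) * exp (- (1 * (0 + c * x)))))
      = sqrt c * (indicator {v<..} x * (x powr (- 1 / 2) * exp (- (c * x))))"
      using assms by (auto simp: indicator_def mult.assoc[symmetric])
  qed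
  also have "\<dots> = sqrt c * (\<integral>x. indicator {v<..} x * (x powr (- 1 / 2) * exp (- (c * x))) \<partial>lborel)"
    by (rule integral_mult_right_zero)
  finally show "upper_incomplete_gamma (1 / 2) (c * v) = sqrt c * (\<integral>x. indicator {v<..} x * (x powr (- 1 / 2) * exp (- (c * x))) \<partial>lborel)"
    by (simp add: w_def)
qed

text \<open>The substitution is x/(x + t^2), mapping (0, D) to (0, D/(D + t^2)), and this endpoint
  is D y^2/|Q(\<tau>,1)|^2. In the application the exponent -s - 1/2 is -k and comes from a gamma
  integral over the height.\<close>

lemma incomplete_beta_substitution:
  fixes D t s :: real
  assumes D: "D > 0" and t: "t \<noteq> 0" and s: "s > 1"
  shows "t * (\<integral>x. indicator {0<..<D} x * (x powr (s - 1) * (x + t\<^sup>2) powr (- s - 1 / 2)) \<partial>lborel)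
    = sgn t * incomplete_beta (D / (D + t\<^sup>2)) s (1 / 2)"
proof -
  define g where "g = (\<lambda>x. x / (x + t\<^sup>2))"
  define g' where "g' = (\<lambda>x. t\<^sup>2 / (x + t\<^sup>2)\<^sup>2)"
  define f where "f = (\<lambda>\<sigma>::real. \<sigma> powr (s - 1) * (1 - \<sigma>) powr (1 / 2 - 1))"
  have t2: "t\<^sup>2 > 0" using t by simp
  have gb: "g 0 = 0" "g D = D / (D + t\<^sup>2)" "g D \<le> 1"
    using D t2 by (simp_all add: g_def divide_le_eq_1 add_pos_pos)
  have int: "set_integrable lborel {g 0..g D} f"
    unfolding f_def by (rule set_integrable_subset[OF integrable_Beta[of s "1 / 2"]]) (use s gb in auto)
  have der: "(g has_real_derivative g' x) (at x)" if "x \<in> {0..D}" for x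
  proof -
    have "x + t\<^sup>2 \<noteq> 0" using that add_nonneg_pos[OF _ t2, of x] by auto
    then show ?thesis unfolding g_def g'_def
      by (auto intro!: derivative_eq_intros simp: power2_eq_square field_simps)
  qed
  have "incomplete_beta (D / (D + t\<^sup>2)) s (1 / 2) = (LINT x:{g 0..g D}|lborel. f x)"
    unfolding incomplete_beta_def using set_borel_integral_eq_integral(2)[OF int] by (simp add: gb f_def)
  also have "\<dots> = (\<integral>x. f x * indicator {g 0..g D} x \<partial>lborel)"
    by (simp add: set_lebesgue_integral_def mult.commute)
  also have "\<dots> = (\<integral>x. f (g x) * g' x * indicator {0..D} x \<partial>lborel)"
  proof (rule integral_substitution(2)[OF int der])
    have "x + t\<^sup>2 \<noteq> 0" if "x \<in> {0..D}" for x
    proof -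
      have "0 \<le> x" using that by simp
      then show ?thesis using t2 by linarith
    qed
    then have "\<forall>x\<in>{0..D}. (x + t\<^sup>2)\<^sup>2 \<noteq> 0" by (intro ballI) (metis power_not_zero)
    then show "continuous_on {0..D} g'" unfolding g'_def by (intro continuous_on_divide continuous_intros)
    show "0 \<le> g' x" for x by (simp add: g'_def)
  qed (use D in auto)
  also have "\<dots> = (\<integral>x. \<bar>t\<bar> * (indicator {0<..<D} x * (x powr (s - 1) * (x + t\<^sup>2) powr (- s - 1 / 2))) \<partial>lborel)"
  proof (rule integral_cong_AE)
    show "AE x in lborel. f (g x) * g' x * indicator {0..D} x = \<bar>t\<bar> * (indicator {0<..<D} x * (x powr (s - 1) * (x + t\<^sup>2) powr (- s - 1 / 2)))"
      using AE_lborel_singleton[of D] AE_lborel_singleton[of 0]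
    proof eventually_elim
      case (elim x)
      show ?case
      proof (cases "x \<in> {0<..<D}")
        case True
        then have x: "x > 0" "x + t\<^sup>2 > 0" using t2 by (auto simp: add_pos_pos)
        define r where "r = x + t\<^sup>2"
        have r: "r > 0" using x by (simp add: r_def)
        have "1 - x / r = t\<^sup>2 / r" using r by (simp add: r_def field_simps)
        then have "f (g x) = (x / r) powr (s - 1) * (t\<^sup>2 / r) powr (- 1 / 2)" by (simp add: f_def g_def r_def)
        also have "\<dots> = x powr (s - 1) * r powr (1 - s) * ((t\<^sup>2) powr (- 1 / 2) * r powr (1 / 2))"
        proof -
          have d: "(p / r) powr e = p powr e * r powr (- e)" if "p \<ge> 0" for p e
            using that r by (simp add: powr_divide powr_minus_divide)
          show ?thesis using d[of x "s - 1"] d[of "t\<^sup>2" "- 1 / 2"] x by simp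
        qed
        also have "(t\<^sup>2) powr (- 1 / 2) = 1 / \<bar>t\<bar>"
        proof -
          have "(t\<^sup>2) powr (- (1 / 2)) = 1 / (t\<^sup>2) powr (1 / 2)" by (rule powr_minus_divide)
          also have "(t\<^sup>2) powr (1 / 2) = \<bar>t\<bar>" by (simp add: powr_half_sqrt)
          finally show ?thesis by simp
        qed
        also have "x powr (s - 1) * r powr (1 - s) * (1 / \<bar>t\<bar> * r powr (1 / 2)) * g' x
            = \<bar>t\<bar> * (x powr (s - 1) * (r powr (1 - s) * r powr (1 / 2) * r powr (- 2)))"
        proof -
          have "r powr (- 2) = 1 / r\<^sup>2" using r by (simp only: powr_minus_divide powr_numeral)
          moreover have "g' x = t\<^sup>2 / r\<^sup>2" by (simp add: g'_def r_def)
          ultimately have g': "g' x = \<bar>t\<bar> * \<bar>t\<bar> * r powr (- 2)" by (simp add: power2_eq_square)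
          have "X * R1 * (1 / c * R2) * (c * c * R3) = c * (X * (R1 * R2 * R3))" if "c \<noteq> 0" for X R1 R2 R3 c :: real
            using that by simp
          then show ?thesis unfolding g' using t by (metis abs_eq_0)
        qed
        also have "r powr (1 - s) * r powr (1 / 2) * r powr (- 2) = r powr (- s - 1 / 2)"
          unfolding powr_add[symmetric] by (rule arg_cong[where f = "(powr) r"]) simp
        finally show ?thesis using True by (simp add: r_def)
      qed (use elim in \<open>auto simp: indicator_def\<close>)
    qed
  qed (auto simp: f_def g_def g'_def)
  also have "\<dots> = \<bar>t\<bar> * (\<integral>x. indicator {0<..<D} x * (x powr (s - 1) * (x + t\<^sup>2) powr (- s - 1 / 2)) \<partial>lborel)"
    by (rule integral_mult_right_zero)
  finally show ?thesis using t by (simp add: sgn_if abs_if)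
qed

lemma incomplete_beta_1: "s > 0 \<Longrightarrow> incomplete_beta 1 s (1 / 2) = Gamma s * sqrt pi / Gamma (s + 1 / 2)"
proof -
  assume s: "s > 0"
  have "incomplete_beta 1 s (1 / 2) = Beta s (1 / 2)"
    unfolding incomplete_beta_def by (rule integral_unique, rule has_integral_Beta_real) (use s in auto)
  then show ?thesis by (simp add: Beta_def Gamma_one_half_real)
qed


text \<open>The Q-th terms of both series in one; the test on \<open>disc Q\<close> encodes that the
  holomorphic series runs over positive discriminants.\<close>

definition zterm :: "nat \<Rightarrow> complex \<Rightarrow> complex \<Rightarrow> quad_form \<Rightarrow> complex" where
  "zterm k \<tau> z Q = of_real (sgn (form_at Q \<tau>)) * form_eval Q \<tau> 1 ^ (k - 1) *
     of_real ((if disc Q > 0 then 2 / incomplete_beta 1 (real k - 1 / 2) (1 / 2) *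
         psi_fun k (of_int (disc Q) * (Im \<tau>)\<^sup>2 / (cmod (form_eval Q \<tau> 1))\<^sup>2) else 0)
       - 1 / sqrt pi * upper_incomplete_gamma (1 / 2) (4 * pi * (form_at Q \<tau>)\<^sup>2 * Im z)) *
     exp (2 * of_real pi * \<i> * of_int (disc Q) * z)"

text \<open>Pairs are (height, abscissa), so that the inner integral of the iterated form is the
  horizontal one.\<close>

definition lift_integrand :: "nat \<Rightarrow> complex \<Rightarrow> complex \<Rightarrow> quad_form \<Rightarrow> real \<times> real \<Rightarrow> complex" where
  "lift_integrand k z \<tau> Q = (\<lambda>(\<eta>, u). of_real (indicator {0<..} \<eta> * \<eta> ^ (k - 1)) *
     (of_real (form_at Q \<tau>) * form_eval Q \<tau> 1 ^ (k - 1) * gauss_wt \<tau> (Complex u \<eta>) Q) *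
     hker (real k - 1 / 2) z (Complex u \<eta>))"

definition lift_const :: "nat \<Rightarrow> complex" where
  "lift_const k = 2 * of_real pi * \<i> * of_real (hankel_const (real k - 1 / 2) *
     ((4 * pi) powr (- real k) * (Gamma (real k - 1 / 2) * sqrt pi)))"

lemma lift_const_nonzero: "k \<ge> 1 \<Longrightarrow> lift_const k \<noteq> 0"
proof -
  assume "k \<ge> 1"
  then have "Gamma (real k - 1 / 2) > 0" by (intro Gamma_real_pos) auto
  then have "Gamma (real k - 1 / 2) \<noteq> 0" by simp
  then show ?thesis by (simp add: lift_const_def hankel_const_def)
qed

text \<open>The part over (0, D) is a double integral whose \<eta>-integral is a gamma integral with
  parameter k. In the jump part \<eta>^(k-1) \<eta>^(-s) = \<eta>^(-1/2), hence parameter 1/2.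
  Expressing Gamma(k) by the complete beta value gives both parts the same constant.\<close>

lemma radial_integral:
  fixes D t v :: real
  assumes k: "k \<ge> 2" and t: "t \<noteq> 0" and v: "v > 0"
  defines "s \<equiv> real k - 1 / 2"
  defines "A \<equiv> (\<lambda>\<eta>. \<integral>x. indicator {0<..<D} x * (x powr (s - 1) * exp (- (4 * pi * \<eta> * x))) \<partial>lborel)"
  shows "t * (\<integral>\<eta>. indicator {0<..} \<eta> * (\<eta> ^ (k - 1) * exp (- (4 * pi * \<eta> * t\<^sup>2))) * (A \<eta> - (if v < \<eta> then Gamma s * (4 * pi * \<eta>) powr (- s) else 0)) \<partial>lborel)
    = (4 * pi) powr (- real k) * (Gamma s * sqrt pi) * (sgn t *
       ((if D > 0 then incomplete_beta (D / (D + t\<^sup>2)) s (1 / 2) / incomplete_beta 1 s (1 / 2) else 0)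
        - 1 / sqrt pi * upper_incomplete_gamma (1 / 2) (4 * pi * t\<^sup>2 * v)))"
proof -
  have s: "s > 1" using k by (simp add: s_def)
  have t2: "t\<^sup>2 > 0" using t by simp
  define R1 where "R1 = (\<lambda>\<eta>. indicator {0<..} \<eta> * (\<eta> ^ (k - 1) * exp (- (4 * pi * \<eta> * t\<^sup>2))) * A \<eta>)"
  define R2 where "R2 = (\<lambda>\<eta>. indicator {v<..} \<eta> * (\<eta> powr (- 1 / 2) * exp (- ((4 * pi * t\<^sup>2) * \<eta>))))"
  have c: "4 * pi * t\<^sup>2 > 0" using t2 by simp
  note U = upper_incomplete_gamma_half[OF c v, folded R2_def]
  define f where "f = (\<lambda>x \<eta>. (indicator {0<..<D} x * x powr (s - 1)) * (indicator {0<..} \<eta> * (\<eta> powr (real k - 1) * exp (- ((4 * pi * (x + t\<^sup>2)) * \<eta>)))) :: real)"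
  have fm: "(\<lambda>(x, \<eta>). f x \<eta>) \<in> borel_measurable (lborel \<Otimes>\<^sub>M lborel)" unfolding f_def by measurable
  have g: "has_bochner_integral lborel (\<lambda>\<eta>. f x \<eta>) (indicator {0<..<D} x * x powr (s - 1) * (Gamma (real k) * (4 * pi * (x + t\<^sup>2)) powr (- real k)))" for x
  proof (cases "x \<in> {0<..<D}")
    case True
    then have "4 * pi * (x + t\<^sup>2) > 0" using t2 by (simp add: add_pos_pos)
    then show ?thesis unfolding f_def using k by (intro has_bochner_integral_mult_right gamma_integrable_real) auto
  qed (auto simp: f_def indicator_def has_bochner_integral_zero)
  have fx: "(\<integral>\<eta>. f x \<eta> \<partial>lborel) = indicator {0<..<D} x * x powr (s - 1) * (Gamma (real k) * (4 * pi * (x + t\<^sup>2)) powr (- real k))"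
    "integrable lborel (f x)" for x using g[of x] by (simp_all add: has_bochner_integral_iff)
  have f0: "f x \<eta> \<ge> 0" for x \<eta> by (simp add: f_def)
  have pi4: "(4 * pi * (x + t\<^sup>2)) powr (- real k) = (4 * pi) powr (- real k) * (x + t\<^sup>2) powr (- s - 1 / 2)" if "x > 0" for x
    using that by (simp add: powr_mult s_def)
  define B where "B = (\<integral>x. indicator {0<..<D} x * (x powr (s - 1) * (x + t\<^sup>2) powr (- s - 1 / 2)) \<partial>lborel)"
  have B1: "integrable lborel (\<lambda>x. indicator {0<..<D} x * x powr (s - 1) * (Gamma (real k) * (4 * pi * (x + t\<^sup>2)) powr (- real k)))"
  proof (rule Bochner_Integration.integrable_bound)
    \<comment> \<open>On (0, D) the inequality 1 \<le> exp(D - x) trades the cutoff for an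
      exponential and reduces integrability to a gamma integral.\<close>
    show "integrable lborel (\<lambda>x. (Gamma (real k) * (4 * pi * t\<^sup>2) powr (- real k) * exp D) * (indicator {0<..} x * (x powr (s - 1) * exp (- (1 * x)))))"
      using gamma_integrable_real[of s 1] s by (intro integrable_mult_right) (simp_all add: has_bochner_integral_iff)
    show "AE x in lborel. norm (indicator {0<..<D} x * x powr (s - 1) * (Gamma (real k) * (4 * pi * (x + t\<^sup>2)) powr (- real k)))
       \<le> norm ((Gamma (real k) * (4 * pi * t\<^sup>2) powr (- real k) * exp D) * (indicator {0<..} x * (x powr (s - 1) * exp (- (1 * x)))))"
    proof (rule AE_I2)
      fix x
      show "norm (indicator {0<..<D} x * x powr (s - 1) * (Gamma (real k) * (4 * pi * (x + t\<^sup>2)) powr (- real k)))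
       \<le> norm ((Gamma (real k) * (4 * pi * t\<^sup>2) powr (- real k) * exp D) * (indicator {0<..} x * (x powr (s - 1) * exp (- (1 * x)))))"
      proof (cases "x \<in> {0<..<D}")
        case True
        have G: "Gamma (real k) > 0" using k by (intro Gamma_real_pos) auto
        have "(4 * pi * (x + t\<^sup>2)) powr (- real k) \<le> (4 * pi * t\<^sup>2) powr (- real k)"
          using True t2 by (intro powr_mono2') auto
        moreover have "1 \<le> exp D * exp (- x)" using True by (simp add: exp_add[symmetric])
        ultimately have "(4 * pi * (x + t\<^sup>2)) powr (- real k) * 1 \<le> (4 * pi * t\<^sup>2) powr (- real k) * (exp D * exp (- x))"
          by (intro mult_mono) auto
        then have "Gamma (real k) * x powr (s - 1) * ((4 * pi * (x + t\<^sup>2)) powr (- real k) * 1) \<le> Gamma (real k) * x powr (s - 1) * ((4 * pi * t\<^sup>2) powr (- real k) * (exp D * exp (- x)))"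
          using G by (intro mult_left_mono) auto
        then show ?thesis using True G by (simp add: abs_mult mult_ac)
      qed (simp add: indicator_def)
    qed
  qed measurable
  have fi: "integrable (lborel \<Otimes>\<^sub>M lborel) (\<lambda>(x, \<eta>). f x \<eta>)"
  proof (rule lborel_pair.Fubini_integrable[OF fm])
    show "integrable lborel (\<lambda>x. \<integral>y. norm (case (x, y) of (x, \<eta>) \<Rightarrow> f x \<eta>) \<partial>lborel)"
      using B1 f0 by (simp add: fx)
  qed (simp add: fx)
  have A: "indicator {0<..} \<eta> * (\<eta> ^ (k - 1) * exp (- (4 * pi * \<eta> * t\<^sup>2))) * A \<eta> = (\<integral>x. f x \<eta> \<partial>lborel)" for \<eta>
  proof -
    have "indicator {0<..} \<eta> * (\<eta> ^ (k - 1) * exp (- (4 * pi * \<eta> * t\<^sup>2))) * A \<eta>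
      = (\<integral>x. indicator {0<..} \<eta> * (\<eta> ^ (k - 1) * exp (- (4 * pi * \<eta> * t\<^sup>2))) * (indicator {0<..<D} x * (x powr (s - 1) * exp (- (4 * pi * \<eta> * x)))) \<partial>lborel)"
      unfolding A_def by (rule integral_mult_right_zero[symmetric])
    also have "\<dots> = (\<integral>x. f x \<eta> \<partial>lborel)"
    proof (intro Bochner_Integration.integral_cong refl)
      fix x
      have "exp (- (4 * pi * \<eta> * t\<^sup>2)) * exp (- (4 * pi * \<eta> * x)) = exp (- ((4 * pi * (x + t\<^sup>2)) * \<eta>))"
        by (simp add: exp_add[symmetric] algebra_simps)
      moreover have "\<eta> ^ (k - 1) = \<eta> powr (real k - 1)" if "\<eta> > 0"
        using that k powr_realpow[OF that, of "k - 1"] by (simp add: of_nat_diff)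
      ultimately show "indicator {0<..} \<eta> * (\<eta> ^ (k - 1) * exp (- (4 * pi * \<eta> * t\<^sup>2))) * (indicator {0<..<D} x * (x powr (s - 1) * exp (- (4 * pi * \<eta> * x)))) = f x \<eta>"
        by (cases "\<eta> > 0") (simp_all add: f_def mult_ac)
    qed
    finally show ?thesis .
  qed
  have R1i: "integrable lborel R1" and R1v: "integral\<^sup>L lborel R1 = Gamma (real k) * (4 * pi) powr (- real k) * B"
  proof -
    show "integrable lborel R1" unfolding R1_def A using lborel_pair.integrable_snd[OF fi] by simp
    have "integral\<^sup>L lborel R1 = (\<integral>x. (\<integral>\<eta>. f x \<eta> \<partial>lborel) \<partial>lborel)"
      unfolding R1_def A by (rule lborel_pair.Fubini_integral) (use fi in simp)
    also have "\<dots> = (\<integral>x. Gamma (real k) * (4 * pi) powr (- real k) * (indicator {0<..<D} x * (x powr (s - 1) * (x + t\<^sup>2) powr (- s - 1 / 2))) \<partial>lborel)"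
      unfolding fx by (intro Bochner_Integration.integral_cong refl) (auto simp: indicator_def pi4)
    finally show "integral\<^sup>L lborel R1 = Gamma (real k) * (4 * pi) powr (- real k) * B"
      unfolding B_def by (simp only: integral_mult_right_zero)
  qed
  have split: "indicator {0<..} \<eta> * (\<eta> ^ (k - 1) * exp (- (4 * pi * \<eta> * t\<^sup>2))) * (A \<eta> - (if v < \<eta> then Gamma s * (4 * pi * \<eta>) powr (- s) else 0))
     = R1 \<eta> - Gamma s * (4 * pi) powr (- s) * R2 \<eta>" for \<eta>
  proof -
    have "\<eta> ^ (k - 1) * (4 * pi * \<eta>) powr (- s) = (4 * pi) powr (- s) * \<eta> powr (- 1 / 2)" if "\<eta> > 0"
    proof -
      have "\<eta> ^ (k - 1) = \<eta> powr (real k - 1)" using that k powr_realpow[OF that, of "k - 1"] by (simp add: of_nat_diff)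
      then show ?thesis using that by (simp add: powr_mult powr_add[symmetric] s_def)
    qed
    then show ?thesis using v by (auto simp: R1_def R2_def indicator_def algebra_simps)
  qed
  have I: "(\<integral>\<eta>. indicator {0<..} \<eta> * (\<eta> ^ (k - 1) * exp (- (4 * pi * \<eta> * t\<^sup>2))) * (A \<eta> - (if v < \<eta> then Gamma s * (4 * pi * \<eta>) powr (- s) else 0)) \<partial>lborel)
    = Gamma (real k) * (4 * pi) powr (- real k) * B - Gamma s * (4 * pi) powr (- s) * integral\<^sup>L lborel R2"
    unfolding split using R1i U(1) R1v by simp
  have R2v: "t * integral\<^sup>L lborel R2 = sgn t * ((4 * pi) powr (- 1 / 2) * upper_incomplete_gamma (1 / 2) (4 * pi * t\<^sup>2 * v))"
  proof -
    have "sqrt (4 * pi * t\<^sup>2) = (4 * pi) powr (1 / 2) * \<bar>t\<bar>" by (simp add: real_sqrt_mult powr_half_sqrt)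
    then have "upper_incomplete_gamma (1 / 2) (4 * pi * t\<^sup>2 * v) = (4 * pi) powr (1 / 2) * \<bar>t\<bar> * integral\<^sup>L lborel R2"
      using U(2) by simp
    moreover have "(4 * pi) powr (- 1 / 2) * (4 * pi) powr (1 / 2) = 1" by (simp add: powr_add[symmetric])
    ultimately have "(4 * pi) powr (- 1 / 2) * upper_incomplete_gamma (1 / 2) (4 * pi * t\<^sup>2 * v) = \<bar>t\<bar> * integral\<^sup>L lborel R2"
      by (simp add: mult.assoc[symmetric])
    then show ?thesis by (simp add: mult.assoc[symmetric] sgn_if abs_if)
  qed
  have Bv: "t * B = sgn t * (if D > 0 then incomplete_beta (D / (D + t\<^sup>2)) s (1 / 2) else 0)"
  proof (cases "D > 0")
    case True
    then show ?thesis using incomplete_beta_substitution[OF True t s] by (simp add: B_def)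
  qed (simp add: B_def)
  have ks: "s + 1 / 2 = real k" by (simp add: s_def)
  have Gs: "Gamma s > 0" "Gamma (real k) > 0" using s k by (auto intro!: Gamma_real_pos)
  have b1: "incomplete_beta 1 s (1 / 2) = Gamma s * sqrt pi / Gamma (real k)"
    using incomplete_beta_1[of s] s ks by simp
  have ps: "(4 * pi) powr (- s) * (4 * pi) powr (- 1 / 2) = (4 * pi) powr (- real k)"
    by (simp add: powr_add[symmetric] s_def)
  have "t * (Gamma (real k) * (4 * pi) powr (- real k) * B - Gamma s * (4 * pi) powr (- s) * integral\<^sup>L lborel R2)
    = Gamma (real k) * (4 * pi) powr (- real k) * (t * B) - Gamma s * (4 * pi) powr (- s) * (t * integral\<^sup>L lborel R2)"
    by (simp add: algebra_simps)
  also have "\<dots> = (4 * pi) powr (- real k) * (sgn t * (Gamma (real k) * (if D > 0 then incomplete_beta (D / (D + t\<^sup>2)) s (1 / 2) else 0)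
      - Gamma s * upper_incomplete_gamma (1 / 2) (4 * pi * t\<^sup>2 * v)))"
    unfolding R2v Bv ps[symmetric] by (simp add: algebra_simps)
  also have "\<dots> = (4 * pi) powr (- real k) * (Gamma s * sqrt pi) * (sgn t *
       ((if D > 0 then incomplete_beta (D / (D + t\<^sup>2)) s (1 / 2) / incomplete_beta 1 s (1 / 2) else 0)
        - 1 / sqrt pi * upper_incomplete_gamma (1 / 2) (4 * pi * t\<^sup>2 * v)))"
    unfolding b1 using Gs by (simp add: field_simps)
  finally show ?thesis unfolding I .
qed

section \<open>The lift of a single form\<close>

lemma measurable_Complex_swap [measurable]:
  "(\<lambda>p::real \<times> real. Complex (snd p) (fst p)) \<in> borel_measurable (lborel \<Otimes>\<^sub>M lborel)"
proof -
  have "(\<lambda>p::real \<times> real. Complex (snd p) (fst p)) \<in> borel_measurable borel"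
    by (intro borel_measurable_continuous_onI continuous_on_Complex continuous_intros)
  then show ?thesis unfolding lborel_prod by simp
qed

lemma hker_measurable:
  assumes z: "Im z > 0"
  shows "(\<lambda>p. complex_of_real (indicator {0<..} (fst p)) * hker s z (Complex (snd p) (fst p))) \<in> borel_measurable (lborel \<Otimes>\<^sub>M lborel)"
proof -
  let ?S = "{p::real \<times> real. 0 < fst p}"
  have op: "open ?S" by (intro open_Collect_less continuous_intros)
  have "continuous_on ?S (\<lambda>p. (\<i> * (cnj (Complex (snd p) (fst p)) - z)) powr (- of_real s))"
    using z by (intro continuous_intros continuous_on_Complex) (auto simp: complex_nonpos_Reals_iff complex_eq_iff)
  then have "(\<lambda>p. indicator ?S p *\<^sub>R (\<i> * (cnj (Complex (snd p) (fst p)) - z)) powr (- of_real s)) \<in> borel_measurable borel"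
    using op by (intro borel_measurable_continuous_on_indicator) auto
  then have [measurable]: "(\<lambda>p. indicator ?S p *\<^sub>R (\<i> * (cnj (Complex (snd p) (fst p)) - z)) powr (- of_real s)) \<in> borel_measurable (lborel \<Otimes>\<^sub>M lborel)"
    unfolding lborel_prod by simp
  have "(\<lambda>p. complex_of_real (indicator {0<..} (fst p)) * hker s z (Complex (snd p) (fst p)))
    = (\<lambda>p. 1 / (Complex (snd p) (fst p) - z) * (indicator ?S p *\<^sub>R (\<i> * (cnj (Complex (snd p) (fst p)) - z)) powr (- of_real s)))"
    by (auto simp: hker_def indicator_def fun_eq_iff)
  also have "\<dots> \<in> borel_measurable (lborel \<Otimes>\<^sub>M lborel)" by measurable
  finally show ?thesis .
qed

lemma lift_integrand_measurable:
  assumes z: "Im z > 0"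
  shows "lift_integrand k z \<tau> Q \<in> borel_measurable (lborel \<Otimes>\<^sub>M lborel)"
proof -
  note [measurable] = hker_measurable[OF z, of "real k - 1 / 2"]
  have "lift_integrand k z \<tau> Q = (\<lambda>p. of_real (fst p ^ (k - 1)) *
     (of_real (form_at Q \<tau>) * form_eval Q \<tau> 1 ^ (k - 1) *
       (exp (2 * of_real pi * \<i> * of_int (disc Q) * Complex (snd p) (fst p)) * of_real (exp (- (4 * pi * fst p * (form_at Q \<tau>)\<^sup>2))))) *
     (of_real (indicator {0<..} (fst p)) * hker (real k - 1 / 2) z (Complex (snd p) (fst p))))"
    by (auto simp: lift_integrand_def gauss_wt_def fun_eq_iff)
  also have "\<dots> \<in> borel_measurable (lborel \<Otimes>\<^sub>M lborel)" by measurable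
  finally show ?thesis .
qed

text \<open>Horizontal integration is \<open>hker_inner_integral\<close>, valid off the null set
  \<eta> = Im z, and the vertical one is \<open>radial_integral\<close>. A form with
  \<open>form_at\<close> = 0 gives 0 on both sides, once through the linear factor and once through
  sgn.\<close>

lemma lift_integrand_iterated:
  assumes \<tau>: "Im \<tau> > 0" and z: "Im z > 0" and k: "k \<ge> 4"
  shows "(\<integral>\<eta>. (\<integral>u. lift_integrand k z \<tau> Q (\<eta>, u) \<partial>lborel) \<partial>lborel) = lift_const k * zterm k \<tau> z Q"
proof (cases "form_at Q \<tau> = 0")
  case True
  then show ?thesis by (simp add: lift_integrand_def zterm_def)
next
  case False
  define t D P s where "t = form_at Q \<tau>" and "D = real_of_int (disc Q)" and "P = form_eval Q \<tau> 1 ^ (k - 1)"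
    and "s = real k - 1 / 2"
  have t: "t \<noteq> 0" using False by (simp add: t_def)
  have s: "s \<ge> 2" using k by (simp add: s_def)
  define R where "R = (\<lambda>\<eta>. indicator {0<..} \<eta> * (\<eta> ^ (k - 1) * exp (- (4 * pi * \<eta> * t\<^sup>2))) *
     ((\<integral>x. indicator {0<..<D} x * (x powr (s - 1) * exp (- (4 * pi * \<eta> * x))) \<partial>lborel) - (if Im z < \<eta> then Gamma s * (4 * pi * \<eta>) powr (- s) else 0)))"
  define K where "K = 2 * of_real pi * \<i> * of_real (hankel_const s) * exp (2 * of_real pi * \<i> * of_real D * z) * P"
  have inner: "(\<integral>u. lift_integrand k z \<tau> Q (\<eta>, u) \<partial>lborel) = K * of_real t * of_real (R \<eta>)" if "\<eta> \<noteq> Im z" for \<eta>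
  proof (cases "\<eta> > 0")
    case True
    have "(\<integral>u. lift_integrand k z \<tau> Q (\<eta>, u) \<partial>lborel)
       = (\<integral>u. of_real (\<eta> ^ (k - 1) * exp (- (4 * pi * \<eta> * t\<^sup>2)) * t) * P * (exp (2 * of_real pi * \<i> * of_real D * Complex u \<eta>) * hker s z (Complex u \<eta>)) \<partial>lborel)"
      using True by (intro Bochner_Integration.integral_cong refl)
        (simp add: lift_integrand_def gauss_wt_def t_def D_def P_def s_def mult_ac)
    also have "\<dots> = of_real (\<eta> ^ (k - 1) * exp (- (4 * pi * \<eta> * t\<^sup>2)) * t) * P * (\<integral>u. exp (2 * of_real pi * \<i> * of_real D * Complex u \<eta>) * hker s z (Complex u \<eta>) \<partial>lborel)"
      by (rule integral_mult_right_zero)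
    also have "\<dots> = K * of_real t * of_real (R \<eta>)"
      unfolding hker_inner_integral[OF z True that s] using True by (simp add: K_def R_def mult_ac)
    finally show ?thesis .
  qed (simp add: lift_integrand_def R_def)
  have Rm: "R \<in> borel_measurable lborel" unfolding R_def by measurable
  have "(\<integral>\<eta>. (\<integral>u. lift_integrand k z \<tau> Q (\<eta>, u) \<partial>lborel) \<partial>lborel) = (\<integral>\<eta>. K * of_real t * of_real (R \<eta>) \<partial>lborel)"
  proof (rule integral_cong_AE)
    show "AE \<eta> in lborel. (\<integral>u. lift_integrand k z \<tau> Q (\<eta>, u) \<partial>lborel) = K * of_real t * of_real (R \<eta>)"
      using AE_lborel_singleton[of "Im z"] by eventually_elim (rule inner)
    show "(\<lambda>\<eta>. \<integral>u. lift_integrand k z \<tau> Q (\<eta>, u) \<partial>lborel) \<in> borel_measurable lborel"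
    proof -
      note [measurable] = lift_integrand_measurable[OF z]
      show ?thesis by measurable
    qed
  qed (use Rm in measurable)
  also have "\<dots> = K * of_real t * of_real (integral\<^sup>L lborel R)"
    by (simp only: integral_mult_right_zero integral_complex_of_real)
  also have "\<dots> = K * of_real (t * integral\<^sup>L lborel R)" by simp
  also have "t * integral\<^sup>L lborel R = (4 * pi) powr (- real k) * (Gamma s * sqrt pi) * (sgn t *
       ((if D > 0 then incomplete_beta (D / (D + t\<^sup>2)) s (1 / 2) / incomplete_beta 1 s (1 / 2) else 0)
        - 1 / sqrt pi * upper_incomplete_gamma (1 / 2) (4 * pi * t\<^sup>2 * Im z)))"
    unfolding R_def s_def by (rule radial_integral) (use k t z in auto)
  also have "(if D > 0 then incomplete_beta (D / (D + t\<^sup>2)) s (1 / 2) / incomplete_beta 1 s (1 / 2) else 0)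
    = (if disc Q > 0 then 2 / incomplete_beta 1 (real k - 1 / 2) (1 / 2) *
         psi_fun k (of_int (disc Q) * (Im \<tau>)\<^sup>2 / (cmod (form_eval Q \<tau> 1))\<^sup>2) else 0)"
  proof -
    have "of_int (disc Q) * (Im \<tau>)\<^sup>2 / (cmod (form_eval Q \<tau> 1))\<^sup>2 = D / (D + t\<^sup>2)"
      unfolding norm_form_eval[OF \<tau>] using \<tau> by (simp add: D_def t_def)
    then show ?thesis by (simp add: psi_fun_def s_def D_def)
  qed
  finally show ?thesis
    by (simp add: zterm_def lift_const_def K_def t_def D_def P_def s_def mult_ac)
qed

section \<open>An integrable majorant for the lift\<close>

lemma integrable_exp_powr_abs:
  fixes a c :: real
  assumes "a > 0" "c > 0"
  shows "integrable lborel (\<lambda>x. \<bar>x\<bar> powr (a - 1) * exp (- (c * \<bar>x\<bar>)))"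
proof -
  define f where "f = (\<lambda>x. indicator {0<..} x * (x powr (a - 1) * exp (- (c * x))) :: real)"
  have f: "integrable lborel f"
    using gamma_integrable_real[OF assms] by (simp add: f_def has_bochner_integral_iff)
  have f': "integrable lborel (\<lambda>x. f (0 + (-1) * x))" by (rule lborel_integrable_real_affine[OF f]) simp
  have "integrable lborel (\<lambda>x. f x + f (0 + (-1) * x))" using f f' by (rule Bochner_Integration.integrable_add)
  moreover have "AE x in lborel. f x + f (0 + (-1) * x) = \<bar>x\<bar> powr (a - 1) * exp (- (c * \<bar>x\<bar>))"
    using AE_lborel_singleton[of 0] by eventually_elim (auto simp: f_def indicator_def)
  ultimately show ?thesis by (subst (asm) integrable_cong_AE) (auto simp: f_def)
qed

text \<open>The majorant has to absorb the pole at z, be integrable down to height 0 and at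
  infinity, and decay summably in the size n. The pole is split by |w - z|^2 \<ge> |\<eta> - v| |u -
  x| into two integrable inverse square roots.\<close>

lemma lift_dominating_functions:
  fixes z :: complex and \<epsilon> :: real
  assumes k: "k \<ge> 4" and z: "Im z > 0" and \<epsilon>: "\<epsilon> > 0"
  obtains A B :: "real \<Rightarrow> real" where "integrable lborel A" "integrable lborel B" "\<And>x. A x \<ge> 0" "\<And>x. B x \<ge> 0"
    "\<And>\<eta> u n. \<eta> \<noteq> Im z \<Longrightarrow> u \<noteq> Re z \<Longrightarrow> n \<ge> 1 \<Longrightarrow>
      indicator {0<..} \<eta> * \<eta> ^ (k - 1) * (n ^ k * exp (- (\<epsilon> * \<eta> * n\<^sup>2))) * norm (hker (real k - 1 / 2) z (Complex u \<eta>))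
      \<le> n powr (- 7 / 2) * (A \<eta> * B u)"
proof -
  \<comment> \<open>With N = k - 1/4, the bound of exp(-X) by a multiple of X^(-N) turns
    \<eta>^(k-1) into \<eta>^(-3/4), still integrable at 0, and n^k into n^(1/2-k) \<le>
    n^(-7/2).\<close>
  define v x s N where "v = Im z" and "x = Re z" and "s = real k - 1 / 2" and "N = real k - 1 / 4"
  have v: "v > 0" and s: "s \<ge> 2" and N: "N > 0" using z k by (auto simp: v_def s_def N_def)
  \<comment> \<open>One half of the Gaussian exponent pays for the powers, the other half for decay
    in \<eta>.\<close>
  define c where "c = \<epsilon> / 2"
  have c: "c > 0" using \<epsilon> by (simp add: c_def)
  define C where "C = N powr N * c powr (- N) * v powr (2 - s)"
  have C: "C \<ge> 0" by (simp add: C_def)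
  define A where "A = (\<lambda>\<eta>. C * (indicator {0<..} \<eta> * (exp (- (c * \<eta>)) * (\<eta> powr (- 3 / 4) * \<bar>\<eta> - v\<bar> powr (- 1 / 2)))))"
  define B where "B = (\<lambda>u. \<bar>u - x\<bar> powr (- 1 / 2) * (1 / (v\<^sup>2 + (u - x)\<^sup>2)))"
  have Ai: "integrable lborel A"
  proof -
    \<comment> \<open>The singularities at 0 and at v are separated at v/2: on either side one of
      the two factors is at most its value at distance v/2.\<close>
    define G where "G = (\<lambda>\<eta>. (v / 2) powr (- 1 / 2) * (indicator {0<..} \<eta> * (\<eta> powr (1 / 4 - 1) * exp (- (c * \<eta>))))
      + (v / 2) powr (- 3 / 4) * exp (c * v) * (\<bar>- v + 1 * \<eta>\<bar> powr (1 / 2 - 1) * exp (- (c * \<bar>- v + 1 * \<eta>\<bar>))))"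
    have "integrable lborel G"
      unfolding G_def
    proof (intro Bochner_Integration.integrable_add integrable_mult_right)
      show "integrable lborel (\<lambda>\<eta>. indicator {0<..} \<eta> * (\<eta> powr (1 / 4 - 1) * exp (- (c * \<eta>))))"
        using gamma_integrable_real[of "1 / 4" c] c by (simp add: has_bochner_integral_iff)
      show "integrable lborel (\<lambda>\<eta>. \<bar>- v + 1 * \<eta>\<bar> powr (1 / 2 - 1) * exp (- (c * \<bar>- v + 1 * \<eta>\<bar>)))"
        by (rule lborel_integrable_real_affine[OF integrable_exp_powr_abs]) (use c in auto)
    qed
    then have "integrable lborel (\<lambda>\<eta>. indicator {0<..} \<eta> * (exp (- (c * \<eta>)) * (\<eta> powr (- 3 / 4) * \<bar>\<eta> - v\<bar> powr (- 1 / 2))))"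
    proof (rule Bochner_Integration.integrable_bound)
      show "AE \<eta> in lborel. norm (indicator {0<..} \<eta> * (exp (- (c * \<eta>)) * (\<eta> powr (- 3 / 4) * \<bar>\<eta> - v\<bar> powr (- 1 / 2)))) \<le> norm (G \<eta>)"
      proof (rule AE_I2)
        fix \<eta> :: real
        have G0: "G \<eta> \<ge> 0" unfolding G_def by (intro add_nonneg_nonneg mult_nonneg_nonneg) auto
        show "norm (indicator {0<..} \<eta> * (exp (- (c * \<eta>)) * (\<eta> powr (- 3 / 4) * \<bar>\<eta> - v\<bar> powr (- 1 / 2)))) \<le> norm (G \<eta>)"
        proof (cases "\<eta> > 0")
          case True
          define p q where "p = \<eta> powr (- 3 / 4)" and "q = \<bar>\<eta> - v\<bar> powr (- 1 / 2)"
          have pq: "p \<ge> 0" "q \<ge> 0" by (auto simp: p_def q_def)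
          have le: "p * q \<le> (v / 2) powr (- 1 / 2) * p + (v / 2) powr (- 3 / 4) * q"
          proof (cases "\<eta> \<ge> v / 2")
            case True
            then have "p \<le> (v / 2) powr (- 3 / 4)" unfolding p_def using v by (intro powr_mono2') auto
            then have "p * q \<le> (v / 2) powr (- 3 / 4) * q" using pq by (intro mult_right_mono)
            then show ?thesis using pq by (simp add: add_increasing)
          next
            case False
            then have "q \<le> (v / 2) powr (- 1 / 2)" unfolding q_def using v by (intro powr_mono2') auto
            then have "q * p \<le> (v / 2) powr (- 1 / 2) * p" using pq by (intro mult_right_mono)
            then show ?thesis using pq by (simp add: add_increasing2 mult.commute)
          qed
          have ee: "exp (- (c * \<eta>)) \<le> exp (c * v) * exp (- (c * \<bar>- v + 1 * \<eta>\<bar>))"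
          proof -
            have "\<bar>- v + \<eta>\<bar> \<le> v + \<eta>" using v True by linarith
            then have "c * \<bar>- v + \<eta>\<bar> \<le> c * (v + \<eta>)" using c by (intro mult_left_mono) auto
            then show ?thesis by (simp add: exp_add[symmetric] algebra_simps)
          qed
          have "exp (- (c * \<eta>)) * (p * q) \<le> exp (- (c * \<eta>)) * ((v / 2) powr (- 1 / 2) * p + (v / 2) powr (- 3 / 4) * q)"
            using le by (intro mult_left_mono) auto
          also have "\<dots> = (v / 2) powr (- 1 / 2) * (p * exp (- (c * \<eta>))) + (v / 2) powr (- 3 / 4) * q * exp (- (c * \<eta>))"
            by (simp add: algebra_simps)
          also have "\<dots> \<le> (v / 2) powr (- 1 / 2) * (p * exp (- (c * \<eta>))) + (v / 2) powr (- 3 / 4) * q * (exp (c * v) * exp (- (c * \<bar>- v + 1 * \<eta>\<bar>)))"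
            using ee pq by (intro add_left_mono mult_left_mono) auto
          also have "\<dots> = G \<eta>" using True by (simp add: G_def p_def q_def mult_ac)
          finally show ?thesis using True G0 pq by (simp add: p_def q_def abs_mult)
        qed (use G0 in simp)
      qed
    qed measurable
    then show ?thesis unfolding A_def by (rule integrable_mult_right)
  qed
  have Bi: "integrable lborel B"
  proof -
    \<comment> \<open>For |u| \<le> 1 the singular factor is kept, the denominator is bounded below
      by v^2 and exp(1 - |u|) \<ge> 1; for larger |u| the singular factor is at most 1.\<close>
    define G where "G = (\<lambda>u. (1 / v\<^sup>2 * exp 1) * (\<bar>u\<bar> powr (1 / 2 - 1) * exp (- (1 * \<bar>u\<bar>))) + 1 / (v\<^sup>2 + u\<^sup>2))"
    have "integrable lborel G"
      unfolding G_def by (intro Bochner_Integration.integrable_add integrable_mult_right integrable_exp_powr_abs integrable_cauchy_density v) auto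
    then have "integrable lborel (\<lambda>u. \<bar>u\<bar> powr (- 1 / 2) * (1 / (v\<^sup>2 + u\<^sup>2)))"
    proof (rule Bochner_Integration.integrable_bound)
      show "AE u in lborel. norm (\<bar>u\<bar> powr (- 1 / 2) * (1 / (v\<^sup>2 + u\<^sup>2))) \<le> norm (G u)"
      proof (rule AE_I2)
        fix u :: real
        have pos: "v\<^sup>2 + u\<^sup>2 > 0" using v by (simp add: add_pos_nonneg)
        have "\<bar>u\<bar> powr (- 1 / 2) * (1 / (v\<^sup>2 + u\<^sup>2)) \<le> G u"
        proof (cases "\<bar>u\<bar> \<le> 1")
          case True
          have "1 / (v\<^sup>2 + u\<^sup>2) \<le> 1 / v\<^sup>2" using v by (intro divide_left_mono) (auto simp: add_pos_nonneg)
          moreover have "1 \<le> exp 1 * exp (- \<bar>u\<bar>)" using True by (simp add: exp_add[symmetric])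
          ultimately have "1 / (v\<^sup>2 + u\<^sup>2) * 1 \<le> 1 / v\<^sup>2 * (exp 1 * exp (- \<bar>u\<bar>))"
            by (intro mult_mono) auto
          then have "\<bar>u\<bar> powr (- 1 / 2) * (1 / (v\<^sup>2 + u\<^sup>2) * 1) \<le> \<bar>u\<bar> powr (- 1 / 2) * (1 / v\<^sup>2 * (exp 1 * exp (- \<bar>u\<bar>)))"
            by (intro mult_left_mono) auto
          then have "\<bar>u\<bar> powr (- 1 / 2) * (1 / (v\<^sup>2 + u\<^sup>2)) \<le> (1 / v\<^sup>2 * exp 1) * (\<bar>u\<bar> powr (1 / 2 - 1) * exp (- (1 * \<bar>u\<bar>)))"
            by (simp add: mult_ac)
          then show ?thesis unfolding G_def using pos by (smt (verit) divide_nonneg_pos)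
        next
          case False
          then have "\<bar>u\<bar> powr (- 1 / 2) \<le> 1 powr (- 1 / 2)" by (intro powr_mono2') auto
          then have "\<bar>u\<bar> powr (- 1 / 2) * (1 / (v\<^sup>2 + u\<^sup>2)) \<le> 1 * (1 / (v\<^sup>2 + u\<^sup>2))"
            using pos by (intro mult_right_mono) auto
          moreover have "0 \<le> (1 / v\<^sup>2 * exp 1) * (\<bar>u\<bar> powr (1 / 2 - 1) * exp (- (1 * \<bar>u\<bar>)))" by simp
          ultimately show ?thesis unfolding G_def by linarith
        qed
        then show "norm (\<bar>u\<bar> powr (- 1 / 2) * (1 / (v\<^sup>2 + u\<^sup>2))) \<le> norm (G u)"
          using pos by (simp add: abs_mult)
      qed
    qed measurable
    then have "integrable lborel (\<lambda>u. \<bar>- x + 1 * u\<bar> powr (- 1 / 2) * (1 / (v\<^sup>2 + (- x + 1 * u)\<^sup>2)))"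
      by (rule lborel_integrable_real_affine) simp
    then show ?thesis by (simp add: B_def)
  qed
  have main: "indicator {0<..} \<eta> * \<eta> ^ (k - 1) * (n ^ k * exp (- (\<epsilon> * \<eta> * n\<^sup>2))) * norm (hker s z (Complex u \<eta>))
      \<le> n powr (- 7 / 2) * (A \<eta> * B u)" if \<eta>v: "\<eta> \<noteq> v" and ux: "u \<noteq> x" and n: "n \<ge> 1" for \<eta> u n
  proof (cases "\<eta> > 0")
    case True
    define w where "w = Complex u \<eta>"
    have h1: "1 / norm (w - z) \<le> \<bar>\<eta> - v\<bar> powr (- 1 / 2) * \<bar>u - x\<bar> powr (- 1 / 2)"
    proof -
      have pos: "\<bar>\<eta> - v\<bar> > 0" "\<bar>u - x\<bar> > 0" using \<eta>v ux by auto
      have "(norm (w - z))\<^sup>2 = \<bar>u - x\<bar>\<^sup>2 + \<bar>\<eta> - v\<bar>\<^sup>2" by (simp add: w_def cmod_power2 x_def v_def)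
      also have "\<dots> \<ge> \<bar>\<eta> - v\<bar> * \<bar>u - x\<bar>"
        using sum_squares_bound[of "\<bar>\<eta> - v\<bar>" "\<bar>u - x\<bar>"] mult_nonneg_nonneg[of "\<bar>\<eta> - v\<bar>" "\<bar>u - x\<bar>"] by linarith
      finally have "sqrt (\<bar>\<eta> - v\<bar> * \<bar>u - x\<bar>) \<le> norm (w - z)" by (intro real_le_lsqrt) auto
      then have "1 / norm (w - z) \<le> 1 / sqrt (\<bar>\<eta> - v\<bar> * \<bar>u - x\<bar>)"
        using pos by (intro divide_left_mono) (auto intro!: mult_pos_pos simp: w_def complex_eq_iff x_def v_def)
      also have "\<dots> = \<bar>\<eta> - v\<bar> powr (- 1 / 2) * \<bar>u - x\<bar> powr (- 1 / 2)"
        using pos by (simp add: real_sqrt_mult powr_minus powr_half_sqrt field_simps)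
      finally show ?thesis .
    qed
    define q where "q = \<i> * (cnj w - z)"
    have nq: "(norm q)\<^sup>2 = (\<eta> + v)\<^sup>2 + (u - x)\<^sup>2" by (simp add: q_def w_def cmod_power2 x_def v_def norm_mult) (simp add: power2_eq_square algebra_simps)
    have Req: "Re q = \<eta> + v" by (simp add: q_def w_def v_def)
    then have vq: "v \<le> norm q" using complex_Re_le_cmod[of q] True by linarith
    have "v\<^sup>2 \<le> (\<eta> + v)\<^sup>2" using v True by (intro power_mono) auto
    then have ge: "v\<^sup>2 + (u - x)\<^sup>2 \<le> (norm q)\<^sup>2" unfolding nq by simp
    have h2: "norm (q powr (- of_real s)) \<le> v powr (2 - s) * (1 / (v\<^sup>2 + (u - x)\<^sup>2))"
    proof -
      have "norm (q powr (- of_real s)) \<le> v powr (2 - s) / (norm q)\<^sup>2"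
        unfolding norm_powr_neg_real by (rule powr_neg_le[OF v vq s])
      also have "\<dots> \<le> v powr (2 - s) / (v\<^sup>2 + (u - x)\<^sup>2)"
      proof (intro divide_left_mono ge)
        have "v\<^sup>2 + (u - x)\<^sup>2 > 0" using v by (simp add: add_pos_nonneg)
        then show "0 < (norm q)\<^sup>2 * (v\<^sup>2 + (u - x)\<^sup>2)" using ge by (intro mult_pos_pos) linarith+
      qed simp
      finally show ?thesis by simp
    qed
    have hk: "norm (hker s z w) \<le> (\<bar>\<eta> - v\<bar> powr (- 1 / 2) * \<bar>u - x\<bar> powr (- 1 / 2)) * (v powr (2 - s) * (1 / (v\<^sup>2 + (u - x)\<^sup>2)))"
      unfolding hker_def norm_mult norm_divide norm_one q_def[symmetric] by (intro mult_mono h1 h2) auto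
    define X where "X = c * \<eta> * n\<^sup>2"
    have X: "X > 0" using c True n by (simp add: X_def)
    have e1: "exp (- (\<epsilon> * \<eta> * n\<^sup>2)) \<le> exp (- (c * \<eta>)) * (N powr N * X powr (- N))"
    proof -
      have "\<eta> * 1 \<le> \<eta> * n\<^sup>2" using True n by (intro mult_left_mono) auto
      then have "c * \<eta> \<le> X" using c by (simp add: X_def)
      then have "exp (- X) \<le> exp (- (c * \<eta>))" by simp
      then have "exp (- X) * exp (- X) \<le> exp (- (c * \<eta>)) * (N powr N * X powr (- N))"
        using exp_mult_powr_bounded[OF N X] by (intro mult_mono) auto
      moreover have "exp (- X) * exp (- X) = exp (- (\<epsilon> * \<eta> * n\<^sup>2))" by (simp add: exp_add[symmetric] X_def c_def)
      ultimately show ?thesis by simp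
    qed
    have pw: "\<eta> ^ (k - 1) * (n ^ k * X powr (- N)) = c powr (- N) * \<eta> powr (- 3 / 4) * n powr (1 / 2 - real k)"
    proof -
      have n0: "n > 0" using n by simp
      have a: "\<eta> ^ (k - 1) = \<eta> powr (real k - 1)" using True k powr_realpow[OF True, of "k - 1"] by (simp add: of_nat_diff)
      have b: "n ^ k = n powr (real k)" using powr_realpow[OF n0, of k] by simp
      have d: "n\<^sup>2 = n powr 2" using n0 by simp
      have "X powr (- N) = c powr (- N) * \<eta> powr (- N) * (n\<^sup>2) powr (- N)"
        unfolding X_def using c True n0 by (simp add: powr_mult)
      also have "(n\<^sup>2) powr (- N) = n powr (- (2 * N))" unfolding d powr_powr by simp
      finally have "X powr (- N) = c powr (- N) * \<eta> powr (- N) * n powr (- (2 * N))" .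
      then have "\<eta> ^ (k - 1) * (n ^ k * X powr (- N)) = c powr (- N) * (\<eta> powr (real k - 1) * \<eta> powr (- N)) * (n powr (real k) * n powr (- (2 * N)))"
        unfolding a b by (simp only: mult_ac)
      also have "\<eta> powr (real k - 1) * \<eta> powr (- N) = \<eta> powr (- 3 / 4)" unfolding powr_add[symmetric] by (simp add: N_def)
      also have "n powr (real k) * n powr (- (2 * N)) = n powr (1 / 2 - real k)" unfolding powr_add[symmetric] by (simp add: N_def)
      finally show ?thesis .
    qed
    have n7: "n powr (1 / 2 - real k) \<le> n powr (- 7 / 2)" using n k by (intro powr_mono) auto
    have "\<eta> ^ (k - 1) * (n ^ k * exp (- (\<epsilon> * \<eta> * n\<^sup>2))) \<le> \<eta> ^ (k - 1) * (n ^ k * (exp (- (c * \<eta>)) * (N powr N * X powr (- N))))"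
      using e1 True n by (intro mult_left_mono) auto
    also have "\<dots> = exp (- (c * \<eta>)) * N powr N * (\<eta> ^ (k - 1) * (n ^ k * X powr (- N)))" by (simp only: mult_ac)
    also have "\<dots> = exp (- (c * \<eta>)) * N powr N * (c powr (- N) * \<eta> powr (- 3 / 4)) * n powr (1 / 2 - real k)"
      unfolding pw by (simp only: mult_ac)
    also have "\<dots> \<le> exp (- (c * \<eta>)) * N powr N * (c powr (- N) * \<eta> powr (- 3 / 4)) * n powr (- 7 / 2)"
      using n7 by (intro mult_left_mono) auto
    finally have m1: "\<eta> ^ (k - 1) * (n ^ k * exp (- (\<epsilon> * \<eta> * n\<^sup>2))) \<le> exp (- (c * \<eta>)) * N powr N * (c powr (- N) * \<eta> powr (- 3 / 4)) * n powr (- 7 / 2)" .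
    have "\<eta> ^ (k - 1) * (n ^ k * exp (- (\<epsilon> * \<eta> * n\<^sup>2))) * norm (hker s z w)
      \<le> exp (- (c * \<eta>)) * N powr N * (c powr (- N) * \<eta> powr (- 3 / 4)) * n powr (- 7 / 2) *
        ((\<bar>\<eta> - v\<bar> powr (- 1 / 2) * \<bar>u - x\<bar> powr (- 1 / 2)) * (v powr (2 - s) * (1 / (v\<^sup>2 + (u - x)\<^sup>2))))"
      using True n by (intro mult_mono m1 hk) (auto intro!: mult_nonneg_nonneg)
    also have "\<dots> = n powr (- 7 / 2) * (A \<eta> * B u)"
      using True by (simp add: A_def B_def C_def mult_ac)
    finally show ?thesis using True by (simp add: w_def)
  qed (use v in \<open>simp add: A_def\<close>)
  show ?thesis
  proof (rule that[OF Ai Bi])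
    show "A x \<ge> 0" for x unfolding A_def using C by (intro mult_nonneg_nonneg) auto
    show "B x \<ge> 0" for x unfolding B_def by (intro mult_nonneg_nonneg) auto
  qed (use main in \<open>auto simp: s_def v_def x_def\<close>)
qed

text \<open>A common real majorant: the integrands at \<tau>, and their complexifications nearby,
  are bounded by a constant times it.\<close>

definition lift_weight :: "nat \<Rightarrow> real \<Rightarrow> complex \<Rightarrow> quad_form \<Rightarrow> real \<times> real \<Rightarrow> real" where
  "lift_weight k \<epsilon> z Q = (\<lambda>(\<eta>, u). indicator {0<..} \<eta> * \<eta> ^ (k - 1) *
     (form_size Q ^ k * exp (- (\<epsilon> * \<eta> * (form_size Q)\<^sup>2))) * norm (hker (real k - 1 / 2) z (Complex u \<eta>)))"

lemma AE_pair_ne: "AE p in (lborel \<Otimes>\<^sub>M lborel). fst p \<noteq> (a::real) \<and> snd p \<noteq> (b::real)"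
proof -
  have 1: "({a} \<times> UNIV) \<union> (UNIV \<times> {b}) \<in> null_sets (lborel \<Otimes>\<^sub>M lborel)"
  proof (rule null_sets.Un)
    show "{a} \<times> UNIV \<in> null_sets (lborel \<Otimes>\<^sub>M lborel)"
      by (rule null_setsI) (auto simp: lborel.emeasure_pair_measure_Times)
    show "UNIV \<times> {b} \<in> null_sets (lborel \<Otimes>\<^sub>M lborel)"
      by (rule null_setsI) (auto simp: lborel.emeasure_pair_measure_Times)
  qed
  show ?thesis by (rule AE_I'[OF 1]) auto
qed

text \<open>The lines through z with \<eta> = Im z or u = Re z are excluded, since there the inverse
  square roots in the majorant take the value \<open>0 powr (- 1 / 2)\<close> = 0. They form a null
  set independent of \<open>Q\<close>, so the bound holds for all forms simultaneously.\<close>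

lemma lift_weight_dominated:
  assumes k: "k \<ge> 4" and z: "Im z > 0" and \<epsilon>: "\<epsilon> > 0"
  obtains G where "integrable (lborel \<Otimes>\<^sub>M lborel) G" "\<And>p. G p \<ge> 0"
    "AE p in (lborel \<Otimes>\<^sub>M lborel). \<forall>Q. lift_weight k \<epsilon> z Q p \<le> form_size Q powr (- 7 / 2) * G p"
proof -
  obtain A B :: "real \<Rightarrow> real" where AB: "integrable lborel A" "integrable lborel B" "\<And>x. A x \<ge> 0" "\<And>x. B x \<ge> 0"
    "\<And>\<eta> u n. \<eta> \<noteq> Im z \<Longrightarrow> u \<noteq> Re z \<Longrightarrow> n \<ge> 1 \<Longrightarrow>
      indicator {0<..} \<eta> * \<eta> ^ (k - 1) * (n ^ k * exp (- (\<epsilon> * \<eta> * n\<^sup>2))) * norm (hker (real k - 1 / 2) z (Complex u \<eta>))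
      \<le> n powr (- 7 / 2) * (A \<eta> * B u)"
    using lift_dominating_functions[OF assms] by blast
  show ?thesis
  proof (rule that[OF integrable_pair_mult[OF AB(1,2)]])
    show "AE p in (lborel \<Otimes>\<^sub>M lborel). \<forall>Q. lift_weight k \<epsilon> z Q p \<le> form_size Q powr (- 7 / 2) * (case p of (x, y) \<Rightarrow> A x * B y)"
      using AE_pair_ne[of "Im z" "Re z"]
    proof eventually_elim
      case (elim p)
      show ?case
      proof
        fix Q
        show "lift_weight k \<epsilon> z Q p \<le> form_size Q powr (- 7 / 2) * (case p of (x, y) \<Rightarrow> A x * B y)"
        proof (cases "Q = (0, 0, 0)")
          case True
          then show ?thesis using k by (simp add: lift_weight_def form_size_def case_prod_unfold power_0_left)
        next
          case False
          show ?thesis using AB(5)[of "fst p" "snd p" "form_size Q"] elim form_size_ge_1[OF False]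
            by (simp add: lift_weight_def case_prod_unfold)
        qed
      qed
    qed
  qed (use AB in auto)
qed

lemma lift_weight_pointwise_summable:
  assumes k: "k \<ge> 1" and \<epsilon>: "\<epsilon> > 0"
  shows "(\<lambda>Q. lift_weight k \<epsilon> z Q p) summable_on UNIV"
proof (cases "fst p > 0")
  case True
  let ?K = "fst p ^ (k - 1) * norm (hker (real k - 1 / 2) z (Complex (snd p) (fst p)))"
  have e: "\<epsilon> * fst p > 0" using True \<epsilon> by simp
  show ?thesis
  proof (rule summable_on_comparison_test)
    show "(\<lambda>Q. ?K * exp (- (\<epsilon> * fst p) * form_size Q ^ 2 + real k * form_size Q)) summable_on UNIV"
      by (intro summable_on_cmult_right gauss_form_size_summable e)
    fix Q :: quad_form
    have "form_size Q ^ k \<le> exp (real k * form_size Q)" by (rule power_le_exp) simp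
    then have "form_size Q ^ k * exp (- (\<epsilon> * fst p * (form_size Q)\<^sup>2)) \<le> exp (real k * form_size Q) * exp (- (\<epsilon> * fst p * (form_size Q)\<^sup>2))"
      by (intro mult_right_mono) auto
    then have "?K * (form_size Q ^ k * exp (- (\<epsilon> * fst p * (form_size Q)\<^sup>2))) \<le> ?K * exp (- (\<epsilon> * fst p) * form_size Q ^ 2 + real k * form_size Q)"
      using True by (intro mult_left_mono) (auto simp: exp_add[symmetric] algebra_simps)
    then show "lift_weight k \<epsilon> z Q p \<le> ?K * exp (- (\<epsilon> * fst p) * form_size Q ^ 2 + real k * form_size Q)"
      using True by (simp add: lift_weight_def case_prod_unfold mult_ac)
    show "0 \<le> lift_weight k \<epsilon> z Q p" using True by (simp add: lift_weight_def case_prod_unfold)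
  qed
next
  case False
  then show ?thesis by (simp add: lift_weight_def case_prod_unfold)
qed

section \<open>Absolute convergence of the lift\<close>

lemma lift_weight_nonneg: "0 \<le> lift_weight k \<epsilon> z Q p"
  by (auto simp: lift_weight_def indicator_def split: prod.split)

lemma lift_weight_measurable:
  assumes z: "Im z > 0"
  shows "lift_weight k \<epsilon> z Q \<in> borel_measurable (lborel \<Otimes>\<^sub>M lborel)"
proof -
  note [measurable] = hker_measurable[OF z, of "real k - 1 / 2"]
  have "lift_weight k \<epsilon> z Q = (\<lambda>p. \<bar>fst p\<bar> ^ (k - 1) * (form_size Q ^ k * exp (- (\<epsilon> * fst p * (form_size Q)\<^sup>2))) *
      norm (of_real (indicator {0<..} (fst p)) * hker (real k - 1 / 2) z (Complex (snd p) (fst p))))"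
    by (auto simp: lift_weight_def fun_eq_iff indicator_def)
  also have "\<dots> \<in> borel_measurable (lborel \<Otimes>\<^sub>M lborel)" by measurable
  finally show ?thesis .
qed

lemma lift_weight_integral_bound:
  assumes k: "k \<ge> 4" and z: "Im z > 0" and \<epsilon>: "\<epsilon> > 0"
  obtains K where "K \<ge> 0" "\<And>Q. integrable (lborel \<Otimes>\<^sub>M lborel) (lift_weight k \<epsilon> z Q)"
    "\<And>Q. (\<integral>p. lift_weight k \<epsilon> z Q p \<partial>(lborel \<Otimes>\<^sub>M lborel)) \<le> K * form_size Q powr (- 7 / 2)"
proof -
  obtain G where G: "integrable (lborel \<Otimes>\<^sub>M lborel) G" "\<And>p. G p \<ge> 0"
    "AE p in (lborel \<Otimes>\<^sub>M lborel). \<forall>Q. lift_weight k \<epsilon> z Q p \<le> form_size Q powr (- 7 / 2) * G p"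
    using lift_weight_dominated[OF assms] by blast
  have i: "integrable (lborel \<Otimes>\<^sub>M lborel) (lift_weight k \<epsilon> z Q)" for Q
  proof (rule Bochner_Integration.integrable_bound)
    show "integrable (lborel \<Otimes>\<^sub>M lborel) (\<lambda>p. form_size Q powr (- 7 / 2) * G p)"
      using G(1) by (rule integrable_mult_right)
    show "AE p in (lborel \<Otimes>\<^sub>M lborel). norm (lift_weight k \<epsilon> z Q p) \<le> norm (form_size Q powr (- 7 / 2) * G p)"
      using G(3)
    proof eventually_elim
      case (elim p)
      then have "lift_weight k \<epsilon> z Q p \<le> form_size Q powr (- 7 / 2) * G p" by blast
      then show ?case using lift_weight_nonneg[of k \<epsilon> z Q p] by simp
    qed
  qed (rule lift_weight_measurable[OF z])
  show ?thesis
  proof (rule that)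
    show "integral\<^sup>L (lborel \<Otimes>\<^sub>M lborel) G \<ge> 0" using G(2) by (intro integral_nonneg_AE) auto
    fix Q
    have "(\<integral>p. lift_weight k \<epsilon> z Q p \<partial>(lborel \<Otimes>\<^sub>M lborel)) \<le> (\<integral>p. form_size Q powr (- 7 / 2) * G p \<partial>(lborel \<Otimes>\<^sub>M lborel))"
    proof (rule integral_mono_AE[OF i])
      show "integrable (lborel \<Otimes>\<^sub>M lborel) (\<lambda>p. form_size Q powr (- 7 / 2) * G p)" using G(1) by (rule integrable_mult_right)
      show "AE p in (lborel \<Otimes>\<^sub>M lborel). lift_weight k \<epsilon> z Q p \<le> form_size Q powr (- 7 / 2) * G p"
        using G(3) by eventually_elim blast
    qed
    then show "(\<integral>p. lift_weight k \<epsilon> z Q p \<partial>(lborel \<Otimes>\<^sub>M lborel)) \<le> integral\<^sup>L (lborel \<Otimes>\<^sub>M lborel) G * form_size Q powr (- 7 / 2)"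
      by (simp add: mult.commute)
  qed (rule i)
qed

section \<open>Complexification in the variable tau\<close>

fun cform_at :: "quad_form \<Rightarrow> complex \<Rightarrow> complex \<Rightarrow> complex" where
  "cform_at (a, b, c) U V = (of_int a * (U\<^sup>2 + V\<^sup>2) + of_int b * U + of_int c) / V"

text \<open>Re \<tau> and Im \<tau> become independent complex variables U and V, with |\<tau>|^2
  replaced by U^2 + V^2 and \<tau> by U + \<i> V. The integration variables stay real. Each factor
  is holomorphic in U, and in V away from 0.\<close>

definition clift :: "nat \<Rightarrow> complex \<Rightarrow> complex \<Rightarrow> complex \<Rightarrow> quad_form \<Rightarrow> real \<times> real \<Rightarrow> complex" where
  "clift k z U V Q = (\<lambda>(\<eta>, u). of_real (indicator {0<..} \<eta> * \<eta> ^ (k - 1)) *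
     (cform_at Q U V * form_eval Q (U + \<i> * V) 1 ^ (k - 1) *
       (exp (2 * of_real pi * \<i> * of_int (disc Q) * Complex u \<eta>) * exp (- (4 * of_real pi * of_real \<eta> * (cform_at Q U V)\<^sup>2)))) *
     hker (real k - 1 / 2) z (Complex u \<eta>))"

lemma cform_at_real: "cform_at Q (of_real (Re \<tau>)) (of_real (Im \<tau>)) = of_real (form_at Q \<tau>)"
  by (cases Q) (simp add: cmod_power2)

lemma clift_real: "clift k z (of_real (Re \<tau>)) (of_real (Im \<tau>)) Q = lift_integrand k z \<tau> Q"
proof -
  have "of_real (Re \<tau>) + \<i> * of_real (Im \<tau>) = \<tau>" by (rule complex_eq[symmetric])
  then show ?thesis
    unfolding clift_def lift_integrand_def cform_at_real gauss_wt_def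
    by (auto simp: fun_eq_iff exp_of_real[symmetric])
qed

lemma clift_measurable:
  assumes z: "Im z > 0"
  shows "clift k z U V Q \<in> borel_measurable (lborel \<Otimes>\<^sub>M lborel)"
proof -
  note [measurable] = hker_measurable[OF z, of "real k - 1 / 2"]
  have "clift k z U V Q = (\<lambda>p. of_real (fst p ^ (k - 1)) *
     (cform_at Q U V * form_eval Q (U + \<i> * V) 1 ^ (k - 1) *
       (exp (2 * of_real pi * \<i> * of_int (disc Q) * Complex (snd p) (fst p)) * exp (- (4 * of_real pi * of_real (fst p) * (cform_at Q U V)\<^sup>2)))) *
     (of_real (indicator {0<..} (fst p)) * hker (real k - 1 / 2) z (Complex (snd p) (fst p))))"
    by (auto simp: clift_def fun_eq_iff)
  also have "\<dots> \<in> borel_measurable (lborel \<Otimes>\<^sub>M lborel)" by measurable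
  finally show ?thesis .
qed

text \<open>Near a real point the coefficients of a, b, c in \<open>cform_at\<close> and
  \<open>form_eval\<close> move by less than \<delta>, so the values move by at most \<delta> times
  the size. The real part of the squared \<open>cform_at\<close> then drops so little that the
  positive definite form keeps half of its lower bound.\<close>

lemma clift_bound:
  assumes \<tau>: "Im \<tau> > 0" and k: "k \<ge> 1"
  obtains r C \<epsilon> where "r > 0" "C > 0" "\<epsilon> > 0"
    "\<And>z U V Q p. U \<in> ball (of_real (Re \<tau>)) r \<Longrightarrow> V \<in> ball (of_real (Im \<tau>)) r \<Longrightarrow>
       V \<noteq> 0 \<and> norm (clift k z U V Q p) \<le> C * lift_weight k \<epsilon> z Q p"
proof -
  obtain \<kappa> where \<kappa>: "\<kappa> > 0" "\<And>Q. \<kappa> * form_size Q ^ 2 \<le> of_int (disc Q) + 2 * (form_at Q \<tau>)\<^sup>2"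
    using form_norm_lower[OF \<tau>] by blast
  obtain C where C: "C \<ge> 1" "\<And>Q. \<bar>form_at Q \<tau>\<bar> \<le> C * form_size Q" "\<And>Q. cmod (form_eval Q \<tau> 1) \<le> C * form_size Q"
    using form_upper[OF \<tau>] by blast
  \<comment> \<open>The square of \<open>cform_at\<close> changes by at most \<delta> (2 C + 1) n^2;
    this choice makes the loss in D + 2 t^2 at most \<kappa>/2 times n^2.\<close>
  define \<delta> where "\<delta> = min 1 (\<kappa> / (4 * (2 * C + 1)))"
  have \<delta>: "0 < \<delta>" "\<delta> \<le> 1" "2 * \<delta> * (2 * C + 1) \<le> \<kappa> / 2"
  proof -
    have "\<delta> \<le> \<kappa> / (4 * (2 * C + 1))" by (simp add: \<delta>_def)
    then have "\<delta> * (4 * (2 * C + 1)) \<le> \<kappa>" using C(1) by (simp add: pos_le_divide_eq)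
    then show "2 * \<delta> * (2 * C + 1) \<le> \<kappa> / 2" by (simp add: algebra_simps)
  qed (use \<kappa> C(1) in \<open>auto simp: \<delta>_def\<close>)
  define x y where "x = complex_of_real (Re \<tau>)" and "y = complex_of_real (Im \<tau>)"
  have y: "y \<noteq> 0" using \<tau> by (simp add: y_def)
  have xy: "x + \<i> * y = \<tau>" unfolding x_def y_def by (rule complex_eq[symmetric])
  let ?F = "nhds x \<times>\<^sub>F nhds y"
  have t1: "(fst \<longlongrightarrow> x) ?F" and t2: "(snd \<longlongrightarrow> y) ?F"
    by (rule filterlim_fst) (rule filterlim_snd)
  have cl: "\<forall>\<^sub>F p in ?F. dist (g p) l < \<delta>" if "(g \<longlongrightarrow> l) ?F" for g :: "complex \<times> complex \<Rightarrow> complex" and l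
    using that \<delta>(1) by (rule tendstoD)
  have "\<forall>\<^sub>F p in ?F. snd p \<noteq> 0 \<and> dist (((fst p)\<^sup>2 + (snd p)\<^sup>2) / snd p) ((x\<^sup>2 + y\<^sup>2) / y) < \<delta> \<and> dist (fst p / snd p) (x / y) < \<delta>
      \<and> dist (1 / snd p) (1 / y) < \<delta> \<and> dist ((fst p + \<i> * snd p)\<^sup>2) ((x + \<i> * y)\<^sup>2) < \<delta> \<and> dist (fst p + \<i> * snd p) (x + \<i> * y) < \<delta>"
    by (intro eventually_conj cl tendsto_intros t1 t2 y tendsto_imp_eventually_ne[OF t2])
  then obtain P1 P2 where ev: "eventually P1 (nhds x)" "eventually P2 (nhds y)"
    and P12: "\<And>U V :: complex. P1 U \<Longrightarrow> P2 V \<Longrightarrow> V \<noteq> 0 \<and> dist ((U\<^sup>2 + V\<^sup>2) / V) ((x\<^sup>2 + y\<^sup>2) / y) < \<delta> \<and> dist (U / V) (x / y) < \<delta>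
      \<and> dist (1 / V) (1 / y) < \<delta> \<and> dist ((U + \<i> * V)\<^sup>2) ((x + \<i> * y)\<^sup>2) < \<delta> \<and> dist (U + \<i> * V) (x + \<i> * y) < \<delta>"
    unfolding eventually_prod_filter by auto
  obtain r1 r2 where r: "r1 > 0" "\<And>U. dist U x < r1 \<Longrightarrow> P1 U" "r2 > 0" "\<And>V. dist V y < r2 \<Longrightarrow> P2 V"
    using ev unfolding eventually_nhds_metric by blast
  show ?thesis
  \<comment> \<open>(C + 1)^k covers one factor \<open>cform_at\<close> and k - 1 factors
    \<open>form_eval\<close>; pi \<kappa> is 2 pi times the surviving \<kappa>/2.\<close>
  proof (rule that[of "min r1 r2" "(C + 1) ^ k" "pi * \<kappa>"])
    fix z U V :: complex and Q :: quad_form and p :: "real \<times> real"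
    assume "U \<in> ball (of_real (Re \<tau>)) (min r1 r2)" "V \<in> ball (of_real (Im \<tau>)) (min r1 r2)"
    then have "P1 U" "P2 V" using r by (auto simp: dist_commute x_def y_def)
    note N = P12[OF this]
    obtain a b c where Q: "Q = (a, b, c)" by (cases Q)
    define n where "n = form_size Q"
    have n: "n \<ge> 0" "n = \<bar>of_int a\<bar> + \<bar>of_int b\<bar> + \<bar>of_int c\<bar>" by (auto simp: n_def Q form_size_def)
    have lin: "norm (of_int a * \<alpha> + of_int b * \<beta> + of_int c * \<gamma>) \<le> \<delta> * n" if "norm \<alpha> \<le> \<delta>" "norm \<beta> \<le> \<delta>" "norm \<gamma> \<le> \<delta>" for \<alpha> \<beta> \<gamma> :: complex
    proof -
      have "norm (of_int a * \<alpha> + of_int b * \<beta> + of_int c * \<gamma>) \<le> norm (of_int a * \<alpha>) + norm (of_int b * \<beta>) + norm (of_int c * \<gamma>)"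
        by (intro norm_triangle_mono norm_triangle_ineq) auto
      also have "\<dots> \<le> \<bar>of_int a\<bar> * \<delta> + \<bar>of_int b\<bar> * \<delta> + \<bar>of_int c\<bar> * \<delta>"
        unfolding norm_mult norm_of_int using that by (intro add_mono mult_left_mono) auto
      finally show ?thesis by (simp add: n algebra_simps)
    qed
    define t t0 P where "t = cform_at Q U V" and "t0 = form_at Q \<tau>" and "P = form_eval Q (U + \<i> * V) 1"
    have td: "norm (t - of_real t0) \<le> \<delta> * n"
    proof -
      have "t - of_real t0 = of_int a * ((U\<^sup>2 + V\<^sup>2) / V - (x\<^sup>2 + y\<^sup>2) / y) + of_int b * (U / V - x / y) + of_int c * (1 / V - 1 / y)"
        unfolding t_def t0_def cform_at_real[symmetric] Q cform_at.simps x_def[symmetric] y_def[symmetric]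
        by (simp add: divide_inverse algebra_simps)
      then show ?thesis using lin N by (simp add: dist_norm less_imp_le)
    qed
    have Pd: "norm (P - form_eval Q \<tau> 1) \<le> \<delta> * n"
    proof -
      have "P - form_eval Q \<tau> 1 = of_int a * ((U + \<i> * V)\<^sup>2 - (x + \<i> * y)\<^sup>2) + of_int b * ((U + \<i> * V) - (x + \<i> * y)) + of_int c * 0"
        unfolding P_def Q form_eval.simps xy by (simp add: algebra_simps)
      then show ?thesis using lin[of "(U + \<i> * V)\<^sup>2 - (x + \<i> * y)\<^sup>2" "(U + \<i> * V) - (x + \<i> * y)" 0] N \<delta>(1) by (simp add: dist_norm less_imp_le)
    qed
    have dn: "\<delta> * n \<le> n" using \<delta>(2) n(1) by (simp add: mult_left_le_one_le \<delta>(1) less_imp_le)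
    have tn: "norm t \<le> (C + 1) * n"
      using norm_triangle_ineq2[of t "of_real t0"] td dn C(2)[of Q] by (simp add: t0_def n_def algebra_simps)
    have Pn: "norm P \<le> (C + 1) * n"
      using norm_triangle_ineq2[of P "form_eval Q \<tau> 1"] Pd dn C(3)[of Q] by (simp add: n_def algebra_simps)
    have sq: "t0\<^sup>2 - Re (t\<^sup>2) \<le> \<delta> * (2 * C + 1) * n\<^sup>2"
    proof -
      have "norm (t\<^sup>2 - of_real t0 ^ 2) = norm (t - of_real t0) * norm (t + of_real t0)"
        unfolding norm_mult[symmetric] by (simp add: power2_eq_square algebra_simps)
      also have "\<dots> \<le> (\<delta> * n) * ((2 * C + 1) * n)"
        using td tn C(2)[of Q] norm_triangle_ineq[of t "of_real t0"] n \<delta>(1)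
        by (intro mult_mono) (auto simp: t0_def n_def algebra_simps)
      finally have "norm (t\<^sup>2 - of_real t0 ^ 2) \<le> \<delta> * (2 * C + 1) * n\<^sup>2" by (simp add: power2_eq_square mult_ac)
      moreover have "t0\<^sup>2 - Re (t\<^sup>2) \<le> norm (t\<^sup>2 - of_real t0 ^ 2)"
        using abs_Re_le_cmod[of "t\<^sup>2 - of_real t0 ^ 2"] by (simp add: of_real_power[symmetric] del: of_real_power)
      ultimately show ?thesis by linarith
    qed
    have main: "\<kappa> / 2 * n\<^sup>2 \<le> of_int (disc Q) + 2 * Re (t\<^sup>2)"
    proof -
      have "2 * (\<delta> * (2 * C + 1) * n\<^sup>2) \<le> \<kappa> / 2 * n\<^sup>2" using mult_right_mono[OF \<delta>(3), of "n\<^sup>2"] by simp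
      then show ?thesis using \<kappa>(2)[of Q] sq by (simp add: n_def t0_def)
    qed
    have "norm (clift k z U V Q p) \<le> (C + 1) ^ k * lift_weight k (pi * \<kappa>) z Q p"
    proof (cases "fst p > 0")
      case True
      define \<eta> u where "\<eta> = fst p" and "u = snd p"
      have \<eta>: "\<eta> > 0" using True by (simp add: \<eta>_def)
      have W: "norm (exp (2 * of_real pi * \<i> * of_int (disc Q) * Complex u \<eta>) * exp (- (4 * of_real pi * of_real \<eta> * t\<^sup>2))) \<le> exp (- (pi * \<kappa> * \<eta> * n\<^sup>2))"
      proof -
        have "norm (exp (2 * of_real pi * \<i> * of_int (disc Q) * Complex u \<eta>) * exp (- (4 * of_real pi * of_real \<eta> * t\<^sup>2)))
          = exp (- (2 * pi * \<eta> * (of_int (disc Q) + 2 * Re (t\<^sup>2))))"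
          unfolding norm_mult norm_exp_eq_Re by (simp add: exp_add[symmetric] algebra_simps)
        also have "\<dots> \<le> exp (- (pi * \<kappa> * \<eta> * n\<^sup>2))"
          using mult_left_mono[OF main, of "2 * pi * \<eta>"] \<eta> by (simp add: mult_ac)
        finally show ?thesis .
      qed
      have "norm (t * P ^ (k - 1)) \<le> ((C + 1) * n) ^ k"
      proof -
        have "norm (t * P ^ (k - 1)) \<le> ((C + 1) * n) * ((C + 1) * n) ^ (k - 1)"
          unfolding norm_mult norm_power using C(1) n(1) by (intro mult_mono power_mono tn Pn) auto
        also have "\<dots> = ((C + 1) * n) ^ k" using k by (metis One_nat_def Suc_pred less_eq_Suc_le power_Suc)
        finally show ?thesis .
      qed
      then have "norm (t * P ^ (k - 1)) * norm (exp (2 * of_real pi * \<i> * of_int (disc Q) * Complex u \<eta>) * exp (- (4 * of_real pi * of_real \<eta> * t\<^sup>2)))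
          \<le> ((C + 1) * n) ^ k * exp (- (pi * \<kappa> * \<eta> * n\<^sup>2))"
        using W C(1) n(1) by (intro mult_mono) auto
      then have "\<eta> ^ (k - 1) * (norm (t * P ^ (k - 1)) * norm (exp (2 * of_real pi * \<i> * of_int (disc Q) * Complex u \<eta>) * exp (- (4 * of_real pi * of_real \<eta> * t\<^sup>2)))) * norm (hker (real k - 1 / 2) z (Complex u \<eta>))
          \<le> \<eta> ^ (k - 1) * (((C + 1) * n) ^ k * exp (- (pi * \<kappa> * \<eta> * n\<^sup>2))) * norm (hker (real k - 1 / 2) z (Complex u \<eta>))"
        using \<eta> by (intro mult_right_mono mult_left_mono) auto
      moreover have "norm (clift k z U V Q p) = \<eta> ^ (k - 1) * (norm (t * P ^ (k - 1)) * norm (exp (2 * of_real pi * \<i> * of_int (disc Q) * Complex u \<eta>) * exp (- (4 * of_real pi * of_real \<eta> * t\<^sup>2)))) * norm (hker (real k - 1 / 2) z (Complex u \<eta>))"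
        using \<eta> by (simp only: clift_def case_prod_unfold norm_mult norm_of_real \<eta>_def[symmetric] u_def[symmetric] t_def[symmetric] P_def[symmetric]) (simp add: abs_mult)
      moreover have "(C + 1) ^ k * lift_weight k (pi * \<kappa>) z Q p = \<eta> ^ (k - 1) * (((C + 1) * n) ^ k * exp (- (pi * \<kappa> * \<eta> * n\<^sup>2))) * norm (hker (real k - 1 / 2) z (Complex u \<eta>))"
        using \<eta> by (simp add: lift_weight_def case_prod_unfold \<eta>_def[symmetric] u_def[symmetric] n_def[symmetric] power_mult_distrib mult_ac)
      ultimately show ?thesis by (simp only:)
    qed (simp add: clift_def lift_weight_def case_prod_unfold)
    then show "V \<noteq> 0 \<and> norm (clift k z U V Q p) \<le> (C + 1) ^ k * lift_weight k (pi * \<kappa>) z Q p" using N by blast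
  qed (use r \<kappa> C in auto)
qed

lemma lift_integrand_bound:
  assumes \<tau>: "Im \<tau> > 0" and k: "k \<ge> 1"
  obtains C \<epsilon> where "C > 0" "\<epsilon> > 0" "\<And>z Q p. norm (lift_integrand k z \<tau> Q p) \<le> C * lift_weight k \<epsilon> z Q p"
proof -
  obtain r C \<epsilon> where C: "r > 0" "C > 0" "\<epsilon> > 0"
    "\<And>z U V Q p. U \<in> ball (of_real (Re \<tau>)) r \<Longrightarrow> V \<in> ball (of_real (Im \<tau>)) r \<Longrightarrow>
       V \<noteq> 0 \<and> norm (clift k z U V Q p) \<le> C * lift_weight k \<epsilon> z Q p"
    using clift_bound[OF assms] by metis
  have "norm (lift_integrand k z \<tau> Q p) \<le> C * lift_weight k \<epsilon> z Q p" for z Q p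
    using C(4)[of "of_real (Re \<tau>)" "of_real (Im \<tau>)" z Q p] C(1) by (simp add: clift_real)
  then show ?thesis using C that by blast
qed

lemma lift_integral_zterm:
  assumes \<tau>: "Im \<tau> > 0" and z: "Im z > 0" and k: "k \<ge> 4"
  shows "integrable (lborel \<Otimes>\<^sub>M lborel) (lift_integrand k z \<tau> Q)"
    and "(\<integral>p. lift_integrand k z \<tau> Q p \<partial>(lborel \<Otimes>\<^sub>M lborel)) = lift_const k * zterm k \<tau> z Q"
proof -
  obtain C \<epsilon> where C: "C > 0" "\<epsilon> > 0" "\<And>z Q p. norm (lift_integrand k z \<tau> Q p) \<le> C * lift_weight k \<epsilon> z Q p"
    using lift_integrand_bound[OF \<tau>, of k] k by (metis order_trans one_le_numeral)
  obtain K where K: "\<And>Q. integrable (lborel \<Otimes>\<^sub>M lborel) (lift_weight k \<epsilon> z Q)"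
    using lift_weight_integral_bound[OF k z C(2)] by metis
  show i: "integrable (lborel \<Otimes>\<^sub>M lborel) (lift_integrand k z \<tau> Q)"
  proof (rule Bochner_Integration.integrable_bound)
    show "integrable (lborel \<Otimes>\<^sub>M lborel) (\<lambda>p. C * lift_weight k \<epsilon> z Q p)" using K by (rule integrable_mult_right)
    show "AE p in (lborel \<Otimes>\<^sub>M lborel). norm (lift_integrand k z \<tau> Q p) \<le> norm (C * lift_weight k \<epsilon> z Q p)"
      using order_trans[OF C(3) abs_ge_self] by simp
  qed (rule lift_integrand_measurable[OF z])
  have "(\<integral>p. lift_integrand k z \<tau> Q p \<partial>(lborel \<Otimes>\<^sub>M lborel)) = (\<integral>\<eta>. (\<integral>u. lift_integrand k z \<tau> Q (\<eta>, u) \<partial>lborel) \<partial>lborel)"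
    by (rule lborel_pair.integral_fst'[OF i, symmetric])
  then show "(\<integral>p. lift_integrand k z \<tau> Q p \<partial>(lborel \<Otimes>\<^sub>M lborel)) = lift_const k * zterm k \<tau> z Q"
    using lift_integrand_iterated[OF \<tau> z k] by simp
qed

section \<open>Summation of the lift over all forms\<close>

definition theta_lift_integrand :: "nat \<Rightarrow> complex \<Rightarrow> complex \<Rightarrow> real \<times> real \<Rightarrow> complex" where
  "theta_lift_integrand k \<tau> z = (\<lambda>(\<eta>, u). of_real (indicator {0<..} \<eta> * \<eta> ^ (k - 1)) *
     siegel_theta k \<tau> (Complex u \<eta>) * hker (real k - 1 / 2) z (Complex u \<eta>))"

text \<open>The L1 norm of the Q-th integrand is at most a multiple of size^(-7/2), which is
  summable over a lattice of rank 3, so summation and integration interchange. Dividing by the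
  nonzero \<open>lift_const\<close> gives absolute convergence of the terms.\<close>

lemma zterm_has_sum:
  assumes \<tau>: "Im \<tau> > 0" and z: "Im z > 0" and k: "k \<ge> 4"
  shows "integrable (lborel \<Otimes>\<^sub>M lborel) (theta_lift_integrand k \<tau> z)"
    and "((\<lambda>Q. lift_const k * zterm k \<tau> z Q) has_sum (\<integral>p. theta_lift_integrand k \<tau> z p \<partial>(lborel \<Otimes>\<^sub>M lborel))) UNIV"
    and "(\<lambda>Q. norm (zterm k \<tau> z Q)) summable_on UNIV"
proof -
  obtain C \<epsilon> where C: "C > 0" "\<epsilon> > 0" "\<And>z Q p. norm (lift_integrand k z \<tau> Q p) \<le> C * lift_weight k \<epsilon> z Q p"
    using lift_integrand_bound[OF \<tau>, of k] k by (metis order_trans one_le_numeral)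
  obtain K where K: "K \<ge> 0" "\<And>Q. integrable (lborel \<Otimes>\<^sub>M lborel) (lift_weight k \<epsilon> z Q)"
    "\<And>Q. (\<integral>p. lift_weight k \<epsilon> z Q p \<partial>(lborel \<Otimes>\<^sub>M lborel)) \<le> K * form_size Q powr (- 7 / 2)"
    using lift_weight_integral_bound[OF k z C(2)] by metis
  note I = lift_integral_zterm[OF \<tau> z k]
  define B where "B = (\<lambda>Q. C * K * form_size Q powr (- (7 / 2)))"
  have B: "B summable_on UNIV" unfolding B_def by (intro summable_on_cmult_right form_size_pow_summable) auto
  have bd: "(\<integral>p. norm (lift_integrand k z \<tau> Q p) \<partial>(lborel \<Otimes>\<^sub>M lborel)) \<le> B Q" for Q
  proof -
    have "(\<integral>p. norm (lift_integrand k z \<tau> Q p) \<partial>(lborel \<Otimes>\<^sub>M lborel)) \<le> (\<integral>p. C * lift_weight k \<epsilon> z Q p \<partial>(lborel \<Otimes>\<^sub>M lborel))"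
      by (rule integral_mono) (use I(1) K(2) C(3) in \<open>auto intro: integrable_norm integrable_mult_right\<close>)
    also have "\<dots> = C * (\<integral>p. lift_weight k \<epsilon> z Q p \<partial>(lborel \<Otimes>\<^sub>M lborel))" by (rule integral_mult_right_zero)
    also have "\<dots> \<le> C * (K * form_size Q powr (- 7 / 2))" using C(1) K(3) by (intro mult_left_mono) auto
    finally show ?thesis by (simp add: B_def)
  qed
  have sf: "sigma_finite_measure (lborel \<Otimes>\<^sub>M lborel :: (real \<times> real) measure)"
    by (rule lborel_pair.sigma_finite_measure_axioms)
  have pt: "(\<lambda>Q. norm (lift_integrand k z \<tau> Q p)) summable_on UNIV" for p
  proof (rule summable_on_comparison_test)
    show "(\<lambda>Q. C * lift_weight k \<epsilon> z Q p) summable_on UNIV"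
      using k by (intro summable_on_cmult_right lift_weight_pointwise_summable C) auto
  qed (use C(3) in auto)
  have eq: "(\<Sum>\<^sub>\<infinity>Q. lift_integrand k z \<tau> Q p) = theta_lift_integrand k \<tau> z p" for p
  proof -
    define A B where "A = complex_of_real (indicator {0<..} (fst p) * fst p ^ (k - 1))" and "B = hker (real k - 1 / 2) z (Complex (snd p) (fst p))"
    have "lift_integrand k z \<tau> Q p = (A * B) * (of_real (form_at Q \<tau>) * form_eval Q \<tau> 1 ^ (k - 1) * gauss_wt \<tau> (Complex (snd p) (fst p)) Q)" for Q
      by (simp add: lift_integrand_def case_prod_unfold A_def B_def mult_ac)
    then have "(\<Sum>\<^sub>\<infinity>Q. lift_integrand k z \<tau> Q p) = (A * B) * siegel_theta k \<tau> (Complex (snd p) (fst p))"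
      by (simp only: siegel_theta_def infsum_cmult_right')
    then show ?thesis by (simp add: theta_lift_integrand_def case_prod_unfold A_def B_def mult_ac)
  qed
  note S = has_sum_integral[OF sf I(1) bd B pt]
  show "integrable (lborel \<Otimes>\<^sub>M lborel) (theta_lift_integrand k \<tau> z)" using S(2) by (simp add: eq)
  show "((\<lambda>Q. lift_const k * zterm k \<tau> z Q) has_sum (\<integral>p. theta_lift_integrand k \<tau> z p \<partial>(lborel \<Otimes>\<^sub>M lborel))) UNIV"
    using S(1) by (simp add: eq I(2))
  have "(\<lambda>Q. norm (lift_const k * zterm k \<tau> z Q)) summable_on UNIV"
  proof (rule summable_on_comparison_test[OF B])
    show "norm (lift_const k * zterm k \<tau> z Q) \<le> B Q" for Q
      unfolding I(2)[symmetric] using integral_norm_bound bd order_trans by blast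
  qed auto
  then have "(\<lambda>Q. norm (lift_const k) * norm (zterm k \<tau> z Q)) summable_on UNIV" by (simp add: norm_mult)
  then show "(\<lambda>Q. norm (zterm k \<tau> z Q)) summable_on UNIV"
    using lift_const_nonzero[of k] k by (subst (asm) summable_on_cmult_right') auto
qed

section \<open>The generating function as a theta lift\<close>

text \<open>Shifting the variable by V writes Gamma(1/2; c V) as an integral over a fixed half-line
  with integrand holomorphic in V on the right half-plane: the continuation of the incomplete gamma
  factor off the real heights.\<close>

definition cgamma :: "real \<Rightarrow> complex \<Rightarrow> complex" where
  "cgamma c V = exp (- (of_real c * V)) * of_real (sqrt c) *
     (\<integral>y. 1 / csqrt (V + of_real y) * of_real (indicator {0<..} y * exp (- (c * y))) \<partial>lborel)"

lemma cgamma_integrand_bound: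
  assumes "Re V > 0"
  shows "norm (1 / csqrt (V + of_real y) * of_real (indicator {0<..} y * exp (- (c * y))))
    \<le> indicator {0<..} y * (y powr (1 / 2 - 1) * exp (- (c * y)))"
proof (cases "y > 0")
  case True
  have "y \<le> norm (V + of_real y)" using complex_Re_le_cmod[of "V + of_real y"] assms by simp
  then have "norm (V + of_real y) > 0" using True by linarith
  then have "1 / sqrt (norm (V + of_real y)) \<le> 1 / sqrt y"
    using True \<open>y \<le> norm (V + of_real y)\<close> by (intro divide_left_mono) (auto simp del: zero_less_norm_iff)
  also have "1 / sqrt y = y powr (1 / 2 - 1)" using True powr_minus_divide[of y "1 / 2"] by (simp add: powr_half_sqrt)
  finally have "1 / sqrt (norm (V + of_real y)) * exp (- (c * y)) \<le> y powr (1 / 2 - 1) * exp (- (c * y))"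
    by (intro mult_right_mono) auto
  then show ?thesis using True by (simp add: norm_mult norm_divide norm_csqrt)
qed simp

lemma csqrt_holomorphic_Re_pos: "csqrt holomorphic_on {z. Re z > 0}"
  by (intro holomorphic_intros) (auto simp: complex_nonpos_Reals_iff)

lemma csqrt_shift_measurable:
  assumes "Re V > 0"
  shows "(\<lambda>y. 1 / csqrt (V + of_real y) * of_real (indicator {0<..} y * exp (- (c * y)))) \<in> borel_measurable lborel"
proof -
  have Re: "Re (V + of_real y) > 0" if "y > 0" for y using assms that by simp
  have nz: "csqrt (V + of_real y) \<noteq> 0" if "y > 0" for y
    using Re[OF that] by (metis csqrt_eq_0 less_irrefl zero_complex.sel(1))
  have "continuous_on {0<..} (\<lambda>y. csqrt (V + of_real y))"
    by (rule continuous_on_compose2[OF holomorphic_on_imp_continuous_on[OF csqrt_holomorphic_Re_pos]])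
      (use Re in \<open>auto intro!: continuous_intros\<close>)
  then have "continuous_on {0<..} (\<lambda>y. 1 / csqrt (V + of_real y))"
    by (intro continuous_on_divide continuous_on_const) (use nz in auto)
  then have "(\<lambda>y. indicator {0<..} y *\<^sub>R (1 / csqrt (V + of_real y))) \<in> borel_measurable borel"
    by (intro borel_measurable_continuous_on_indicator) auto
  then have [measurable]: "(\<lambda>y. indicator {0<..} y *\<^sub>R (1 / csqrt (V + of_real y))) \<in> borel_measurable lborel" by simp
  have "(\<lambda>y. 1 / csqrt (V + of_real y) * of_real (indicator {0<..} y * exp (- (c * y))))
     = (\<lambda>y. (indicator {0<..} y *\<^sub>R (1 / csqrt (V + of_real y))) * of_real (exp (- (c * y))))"
    by (auto simp: indicator_def fun_eq_iff)
  also have "\<dots> \<in> borel_measurable lborel" by measurable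
  finally show ?thesis .
qed

text \<open>|V + y| \<ge> y reduces the integral to Gamma(1/2) c^(-1/2). The factor exp(-c Re V)
  must be kept, since it restores the positive definite form in the exponent.\<close>

lemma norm_cgamma_le:
  assumes V: "Re V > 0" and c: "c > 0"
  shows "norm (cgamma c V) \<le> sqrt pi * exp (- (c * Re V))"
proof -
  note G = gamma_integrable_real[of "1 / 2" c, unfolded has_bochner_integral_iff]
  have "norm (\<integral>y. 1 / csqrt (V + of_real y) * of_real (indicator {0<..} y * exp (- (c * y))) \<partial>lborel)
    \<le> (\<integral>y. indicator {0<..} y * (y powr (1 / 2 - 1) * exp (- (c * y))) \<partial>lborel)"
  proof (rule order_trans[OF integral_norm_bound integral_mono])
    show G': "integrable lborel (\<lambda>y. indicator {0<..} y * (y powr (1 / 2 - 1) * exp (- (c * y))))" using G c by simp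
    show "integrable lborel (\<lambda>y. norm (1 / csqrt (V + of_real y) * of_real (indicator {0<..} y * exp (- (c * y)))))"
      by (rule integrable_norm, rule Bochner_Integration.integrable_bound[OF G' csqrt_shift_measurable[OF V]])
        (use order_trans[OF cgamma_integrand_bound[OF V] abs_ge_self] in auto)
  qed (rule cgamma_integrand_bound[OF V])
  also have "\<dots> = sqrt pi * c powr (- (1 / 2))" using G c by (simp add: Gamma_one_half_real)
  also have "\<dots> = sqrt pi / sqrt c" using c by (simp add: powr_minus_divide powr_half_sqrt)
  finally have le: "norm (\<integral>y. 1 / csqrt (V + of_real y) * of_real (indicator {0<..} y * exp (- (c * y))) \<partial>lborel) \<le> sqrt pi / sqrt c" .
  have "norm (cgamma c V) = exp (- (c * Re V)) * sqrt c * norm (\<integral>y. 1 / csqrt (V + of_real y) * of_real (indicator {0<..} y * exp (- (c * y))) \<partial>lborel)"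
    unfolding cgamma_def norm_mult norm_exp_eq_Re norm_of_real using c by simp
  also have "\<dots> \<le> exp (- (c * Re V)) * sqrt c * (sqrt pi / sqrt c)" using le c by (intro mult_left_mono) auto
  finally have "norm (cgamma c V) \<le> exp (- (c * Re V)) * sqrt c * (sqrt pi / sqrt c)" .
  then show ?thesis using c by (simp add: mult.commute)
qed

lemma cgamma_holomorphic:
  assumes c: "c > 0"
  shows "cgamma c holomorphic_on {V. Re V > 0}"
proof -
  note G = gamma_integrable_real[of "1 / 2" c, unfolded has_bochner_integral_iff]
  have "(\<lambda>V. \<integral>y. 1 / csqrt (V + of_real y) * of_real (indicator {0<..} y * exp (- (c * y))) \<partial>lborel) holomorphic_on {V. Re V > 0}"
  proof (rule holomorphic_on_parameter_integral)
    show "open {V. Re V > 0}" by (rule open_halfspace_Re_gt)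
    show "integrable lborel (\<lambda>y. indicator {0<..} y * (y powr (1 / 2 - 1) * exp (- (c * y))))" using G c by simp
    fix y :: real
    show "(\<lambda>V. 1 / csqrt (V + of_real y) * of_real (indicator {0<..} y * exp (- (c * y)))) holomorphic_on {V. Re V > 0}"
    proof (cases "y > 0")
      case True
      have "(\<lambda>V. csqrt (V + of_real y)) holomorphic_on {V. Re V > 0}"
        by (rule holomorphic_on_compose_gen[OF _ csqrt_holomorphic_Re_pos, unfolded o_def]) (use True in \<open>auto intro!: holomorphic_intros\<close>)
      moreover have "V + of_real y \<noteq> 0" if "Re V > 0" for V using that True by (auto simp: complex_eq_iff)
      ultimately show ?thesis by (intro holomorphic_on_mult holomorphic_on_divide holomorphic_on_const) auto
    qed simp
  qed (use csqrt_shift_measurable cgamma_integrand_bound in auto)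
  then show ?thesis unfolding cgamma_def by (intro holomorphic_intros)
qed

lemma cgamma_real:
  assumes v: "v > 0" and c: "c > 0"
  shows "cgamma c (of_real v) = of_real (upper_incomplete_gamma (1 / 2) (c * v))"
proof -
  have "upper_incomplete_gamma (1 / 2) (c * v) = sqrt c * (\<integral>x. indicator {v<..} x * (x powr (- 1 / 2) * exp (- (c * x))) \<partial>lborel)"
    by (rule upper_incomplete_gamma_half(2)[OF c v])
  also have "(\<integral>x. indicator {v<..} x * (x powr (- 1 / 2) * exp (- (c * x))) \<partial>lborel)
    = \<bar>1\<bar> *\<^sub>R (\<integral>y. indicator {v<..} (v + 1 * y) * ((v + 1 * y) powr (- 1 / 2) * exp (- (c * (v + 1 * y)))) \<partial>lborel)"
    by (rule lborel_integral_real_affine) simp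
  also have "\<dots> = (\<integral>y. exp (- (c * v)) * (indicator {0<..} y * (1 / sqrt (v + y) * exp (- (c * y)))) \<partial>lborel)"
    unfolding abs_one scaleR_one
  proof (intro Bochner_Integration.integral_cong refl)
    fix y :: real
    show "indicator {v<..} (v + 1 * y) * ((v + 1 * y) powr (- 1 / 2) * exp (- (c * (v + 1 * y))))
      = exp (- (c * v)) * (indicator {0<..} y * (1 / sqrt (v + y) * exp (- (c * y))))"
    proof (cases "y > 0")
      case True
      have "(v + y) powr (- 1 / 2) = 1 / sqrt (v + y)"
        using True v powr_minus_divide[of "v + y" "1 / 2"] by (simp add: powr_half_sqrt)
      moreover have "exp (- (c * (v + y))) = exp (- (c * v)) * exp (- (c * y))" by (simp add: exp_add[symmetric] algebra_simps)
      ultimately show ?thesis using True by simp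
    qed simp
  qed
  also have "\<dots> = exp (- (c * v)) * (\<integral>y. indicator {0<..} y * (1 / sqrt (v + y) * exp (- (c * y))) \<partial>lborel)"
    by (rule integral_mult_right_zero)
  finally have "complex_of_real (upper_incomplete_gamma (1 / 2) (c * v)) = of_real (exp (- (c * v))) * of_real (sqrt c) *
      of_real (\<integral>y. indicator {0<..} y * (1 / sqrt (v + y) * exp (- (c * y))) \<partial>lborel)" by simp
  also have "complex_of_real (\<integral>y. indicator {0<..} y * (1 / sqrt (v + y) * exp (- (c * y))) \<partial>lborel)
    = (\<integral>y. 1 / csqrt (of_real v + of_real y) * of_real (indicator {0<..} y * exp (- (c * y))) \<partial>lborel)"
    unfolding integral_complex_of_real[symmetric]
  proof (intro Bochner_Integration.integral_cong refl)
    fix y :: real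
    show "complex_of_real (indicator {0<..} y * (1 / sqrt (v + y) * exp (- (c * y)))) = 1 / csqrt (of_real v + of_real y) * of_real (indicator {0<..} y * exp (- (c * y)))"
    proof (cases "y > 0")
      case True
      have "csqrt (of_real v + of_real y) = of_real (sqrt (v + y))"
        unfolding of_real_add[symmetric] using True v by simp
      then show ?thesis using True by simp
    qed simp
  qed
  finally show ?thesis by (simp add: cgamma_def exp_of_real[symmetric])
qed

text \<open>Complexification in z of the nonholomorphic term: U + \<i> V replaces z and V replaces
  Im z. The holomorphic term needs only evaluation at U + \<i> V.\<close>

definition cgterm :: "nat \<Rightarrow> complex \<Rightarrow> complex \<Rightarrow> complex \<Rightarrow> quad_form \<Rightarrow> complex" where
  "cgterm k \<tau> U V Q = - of_real (1 / sqrt pi) * (of_real (sgn (form_at Q \<tau>)) * form_eval Q \<tau> 1 ^ (k - 1)) *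
     cgamma (4 * pi * (form_at Q \<tau>)\<^sup>2) V * exp (2 * of_real pi * \<i> * of_int (disc Q) * (U + \<i> * V))"

definition gterm :: "nat \<Rightarrow> complex \<Rightarrow> complex \<Rightarrow> quad_form \<Rightarrow> complex" where
  "gterm k \<tau> z Q = - of_real (1 / sqrt pi) *
     (of_real (sgn (form_at Q \<tau>)) * form_eval Q \<tau> 1 ^ (k - 1) *
        of_real (upper_incomplete_gamma (1 / 2) (4 * pi * (form_at Q \<tau>)\<^sup>2 * Im z))) *
     exp (2 * of_real pi * \<i> * of_int (disc Q) * z)"

definition fterm :: "nat \<Rightarrow> complex \<Rightarrow> complex \<Rightarrow> quad_form \<Rightarrow> complex" where
  "fterm k \<tau> z Q = (if disc Q > 0 then
     of_real (2 / incomplete_beta 1 (real k - 1 / 2) (1 / 2)) *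
     (of_real (sgn (form_at Q \<tau>)) * form_eval Q \<tau> 1 ^ (k - 1) *
        of_real (psi_fun k (of_int (disc Q) * (Im \<tau>)\<^sup>2 / (cmod (form_eval Q \<tau> 1))\<^sup>2))) *
     exp (2 * of_real pi * \<i> * of_int (disc Q) * z) else 0)"

lemma zterm_split: "zterm k \<tau> z Q = fterm k \<tau> z Q + gterm k \<tau> z Q"
  by (simp add: zterm_def fterm_def gterm_def algebra_simps)

lemma cgterm_real:
  assumes "Im z > 0"
  shows "cgterm k \<tau> (of_real (Re z)) (of_real (Im z)) Q = gterm k \<tau> z Q"
proof (cases "form_at Q \<tau> = 0")
  case False
  have "of_real (Re z) + \<i> * of_real (Im z) = z" by (rule complex_eq[symmetric])
  moreover have "cgamma (4 * pi * (form_at Q \<tau>)\<^sup>2) (of_real (Im z)) = of_real (upper_incomplete_gamma (1 / 2) (4 * pi * (form_at Q \<tau>)\<^sup>2 * Im z))"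
    by (rule cgamma_real) (use assms False in auto)
  ultimately show ?thesis by (simp only: cgterm_def gterm_def mult.assoc)
qed (simp add: cgterm_def gterm_def)

lemma abs_disc_le: "\<bar>real_of_int (disc Q)\<bar> \<le> 4 * (form_size Q)\<^sup>2"
proof -
  obtain a b c where Q: "Q = (a, b, c)" by (cases Q)
  define A B C where "A = \<bar>real_of_int a\<bar>" and "B = \<bar>real_of_int b\<bar>" and "C = \<bar>real_of_int c\<bar>"
  have "real_of_int (disc Q) = (of_int b)\<^sup>2 - 4 * of_int a * of_int c" by (simp add: disc_def Q)
  then have "\<bar>real_of_int (disc Q)\<bar> \<le> \<bar>(of_int b)\<^sup>2\<bar> + \<bar>4 * of_int a * of_int c\<bar>" by (metis abs_triangle_ineq4)
  also have "\<dots> = B\<^sup>2 + 4 * (A * C)" by (simp add: A_def B_def C_def abs_mult)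
  also have "\<dots> \<le> 4 * (A + B + C)\<^sup>2"
  proof -
    have "0 \<le> A * B" "0 \<le> A * C" "0 \<le> B * C" by (auto simp: A_def B_def C_def)
    then show ?thesis by (simp add: power2_sum algebra_simps)
  qed
  finally show ?thesis by (simp add: form_size_def Q A_def B_def C_def)
qed

text \<open>The exponentials of \<open>norm_cgamma_le\<close> and of the discriminant combine to
  exp(-2 pi (D + 2 t^2) Re V). The imaginary part of U disturbs the exponent by at most 2 pi |D| |Im
  U|, where |D| \<le> 4 n^2.\<close>

lemma cgterm_bound:
  assumes \<tau>: "Im \<tau> > 0" and v0: "v0 > 0"
  obtains r C \<epsilon> where "r > 0" "\<epsilon> > 0"
    "\<And>U V Q. \<bar>Im U\<bar> < r \<Longrightarrow> Re V > v0 \<Longrightarrow> norm (cgterm k \<tau> U V Q) \<le> C * exp (- \<epsilon> * (form_size Q)\<^sup>2 + real (k - 1) * form_size Q)"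
proof -
  obtain \<kappa> where \<kappa>: "\<kappa> > 0" "\<And>Q. \<kappa> * form_size Q ^ 2 \<le> of_int (disc Q) + 2 * (form_at Q \<tau>)\<^sup>2"
    using form_norm_lower[OF \<tau>] by blast
  obtain C where C: "C \<ge> 1" "\<And>Q. \<bar>form_at Q \<tau>\<bar> \<le> C * form_size Q" "\<And>Q. cmod (form_eval Q \<tau> 1) \<le> C * form_size Q"
    using form_upper[OF \<tau>] by blast
  show ?thesis
  \<comment> \<open>For |Im U| < v0 \<kappa>/8 the disturbance uses up half of the available 2 pi v0
    \<kappa> n^2 and leaves pi v0 \<kappa> n^2.\<close>
  proof (rule that[of "v0 * \<kappa> / 8" "pi * v0 * \<kappa>" "C ^ (k - 1)"])
    fix U V :: complex and Q :: quad_form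
    assume U: "\<bar>Im U\<bar> < v0 * \<kappa> / 8" and V: "Re V > v0"
    define n t D where "n = form_size Q" and "t = form_at Q \<tau>" and "D = real_of_int (disc Q)"
    show "norm (cgterm k \<tau> U V Q) \<le> C ^ (k - 1) * exp (- (pi * v0 * \<kappa>) * (form_size Q)\<^sup>2 + real (k - 1) * form_size Q)"
    proof (cases "t = 0")
      case False
      have P: "norm (form_eval Q \<tau> 1 ^ (k - 1)) \<le> C ^ (k - 1) * exp (real (k - 1) * n)"
      proof -
        have "norm (form_eval Q \<tau> 1 ^ (k - 1)) \<le> (C * n) ^ (k - 1)"
          unfolding norm_power n_def by (intro power_mono C) auto
        also have "\<dots> \<le> C ^ (k - 1) * exp (real (k - 1) * n)"
          unfolding power_mult_distrib n_def using C(1) by (intro mult_left_mono power_le_exp) auto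
        finally show ?thesis .
      qed
      have g: "norm (cgamma (4 * pi * t\<^sup>2) V) \<le> sqrt pi * exp (- (4 * pi * t\<^sup>2 * Re V))"
        by (rule norm_cgamma_le) (use V v0 False in auto)
      have ex: "- (4 * pi * t\<^sup>2 * Re V) - 2 * pi * D * (Im U + Re V) \<le> - (pi * v0 * \<kappa>) * n\<^sup>2"
      proof -
        have a: "v0 * (\<kappa> * n\<^sup>2) \<le> Re V * (D + 2 * t\<^sup>2)"
          using \<kappa>(1) \<kappa>(2)[of Q] V v0 by (intro mult_mono) (auto simp: n_def D_def t_def)
        have "\<bar>D * Im U\<bar> \<le> (4 * n\<^sup>2) * (v0 * \<kappa> / 8)"
          unfolding abs_mult using abs_disc_le[of Q] U by (intro mult_mono) (auto simp: D_def n_def)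
        then have b: "- (D * Im U) \<le> v0 * (\<kappa> * n\<^sup>2) / 2" by (simp add: abs_le_iff mult_ac)
        have "- (4 * pi * t\<^sup>2 * Re V) - 2 * pi * D * (Im U + Re V) = 2 * pi * (- (D * Im U) - Re V * (D + 2 * t\<^sup>2))"
          by (simp add: algebra_simps)
        also have "\<dots> \<le> 2 * pi * (- (v0 * (\<kappa> * n\<^sup>2) / 2))" using a b by (intro mult_left_mono) auto
        finally show ?thesis by (simp add: mult_ac)
      qed
      have "norm (cgterm k \<tau> U V Q) = 1 / sqrt pi * (norm (form_eval Q \<tau> 1 ^ (k - 1)) * norm (cgamma (4 * pi * t\<^sup>2) V)) * exp (- (2 * pi * D * (Im U + Re V)))"
        using False unfolding cgterm_def norm_mult norm_exp_eq_Re t_def[symmetric] norm_minus_cancel norm_of_real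
        by (simp add: D_def abs_sgn_eq algebra_simps)
      also have "\<dots> \<le> 1 / sqrt pi * ((C ^ (k - 1) * exp (real (k - 1) * n)) * (sqrt pi * exp (- (4 * pi * t\<^sup>2 * Re V)))) * exp (- (2 * pi * D * (Im U + Re V)))"
        using C(1) by (intro mult_right_mono mult_left_mono mult_mono P g) auto
      also have "\<dots> = C ^ (k - 1) * (exp (real (k - 1) * n) * exp (- (4 * pi * t\<^sup>2 * Re V) - 2 * pi * D * (Im U + Re V)))"
      proof -
        have "exp (- (4 * pi * t\<^sup>2 * Re V) - 2 * pi * D * (Im U + Re V)) = exp (- (4 * pi * t\<^sup>2 * Re V)) * exp (- (2 * pi * D * (Im U + Re V)))"
          by (simp add: exp_add[symmetric])
        then show ?thesis by simp
      qed
      also have "\<dots> \<le> C ^ (k - 1) * (exp (real (k - 1) * n) * exp (- (pi * v0 * \<kappa>) * n\<^sup>2))"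
        using ex C(1) by (intro mult_left_mono) auto
      finally show ?thesis by (simp add: exp_add[symmetric] n_def algebra_simps)
    qed (use C(1) in \<open>simp add: cgterm_def t_def\<close>)
  qed (use v0 \<kappa> in auto)
qed

lemma gterm_summable:
  assumes \<tau>: "Im \<tau> > 0" and z: "Im z > 0"
  shows "(\<lambda>Q. norm (gterm k \<tau> z Q)) summable_on UNIV"
proof -
  have z2: "Im z / 2 > 0" using z by simp
  obtain r C \<epsilon> where C: "r > 0" "\<epsilon> > 0"
    "\<And>U V Q. \<bar>Im U\<bar> < r \<Longrightarrow> Re V > Im z / 2 \<Longrightarrow> norm (cgterm k \<tau> U V Q) \<le> C * exp (- \<epsilon> * (form_size Q)\<^sup>2 + real (k - 1) * form_size Q)"
    using cgterm_bound[OF \<tau> z2, of k] by metis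
  show ?thesis
  proof (rule summable_on_comparison_test)
    show "(\<lambda>Q. C * exp (- \<epsilon> * (form_size Q)\<^sup>2 + real (k - 1) * form_size Q)) summable_on UNIV"
      by (intro summable_on_cmult_right gauss_form_size_summable C)
    show "norm (gterm k \<tau> z Q) \<le> C * exp (- \<epsilon> * (form_size Q)\<^sup>2 + real (k - 1) * form_size Q)" for Q
      using C(3)[of "of_real (Re z)" "of_real (Im z)" Q] C(1) z by (simp add: cgterm_real)
  qed auto
qed

text \<open>The holomorphic term is the lifted term minus the nonholomorphic one, and both of these
  are absolutely summable; this replaces an estimate of the beta values.\<close>

lemma fterm_summable:
  assumes "Im \<tau> > 0" "Im z > 0" "k \<ge> 4"
  shows "(\<lambda>Q. norm (fterm k \<tau> z Q)) summable_on UNIV"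
proof (rule summable_on_comparison_test)
  show "(\<lambda>Q. norm (zterm k \<tau> z Q) + norm (gterm k \<tau> z Q)) summable_on UNIV"
    by (intro summable_on_add zterm_has_sum(3) gterm_summable assms)
  show "norm (fterm k \<tau> z Q) \<le> norm (zterm k \<tau> z Q) + norm (gterm k \<tau> z Q)" for Q
    unfolding zterm_split by (metis add.commute norm_add_leD order_refl)
qed auto

section \<open>Regrouping by discriminant and the Fourier expansion in z\<close>

lemma has_sum_by_disc:
  fixes f :: "quad_form \<Rightarrow> complex"
  assumes "(\<lambda>Q. norm (f Q)) summable_on UNIV"
  shows "((\<lambda>D. infsum f (forms_of_disc D)) has_sum infsum f UNIV) UNIV"
proof (rule has_sum_SigmaD)
  have f: "f summable_on UNIV" using assms by (rule abs_summable_summable)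
  have "bij_betw (\<lambda>p::int \<times> quad_form. snd p) (Sigma UNIV forms_of_disc) UNIV"
    by (rule bij_betwI[where g = "\<lambda>Q. (disc Q, Q)"]) (auto simp: forms_of_disc_def disc_def)
  then show "((\<lambda>p. f (snd p)) has_sum infsum f UNIV) (Sigma UNIV forms_of_disc)"
    using has_sum_infsum[OF f] by (simp only: has_sum_reindex_bij_betw)
  show "((\<lambda>Q. f (snd (D, Q))) has_sum infsum f (forms_of_disc D)) (forms_of_disc D)" for D
    using has_sum_infsum[OF summable_on_subset_banach[OF f]] by simp
qed

lemma disc_in: "Q \<in> forms_of_disc D \<longleftrightarrow> disc Q = D"
  by (cases Q) (simp add: forms_of_disc_def disc_def)

lemma infsum_fterm_disc:
  "infsum (fterm k \<tau> z) (forms_of_disc D) = (if D > 0 then F_fun k D \<tau> * exp (2 * of_real pi * \<i> * of_int D * z) else 0)"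
proof -
  have "infsum (fterm k \<tau> z) (forms_of_disc D) = (\<Sum>\<^sub>\<infinity>Q\<in>forms_of_disc D. (if D > 0 then
     of_real (2 / incomplete_beta 1 (real k - 1 / 2) (1 / 2)) *
     (of_real (sgn (form_at Q \<tau>)) * form_eval Q \<tau> 1 ^ (k - 1) *
        of_real (psi_fun k (of_int D * (Im \<tau>)\<^sup>2 / (cmod (form_eval Q \<tau> 1))\<^sup>2))) *
     exp (2 * of_real pi * \<i> * of_int D * z) else 0))"
    by (rule infsum_cong) (simp only: fterm_def disc_in)
  also have "\<dots> = (if D > 0 then F_fun k D \<tau> * exp (2 * of_real pi * \<i> * of_int D * z) else 0)"
  proof (cases "D > 0")
    case True
    show ?thesis by (simp only: True if_True F_fun_def infsum_cmult_left' infsum_cmult_right')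
  qed simp
  finally show ?thesis .
qed

lemma infsum_gterm_disc:
  "infsum (gterm k \<tau> z) (forms_of_disc D) = G_fun k D (Im z) \<tau> * exp (2 * of_real pi * \<i> * of_int D * z)"
proof -
  have "infsum (gterm k \<tau> z) (forms_of_disc D) = (\<Sum>\<^sub>\<infinity>Q\<in>forms_of_disc D. - of_real (1 / sqrt pi) *
     (of_real (sgn (form_at Q \<tau>)) * form_eval Q \<tau> 1 ^ (k - 1) *
        of_real (upper_incomplete_gamma (1 / 2) (4 * pi * (form_at Q \<tau>)\<^sup>2 * Im z))) *
     exp (2 * of_real pi * \<i> * of_int D * z))"
    by (rule infsum_cong) (simp only: gterm_def disc_in)
  also have "\<dots> = G_fun k D (Im z) \<tau> * exp (2 * of_real pi * \<i> * of_int D * z)"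
    by (simp only: G_fun_def infsum_cmult_left' infsum_cmult_right')
  finally show ?thesis .
qed

lemma Psi_eq_infsum:
  assumes "Im \<tau> > 0" "Im z > 0" "k \<ge> 4"
  shows "Psi k \<tau> z = (\<Sum>\<^sub>\<infinity>Q. fterm k \<tau> z Q)"
proof -
  have "((\<lambda>D. infsum (fterm k \<tau> z) (forms_of_disc D)) has_sum (\<Sum>\<^sub>\<infinity>Q. fterm k \<tau> z Q)) UNIV"
    by (rule has_sum_by_disc[OF fterm_summable[OF assms]])
  then have "((\<lambda>D. F_fun k D \<tau> * exp (2 * of_real pi * \<i> * of_int D * z)) has_sum (\<Sum>\<^sub>\<infinity>Q. fterm k \<tau> z Q)) {D::int. D > 0}"
    by (subst (asm) has_sum_cong_neutral[where T = "{D::int. D > 0}" and g = "\<lambda>D. F_fun k D \<tau> * exp (2 * of_real pi * \<i> * of_int D * z)"])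
      (auto simp: infsum_fterm_disc)
  then show ?thesis unfolding Psi_def by (rule infsumI)
qed

lemma Psi_star_eq_infsum:
  assumes "Im \<tau> > 0" "Im z > 0"
  shows "Psi_star k \<tau> z = (\<Sum>\<^sub>\<infinity>Q. gterm k \<tau> z Q)"
  unfolding Psi_star_def using has_sum_by_disc[OF gterm_summable[OF assms]]
  by (simp only: infsum_gterm_disc) (rule infsumI)

lemma Psi_hat_eq_infsum:
  assumes "Im \<tau> > 0" "Im z > 0" "k \<ge> 4"
  shows "Psi_hat k \<tau> z = (\<Sum>\<^sub>\<infinity>Q. zterm k \<tau> z Q)"
proof -
  have "(\<Sum>\<^sub>\<infinity>Q. zterm k \<tau> z Q) = (\<Sum>\<^sub>\<infinity>Q. fterm k \<tau> z Q + gterm k \<tau> z Q)"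
    by (rule infsum_cong) (rule zterm_split)
  also have "\<dots> = (\<Sum>\<^sub>\<infinity>Q. fterm k \<tau> z Q) + (\<Sum>\<^sub>\<infinity>Q. gterm k \<tau> z Q)"
    by (rule infsum_add[OF abs_summable_summable[OF fterm_summable[OF assms]] abs_summable_summable[OF gterm_summable[OF assms(1,2)]]])
  finally have "(\<Sum>\<^sub>\<infinity>Q. zterm k \<tau> z Q) = (\<Sum>\<^sub>\<infinity>Q. fterm k \<tau> z Q) + (\<Sum>\<^sub>\<infinity>Q. gterm k \<tau> z Q)" .
  then show ?thesis unfolding Psi_hat_def using Psi_eq_infsum[OF assms] Psi_star_eq_infsum[OF assms(1,2)] by simp
qed

lemma Psi_hat_eq_integral:
  assumes "Im \<tau> > 0" "Im z > 0" "k \<ge> 4"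
  shows "lift_const k * Psi_hat k \<tau> z = (\<integral>p. theta_lift_integrand k \<tau> z p \<partial>(lborel \<Otimes>\<^sub>M lborel))"
proof -
  have "(\<Sum>\<^sub>\<infinity>Q. lift_const k * zterm k \<tau> z Q) = (\<integral>p. theta_lift_integrand k \<tau> z p \<partial>(lborel \<Otimes>\<^sub>M lborel))"
    by (rule infsumI[OF zterm_has_sum(2)[OF assms]])
  then show ?thesis by (simp only: infsum_cmult_right' Psi_hat_eq_infsum[OF assms])
qed

text \<open>A discriminant is congruent to a square modulo 4, so \<open>forms_of_disc n\<close> is
  empty for the residues 2 and 3.\<close>

lemma Psi_hat_fourier:
  assumes "Im \<tau> > 0" "Im z > 0" "k \<ge> 4"
  shows "((\<lambda>n. ((if n > 0 then F_fun k n \<tau> else 0) + G_fun k n (Im z) \<tau>) * exp (2 * of_real pi * \<i> * of_int n * z)) has_sum Psi_hat k \<tau> z)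
    {n::int. [n = 0] (mod 4) \<or> [n = 1] (mod 4)}"
proof -
  have "((\<lambda>D. infsum (fterm k \<tau> z) (forms_of_disc D) + infsum (gterm k \<tau> z) (forms_of_disc D)) has_sum Psi_hat k \<tau> z) UNIV"
    unfolding Psi_hat_def Psi_eq_infsum[OF assms] Psi_star_eq_infsum[OF assms(1,2)]
    by (intro has_sum_add has_sum_by_disc fterm_summable gterm_summable assms)
  then show ?thesis
  proof (subst (asm) has_sum_cong_neutral)
    fix n :: int
    assume n: "n \<in> UNIV - {n::int. [n = 0] (mod 4) \<or> [n = 1] (mod 4)}"
    have "b\<^sup>2 - 4 * a * c \<noteq> n" for a b c
    proof
      assume "b\<^sup>2 - 4 * a * c = n"
      then have "n mod 4 = b\<^sup>2 mod 4" by (metis mod_mult_self4 mult.assoc diff_add_cancel mult.commute mod_mult_self2)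
      moreover have "b\<^sup>2 mod 4 \<in> {0, 1}"
      proof (cases "even b")
        case True
        then obtain m where "b = 2 * m" by (rule evenE)
        then show ?thesis by (simp add: power_mult_distrib)
      next
        case False
        then obtain m where "b = 2 * m + 1" by (rule oddE)
        then have "b\<^sup>2 = 1 + 4 * (m\<^sup>2 + m)" by (simp add: power2_eq_square algebra_simps)
        then have "b\<^sup>2 mod 4 = 1" by presburger
        then show ?thesis by simp
      qed
      ultimately show False using n by (auto simp: cong_def)
    qed
    then have "forms_of_disc n = {}" by (auto simp: forms_of_disc_def)
    then show "infsum (fterm k \<tau> z) (forms_of_disc n) + infsum (gterm k \<tau> z) (forms_of_disc n) = 0" by simp
  qed (auto simp: infsum_fterm_disc infsum_gterm_disc distrib_right)
qed

section \<open>Invariance under the two groups\<close>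

text \<open>The change of variables is carried out on \<open>real^2\<close>, iterated integration on
  pairs; this identifies the two Lebesgue measures.\<close>

lemma lborel_real2: "distr (lborel :: (real^2) measure) borel (\<lambda>x. (x $ 1, x $ 2)) = (lborel :: (real \<times> real) measure)"
proof (rule lborel_eqI[symmetric])
  let ?f = "\<lambda>x :: real^2. (x $ 1, x $ 2)"
  have "?f \<in> borel_measurable borel" by (intro borel_measurable_continuous_onI continuous_intros)
  then have m: "?f \<in> borel_measurable lborel" by simp
  fix l u :: "real \<times> real"
  assume le: "\<And>b. b \<in> Basis \<Longrightarrow> l \<bullet> b \<le> u \<bullet> b"
  have le': "fst l \<le> fst u" "snd l \<le> snd u" using le[of "(1, 0)"] le[of "(0, 1)"] by (simp_all add: Basis_prod_def inner_prod_def)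
  define l' u' :: "real^2" where "l' = vector [fst l, snd l]" and "u' = vector [fst u, snd u]"
  have Basis2: "(Basis :: (real^2) set) = {axis 1 1, axis 2 1}" by (auto simp: Basis_vec_def UNIV_2)
  have ne: "(axis 1 1 :: real^2) \<noteq> axis 2 1" by (simp add: axis_eq_axis)
  have "emeasure (distr lborel borel ?f) (box l u) = emeasure lborel (?f -` box l u)"
    using m by (subst emeasure_distr) auto
  also have "?f -` box l u = box l' u'"
    by (auto simp: box_def Basis2 Basis_prod_def l'_def u'_def inner_axis inner_prod_def)
  also have "emeasure lborel (box l' u') = ennreal (\<Prod>b\<in>Basis. (u' - l') \<bullet> b)"
    using le' by (intro emeasure_lborel_box) (auto simp: Basis2 l'_def u'_def inner_axis)
  also have "(\<Prod>b\<in>Basis. (u' - l') \<bullet> b) = (fst u - fst l) * (snd u - snd l)"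
    using ne by (simp add: Basis2 l'_def u'_def inner_axis)
  also have "\<dots> = (\<Prod>b\<in>Basis. (u - l) \<bullet> b)"
    by (cases u, cases l) (auto simp: Basis_prod_def prod.union_disjoint inner_prod_def)
  finally show "emeasure (distr lborel borel ?f) (box l u) = ennreal (\<Prod>b\<in>Basis. (u - l) \<bullet> b)" .
qed simp

text \<open>The real Jacobian determinant of a holomorphic map is |g'|^2. The coordinates are (Im,
  Re), matching the order (height, abscissa) of the integration variables.\<close>

lemma real2_change_of_variables:
  fixes g g' H :: "complex \<Rightarrow> complex"
  assumes S: "open S" and der: "\<And>w. w \<in> S \<Longrightarrow> (g has_field_derivative g' w) (at w)" and inj: "inj_on g S"
    and i1: "integrable (lborel \<Otimes>\<^sub>M lborel) (\<lambda>p. indicator (g ` S) (Complex (snd p) (fst p)) *\<^sub>R H (Complex (snd p) (fst p)))"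
    and i2: "integrable (lborel \<Otimes>\<^sub>M lborel) (\<lambda>p. indicator S (Complex (snd p) (fst p)) *\<^sub>R ((norm (g' (Complex (snd p) (fst p))))\<^sup>2 *\<^sub>R H (g (Complex (snd p) (fst p)))))"
  shows "(\<integral>p. indicator (g ` S) (Complex (snd p) (fst p)) *\<^sub>R H (Complex (snd p) (fst p)) \<partial>(lborel \<Otimes>\<^sub>M lborel))
    = (\<integral>p. indicator S (Complex (snd p) (fst p)) *\<^sub>R ((norm (g' (Complex (snd p) (fst p))))\<^sup>2 *\<^sub>R H (g (Complex (snd p) (fst p)))) \<partial>(lborel \<Otimes>\<^sub>M lborel))"
proof -
  define \<phi> :: "real^2 \<Rightarrow> real \<times> real" where "\<phi> = (\<lambda>x. (x $ 1, x $ 2))"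
  define \<kappa> :: "real^2 \<Rightarrow> complex" where "\<kappa> = (\<lambda>x. Complex (x $ 2) (x $ 1))"
  define \<iota> :: "complex \<Rightarrow> real^2" where "\<iota> = (\<lambda>w. vector [Im w, Re w])"
  have \<kappa>\<iota> [simp]: "\<kappa> (\<iota> w) = w" for w by (simp add: \<kappa>_def \<iota>_def)
  have \<iota>\<kappa> [simp]: "\<iota> (\<kappa> x) = x" for x by (simp add: \<kappa>_def \<iota>_def vec_eq_iff forall_2)
  have bl: "bounded_linear \<iota>"
    by (rule linear_conv_bounded_linear[THEN iffD1], rule linearI) (auto simp: \<iota>_def vec_eq_iff forall_2)
  have bk: "bounded_linear \<kappa>"
    by (rule linear_conv_bounded_linear[THEN iffD1], rule linearI) (auto simp: \<kappa>_def complex_eq_iff)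
  have "\<phi> \<in> borel_measurable borel" unfolding \<phi>_def
    by (intro borel_measurable_continuous_onI continuous_intros)
  then have m\<phi>: "\<phi> \<in> borel_measurable lborel" by simp
  have M: "lborel \<Otimes>\<^sub>M lborel = distr lborel borel \<phi>" unfolding \<phi>_def lborel_real2 by (rule lborel_prod)
  have tr: "integrable lborel (\<lambda>x. f (\<phi> x)) \<and> (\<integral>p. f p \<partial>(lborel \<Otimes>\<^sub>M lborel)) = (\<integral>x. f (\<phi> x) \<partial>lborel)"
    if f: "integrable (lborel \<Otimes>\<^sub>M lborel) f" for f :: "real \<times> real \<Rightarrow> complex"
  proof -
    have fm: "f \<in> borel_measurable borel" using borel_measurable_integrable[OF f] by (simp add: lborel_prod)
    show ?thesis
      using f unfolding M by (simp add: integrable_distr_eq[OF m\<phi> fm] integral_distr[OF m\<phi> fm])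
  qed
  have leb: "set_integrable lebesgue A (\<lambda>x. \<iota> (F x)) \<and> \<iota> (\<integral>x. indicator A x *\<^sub>R F x \<partial>lborel) = integral A (\<lambda>x. \<iota> (F x))"
    if F: "integrable lborel (\<lambda>x. indicator A x *\<^sub>R F x)" for A and F :: "real^2 \<Rightarrow> complex"
  proof -
    have 1: "integrable lborel (\<lambda>x. \<iota> (indicator A x *\<^sub>R F x))" by (rule integrable_bounded_linear[OF bl F])
    then have 2: "integrable lebesgue (\<lambda>x. \<iota> (indicator A x *\<^sub>R F x))" by (simp add: integrable_completion borel_measurable_integrable)
    have sc: "\<iota> (indicator A x *\<^sub>R F x) = indicator A x *\<^sub>R \<iota> (F x)" for x by (rule linear_scale[OF bounded_linear.linear[OF bl]])
    have 3: "set_integrable lebesgue A (\<lambda>x. \<iota> (F x))" using 2 by (simp add: set_integrable_def sc)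
    have "\<iota> (\<integral>x. indicator A x *\<^sub>R F x \<partial>lborel) = (\<integral>x. \<iota> (indicator A x *\<^sub>R F x) \<partial>lborel)"
      by (rule integral_bounded_linear[OF bl F, symmetric])
    also have "\<dots> = (\<integral>x. \<iota> (indicator A x *\<^sub>R F x) \<partial>lebesgue)"
      by (rule integral_completion[symmetric, OF borel_measurable_integrable[OF 1]])
    also have "\<dots> = integral A (\<lambda>x. \<iota> (F x))"
      using set_lebesgue_integral_eq_integral(2)[OF 3] by (simp add: set_lebesgue_integral_def sc)
    finally show ?thesis using 3 by simp
  qed
  define T where "T = \<kappa> -` S"
  define G where "G = (\<lambda>x. \<iota> (g (\<kappa> x)))"
  define G' where "G' = (\<lambda>x h. \<iota> (g' (\<kappa> x) * \<kappa> h))"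
  have op: "open T" unfolding T_def by (rule open_vimage[OF S linear_continuous_on[OF bk]])
  have GT: "x \<in> G ` T \<longleftrightarrow> \<kappa> x \<in> g ` S" for x
  proof
    assume "\<kappa> x \<in> g ` S"
    then obtain w where w: "w \<in> S" "\<kappa> x = g w" by blast
    have "x = G (\<iota> w)" unfolding G_def \<kappa>\<iota> w(2)[symmetric] \<iota>\<kappa> ..
    moreover have "\<iota> w \<in> T" using w(1) by (simp add: T_def)
    ultimately show "x \<in> G ` T" by blast
  qed (auto simp: G_def T_def)
  have \<phi>\<kappa>: "Complex (snd (\<phi> x)) (fst (\<phi> x)) = \<kappa> x" for x by (simp add: \<phi>_def \<kappa>_def)
  have derG: "(G has_derivative G' x) (at x within T)" if "x \<in> T" for x
  proof -
    have "(g has_derivative (*) (g' (\<kappa> x))) (at (\<kappa> x))"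
      using der that by (simp add: T_def has_field_derivative_def)
    then have "((\<lambda>x. g (\<kappa> x)) has_derivative (\<lambda>h. g' (\<kappa> x) * \<kappa> h)) (at x)"
      using bounded_linear_imp_has_derivative[OF bk] by (rule has_derivative_compose[rotated])
    then have "((\<lambda>x. \<iota> (g (\<kappa> x))) has_derivative (\<lambda>h. \<iota> (g' (\<kappa> x) * \<kappa> h))) (at x)"
      by (rule bounded_linear.has_derivative[OF bl])
    then show ?thesis unfolding G_def G'_def by (rule has_derivative_at_withinI)
  qed
  have injG: "inj_on G T"
  proof (rule inj_onI)
    fix x y assume "x \<in> T" "y \<in> T" "G x = G y"
    then have "g (\<kappa> x) = g (\<kappa> y)" by (metis G_def \<kappa>\<iota>)
    then have "\<kappa> x = \<kappa> y" using inj \<open>x \<in> T\<close> \<open>y \<in> T\<close> by (auto simp: T_def dest: inj_onD)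
    then show "x = y" by (metis \<iota>\<kappa>)
  qed
  have det: "\<bar>det (matrix (G' x))\<bar> = (norm (g' (\<kappa> x)))\<^sup>2" for x
  proof -
    have "det (matrix (G' x)) = Re (g' (\<kappa> x)) * Re (g' (\<kappa> x)) + Im (g' (\<kappa> x)) * Im (g' (\<kappa> x))"
      by (simp add: det_2 matrix_def G'_def \<iota>_def \<kappa>_def axis_def)
    then show ?thesis by (simp only: cmod_power2) (simp add: power2_eq_square)
  qed
  have I1: "integrable lborel (\<lambda>x. indicator (G ` T) x *\<^sub>R H (\<kappa> x))"
    and E1: "(\<integral>p. indicator (g ` S) (Complex (snd p) (fst p)) *\<^sub>R H (Complex (snd p) (fst p)) \<partial>(lborel \<Otimes>\<^sub>M lborel)) = (\<integral>x. indicator (G ` T) x *\<^sub>R H (\<kappa> x) \<partial>lborel)"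
  proof -
    have eq: "indicator (g ` S) (Complex (snd (\<phi> x)) (fst (\<phi> x))) *\<^sub>R H (Complex (snd (\<phi> x)) (fst (\<phi> x))) = indicator (G ` T) x *\<^sub>R H (\<kappa> x)" for x
      unfolding \<phi>\<kappa> by (simp add: indicator_def GT)
    show "integrable lborel (\<lambda>x. indicator (G ` T) x *\<^sub>R H (\<kappa> x))"
      "(\<integral>p. indicator (g ` S) (Complex (snd p) (fst p)) *\<^sub>R H (Complex (snd p) (fst p)) \<partial>(lborel \<Otimes>\<^sub>M lborel)) = (\<integral>x. indicator (G ` T) x *\<^sub>R H (\<kappa> x) \<partial>lborel)"
      using tr[OF i1] unfolding eq by blast+
  qed
  have I2: "integrable lborel (\<lambda>x. indicator T x *\<^sub>R ((norm (g' (\<kappa> x)))\<^sup>2 *\<^sub>R H (g (\<kappa> x))))"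
    and E2: "(\<integral>p. indicator S (Complex (snd p) (fst p)) *\<^sub>R ((norm (g' (Complex (snd p) (fst p))))\<^sup>2 *\<^sub>R H (g (Complex (snd p) (fst p)))) \<partial>(lborel \<Otimes>\<^sub>M lborel))
      = (\<integral>x. indicator T x *\<^sub>R ((norm (g' (\<kappa> x)))\<^sup>2 *\<^sub>R H (g (\<kappa> x))) \<partial>lborel)"
  proof -
    have eq: "indicator S (Complex (snd (\<phi> x)) (fst (\<phi> x))) *\<^sub>R ((norm (g' (Complex (snd (\<phi> x)) (fst (\<phi> x)))))\<^sup>2 *\<^sub>R H (g (Complex (snd (\<phi> x)) (fst (\<phi> x)))))
      = indicator T x *\<^sub>R ((norm (g' (\<kappa> x)))\<^sup>2 *\<^sub>R H (g (\<kappa> x)))" for x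
      unfolding \<phi>\<kappa> by (simp add: indicator_def T_def)
    show "integrable lborel (\<lambda>x. indicator T x *\<^sub>R ((norm (g' (\<kappa> x)))\<^sup>2 *\<^sub>R H (g (\<kappa> x))))"
      "(\<integral>p. indicator S (Complex (snd p) (fst p)) *\<^sub>R ((norm (g' (Complex (snd p) (fst p))))\<^sup>2 *\<^sub>R H (g (Complex (snd p) (fst p)))) \<partial>(lborel \<Otimes>\<^sub>M lborel))
      = (\<integral>x. indicator T x *\<^sub>R ((norm (g' (\<kappa> x)))\<^sup>2 *\<^sub>R H (g (\<kappa> x))) \<partial>lborel)"
      using tr[OF i2] unfolding eq by blast+
  qed
  have "T \<in> sets lebesgue" using op by simp
  from has_absolute_integral_change_of_variables[OF this derG injG, of "\<lambda>x. \<iota> (H (\<kappa> x))" "integral (G ` T) (\<lambda>x. \<iota> (H (\<kappa> x)))"]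
  have "integral T (\<lambda>x. \<bar>det (matrix (G' x))\<bar> *\<^sub>R \<iota> (H (\<kappa> (G x)))) = integral (G ` T) (\<lambda>x. \<iota> (H (\<kappa> x)))"
    using leb[OF I1] by blast
  moreover have "\<bar>det (matrix (G' x))\<bar> *\<^sub>R \<iota> (H (\<kappa> (G x))) = \<iota> ((norm (g' (\<kappa> x)))\<^sup>2 *\<^sub>R H (g (\<kappa> x)))" for x
    unfolding det G_def \<kappa>\<iota> by (rule linear_scale[OF bounded_linear.linear[OF bl], symmetric])
  ultimately have "\<iota> (\<integral>x. indicator T x *\<^sub>R ((norm (g' (\<kappa> x)))\<^sup>2 *\<^sub>R H (g (\<kappa> x))) \<partial>lborel) = \<iota> (\<integral>x. indicator (G ` T) x *\<^sub>R H (\<kappa> x) \<partial>lborel)"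
    using leb[OF I1] leb[OF I2] by simp
  then have "\<kappa> (\<iota> (\<integral>x. indicator T x *\<^sub>R ((norm (g' (\<kappa> x)))\<^sup>2 *\<^sub>R H (g (\<kappa> x))) \<partial>lborel)) = \<kappa> (\<iota> (\<integral>x. indicator (G ` T) x *\<^sub>R H (\<kappa> x) \<partial>lborel))"
    by (rule arg_cong)
  then show ?thesis unfolding E1 E2 \<kappa>\<iota> by simp
qed

text \<open>A branch count: the arguments of q and of the quotient lie in (-pi/2, pi/2), that of a
  in (-pi, 0) and that of b in (0, pi). The multiple of 2 pi by which the two sides differ is
  therefore smaller than 2 pi.\<close>

lemma Ln_lower_kernel:
  assumes q: "Re q > 0" "Re (q / (a * b)) > 0" and a: "Im a < 0" and b: "Im b > 0"
  shows "Ln (q / (a * b)) = Ln q - Ln a - Ln b"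
proof -
  have nz: "q \<noteq> 0" "a \<noteq> 0" "b \<noteq> 0" "q / (a * b) \<noteq> 0" using assms by auto
  have "exp (Ln (q / (a * b))) = exp (Ln q - Ln a - Ln b)" using nz by (simp add: exp_diff)
  then obtain n :: int where n: "Ln (q / (a * b)) = Ln q - Ln a - Ln b + of_real (of_int (2 * n) * pi) * \<i>"
    unfolding exp_eq by blast
  have "\<bar>Im (Ln q)\<bar> < pi / 2" "\<bar>Im (Ln (q / (a * b)))\<bar> < pi / 2" using Re_Ln_pos_lt_imp q by auto
  moreover have "- pi < Im (Ln a)" "Im (Ln a) < 0" using Im_Ln_pos_le[of a] a nz mpi_less_Im_Ln[of a] Im_Ln_le_pi[of a] by auto
  moreover have "0 < Im (Ln b)" "Im (Ln b) < pi" using Im_Ln_pos_lt[of b] b nz by auto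
  moreover have "Im (Ln (q / (a * b))) = Im (Ln q) - Im (Ln a) - Im (Ln b) + 2 * pi * of_int n" unfolding n by simp
  ultimately have "\<bar>2 * pi * of_int n\<bar> < 2 * pi" by linarith
  then have "\<bar>real_of_int n\<bar> < 1" by (simp add: abs_mult)
  then have "n = 0" by linarith
  then show ?thesis using n by simp
qed

section \<open>The lift under the lower triangular generator\<close>

lemma csqrt_power_eq_exp: "z \<noteq> 0 \<Longrightarrow> csqrt z ^ m = exp (of_real (real m / 2) * Ln z)"
  by (simp add: csqrt_exp_Ln exp_of_nat_mult[symmetric])

text \<open>The substitution divides w - z by j J and cnj w - z by cnj j J. So J occurs to the power
  1 + (k - 1/2), which is the weight in z, and the rest depends on w alone.\<close>

lemma hker_lower:
  assumes w: "Im w > 0" and z: "Im z > 0" and k: "k \<ge> 1"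
  defines "j \<equiv> 4 * w + 1" and "J \<equiv> 4 * z + 1"
  shows "hker (real k - 1 / 2) (z / J) (w / j) = csqrt J ^ (2 * k + 1) * (j * cnj (csqrt j) ^ (2 * k - 1)) * hker (real k - 1 / 2) z w"
proof -
  define s where "s = real k - 1 / 2"
  have j: "j \<noteq> 0" "Im (w / j) > 0" and J: "J \<noteq> 0" "Im (z / J) > 0"
    using lower_moebius_upper[OF w] lower_moebius_upper[OF z] by (auto simp: j_def J_def)
  define q where "q = \<i> * (cnj w - z)"
  have q': "\<i> * (cnj (w / j) - z / J) = q / (cnj j * J)"
    unfolding q_def using j(1) J(1) by (simp add: field_simps) (simp add: j_def J_def algebra_simps)
  have d: "w / j - z / J = (w - z) / (j * J)"
    using j(1) J(1) by (simp add: field_simps) (simp add: j_def J_def algebra_simps)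
  have Rq: "Re q > 0" using w z by (simp add: q_def)
  have Rq': "Re (q / (cnj j * J)) > 0" unfolding q'[symmetric] using j(2) J(2) by (simp del: complex_cnj_divide)
  have L: "Ln (q / (cnj j * J)) = Ln q - Ln (cnj j) - Ln J"
    by (rule Ln_lower_kernel[OF Rq Rq']) (use w z in \<open>auto simp: j_def J_def\<close>)
  have nz: "q \<noteq> 0" "q / (cnj j * J) \<noteq> 0" using Rq Rq' by auto
  have "(q / (cnj j * J)) powr (- of_real s) = exp (- of_real s * Ln q) * exp (of_real s * Ln (cnj j)) * exp (of_real s * Ln J)"
  proof -
    have "(q / (cnj j * J)) powr (- of_real s) = exp (- of_real s * (Ln q - Ln (cnj j) - Ln J))"
      by (simp only: powr_def nz(2) if_False L)
    then show ?thesis by (simp add: exp_add[symmetric] algebra_simps)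
  qed
  also have "exp (- of_real s * Ln q) = q powr (- of_real s)" using nz(1) by (simp add: powr_def)
  also have "exp (of_real s * Ln (cnj j)) = cnj (csqrt j) ^ (2 * k - 1)"
  proof -
    have "Ln (cnj j) = cnj (Ln j)" using w by (intro cnj_Ln[symmetric]) (auto simp: j_def complex_nonpos_Reals_iff)
    moreover have e: "csqrt j ^ (2 * k - 1) = exp (of_real s * Ln j)"
      unfolding csqrt_power_eq_exp[OF j(1)] using k by (simp add: s_def of_nat_diff diff_divide_distrib)
    moreover have "cnj (csqrt j) ^ (2 * k - 1) = exp (of_real s * cnj (Ln j))"
    proof -
      have "cnj (csqrt j) ^ (2 * k - 1) = cnj (exp (of_real s * Ln j))" unfolding e[symmetric] by simp
      then show ?thesis by (simp only: exp_cnj complex_cnj_mult complex_cnj_complex_of_real)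
    qed
    ultimately show ?thesis by simp
  qed
  finally have P: "(q / (cnj j * J)) powr (- of_real s) = q powr (- of_real s) * cnj (csqrt j) ^ (2 * k - 1) * exp (of_real s * Ln J)" .
  have "csqrt J ^ (2 * k + 1) = exp (of_real s * Ln J + Ln J)"
    unfolding csqrt_power_eq_exp[OF J(1)] by (simp add: s_def algebra_simps add_divide_distrib)
  then have C: "csqrt J ^ (2 * k + 1) = exp (of_real s * Ln J) * J" using J(1) by (simp add: exp_add)
  show ?thesis
    unfolding s_def[symmetric] hker_def q' d P C q_def[symmetric] by (simp add: mult_ac)
qed

text \<open>All powers of j cancel: the area factor |j|^(-4) and the height power |j|^(-2(k-1))
  against the factors of the theta series and of the kernel.\<close>

lemma theta_lift_integrand_lower:
  assumes \<tau>: "Im \<tau> > 0" and w: "Im w > 0" and z: "Im z > 0" and k: "k \<ge> 1"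
  shows "(norm (1 / (4 * w + 1)\<^sup>2))\<^sup>2 *\<^sub>R theta_lift_integrand k \<tau> (z / (4 * z + 1)) (Im (w / (4 * w + 1)), Re (w / (4 * w + 1)))
    = csqrt (4 * z + 1) ^ (2 * k + 1) * theta_lift_integrand k \<tau> z (Im w, Re w)"
proof -
  define j J r where "j = 4 * w + 1" and "J = 4 * z + 1" and "r = csqrt j"
  have j: "j \<noteq> 0" "Im (w / j) > 0" using lower_moebius_upper[OF w] by (auto simp: j_def)
  have r0: "r \<noteq> 0" using j by (simp add: r_def)
  have jr: "j = r\<^sup>2" by (simp add: r_def)
  define N where "N = complex_of_real (norm j)"
  have N0: "N \<noteq> 0" using j by (simp add: N_def)
  have Nr: "N = r * cnj r" unfolding N_def jr norm_power by (simp add: complex_norm_square del: of_real_power add: of_real_power[symmetric])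
  have th: "siegel_theta k \<tau> (w / j) = j ^ (k - 1) * cnj j * N * r * siegel_theta k \<tau> w"
    using siegel_theta_lower[OF \<tau> w, of k] k by (simp add: j_def N_def r_def)
  have hk: "hker (real k - 1 / 2) (z / J) (w / j) = csqrt J ^ (2 * k + 1) * (j * cnj r ^ (2 * k - 1)) * hker (real k - 1 / 2) z w"
    using hker_lower[OF w z k] by (simp add: j_def J_def r_def)
  have Imw: "complex_of_real (Im (w / j) ^ (k - 1)) = of_real (Im w ^ (k - 1)) / N ^ (2 * (k - 1))"
    unfolding j_def Im_lower_moebius N_def by (simp add: power_divide power_mult)
  have nn: "complex_of_real ((norm (1 / j\<^sup>2))\<^sup>2) = 1 / N ^ 4"
    by (simp add: N_def norm_divide norm_power power_divide power_mult[symmetric])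
  \<comment> \<open>With r = csqrt j every factor is a power of r, of cnj r, or of |j| = r cnj r.
    For k = m + 1 both r and cnj r occur to the power 2m + 3, next to one further |j|.\<close>
  have one: "1 / N ^ 4 * (1 / N ^ (2 * (k - 1))) * (j ^ (k - 1) * cnj j * N * r) * (j * cnj r ^ (2 * k - 1)) = 1"
  proof -
    obtain m where m: "k = Suc m" using k by (cases k) auto
    have cj: "cnj j = (cnj r)\<^sup>2" by (simp add: jr)
    have a: "j ^ (k - 1) * cnj j * N * r * (j * cnj r ^ (2 * k - 1)) = N * (r ^ (2 * m + 3) * cnj r ^ (2 * m + 3))"
    proof -
      have "j ^ (k - 1) = r ^ (2 * m)" "cnj r ^ (2 * k - 1) = cnj r ^ (2 * m + 1)" by (simp_all add: jr m power_mult)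
      then show ?thesis unfolding cj by (simp add: jr power_add power2_eq_square power3_eq_cube mult_ac)
    qed
    also have "r ^ (2 * m + 3) * cnj r ^ (2 * m + 3) = N ^ (2 * m + 3)" by (simp only: Nr power_mult_distrib)
    also have "N * N ^ (2 * m + 3) = N ^ 4 * N ^ (2 * (k - 1))" by (simp add: m power_add[symmetric] power_Suc[symmetric] del: power_Suc)
    finally have b: "j ^ (k - 1) * cnj j * N * r * (j * cnj r ^ (2 * k - 1)) = N ^ 4 * N ^ (2 * (k - 1))" .
    have "1 / N ^ 4 * (1 / N ^ (2 * (k - 1))) * (j ^ (k - 1) * cnj j * N * r) * (j * cnj r ^ (2 * k - 1))
      = (j ^ (k - 1) * cnj j * N * r * (j * cnj r ^ (2 * k - 1))) / (N ^ 4 * N ^ (2 * (k - 1)))" by simp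
    then show ?thesis unfolding b using N0 by simp
  qed
  have ww: "Complex (Re (w / j)) (Im (w / j)) = w / j" "Complex (Re w) (Im w) = w" by simp_all
  have L: "theta_lift_integrand k \<tau> (z / J) (Im (w / j), Re (w / j)) = of_real (Im (w / j) ^ (k - 1)) * siegel_theta k \<tau> (w / j) * hker (real k - 1 / 2) (z / J) (w / j)"
    using j(2) by (simp add: theta_lift_integrand_def)
  have R: "theta_lift_integrand k \<tau> z (Im w, Re w) = of_real (Im w ^ (k - 1)) * siegel_theta k \<tau> w * hker (real k - 1 / 2) z w"
    using w by (simp add: theta_lift_integrand_def)
  have "of_real ((norm (1 / j\<^sup>2))\<^sup>2) * theta_lift_integrand k \<tau> (z / J) (Im (w / j), Re (w / j))
    = (1 / N ^ 4 * (1 / N ^ (2 * (k - 1))) * (j ^ (k - 1) * cnj j * N * r) * (j * cnj r ^ (2 * k - 1))) *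
      (csqrt J ^ (2 * k + 1) * theta_lift_integrand k \<tau> z (Im w, Re w))"
    unfolding L R Imw th hk nn by (simp add: mult_ac)
  then show ?thesis unfolding one j_def[symmetric] J_def[symmetric] scaleR_conv_of_real by simp
qed

text \<open>The substitution w \<mapsto> w/(4w + 1) preserves the upper half-plane, and the
  pointwise identity for the integrand moves the automorphy factor of z outside the
  integral.\<close>

lemma Psi_hat_lower:
  assumes \<tau>: "Im \<tau> > 0" and z: "Im z > 0" and k: "k \<ge> 4"
  shows "Psi_hat k \<tau> (z / (4 * z + 1)) = csqrt (4 * z + 1) ^ (2 * k + 1) * Psi_hat k \<tau> z"
proof -
  define J z' where "J = csqrt (4 * z + 1) ^ (2 * k + 1)" and "z' = z / (4 * z + 1)"
  have z': "Im z' > 0" using lower_moebius_upper[OF z] by (simp add: z'_def)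
  define S where "S = {w. Im w > 0}"
  define g where "g = (\<lambda>w::complex. w / (4 * w + 1))"
  define H where "H = (\<lambda>w. theta_lift_integrand k \<tau> z' (Im w, Re w))"
  have gS: "g ` S = S"
  proof
    show "g ` S \<subseteq> S" using lower_moebius_upper by (auto simp: S_def g_def)
    show "S \<subseteq> g ` S"
    proof
      fix w assume "w \<in> S"
      then have w: "Im w > 0" by (simp add: S_def)
      then have nz: "1 - 4 * w \<noteq> 0" by (auto simp: complex_eq_iff)
      define x where "x = w / (1 - 4 * w)"
      have "Im x = Im w / (cmod (1 - 4 * w))\<^sup>2" unfolding x_def Im_divide by (simp add: cmod_power2 algebra_simps)
      then have "x \<in> S" using w nz by (simp add: S_def)
      have "4 * x + 1 = 1 / (1 - 4 * w)" using nz by (simp add: x_def field_simps)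
      then have "g x = w" using nz by (simp add: g_def x_def)
      then show "w \<in> g ` S" using \<open>x \<in> S\<close> by blast
    qed
  qed
  have inj: "inj_on g S"
  proof (rule inj_onI)
    fix x y assume "x \<in> S" "y \<in> S" "g x = g y"
    moreover have "4 * x + 1 \<noteq> 0" "4 * y + 1 \<noteq> 0" using \<open>x \<in> S\<close> \<open>y \<in> S\<close> lower_moebius_upper by (auto simp: S_def)
    ultimately have "x * (4 * y + 1) = y * (4 * x + 1)" by (simp add: g_def frac_eq_eq)
    then show "x = y" by (simp add: algebra_simps)
  qed
  have der: "(g has_field_derivative 1 / (4 * w + 1)\<^sup>2) (at w)" if "w \<in> S" for w
  proof -
    have "4 * w + 1 \<noteq> 0" using that lower_moebius_upper by (auto simp: S_def)
    then show ?thesis unfolding g_def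
      by (auto intro!: derivative_eq_intros simp: power2_eq_square field_simps)
  qed
  have op: "open S" unfolding S_def by (rule open_halfspace_Im_gt)
  have e1: "indicator (g ` S) (Complex (snd p) (fst p)) *\<^sub>R H (Complex (snd p) (fst p)) = theta_lift_integrand k \<tau> z' p" for p
    unfolding gS by (auto simp: S_def H_def theta_lift_integrand_def case_prod_unfold indicator_def)
  have e2: "indicator S (Complex (snd p) (fst p)) *\<^sub>R ((norm (1 / (4 * Complex (snd p) (fst p) + 1)\<^sup>2))\<^sup>2 *\<^sub>R H (g (Complex (snd p) (fst p)))) = J * theta_lift_integrand k \<tau> z p" for p
  proof (cases "fst p > 0")
    case True
    have "(norm (1 / (4 * Complex (snd p) (fst p) + 1)\<^sup>2))\<^sup>2 *\<^sub>R H (g (Complex (snd p) (fst p))) = J * theta_lift_integrand k \<tau> z (Im (Complex (snd p) (fst p)), Re (Complex (snd p) (fst p)))"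
      unfolding H_def g_def z'_def J_def by (rule theta_lift_integrand_lower) (use \<tau> z k True in auto)
    then show ?thesis using True by (simp add: S_def)
  qed (simp add: S_def theta_lift_integrand_def case_prod_unfold)
  have "(\<integral>p. theta_lift_integrand k \<tau> z' p \<partial>(lborel \<Otimes>\<^sub>M lborel)) = (\<integral>p. J * theta_lift_integrand k \<tau> z p \<partial>(lborel \<Otimes>\<^sub>M lborel))"
    using real2_change_of_variables[OF op der inj, of H, unfolded e1 e2] zterm_has_sum(1)[OF \<tau> z' k] zterm_has_sum(1)[OF \<tau> z k] by simp
  then have "lift_const k * Psi_hat k \<tau> z' = J * (lift_const k * Psi_hat k \<tau> z)"
    by (simp only: integral_mult_right_zero Psi_hat_eq_integral[OF \<tau> z' k] Psi_hat_eq_integral[OF \<tau> z k])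
  then show ?thesis using lift_const_nonzero[of k] k by (simp add: J_def z'_def)
qed

section \<open>Modularity in z\<close>

lemma exp_int_shift: "exp (2 * of_real pi * \<i> * of_int D * (z + 1)) = exp (2 * of_real pi * \<i> * of_int D * z)"
proof -
  have "exp (2 * of_real pi * \<i> * of_int D) = 1"
    using exp_integer_2pi[of "of_int D"] by (simp add: mult_ac)
  then show ?thesis by (simp only: distrib_left mult_1_right exp_add)
qed

lemma Psi_hat_translate: "Psi_hat k \<tau> (z + 1) = Psi_hat k \<tau> z"
  unfolding Psi_hat_def Psi_def Psi_star_def exp_int_shift by simp

lemma cocycle_nonzero:
  assumes "M \<in> SL2Z" "Im z > 0"
  shows "cocycle M z \<noteq> 0"
proof
  assume 0: "cocycle M z = 0"
  then have "of_int (M $ 2 $ 1) * Im z = 0" by (simp add: cocycle_def complex_eq_iff)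
  then have c: "M $ 2 $ 1 = 0" using assms by simp
  then have "M $ 2 $ 2 = 0" using 0 by (simp add: cocycle_def)
  then show False using assms c by (simp add: SL2Z_def det_2)
qed

text \<open>By the determinant a prime dividing the lower right entry cannot divide the lower left
  one, so no Legendre factor vanishes. This permits the division hidden in the negative power in
  \<open>slash\<close>.\<close>

lemma theta_factor_nonzero:
  assumes M: "M \<in> SL2Z" and z: "Im z > 0"
  shows "theta_factor M z \<noteq> 0"
proof -
  define c d where "c = M $ 2 $ 1" and "d = M $ 2 $ 2"
  have det: "M $ 1 $ 1 * d - M $ 1 $ 2 * c = 1" using M by (simp add: SL2Z_def det_2 c_def d_def)
  have "Legendre c p \<noteq> 0" if "p \<in> prime_factors \<bar>d\<bar>" for p
  proof
    assume "Legendre c p = 0"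
    then have "p dvd c" by (auto simp: Legendre_def cong_0_iff split: if_splits)
    moreover have "p dvd d" using that by (auto dest: in_prime_factors_imp_dvd)
    ultimately have "p dvd 1" unfolding det[symmetric] by simp
    moreover have "prime p" using that by (rule in_prime_factors_imp_prime)
    ultimately show False using not_prime_unit by blast
  qed
  then have "shimura_symbol c d \<noteq> 0" by (auto simp: shimura_symbol_def)
  moreover have "csqrt (cocycle M z) \<noteq> 0" using cocycle_nonzero[OF assms] by (metis csqrt_eq_0)
  ultimately show ?thesis by (simp add: theta_factor_def theta_eps_def c_def d_def)
qed

lemma half_integer_notin_Ints: "real k + 1 / 2 \<notin> \<int>"
proof
  assume "real k + 1 / 2 \<in> \<int>"
  then obtain n :: int where "real k + 1 / 2 = of_int n" by (auto elim: Ints_cases)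
  then have "real_of_int (2 * int k + 1) = real_of_int (2 * n)" by simp
  then have "2 * int k + 1 = 2 * n" by linarith
  then show False by presburger
qed

lemma Psi_hat_slash_z:
  assumes \<tau>: "Im \<tau> > 0" and z: "Im z > 0" and k: "k \<ge> 4" and M: "M \<in> Gamma0_4"
  shows "slash (real k + 1 / 2) (\<lambda>z. Psi_hat k \<tau> z) M z = Psi_hat k \<tau> z"
proof -
  have fl: "\<lfloor>2 * (real k + 1 / 2)\<rfloor> = int (2 * k + 1)"
  proof -
    have "2 * (real k + 1 / 2) = of_int (int (2 * k + 1))" by simp
    then show ?thesis by (simp only: floor_of_int)
  qed
  have SL: "M \<in> SL2Z" using M by (simp add: Gamma0_4_def)
  have "Psi_hat k \<tau> (moebius M z) = theta_factor M z ^ (2 * k + 1) * Psi_hat k \<tau> z"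
    by (rule Gamma0_4_transformation[OF _ _ M z]) (auto simp: Psi_hat_translate Psi_hat_lower[OF \<tau> _ k])
  then have "slash (real k + 1 / 2) (\<lambda>z. Psi_hat k \<tau> z) M z
    = inverse (theta_factor M z ^ (2 * k + 1)) * (theta_factor M z ^ (2 * k + 1) * Psi_hat k \<tau> z)"
    unfolding slash_def fl power_int_minus power_int_of_nat using half_integer_notin_Ints by simp
  moreover have "theta_factor M z ^ (2 * k + 1) \<noteq> 0" using theta_factor_nonzero[OF SL z] by simp
  ultimately show ?thesis by (metis (no_types) mult.assoc left_inverse mult_1_left)
qed

section \<open>Modularity in tau by unimodular substitution into the forms\<close>

fun form_act :: "int \<Rightarrow> int \<Rightarrow> int \<Rightarrow> int \<Rightarrow> quad_form \<Rightarrow> quad_form" where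
  "form_act \<alpha> \<beta> \<gamma> \<delta> (a, b, c) = (a * \<alpha>\<^sup>2 + b * \<alpha> * \<gamma> + c * \<gamma>\<^sup>2, 2 * a * \<alpha> * \<beta> + b * (\<alpha> * \<delta> + \<beta> * \<gamma>) + 2 * c * \<gamma> * \<delta>,
     a * \<beta>\<^sup>2 + b * \<beta> * \<delta> + c * \<delta>\<^sup>2)"

lemma form_act_inverse:
  assumes "\<alpha> * \<delta> - \<beta> * \<gamma> = 1"
  shows "form_act \<delta> (- \<beta>) (- \<gamma>) \<alpha> (form_act \<alpha> \<beta> \<gamma> \<delta> Q) = Q"
proof (cases Q)
  case (fields a b c)
  have "form_act \<delta> (- \<beta>) (- \<gamma>) \<alpha> (form_act \<alpha> \<beta> \<gamma> \<delta> (a, b, c))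
    = (a * (\<alpha> * \<delta> - \<beta> * \<gamma>)\<^sup>2, b * (\<alpha> * \<delta> - \<beta> * \<gamma>)\<^sup>2, c * (\<alpha> * \<delta> - \<beta> * \<gamma>)\<^sup>2)"
    by (simp add: power2_eq_square algebra_simps)
  then show ?thesis using assms by (simp add: fields)
qed

lemma form_act_bij:
  assumes "\<alpha> * \<delta> - \<beta> * \<gamma> = 1"
  shows "bij (form_act \<alpha> \<beta> \<gamma> \<delta>)"
proof (rule bij_betw_byWitness[where f' = "form_act \<delta> (- \<beta>) (- \<gamma>) \<alpha>"])
  have "\<delta> * \<alpha> - (- \<beta>) * (- \<gamma>) = 1" using assms by (simp add: mult.commute)
  from form_act_inverse[OF this] show "\<forall>Q\<in>UNIV. form_act \<alpha> \<beta> \<gamma> \<delta> (form_act \<delta> (- \<beta>) (- \<gamma>) \<alpha> Q) = Q" by simp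
qed (use form_act_inverse[OF assms] in auto)

lemma disc_form_act: "disc (form_act \<alpha> \<beta> \<gamma> \<delta> Q) = (\<alpha> * \<delta> - \<beta> * \<gamma>)\<^sup>2 * disc Q"
  by (cases Q) (simp add: disc_def power2_eq_square algebra_simps)

lemma form_eval_act:
  assumes "of_int \<gamma> * \<tau> + of_int \<delta> \<noteq> (0::complex)"
  shows "form_eval (form_act \<alpha> \<beta> \<gamma> \<delta> Q) \<tau> 1
    = (of_int \<gamma> * \<tau> + of_int \<delta>)\<^sup>2 * form_eval Q ((of_int \<alpha> * \<tau> + of_int \<beta>) / (of_int \<gamma> * \<tau> + of_int \<delta>)) 1"
proof (cases Q)
  case (fields a b c)
  define j n where "j = of_int \<gamma> * \<tau> + of_int \<delta>" and "n = of_int \<alpha> * \<tau> + of_int \<beta>"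
  have "j\<^sup>2 * form_eval Q (n / j) 1 = of_int a * n\<^sup>2 + of_int b * n * j + of_int c * j\<^sup>2"
    using assms by (simp add: fields j_def[symmetric] power_divide distrib_left power2_eq_square)
  also have "\<dots> = form_eval (form_act \<alpha> \<beta> \<gamma> \<delta> Q) \<tau> 1"
    by (simp add: fields n_def j_def power2_eq_square algebra_simps)
  finally show ?thesis by (simp add: j_def n_def)
qed

lemma form_at_act:
  assumes det: "\<alpha> * \<delta> - \<beta> * \<gamma> = 1" and j: "of_int \<gamma> * \<tau> + of_int \<delta> \<noteq> (0::complex)" and \<tau>: "Im \<tau> > 0"
  defines "\<tau>' \<equiv> (of_int \<alpha> * \<tau> + of_int \<beta>) / (of_int \<gamma> * \<tau> + of_int \<delta>)"
  shows "form_at (form_act \<alpha> \<beta> \<gamma> \<delta> Q) \<tau> = form_at Q \<tau>'"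
    and "Im \<tau>' = Im \<tau> / (cmod (of_int \<gamma> * \<tau> + of_int \<delta>))\<^sup>2"
proof -
  obtain a b c where Q: "Q = (a, b, c)" by (cases Q)
  define x y where "x = Re \<tau>" and "y = Im \<tau>"
  define N where "N = (cmod (of_int \<gamma> * \<tau> + of_int \<delta>))\<^sup>2"
  have N0: "N > 0" using j by (simp add: N_def)
  have N: "N = (of_int \<gamma> * x + of_int \<delta>)\<^sup>2 + (of_int \<gamma> * y)\<^sup>2" by (simp add: N_def cmod_power2 x_def y_def)
  have d: "real_of_int \<alpha> * of_int \<delta> - of_int \<beta> * of_int \<gamma> = 1"
    using det by (metis of_int_1 of_int_diff of_int_mult)
  have Re: "Re \<tau>' = ((of_int \<alpha> * x + of_int \<beta>) * (of_int \<gamma> * x + of_int \<delta>) + of_int \<alpha> * of_int \<gamma> * y\<^sup>2) / N"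
    unfolding \<tau>'_def Re_divide N by (simp add: x_def y_def power2_eq_square mult_ac)
  have "Im \<tau>' = (of_int \<alpha> * of_int \<delta> - of_int \<beta> * of_int \<gamma>) * y / N"
    unfolding \<tau>'_def Im_divide N by (simp add: x_def y_def algebra_simps)
  then have Im: "Im \<tau>' = y / N" using d by simp
  then show "Im \<tau>' = Im \<tau> / (cmod (of_int \<gamma> * \<tau> + of_int \<delta>))\<^sup>2" by (simp add: N_def y_def)
  have nm: "(cmod \<tau>')\<^sup>2 = ((of_int \<alpha> * x + of_int \<beta>)\<^sup>2 + (of_int \<alpha> * y)\<^sup>2) / N"
    unfolding \<tau>'_def norm_divide power_divide N_def[symmetric] by (simp add: cmod_power2 x_def y_def)
  have "form_at Q \<tau>' = (of_int a * ((of_int \<alpha> * x + of_int \<beta>)\<^sup>2 + (of_int \<alpha> * y)\<^sup>2)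
      + of_int b * ((of_int \<alpha> * x + of_int \<beta>) * (of_int \<gamma> * x + of_int \<delta>) + of_int \<alpha> * of_int \<gamma> * y\<^sup>2) + of_int c * N) / y"
  proof -
    have "(A * (P / N) + B * (R / N) + C) / (y / N) = (A * P + B * R + C * N) / y" for A B C P R :: real
      using N0 by (cases "y = 0") (auto simp: field_simps)
    then show ?thesis unfolding Q form_at.simps Im nm Re .
  qed
  also have "\<dots> = form_at (form_act \<alpha> \<beta> \<gamma> \<delta> Q) \<tau>"
    unfolding Q form_act.simps form_at.simps N cmod_power2 x_def[symmetric] y_def[symmetric]
    by (rule arg_cong[where f = "\<lambda>x. x / y"]) (simp add: power2_eq_square algebra_simps)
  finally show "form_at (form_act \<alpha> \<beta> \<gamma> \<delta> Q) \<tau> = form_at Q \<tau>'" by simp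
qed

text \<open>\<open>form_at\<close>, the discriminant and |Q(\<tau>,1)|/y are invariant under the
  simultaneous action. Only Q(\<tau>,1)^(k-1) changes, by the square of the cocycle for each
  factor.\<close>

lemma zterm_act:
  assumes M: "M \<in> SL2Z" and \<tau>: "Im \<tau> > 0"
  shows "zterm k \<tau> z (form_act (M $ 1 $ 1) (M $ 1 $ 2) (M $ 2 $ 1) (M $ 2 $ 2) Q)
    = cocycle M \<tau> ^ (2 * (k - 1)) * zterm k (moebius M \<tau>) z Q"
proof -
  define \<alpha> \<beta> \<gamma> \<delta> where "\<alpha> = M $ 1 $ 1" and "\<beta> = M $ 1 $ 2" and "\<gamma> = M $ 2 $ 1" and "\<delta> = M $ 2 $ 2"
  have det: "\<alpha> * \<delta> - \<beta> * \<gamma> = 1" using M by (simp add: SL2Z_def det_2 \<alpha>_def \<beta>_def \<gamma>_def \<delta>_def)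
  define j where "j = of_int \<gamma> * \<tau> + of_int \<delta>"
  have cj: "cocycle M \<tau> = j" by (simp add: cocycle_def j_def \<gamma>_def \<delta>_def)
  have j0: "j \<noteq> 0" using cocycle_nonzero[OF M \<tau>] by (simp add: cj)
  define \<tau>' where "\<tau>' = (of_int \<alpha> * \<tau> + of_int \<beta>) / j"
  have mb: "moebius M \<tau> = \<tau>'" by (simp add: moebius_def cj \<tau>'_def \<alpha>_def \<beta>_def)
  note A = form_at_act[OF det j0[unfolded j_def] \<tau>, folded j_def, folded \<tau>'_def]
  have ev: "form_eval (form_act \<alpha> \<beta> \<gamma> \<delta> Q) \<tau> 1 = j\<^sup>2 * form_eval Q \<tau>' 1"
    using form_eval_act[OF j0[unfolded j_def]] by (simp add: j_def \<tau>'_def)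
  have pw: "form_eval (form_act \<alpha> \<beta> \<gamma> \<delta> Q) \<tau> 1 ^ (k - 1) = j ^ (2 * (k - 1)) * form_eval Q \<tau>' 1 ^ (k - 1)"
    unfolding ev by (simp add: power_mult_distrib power_mult)
  have q: "X * (Im \<tau>)\<^sup>2 / (cmod (form_eval (form_act \<alpha> \<beta> \<gamma> \<delta> Q) \<tau> 1))\<^sup>2 = X * (Im \<tau>')\<^sup>2 / (cmod (form_eval Q \<tau>' 1))\<^sup>2" for X
    unfolding ev A(2) using j0 by (simp add: norm_mult norm_power power_mult_distrib power_divide)
  have dd: "disc (form_act \<alpha> \<beta> \<gamma> \<delta> Q) = disc Q" unfolding disc_form_act det by simp
  show ?thesis
    unfolding mb cj unfolding \<alpha>_def[symmetric] \<beta>_def[symmetric] \<gamma>_def[symmetric] \<delta>_def[symmetric]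
    unfolding zterm_def dd q A(1) pw by (simp only: mult_ac)
qed

lemma Psi_hat_slash_tau:
  assumes \<tau>: "Im \<tau> > 0" and z: "Im z > 0" and k: "k \<ge> 4" and M: "M \<in> SL2Z"
  shows "slash (2 - 2 * real k) (\<lambda>\<tau>. Psi_hat k \<tau> z) M \<tau> = Psi_hat k \<tau> z"
proof -
  have int: "2 - 2 * real k = of_int (2 - 2 * int k)" by simp
  have fl: "\<lfloor>2 - 2 * real k\<rfloor> = - int (2 * (k - 1))" using k unfolding int by (simp only: floor_of_int)
  have isint: "2 - 2 * real k \<in> \<int>" unfolding int by (rule Ints_of_int)
  let ?a = "form_act (M $ 1 $ 1) (M $ 1 $ 2) (M $ 2 $ 1) (M $ 2 $ 2)"
  have "M $ 1 $ 1 * M $ 2 $ 2 - M $ 1 $ 2 * M $ 2 $ 1 = 1" using M by (simp add: SL2Z_def det_2)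
  then have bij: "bij ?a" by (rule form_act_bij)
  have \<tau>': "Im (moebius M \<tau>) > 0"
  proof -
    have "Im (moebius M \<tau>) = Im \<tau> / (cmod (cocycle M \<tau>))\<^sup>2"
      using form_at_act(2)[of "M $ 1 $ 1" "M $ 2 $ 2" "M $ 1 $ 2" "M $ 2 $ 1" \<tau>] cocycle_nonzero[OF M \<tau>] \<tau> M
      by (simp add: SL2Z_def det_2 cocycle_def moebius_def)
    then show ?thesis using cocycle_nonzero[OF M \<tau>] \<tau> by simp
  qed
  have "Psi_hat k \<tau> z = (\<Sum>\<^sub>\<infinity>Q. zterm k \<tau> z (?a Q))"
    unfolding Psi_hat_eq_infsum[OF \<tau> z k] by (rule infsum_reindex_bij_betw[OF bij, symmetric])
  also have "\<dots> = cocycle M \<tau> ^ (2 * (k - 1)) * Psi_hat k (moebius M \<tau>) z"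
    unfolding zterm_act[OF M \<tau>] Psi_hat_eq_infsum[OF \<tau>' z k] by (rule infsum_cmult_right')
  finally show ?thesis unfolding slash_def fl minus_minus power_int_of_nat using isint by simp
qed

section \<open>Real analyticity\<close>

text \<open>Cauchy's formula writes the derivative as an integral over a fixed circle, with
  integrand holomorphic in V at each point of the circle. Separate holomorphy and a uniform bound
  suffice for differentiating under this integral.\<close>

lemma holomorphic_higher_deriv_parameter:
  fixes f :: "complex \<Rightarrow> complex \<Rightarrow> complex"
  assumes \<rho>: "0 < \<rho>" "\<rho> < R"
    and hU: "\<And>V. V \<in> S \<Longrightarrow> (\<lambda>U. f U V) holomorphic_on ball x0 R"
    and hV: "\<And>U. U \<in> ball x0 R \<Longrightarrow> (\<lambda>V. f U V) holomorphic_on S"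
    and bd: "\<And>U V. U \<in> ball x0 R \<Longrightarrow> V \<in> S \<Longrightarrow> norm (f U V) \<le> B"
    and S: "open S"
  shows "(\<lambda>V. (deriv ^^ m) (\<lambda>U. f U V) x0) holomorphic_on S"
proof -
  define c where "c = circlepath x0 \<rho>"
  have cn: "norm (c \<theta> - x0) = \<rho>" for \<theta>
    using \<rho> by (simp add: c_def circlepath norm_mult norm_exp_eq_Re)
  have cb: "c \<theta> \<in> ball x0 R" for \<theta> using cn[of \<theta>] \<rho> by (simp add: dist_norm norm_minus_commute)
  have cc: "continuous_on A c" for A unfolding c_def circlepath by (intro continuous_intros)
  define E where "E = (\<lambda>\<theta>::real. 2 * of_real pi * \<i> * of_real \<rho> * exp (2 * of_real pi * \<i> * of_real \<theta>))"
  have nE: "norm (E \<theta>) = 2 * pi * \<rho>" for \<theta> using \<rho> by (simp add: E_def norm_mult norm_exp_eq_Re)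
  define h where "h = (\<lambda>V \<theta>. f (c \<theta>) V / (c \<theta> - x0) ^ Suc m * E \<theta>)"
  have ne: "c \<theta> - x0 \<noteq> 0" for \<theta> using cn[of \<theta>] \<rho> by auto
  have hc: "continuous_on {0..1} (h V)" if "V \<in> S" for V
  proof -
    have "continuous_on {0..1} (\<lambda>\<theta>. f (c \<theta>) V)"
      by (rule continuous_on_compose2[OF holomorphic_on_imp_continuous_on[OF hU[OF that]] cc]) (use cb in auto)
    then show ?thesis unfolding h_def E_def using ne by (intro continuous_intros cc) auto
  qed
  have si: "set_integrable lborel {0..1} (h V)" if "V \<in> S" for V
    by (rule borel_integrable_atLeastAtMost'[OF hc[OF that]])
  have eq: "(deriv ^^ m) (\<lambda>U. f U V) x0 = fact m / (2 * of_real pi * \<i>) * (\<integral>\<theta>. indicator {0..1} \<theta> *\<^sub>R h V \<theta> \<partial>lborel)" if V: "V \<in> S" for V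
  proof -
    have sub: "cball x0 \<rho> \<subseteq> ball x0 R" using \<rho> by auto
    have "contour_integral (circlepath x0 \<rho>) (\<lambda>u. f u V / (u - x0) ^ Suc m) = (2 * pi * \<i>) * (deriv ^^ m) (\<lambda>U. f U V) x0 / fact m"
    proof (rule Cauchy_contour_integral_circlepath)
      show "continuous_on (cball x0 \<rho>) (\<lambda>U. f U V)"
        using hU[OF V] sub by (meson holomorphic_on_imp_continuous_on continuous_on_subset)
      show "(\<lambda>U. f U V) holomorphic_on ball x0 \<rho>"
        using hU[OF V] \<rho> by (meson holomorphic_on_subset subset_ball less_imp_le)
    qed (use \<rho> in auto)
    moreover have "contour_integral (circlepath x0 \<rho>) (\<lambda>u. f u V / (u - x0) ^ Suc m) = integral {0..1} (h V)"
      unfolding contour_integral_integral vector_derivative_circlepath h_def E_def c_def by simp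
    moreover have "integral {0..1} (h V) = (\<integral>\<theta>. indicator {0..1} \<theta> *\<^sub>R h V \<theta> \<partial>lborel)"
      using set_borel_integral_eq_integral(2)[OF si[OF V]] by (simp add: set_lebesgue_integral_def)
    ultimately show ?thesis by (simp add: field_simps)
  qed
  have "(\<lambda>V. \<integral>\<theta>. indicator {0..1} \<theta> *\<^sub>R h V \<theta> \<partial>lborel) holomorphic_on S"
  proof (rule holomorphic_on_parameter_integral[OF S])
    show "(\<lambda>\<theta>. indicator {0..1} \<theta> *\<^sub>R h V \<theta>) \<in> borel_measurable lborel" if "V \<in> S" for V
      using si[OF that] by (simp add: set_integrable_def borel_measurable_integrable)
    show "(\<lambda>V. indicator {0..1} \<theta> *\<^sub>R h V \<theta>) holomorphic_on S" for \<theta>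
      unfolding h_def scaleR_conv_of_real by (intro holomorphic_intros hV cb) (use ne in auto)
    show "norm (indicator {0..1} \<theta> *\<^sub>R h V \<theta>) \<le> indicator {0..1} \<theta> * (B / \<rho> ^ Suc m * (2 * pi * \<rho>))" if "V \<in> S" for V \<theta>
    proof -
      have "norm (h V \<theta>) \<le> B / \<rho> ^ Suc m * (2 * pi * \<rho>)"
        unfolding h_def norm_mult norm_divide norm_power cn nE using bd[OF cb that] \<rho>
        by (intro mult_right_mono divide_right_mono) auto
      then show ?thesis
      proof (cases "\<theta> \<in> {0..1}")
        case True
        with \<open>norm (h V \<theta>) \<le> _\<close> show ?thesis by (simp only: indicator_simps scaleR_one mult_1_left)
      next
        case False
        then show ?thesis unfolding indicator_simps(2)[OF False] by simp
      qed
    qed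
    show "integrable lborel (\<lambda>\<theta>. indicator {0..1::real} \<theta> * (B / \<rho> ^ Suc m * (2 * pi * \<rho>)))"
      by (intro integrable_mult_left) auto
  qed
  then have "(\<lambda>V. fact m / (2 * of_real pi * \<i>) * (\<integral>\<theta>. indicator {0..1} \<theta> *\<^sub>R h V \<theta> \<partial>lborel)) holomorphic_on S"
    by (intro holomorphic_intros)
  then show ?thesis by (rule holomorphic_transform) (simp add: eq)
qed

text \<open>The Taylor coefficients in U are holomorphic in V and are expanded in turn. Two
  applications of Cauchy's estimate bound the double coefficients by B/\<rho>^(m+n), so at half the
  radius a double geometric series dominates.\<close>

lemma separately_holomorphic_power_series:
  fixes f :: "complex \<Rightarrow> complex \<Rightarrow> complex"
  assumes R: "R > 0"
    and hU: "\<And>V. V \<in> ball y0 R \<Longrightarrow> (\<lambda>U. f U V) holomorphic_on ball x0 R"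
    and hV: "\<And>U. U \<in> ball x0 R \<Longrightarrow> (\<lambda>V. f U V) holomorphic_on ball y0 R"
    and bd: "\<And>U V. U \<in> ball x0 R \<Longrightarrow> V \<in> ball y0 R \<Longrightarrow> norm (f U V) \<le> B"
  obtains r a where "r > 0" "\<And>U V. U \<in> ball x0 r \<Longrightarrow> V \<in> ball y0 r \<Longrightarrow>
    ((\<lambda>(m, n). a m n * ((U - x0) ^ m * (V - y0) ^ n)) has_sum f U V) UNIV"
proof -
  define \<rho> where "\<rho> = R / 2"
  have \<rho>: "0 < \<rho>" "\<rho> < R" using R by (auto simp: \<rho>_def)
  have B: "B \<ge> 0" using bd[of x0 y0] R order_trans[OF norm_ge_zero] by auto
  define b where "b = (\<lambda>m V. (deriv ^^ m) (\<lambda>U. f U V) x0)"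
  have bhol: "b m holomorphic_on ball y0 R" for m
    unfolding b_def by (rule holomorphic_higher_deriv_parameter[OF \<rho> hU hV bd]) auto
  have sub: "cball x \<rho> \<subseteq> ball x R" "ball x \<rho> \<subseteq> ball x R" for x :: complex using \<rho> by auto
  have bb: "norm (b m V) \<le> fact m * B / \<rho> ^ m" if "V \<in> ball y0 R" for m V
    unfolding b_def
  proof (rule Cauchy_inequality)
    show "(\<lambda>U. f U V) holomorphic_on ball x0 \<rho>" using hU[OF that] sub by (meson holomorphic_on_subset)
    show "continuous_on (cball x0 \<rho>) (\<lambda>U. f U V)"
      using hU[OF that] sub by (meson holomorphic_on_imp_continuous_on continuous_on_subset)
    show "norm (f U V) \<le> B" if "norm (x0 - U) = \<rho>" for U
      by (rule bd) (use that \<rho> \<open>V \<in> ball y0 R\<close> in \<open>auto simp: dist_norm\<close>)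
  qed (use \<rho> in auto)
  define a where "a = (\<lambda>m n. (deriv ^^ n) (b m) y0 / (fact m * fact n))"
  have ab: "norm ((deriv ^^ n) (b m) y0) \<le> fact n * (fact m * B / \<rho> ^ m) / \<rho> ^ n" for m n
  proof (rule Cauchy_inequality)
    show "b m holomorphic_on ball y0 \<rho>" using bhol sub by (meson holomorphic_on_subset)
    show "continuous_on (cball y0 \<rho>) (b m)"
      using bhol sub by (meson holomorphic_on_imp_continuous_on continuous_on_subset)
    show "norm (b m V) \<le> fact m * B / \<rho> ^ m" if "norm (y0 - V) = \<rho>" for V
      by (rule bb) (use that \<rho> in \<open>auto simp: dist_norm\<close>)
  qed (use \<rho> in auto)
  have an: "norm (a m n) \<le> B / (\<rho> ^ m * \<rho> ^ n)" for m n
  proof -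
    have "norm (a m n) \<le> (fact n * (fact m * B / \<rho> ^ m) / \<rho> ^ n) / (fact m * fact n)"
      unfolding a_def norm_divide using divide_right_mono[OF ab[of n m], of "fact m * fact n"] by (simp add: norm_mult)
    then show ?thesis by (simp add: field_simps)
  qed
  show ?thesis
  proof (rule that[of "\<rho> / 2" a])
    show "\<rho> / 2 > 0" using \<rho> by simp
    fix U V assume U: "U \<in> ball x0 (\<rho> / 2)" and V: "V \<in> ball y0 (\<rho> / 2)"
    have U': "U \<in> ball x0 \<rho>" and V': "V \<in> ball y0 \<rho>" and VR: "V \<in> ball y0 R" using U V \<rho> by auto
    have pU: "norm ((U - x0) ^ m) \<le> (\<rho> / 2) ^ m" for m
      unfolding norm_power using U by (intro power_mono) (auto simp: dist_norm norm_minus_commute)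
    have pV: "norm ((V - y0) ^ n) \<le> (\<rho> / 2) ^ n" for n
      unfolding norm_power using V by (intro power_mono) (auto simp: dist_norm norm_minus_commute)
    have tb: "norm (a m n * ((U - x0) ^ m * (V - y0) ^ n)) \<le> B * ((1 / 2) ^ m * (1 / 2) ^ n)" for m n
    proof -
      have "norm (a m n * ((U - x0) ^ m * (V - y0) ^ n)) \<le> B / (\<rho> ^ m * \<rho> ^ n) * ((\<rho> / 2) ^ m * (\<rho> / 2) ^ n)"
        unfolding norm_mult using B \<rho> by (intro mult_mono an pU pV) auto
      also have "\<dots> = B * ((1 / 2) ^ m * (1 / 2) ^ n)" using \<rho> by (simp add: power_divide field_simps)
      finally show ?thesis .
    qed
    have g: "((\<lambda>n. (1 / 2 :: real) ^ n) has_sum 2) UNIV"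
      using geometric_sums[of "1 / 2 :: real"] by (intro norm_summable_imp_has_sum) (auto simp: summable_geometric)
    have ss: "(\<lambda>(m, n). a m n * ((U - x0) ^ m * (V - y0) ^ n)) summable_on Sigma UNIV (\<lambda>_. UNIV)"
    proof (rule abs_summable_summable, rule summable_on_comparison_test)
      have "(\<lambda>(m, n). B * (1 / 2) ^ m * (1 / 2 :: real) ^ n) summable_on Sigma UNIV (\<lambda>_. UNIV)"
        by (rule summable_on_SigmaI[where g = "\<lambda>m. B * (1 / 2) ^ m * 2"])
          (use B g in \<open>auto intro!: has_sum_cmult_right summable_on_cmult_left summable_on_cmult_right simp: has_sum_imp_summable\<close>)
      then show "(\<lambda>(m, n). B * ((1 / 2) ^ m * (1 / 2 :: real) ^ n)) summable_on Sigma UNIV (\<lambda>_. UNIV)" by (simp add: mult.assoc)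
    qed (use tb in auto)
    have in1: "((\<lambda>n. a m n * ((U - x0) ^ m * (V - y0) ^ n)) has_sum b m V / fact m * (U - x0) ^ m) UNIV" for m
    proof (rule norm_summable_imp_has_sum)
      show "summable (\<lambda>n. norm (a m n * ((U - x0) ^ m * (V - y0) ^ n)))"
      proof (rule summable_comparison_test')
        show "summable (\<lambda>n. B * (1 / 2) ^ m * (1 / 2 :: real) ^ n)" by (intro summable_mult summable_geometric) auto
        show "norm (norm (a m n * ((U - x0) ^ m * (V - y0) ^ n))) \<le> B * (1 / 2) ^ m * (1 / 2 :: real) ^ n" for n
          using tb[of m n] by (simp add: mult_ac)
      qed
      have "(\<lambda>n. (deriv ^^ n) (b m) y0 / fact n * (V - y0) ^ n) sums b m V"
        by (rule holomorphic_power_series[OF _ V']) (use bhol sub in \<open>meson holomorphic_on_subset\<close>)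
      then have "(\<lambda>n. ((U - x0) ^ m / fact m) * ((deriv ^^ n) (b m) y0 / fact n * (V - y0) ^ n)) sums ((U - x0) ^ m / fact m * b m V)"
        by (rule sums_mult)
      then show "(\<lambda>n. a m n * ((U - x0) ^ m * (V - y0) ^ n)) sums (b m V / fact m * (U - x0) ^ m)"
        by (simp add: a_def mult_ac)
    qed
    have in2: "((\<lambda>m. b m V / fact m * (U - x0) ^ m) has_sum f U V) UNIV"
    proof (rule norm_summable_imp_has_sum)
      show "summable (\<lambda>m. norm (b m V / fact m * (U - x0) ^ m))"
      proof (rule summable_comparison_test')
        show "summable (\<lambda>m. B * (1 / 2 :: real) ^ m)" by (intro summable_mult summable_geometric) auto
        show "norm (norm (b m V / fact m * (U - x0) ^ m)) \<le> B * (1 / 2 :: real) ^ m" for m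
        proof -
          have "norm (b m V / fact m * (U - x0) ^ m) \<le> (fact m * B / \<rho> ^ m) / fact m * (\<rho> / 2) ^ m"
          proof -
            have "norm (b m V / fact m) \<le> (fact m * B / \<rho> ^ m) / fact m"
              using divide_right_mono[OF bb[OF VR, of m], of "fact m"] by (simp add: norm_divide)
            then show ?thesis unfolding norm_mult using B \<rho> pU[of m] by (intro mult_mono) auto
          qed
          also have "\<dots> = B * (1 / 2) ^ m" using \<rho> by (simp add: power_divide field_simps)
          finally show ?thesis by simp
        qed
      qed
      show "(\<lambda>m. b m V / fact m * (U - x0) ^ m) sums f U V"
        unfolding b_def by (rule holomorphic_power_series[OF _ U']) (use hU[OF VR] sub in \<open>meson holomorphic_on_subset\<close>)
    qed
    have "((\<lambda>(m, n). a m n * ((U - x0) ^ m * (V - y0) ^ n)) has_sum f U V) (Sigma UNIV (\<lambda>_. UNIV))"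
      by (rule has_sum_SigmaI[OF _ in2 ss]) (simp only: prod.case in1)
    then show "((\<lambda>(m, n). a m n * ((U - x0) ^ m * (V - y0) ^ n)) has_sum f U V) UNIV" by simp
  qed
qed

text \<open>The double power series of the complex extension, restricted to real values of both
  variables, is the required expansion.\<close>

lemma real_analytic_onI:
  assumes "\<And>z0. z0 \<in> S \<Longrightarrow> \<exists>R>0. \<exists>f B.
      (\<forall>V\<in>ball (of_real (Im z0)) R. (\<lambda>U. f U V) holomorphic_on ball (of_real (Re z0)) R) \<and>
      (\<forall>U\<in>ball (of_real (Re z0)) R. (\<lambda>V. f U V) holomorphic_on ball (of_real (Im z0)) R) \<and>
      (\<forall>U\<in>ball (of_real (Re z0)) R. \<forall>V\<in>ball (of_real (Im z0)) R. norm (f U V) \<le> B) \<and>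
      (\<forall>z\<in>ball z0 R. F z = f (of_real (Re z)) (of_real (Im z)))"
  shows "real_analytic_on F S"
  unfolding real_analytic_on_def
proof
  fix z0 assume "z0 \<in> S"
  from assms[OF this] obtain R f B where R: "R > 0"
    and hU: "\<And>V. V \<in> ball (of_real (Im z0)) R \<Longrightarrow> (\<lambda>U. f U V) holomorphic_on ball (of_real (Re z0)) R"
    and hV: "\<And>U. U \<in> ball (of_real (Re z0)) R \<Longrightarrow> (\<lambda>V. f U V) holomorphic_on ball (of_real (Im z0)) R"
    and bd: "\<And>U V. U \<in> ball (of_real (Re z0)) R \<Longrightarrow> V \<in> ball (of_real (Im z0)) R \<Longrightarrow> norm (f U V) \<le> B"
    and F: "\<And>z. z \<in> ball z0 R \<Longrightarrow> F z = f (of_real (Re z)) (of_real (Im z))"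
    by blast
  have "\<exists>r>0. \<exists>a. \<forall>U\<in>ball (of_real (Re z0)) r. \<forall>V\<in>ball (of_real (Im z0)) r.
      ((\<lambda>(m, n). a m n * ((U - of_real (Re z0)) ^ m * (V - of_real (Im z0)) ^ n)) has_sum f U V) UNIV"
    by (rule separately_holomorphic_power_series[OF R hU hV bd]; blast)
  then obtain r a where r: "r > 0" and sum: "\<And>U V. U \<in> ball (of_real (Re z0)) r \<Longrightarrow> V \<in> ball (of_real (Im z0)) r \<Longrightarrow>
    ((\<lambda>(m, n). a m n * ((U - of_real (Re z0)) ^ m * (V - of_real (Im z0)) ^ n)) has_sum f U V) UNIV"
    by blast
  show "\<exists>r>0. \<exists>a. \<forall>z\<in>ball z0 r. ((\<lambda>(m, n). a m n * of_real ((Re z - Re z0) ^ m * (Im z - Im z0) ^ n)) has_sum F z) UNIV"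
  proof (intro exI conjI ballI)
    show "min r R > 0" using r R by simp
    fix z assume z: "z \<in> ball z0 (min r R)"
    have "dist (complex_of_real (Re z0)) (of_real (Re z)) < r" "dist (complex_of_real (Im z0)) (of_real (Im z)) < r"
      using abs_Re_le_cmod[of "z0 - z"] abs_Im_le_cmod[of "z0 - z"] z by (auto simp: dist_norm of_real_diff[symmetric] simp del: of_real_diff)
    then show "((\<lambda>(m, n). a m n * of_real ((Re z - Re z0) ^ m * (Im z - Im z0) ^ n)) has_sum F z) UNIV"
      using sum[of "of_real (Re z)" "of_real (Im z)"] F[of z] z by simp
  qed
qed

section \<open>Analyticity of the completed generating function\<close>

lemma holomorphic_on_infsum:
  fixes f :: "complex \<Rightarrow> 'a::countable \<Rightarrow> complex"
  assumes "open S" "\<And>q. (\<lambda>z. f z q) holomorphic_on S" "\<And>z q. z \<in> S \<Longrightarrow> norm (f z q) \<le> g q" "g summable_on UNIV"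
  shows "(\<lambda>z. \<Sum>\<^sub>\<infinity>q. f z q) holomorphic_on S"
  unfolding holomorphic_on_open[OF assms(1)] using holomorphic_infsum(1)[OF assms] by blast

lemma norm_infsum_le:
  fixes f :: "'a \<Rightarrow> complex"
  assumes "\<And>q. norm (f q) \<le> g q" "g summable_on UNIV"
  shows "norm (\<Sum>\<^sub>\<infinity>q. f q) \<le> (\<Sum>\<^sub>\<infinity>q. g q)"
proof -
  have s: "(\<lambda>q. norm (f q)) summable_on UNIV"
    by (rule summable_on_comparison_test[OF assms(2)]) (use assms(1) in auto)
  show ?thesis
    using norm_infsum_bound[OF s] infsum_mono[OF s assms(2)] assms(1) order_trans by blast
qed

lemma form_eval_holomorphic [holomorphic_intros]:
  "g holomorphic_on A \<Longrightarrow> (\<lambda>U. form_eval Q (g U) 1) holomorphic_on A"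
  by (cases Q) (auto intro!: holomorphic_intros)

lemma cform_at_holomorphic:
  "(\<lambda>U. cform_at Q U V) holomorphic_on A"
  "0 \<notin> A \<Longrightarrow> (\<lambda>V. cform_at Q U V) holomorphic_on A"
proof -
  obtain a b c where Q: "Q = (a, b, c)" by (cases Q)
  show "(\<lambda>U. cform_at Q U V) holomorphic_on A"
    unfolding Q cform_at.simps divide_inverse by (intro holomorphic_intros)
  show "0 \<notin> A \<Longrightarrow> (\<lambda>V. cform_at Q U V) holomorphic_on A"
    unfolding Q cform_at.simps by (intro holomorphic_intros) auto
qed

lemma clift_holomorphic:
  "(\<lambda>U. clift k z U V Q p) holomorphic_on A"
  "0 \<notin> A \<Longrightarrow> (\<lambda>V. clift k z U V Q p) holomorphic_on A"
  unfolding clift_def case_prod_unfold by (intro holomorphic_intros cform_at_holomorphic; assumption)+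

text \<open>The integral is complexified here because its integrand contains \<open>form_at\<close>
  itself and no sign, so it extends across the zeros of \<open>form_at\<close>. The majorant is
  uniform in U and V and serves both holomorphy under the integral and the bound on the sum.\<close>

lemma Psi_hat_real_analytic_tau:
  assumes z: "Im z > 0" and k: "k \<ge> 4"
  shows "real_analytic_on (\<lambda>\<tau>. Psi_hat k \<tau> z) upper_half_plane"
proof (rule real_analytic_onI)
  fix \<tau>0 assume "\<tau>0 \<in> upper_half_plane"
  then have \<tau>0: "Im \<tau>0 > 0" by (simp add: upper_half_plane_def)
  have k1: "k \<ge> 1" using k by simp
  obtain r C \<epsilon> where r: "r > 0" "C > 0" "\<epsilon> > 0" and b: "\<And>z U V Q p. U \<in> ball (of_real (Re \<tau>0)) r \<Longrightarrow> V \<in> ball (of_real (Im \<tau>0)) r \<Longrightarrow>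
       V \<noteq> 0 \<and> norm (clift k z U V Q p) \<le> C * lift_weight k \<epsilon> z Q p"
    by (rule clift_bound[OF \<tau>0 k1]) (rule that)
  obtain K where K: "K \<ge> 0" "\<And>Q. integrable (lborel \<Otimes>\<^sub>M lborel) (lift_weight k \<epsilon> z Q)"
    "\<And>Q. (\<integral>p. lift_weight k \<epsilon> z Q p \<partial>(lborel \<Otimes>\<^sub>M lborel)) \<le> K * form_size Q powr (- 7 / 2)"
    by (rule lift_weight_integral_bound[OF k z r(3)]) (rule that)
  define R where "R = min r (Im \<tau>0)"
  have R: "R > 0" using r(1) \<tau>0 by (simp add: R_def)
  define X Y where "X = ball (complex_of_real (Re \<tau>0)) R" and "Y = ball (complex_of_real (Im \<tau>0)) R"
  have bX: "V \<noteq> 0 \<and> norm (clift k z U V Q p) \<le> C * lift_weight k \<epsilon> z Q p" if "U \<in> X" "V \<in> Y" for U V Q p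
    by (rule b) (use that in \<open>auto simp: X_def Y_def R_def\<close>)
  have bnd: "norm (\<integral>p. clift k z U V Q p \<partial>(lborel \<Otimes>\<^sub>M lborel)) \<le> C * K * form_size Q powr (- (7 / 2))" if "U \<in> X" "V \<in> Y" for U V Q
  proof -
    have Ci: "integrable (lborel \<Otimes>\<^sub>M lborel) (\<lambda>p. C * lift_weight k \<epsilon> z Q p)" by (rule integrable_mult_right[OF K(2)])
    have "integrable (lborel \<Otimes>\<^sub>M lborel) (clift k z U V Q)"
      by (rule Bochner_Integration.integrable_bound[OF Ci clift_measurable[OF z]])
        (use order_trans[OF conjunct2[OF bX[OF that]] abs_ge_self] in simp)
    then have "norm (\<integral>p. clift k z U V Q p \<partial>(lborel \<Otimes>\<^sub>M lborel)) \<le> (\<integral>p. C * lift_weight k \<epsilon> z Q p \<partial>(lborel \<Otimes>\<^sub>M lborel))"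
      by (intro order_trans[OF integral_norm_bound integral_mono] integrable_norm Ci conjunct2[OF bX[OF that]])
    also have "\<dots> = C * (\<integral>p. lift_weight k \<epsilon> z Q p \<partial>(lborel \<Otimes>\<^sub>M lborel))" by (rule integral_mult_right_zero)
    also have "\<dots> \<le> C * (K * form_size Q powr (- 7 / 2))" using r(2) K(3) by (intro mult_left_mono) auto
    finally show ?thesis by simp
  qed
  have sm: "(\<lambda>Q. C * K * form_size Q powr (- (7 / 2))) summable_on UNIV"
    by (intro summable_on_cmult_right form_size_pow_summable) auto
  define f where "f = (\<lambda>U V. inverse (lift_const k) * (\<Sum>\<^sub>\<infinity>Q. \<integral>p. clift k z U V Q p \<partial>(lborel \<Otimes>\<^sub>M lborel)))"
  have op: "open X" "open Y" by (auto simp: X_def Y_def)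
  have ne: "X \<noteq> {}" using r \<tau>0 by (auto simp: X_def R_def)
  \<comment> \<open>\<open>clift_bound\<close> yields V \<noteq> 0 only together with some U, hence
    the appeal to a nonempty U-ball.\<close>
  have Y0: "0 \<notin> Y" using bX ne by blast
  define B0 where "B0 = norm (inverse (lift_const k)) * (\<Sum>\<^sub>\<infinity>Q. C * K * form_size Q powr (- (7 / 2)))"
  have "(\<lambda>U. f U V) holomorphic_on X" if "V \<in> Y" for V
    unfolding f_def
  proof (intro holomorphic_on_mult holomorphic_on_const holomorphic_on_infsum[OF op(1) _ _ sm])
    show "(\<lambda>U. \<integral>p. clift k z U V Q p \<partial>(lborel \<Otimes>\<^sub>M lborel)) holomorphic_on X" for Q
      by (rule holomorphic_on_parameter_integral[OF op(1) clift_measurable[OF z] clift_holomorphic(1) _ integrable_mult_right[OF K(2)[of Q], of C]])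
        (use bX that in auto)
  qed (use bnd that in auto)
  moreover have "(\<lambda>V. f U V) holomorphic_on Y" if "U \<in> X" for U
    unfolding f_def
  proof (intro holomorphic_on_mult holomorphic_on_const holomorphic_on_infsum[OF op(2) _ _ sm])
    show "(\<lambda>V. \<integral>p. clift k z U V Q p \<partial>(lborel \<Otimes>\<^sub>M lborel)) holomorphic_on Y" for Q
      by (rule holomorphic_on_parameter_integral[OF op(2) clift_measurable[OF z] clift_holomorphic(2)[OF Y0] _ integrable_mult_right[OF K(2)[of Q], of C]])
        (use bX that in auto)
  qed (use bnd that in auto)
  moreover have "norm (f U V) \<le> B0" if "U \<in> X" "V \<in> Y" for U V
    unfolding f_def B0_def norm_mult by (intro mult_left_mono norm_infsum_le bnd sm that) auto
  moreover have "Psi_hat k \<tau> z = f (of_real (Re \<tau>)) (of_real (Im \<tau>))" if "\<tau> \<in> ball \<tau>0 R" for \<tau>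
  proof -
    have "\<bar>Im \<tau>0 - Im \<tau>\<bar> < Im \<tau>0"
      using abs_Im_le_cmod[of "\<tau>0 - \<tau>"] that by (simp add: dist_norm R_def)
    then have \<tau>: "Im \<tau> > 0" by linarith
    show ?thesis
      unfolding f_def clift_real lift_integral_zterm(2)[OF \<tau> z k] infsum_cmult_right' Psi_hat_eq_infsum[OF \<tau> z k]
      using lift_const_nonzero[OF k1] by simp
  qed
  ultimately have fin: "(\<forall>V\<in>Y. (\<lambda>U. f U V) holomorphic_on X) \<and> (\<forall>U\<in>X. (\<lambda>V. f U V) holomorphic_on Y) \<and>
      (\<forall>U\<in>X. \<forall>V\<in>Y. norm (f U V) \<le> B0) \<and> (\<forall>\<tau>\<in>ball \<tau>0 R. Psi_hat k \<tau> z = f (of_real (Re \<tau>)) (of_real (Im \<tau>)))"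
    by blast
  show "\<exists>R>0. \<exists>f B.
      (\<forall>V\<in>ball (of_real (Im \<tau>0)) R. (\<lambda>U. f U V) holomorphic_on ball (of_real (Re \<tau>0)) R) \<and>
      (\<forall>U\<in>ball (of_real (Re \<tau>0)) R. (\<lambda>V. f U V) holomorphic_on ball (of_real (Im \<tau>0)) R) \<and>
      (\<forall>U\<in>ball (of_real (Re \<tau>0)) R. \<forall>V\<in>ball (of_real (Im \<tau>0)) R. norm (f U V) \<le> B) \<and>
      (\<forall>\<tau>\<in>ball \<tau>0 R. Psi_hat k \<tau> z = f (of_real (Re \<tau>)) (of_real (Im \<tau>)))"
    by (rule exI[of _ R], rule conjI[OF R], rule exI[of _ f], rule exI[of _ B0], rule fin[unfolded X_def Y_def])
qed

lemma cgterm_holomorphic: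
  "(\<lambda>U. cgterm k \<tau> U V Q) holomorphic_on A"
  "(\<And>V. V \<in> A \<Longrightarrow> Re V > 0) \<Longrightarrow> (\<lambda>V. cgterm k \<tau> U V Q) holomorphic_on A"
proof -
  show "(\<lambda>U. cgterm k \<tau> U V Q) holomorphic_on A" unfolding cgterm_def by (intro holomorphic_intros)
  assume A: "\<And>V. V \<in> A \<Longrightarrow> Re V > 0"
  show "(\<lambda>V. cgterm k \<tau> U V Q) holomorphic_on A"
  proof (cases "form_at Q \<tau> = 0")
    case False
    then have "cgamma (4 * pi * (form_at Q \<tau>)\<^sup>2) holomorphic_on A"
      by (intro holomorphic_on_subset[OF cgamma_holomorphic]) (use A in auto)
    then show ?thesis unfolding cgterm_def by (intro holomorphic_intros)
  qed (simp add: cgterm_def)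
qed

text \<open>For positive discriminant the exponential decreases with the height, so the value at one
  point \<i> v0 majorises the term on a whole half-plane.\<close>

lemma norm_fterm_mono:
  assumes "Im w \<ge> Im w'"
  shows "norm (fterm k \<tau> w Q) \<le> norm (fterm k \<tau> w' Q)"
proof (cases "disc Q > 0")
  case True
  have "norm (exp (2 * of_real pi * \<i> * of_int (disc Q) * w)) \<le> norm (exp (2 * of_real pi * \<i> * of_int (disc Q) * w'))"
    using assms True by (simp add: norm_exp_eq_Re)
  then show ?thesis using True unfolding fterm_def norm_mult by (simp only: if_True norm_mult) (intro mult_left_mono mult_nonneg_nonneg; simp)
qed (simp add: fterm_def)

text \<open>The series are used here: the kernel has its pole at w = z, whereas for fixed \<tau> the
  signs are constants and every term of the series extends holomorphically in the complexified
  coordinates.\<close>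

lemma Psi_hat_real_analytic_z:
  assumes \<tau>: "Im \<tau> > 0" and k: "k \<ge> 4"
  shows "real_analytic_on (\<lambda>z. Psi_hat k \<tau> z) upper_half_plane"
proof (rule real_analytic_onI)
  fix z0 assume "z0 \<in> upper_half_plane"
  then have z0: "Im z0 > 0" by (simp add: upper_half_plane_def)
  define v0 where "v0 = Im z0 / 2"
  have v0: "v0 > 0" using z0 by (simp add: v0_def)
  obtain r C \<epsilon> where r: "r > 0" "\<epsilon> > 0" and b: "\<And>U V Q. \<bar>Im U\<bar> < r \<Longrightarrow> Re V > v0 \<Longrightarrow> norm (cgterm k \<tau> U V Q) \<le> C * exp (- \<epsilon> * (form_size Q)\<^sup>2 + real (k - 1) * form_size Q)"
    by (rule cgterm_bound[OF \<tau> v0, of k]) (rule that)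
  \<comment> \<open>This gives Re V > 3 v0/2 and |Im U| < v0/2, so U + \<i> V stays at height at
    least v0, where both majorants apply.\<close>
  define R where "R = min r (v0 / 2)"
  have R: "R > 0" using r v0 by (simp add: R_def)
  define X Y where "X = ball (complex_of_real (Re z0)) R" and "Y = ball (complex_of_real (Im z0)) R"
  have X: "\<bar>Im U\<bar> < r \<and> \<bar>Im U\<bar> < v0 / 2" if "U \<in> X" for U
    using abs_Im_le_cmod[of "of_real (Re z0) - U"] that by (simp add: X_def R_def dist_norm)
  have Y: "Re V > v0 + v0 / 2" if "V \<in> Y" for V
  proof -
    have "\<bar>Im z0 - Re V\<bar> < v0 / 2" using abs_Re_le_cmod[of "of_real (Im z0) - V"] that by (simp add: Y_def R_def dist_norm)
    then show ?thesis unfolding v0_def by linarith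
  qed
  have XY: "Im (U + \<i> * V) \<ge> v0" if "U \<in> X" "V \<in> Y" for U V
  proof -
    have "Im (U + \<i> * V) = Im U + Re V" by simp
    then show ?thesis using X[OF that(1)] Y[OF that(2)] by linarith
  qed
  define F where "F = (\<lambda>Q. norm (fterm k \<tau> (\<i> * of_real v0) Q))"
  have Fs: "F summable_on UNIV" unfolding F_def by (rule fterm_summable[OF \<tau> _ k]) (use v0 in simp)
  have Fb: "norm (fterm k \<tau> w Q) \<le> F Q" if "Im w \<ge> v0" for w Q
    unfolding F_def by (rule norm_fterm_mono) (use that in simp)
  define G where "G = (\<lambda>Q. C * exp (- \<epsilon> * (form_size Q)\<^sup>2 + real (k - 1) * form_size Q))"
  have Gs: "G summable_on UNIV" unfolding G_def by (intro summable_on_cmult_right gauss_form_size_summable r)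
  have Gb: "norm (cgterm k \<tau> U V Q) \<le> G Q" if "U \<in> X" "V \<in> Y" for U V Q
    unfolding G_def by (rule b) (use X[OF that(1)] Y[OF that(2)] v0 in auto)
  have Fh: "(\<lambda>w. fterm k \<tau> w Q) holomorphic_on A" for Q A
    unfolding fterm_def by (cases "disc Q > 0") (auto intro!: holomorphic_intros)
  have op: "open X" "open Y" by (auto simp: X_def Y_def)
  define f where "f = (\<lambda>U V. (\<Sum>\<^sub>\<infinity>Q. fterm k \<tau> (U + \<i> * V) Q) + (\<Sum>\<^sub>\<infinity>Q. cgterm k \<tau> U V Q))"
  define B0 where "B0 = (\<Sum>\<^sub>\<infinity>Q. F Q) + (\<Sum>\<^sub>\<infinity>Q. G Q)"
  have "(\<lambda>U. f U V) holomorphic_on X" if "V \<in> Y" for V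
    unfolding f_def
  proof (rule holomorphic_on_add)
    have "(\<lambda>U. fterm k \<tau> (U + \<i> * V) Q) holomorphic_on X" for Q
      using holomorphic_on_compose[OF _ Fh, of "\<lambda>U. U + \<i> * V" X] by (simp add: o_def holomorphic_intros)
    then show "(\<lambda>U. \<Sum>\<^sub>\<infinity>Q. fterm k \<tau> (U + \<i> * V) Q) holomorphic_on X"
      by (rule holomorphic_on_infsum[OF op(1) _ Fb[OF XY[OF _ that]] Fs])
    show "(\<lambda>U. \<Sum>\<^sub>\<infinity>Q. cgterm k \<tau> U V Q) holomorphic_on X"
      by (rule holomorphic_on_infsum[OF op(1) cgterm_holomorphic(1) Gb[OF _ that] Gs])
  qed
  moreover have "(\<lambda>V. f U V) holomorphic_on Y" if "U \<in> X" for U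
    unfolding f_def
  proof (rule holomorphic_on_add)
    have "(\<lambda>V. fterm k \<tau> (U + \<i> * V) Q) holomorphic_on Y" for Q
      using holomorphic_on_compose[OF _ Fh, of "\<lambda>V. U + \<i> * V" Y] by (simp add: o_def holomorphic_intros)
    then show "(\<lambda>V. \<Sum>\<^sub>\<infinity>Q. fterm k \<tau> (U + \<i> * V) Q) holomorphic_on Y"
      by (rule holomorphic_on_infsum[OF op(2) _ Fb[OF XY[OF that]] Fs])
    have "Re V > 0" if "V \<in> Y" for V using Y[OF that] v0 by linarith
    then have "(\<lambda>V. cgterm k \<tau> U V Q) holomorphic_on Y" for Q by (rule cgterm_holomorphic(2))
    then show "(\<lambda>V. \<Sum>\<^sub>\<infinity>Q. cgterm k \<tau> U V Q) holomorphic_on Y"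
      by (rule holomorphic_on_infsum[OF op(2) _ Gb[OF that] Gs])
  qed
  moreover have "norm (f U V) \<le> B0" if "U \<in> X" "V \<in> Y" for U V
    unfolding f_def B0_def by (intro norm_triangle_mono norm_infsum_le Fb XY Gb Fs Gs that)
  moreover have "Psi_hat k \<tau> z = f (of_real (Re z)) (of_real (Im z))" if "z \<in> ball z0 R" for z
  proof -
    have "\<bar>Im z0 - Im z\<bar> < v0 / 2"
      using abs_Im_le_cmod[of "z0 - z"] that by (simp add: dist_norm R_def)
    then have z: "Im z > 0" using v0 unfolding v0_def by linarith
    have "of_real (Re z) + \<i> * of_real (Im z) = z" by (rule complex_eq[symmetric])
    then show ?thesis
      unfolding f_def Psi_hat_def Psi_eq_infsum[OF \<tau> z k] Psi_star_eq_infsum[OF \<tau> z] cgterm_real[OF z] by simp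
  qed
  ultimately have fin: "(\<forall>V\<in>Y. (\<lambda>U. f U V) holomorphic_on X) \<and> (\<forall>U\<in>X. (\<lambda>V. f U V) holomorphic_on Y) \<and>
      (\<forall>U\<in>X. \<forall>V\<in>Y. norm (f U V) \<le> B0) \<and> (\<forall>z\<in>ball z0 R. Psi_hat k \<tau> z = f (of_real (Re z)) (of_real (Im z)))"
    by blast
  show "\<exists>R>0. \<exists>f B.
      (\<forall>V\<in>ball (of_real (Im z0)) R. (\<lambda>U. f U V) holomorphic_on ball (of_real (Re z0)) R) \<and>
      (\<forall>U\<in>ball (of_real (Re z0)) R. (\<lambda>V. f U V) holomorphic_on ball (of_real (Im z0)) R) \<and>
      (\<forall>U\<in>ball (of_real (Re z0)) R. \<forall>V\<in>ball (of_real (Im z0)) R. norm (f U V) \<le> B) \<and>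
      (\<forall>z\<in>ball z0 R. Psi_hat k \<tau> z = f (of_real (Re z)) (of_real (Im z)))"
    by (rule exI[of _ R], rule conjI[OF R], rule exI[of _ f], rule exI[of _ B0], rule fin[unfolded X_def Y_def])
qed

text \<open>For even \<open>l\<close> the sign in the plus condition is 1, so the condition is
  exactly that satisfied by discriminants; this is where the parity of the weight enters.\<close>

lemma Psi_hat_plus_space:
  assumes \<tau>: "Im \<tau> > 0" and k: "k \<ge> 4" and l: "even l"
  shows "plus_space_expansion l (\<lambda>z. Psi_hat k \<tau> z)"
proof -
  have sign: "(- 1 :: int) ^ nat \<bar>l\<bar> = 1" using l by (simp add: even_nat_iff)
  show ?thesis
    unfolding plus_space_expansion_def sign mult_1_left
    using Psi_hat_fourier[OF \<tau> _ k] by (intro exI[of _ "\<lambda>n v. (if n > 0 then F_fun k n \<tau> else 0) + G_fun k n v \<tau>"])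
      (auto simp: upper_half_plane_def)
qed

theorem theorem1p1:
  fixes k :: nat
  assumes "k \<ge> 4" and "even k"
  shows "(\<forall>\<tau>\<in>upper_half_plane. (\<lambda>z. Psi_hat k \<tau> z) \<in> A_space (real k + 1 / 2)) \<and>
         (\<forall>z\<in>upper_half_plane. (\<lambda>\<tau>. Psi_hat k \<tau> z) \<in> A_space (2 - 2 * real k))"
proof (intro conjI ballI)
  fix \<tau> assume "\<tau> \<in> upper_half_plane"
  then have \<tau>: "Im \<tau> > 0" by (simp add: upper_half_plane_def)
  have "plus_space_expansion l (\<lambda>z. Psi_hat k \<tau> z)" if "real k + 1 / 2 = of_int l + 1 / 2" for l
  proof -
    have "real_of_int (int k) = of_int l" using that by simp
    then have "int k = l" by linarith
    then show ?thesis using Psi_hat_plus_space[OF \<tau> assms(1)] assms(2) by auto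
  qed
  then show "(\<lambda>z. Psi_hat k \<tau> z) \<in> A_space (real k + 1 / 2)"
    using half_integer_notin_Ints[of k] Psi_hat_real_analytic_z[OF \<tau> assms(1)] Psi_hat_slash_z[OF \<tau> _ assms(1)]
    by (auto simp: A_space_def weight_group_def upper_half_plane_def)
next
  fix z assume "z \<in> upper_half_plane"
  then have z: "Im z > 0" by (simp add: upper_half_plane_def)
  have int: "2 - 2 * real k = of_int (2 - 2 * int k)" by simp
  have isint: "2 - 2 * real k \<in> \<int>" unfolding int by (rule Ints_of_int)
  \<comment> \<open>The plus condition concerns half-integral weights; integrality of 2 - 2k makes
    it vacuous here.\<close>
  have "2 - 2 * real k \<noteq> of_int l + 1 / 2" for l
  proof
    assume "2 - 2 * real k = of_int l + 1 / 2"
    then have "real_of_int (2 * (2 - 2 * int k)) = real_of_int (2 * l + 1)" by simp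
    then have "2 * (2 - 2 * int k) = 2 * l + 1" by linarith
    then show False by presburger
  qed
  then show "(\<lambda>\<tau>. Psi_hat k \<tau> z) \<in> A_space (2 - 2 * real k)"
    using Psi_hat_real_analytic_tau[OF z assms(1)] Psi_hat_slash_tau[OF _ z assms(1)] isint
    by (auto simp: A_space_def weight_group_def upper_half_plane_def)
qed

end
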